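(* Let $\Omega\subset\mathbb{R}^3$ be a bounded sliceable domain with Lipschitz boundary $\Gamma$, and let $\emptyset\neq\Gamma_t\subset\Gamma$ be relatively open and separated from $\Gamma_n:=\Gamma\setminus\overline{\Gamma_t}$ by a Lipschitz curve. Let $c_m>0$ be a Maxwell constant and $c_k>0$ an irrotational Korn constant for $(\Omega,\Gamma_t)$ (defined in the context) and $\hat c:=\max\{\sqrt2\,c_k,\;c_m\sqrt{1+2c_k^2}\}$. For a scalar function $u$ put $$T_u:=\begin{bmatrix}0&0&u\\0&0&0\\-u&0&0\end{bmatrix}.$$ Then for all $u$ with $T_u\in\mathring H(\mathrm{Curl};\Gamma_t,\Omega)$, i.e., for all functions $u\in\mathring H(\mathrm{grad};\Gamma_t,\Omega)$, $$\|u\|_{L^2(\Omega)}\leq\hat c\,\|\mathrm{grad}\,u\|_{L^2(\Omega)}.$$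
   Context: A domain is a nonempty connected open set. $L^2(\Omega)$ denotes square-integrable functions, vector fields or $3\times3$ tensor fields (with the Frobenius inner product), $\bot$ is the orthogonal complement in $L^2(\Omega)$. $\mathrm{sym}\,T=\frac12(T+T^\top)$. "$\Gamma_t$ and $\Gamma_n$ are separated by a Lipschitz curve" means that the common relative boundary of $\Gamma_t$ and $\Gamma_n$ in $\Gamma$ is empty or is, locally in bi-Lipschitz charts of $\Gamma$, a Lipschitz curve with $\Gamma_t$ on one side and $\Gamma_n$ on the other. For $\gamma\subset\Gamma$, $\mathring C^\infty(\gamma,\Omega):=\{u\in C^\infty(\overline\Omega):\mathrm{dist}(\mathrm{supp}\,u,\gamma)>0\}$ (all of $C^\infty(\overline\Omega)$ if $\gamma=\emptyset$). $\mathring H(\mathrm{grad};\Gamma_t,\Omega)$ is the closure of $\mathring C^\infty(\Gamma_t,\Omega)$ in $H^1(\Omega)$. $\mathring H(\mathrm{curl};\Gamma_t,\Omega)$ and $\mathring H(\mathrm{div};\Gamma_n,\Omega)$ are the closures of the vector fields with components in $\mathring C^\infty(\Gamma_t,\Omega)$ resp. $\mathring C^\infty(\Gamma_n,\Omega)$ in the graph norms of $\mathrm{curl}$ resp. $\mathrm{div}$ in $L^2$. A lower index $0$ (as in $\mathrm{curl}_0$, $\mathrm{div}_0$) means additionally $\mathrm{curl}\,v=0$ resp. $\mathrm{div}\,v=0$. $\mathcal H(\Omega):=\mathring H(\mathrm{curl}_0;\Gamma_t,\Omega)\cap\mathring H(\mathrm{div}_0;\Gamma_n,\Omega)$. $\mathring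 H(\mathrm{Curl};\Gamma_t,\Omega)$ and $\mathring H(\mathrm{Curl}_0;\Gamma_t,\Omega)$ are the spaces of $3\times3$ tensor fields all of whose rows lie in $\mathring H(\mathrm{curl};\Gamma_t,\Omega)$ resp. $\mathring H(\mathrm{curl}_0;\Gamma_t,\Omega)$. Sliceable: $\Omega$ is sliceable (with respect to $\Gamma_t\neq\emptyset$) if there exist $J\in\mathbb N$ and $\Omega_j\subset\Omega$, $j=1,\dots,J$, such that $\Omega\setminus(\Omega_1\cup\dots\cup\Omega_J)$ is a null set and, for each $j$: the $\Omega_j$ are open, pairwise disjoint, simply connected Lipschitz subdomains of $\Omega$, and $\mathrm{int}_{\mathrm{rel}}(\overline{\Omega_j}\cap\Gamma_t)\neq\emptyset$ (interior relative to $\Gamma$). Maxwell constant $c_m>0$: $\|v\|_{L^2}\leq c_m(\|\mathrm{curl}\,v\|_{L^2}^2+\|\mathrm{div}\,v\|_{L^2}^2)^{1/2}$ for all $v\in\mathring H(\mathrm{curl};\Gamma_t,\Omega)\cap\mathring H(\mathrm{div};\Gamma_n,\Omega)\cap\mathcal H(\Omega)^\bot$. Irrotational Korn constant $c_k>0$: $\|T\|_{L^2}\leq c_k\|\mathrm{sym}\,T\|_{L^2}$ for all $T\in\mathring H(\mathrm{Curl}_0;\Gamma_t,\Omega)$. Such constants exist under the stated assumptions. *)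

theory Defs
  imports "HOL-Analysis.Analysis"
begin

definition is_domain :: "(real^3) set \<Rightarrow> bool" where
  "is_domain \<Omega> \<longleftrightarrow> \<Omega> \<noteq> {} \<and> open \<Omega> \<and> connected \<Omega>"

text \<open>The orthogonal map \<open>Q\<close> is a change of Cartesian coordinates; no translation is needed,
  as it can be absorbed into \<open>g\<close>.\<close>

definition lipschitz_boundary :: "(real^3) set \<Rightarrow> bool" where
  "lipschitz_boundary \<Omega> \<longleftrightarrow>
     (\<forall>p\<in>frontier \<Omega>. \<exists>N (Q :: real^3 \<Rightarrow> real^3) (g :: real \<times> real \<Rightarrow> real) L.
        open N \<and> p \<in> N \<and> orthogonal_transformation Q \<and> L-lipschitz_on UNIV g \<and>
        (\<forall>x\<in>N. (x \<in> \<Omega> \<longleftrightarrow> Q x $ 3 < g (Q x $ 1, Q x $ 2)) \<and>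
               (x \<in> frontier \<Omega> \<longleftrightarrow> Q x $ 3 = g (Q x $ 1, Q x $ 2))))"

text \<open>\<open>\<phi>\<close> is a bi-Lipschitz chart of \<open>\<Gamma>\<close> with inverse \<open>\<psi>\<close>, and \<open>g\<close> describes the Lipschitz curve
  in this chart. An empty common boundary is covered by the universal quantifier.\<close>

definition separated_by_lipschitz_curve ::
    "(real^3) set \<Rightarrow> (real^3) set \<Rightarrow> (real^3) set \<Rightarrow> bool" where
  "separated_by_lipschitz_curve \<Gamma> \<Gamma>t \<Gamma>n \<longleftrightarrow>
     (let S = (top_of_set \<Gamma> frontier_of \<Gamma>t) \<inter> (top_of_set \<Gamma> frontier_of \<Gamma>n) in
      \<forall>p\<in>S. \<exists>U V (\<phi> :: real^3 \<Rightarrow> real \<times> real) \<psi> (g :: real \<Rightarrow> real) L.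
        openin (top_of_set \<Gamma>) U \<and> p \<in> U \<and> open V \<and> \<phi> ` U = V \<and>
        L-lipschitz_on U \<phi> \<and> L-lipschitz_on V \<psi> \<and> (\<forall>x\<in>U. \<psi> (\<phi> x) = x) \<and>
        L-lipschitz_on UNIV g \<and>
        (\<forall>x\<in>U. (x \<in> S \<longleftrightarrow> snd (\<phi> x) = g (fst (\<phi> x))) \<and>
               (x \<in> \<Gamma>t \<longleftrightarrow> snd (\<phi> x) < g (fst (\<phi> x))) \<and>
               (x \<in> \<Gamma>n \<longleftrightarrow> snd (\<phi> x) > g (fst (\<phi> x)))))"

definition sliceable :: "(real^3) set \<Rightarrow> (real^3) set \<Rightarrow> bool" where
  "sliceable \<Omega> \<Gamma>t \<longleftrightarrow>
     (\<exists>(J :: nat) (\<Omega>s :: nat \<Rightarrow> (real^3) set).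
        (\<forall>j\<in>{1..J}. \<Omega>s j \<subseteq> \<Omega>) \<and>
        \<Omega> - (\<Union>j\<in>{1..J}. \<Omega>s j) \<in> null_sets lebesgue \<and>
        (\<forall>j\<in>{1..J}. \<forall>k\<in>{1..J}. j \<noteq> k \<longrightarrow> \<Omega>s j \<inter> \<Omega>s k = {}) \<and>
        (\<forall>j\<in>{1..J}. is_domain (\<Omega>s j) \<and> lipschitz_boundary (\<Omega>s j) \<and> simply_connected (\<Omega>s j) \<and>
           top_of_set (frontier \<Omega>) interior_of (closure (\<Omega>s j) \<inter> \<Gamma>t) \<noteq> {}))"

definition pderiv3 :: "3 \<Rightarrow> (real^3 \<Rightarrow> real) \<Rightarrow> real^3 \<Rightarrow> real" where
  "pderiv3 i f x = frechet_derivative f (at x) (axis i 1)"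

primrec C_k :: "nat \<Rightarrow> (real^3 \<Rightarrow> real) \<Rightarrow> bool" where
  "C_k 0 f \<longleftrightarrow> continuous_on UNIV f"
| "C_k (Suc k) f \<longleftrightarrow> (\<forall>x. f differentiable (at x)) \<and> (\<forall>i. C_k k (pderiv3 i f))"

definition smooth :: "(real^3 \<Rightarrow> real) \<Rightarrow> bool" where
  "smooth f \<longleftrightarrow> (\<forall>k. C_k k f)"

definition grad :: "(real^3 \<Rightarrow> real) \<Rightarrow> real^3 \<Rightarrow> real^3" where
  "grad f x = (\<chi> i. pderiv3 i f x)"

definition curl :: "(real^3 \<Rightarrow> real^3) \<Rightarrow> real^3 \<Rightarrow> real^3" where
  "curl v x = vector
     [pderiv3 2 (\<lambda>y. v y $ 3) x - pderiv3 3 (\<lambda>y. v y $ 2) x,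
      pderiv3 3 (\<lambda>y. v y $ 1) x - pderiv3 1 (\<lambda>y. v y $ 3) x,
      pderiv3 1 (\<lambda>y. v y $ 2) x - pderiv3 2 (\<lambda>y. v y $ 1) x]"

definition div3 :: "(real^3 \<Rightarrow> real^3) \<Rightarrow> real^3 \<Rightarrow> real" where
  "div3 v x = (\<Sum>i\<in>UNIV. pderiv3 i (\<lambda>y. v y $ i) x)"

definition test_fun :: "(real^3) set \<Rightarrow> (real^3 \<Rightarrow> real) set" where
  "test_fun \<Omega> = {\<phi>. smooth \<phi> \<and> compact (closure {x. \<phi> x \<noteq> 0}) \<and> closure {x. \<phi> x \<noteq> 0} \<subseteq> \<Omega>}"

definition test_field :: "(real^3) set \<Rightarrow> (real^3 \<Rightarrow> real^3) set" where
  "test_field \<Omega> = {\<Phi>. \<forall>i. (\<lambda>x. \<Phi> x $ i) \<in> test_fun \<Omega>}"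

text \<open>Elements of \<open>C\<^sup>\<infinity>\<close> of the closure of \<open>\<Omega>\<close> are represented by smooth functions on the whole
  space, of which only the values on \<open>\<Omega>\<close> matter. The distance condition is spelled out because
  \<^const>\<open>setdist\<close> is \<open>0\<close> if one of the two sets is empty.\<close>

definition Cinf0 :: "(real^3) set \<Rightarrow> (real^3) set \<Rightarrow> (real^3 \<Rightarrow> real) set" where
  "Cinf0 \<gamma> \<Omega> = {u. smooth u \<and>
     (\<exists>d>0. \<forall>x\<in>closure {x\<in>\<Omega>. u x \<noteq> 0}. \<forall>y\<in>\<gamma>. d \<le> dist x y)}"

definition Cinf0_field :: "(real^3) set \<Rightarrow> (real^3) set \<Rightarrow> (real^3 \<Rightarrow> real^3) set" where
  "Cinf0_field \<gamma> \<Omega> = {\<Phi>. \<forall>i. (\<lambda>x. \<Phi> x $ i) \<in> Cinf0 \<gamma> \<Omega>}"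

text \<open>Functions are not identified almost everywhere, and their values outside \<open>\<Omega>\<close> are irrelevant.
  On \<open>real^3^3\<close> the norm is the Frobenius norm.\<close>

definition L2 :: "(real^3) set \<Rightarrow> (real^3 \<Rightarrow> 'b::euclidean_space) set" where
  "L2 \<Omega> = {f. f \<in> borel_measurable (lebesgue_on \<Omega>) \<and>
              integrable (lebesgue_on \<Omega>) (\<lambda>x. (norm (f x))\<^sup>2)}"

definition L2_inner ::
    "(real^3) set \<Rightarrow> (real^3 \<Rightarrow> 'b::euclidean_space) \<Rightarrow> (real^3 \<Rightarrow> 'b) \<Rightarrow> real" where
  "L2_inner \<Omega> f g = (\<integral>x. f x \<bullet> g x \<partial>lebesgue_on \<Omega>)"

definition L2_norm :: "(real^3) set \<Rightarrow> (real^3 \<Rightarrow> 'b::euclidean_space) \<Rightarrow> real" where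
  "L2_norm \<Omega> f = sqrt (\<integral>x. (norm (f x))\<^sup>2 \<partial>lebesgue_on \<Omega>)"

definition L2_orth ::
    "(real^3) set \<Rightarrow> (real^3 \<Rightarrow> 'b::euclidean_space) set \<Rightarrow> (real^3 \<Rightarrow> 'b) set" where
  "L2_orth \<Omega> H = {f\<in>L2 \<Omega>. \<forall>h\<in>H. L2_inner \<Omega> f h = 0}"

definition is_weak_grad :: "(real^3) set \<Rightarrow> (real^3 \<Rightarrow> real) \<Rightarrow> (real^3 \<Rightarrow> real^3) \<Rightarrow> bool" where
  "is_weak_grad \<Omega> u G \<longleftrightarrow> u \<in> L2 \<Omega> \<and> G \<in> L2 \<Omega> \<and>
     (\<forall>\<Phi>\<in>test_field \<Omega>. L2_inner \<Omega> u (div3 \<Phi>) = - L2_inner \<Omega> G \<Phi>)"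

definition is_weak_curl :: "(real^3) set \<Rightarrow> (real^3 \<Rightarrow> real^3) \<Rightarrow> (real^3 \<Rightarrow> real^3) \<Rightarrow> bool" where
  "is_weak_curl \<Omega> v w \<longleftrightarrow> v \<in> L2 \<Omega> \<and> w \<in> L2 \<Omega> \<and>
     (\<forall>\<Phi>\<in>test_field \<Omega>. L2_inner \<Omega> v (curl \<Phi>) = L2_inner \<Omega> w \<Phi>)"

definition is_weak_div :: "(real^3) set \<Rightarrow> (real^3 \<Rightarrow> real^3) \<Rightarrow> (real^3 \<Rightarrow> real) \<Rightarrow> bool" where
  "is_weak_div \<Omega> v d \<longleftrightarrow> v \<in> L2 \<Omega> \<and> d \<in> L2 \<Omega> \<and>
     (\<forall>\<phi>\<in>test_fun \<Omega>. L2_inner \<Omega> v (grad \<phi>) = - L2_inner \<Omega> d \<phi>)"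

text \<open>Weak derivatives are unique only up to null sets; the operators below pick a representative.\<close>

definition weak_grad :: "(real^3) set \<Rightarrow> (real^3 \<Rightarrow> real) \<Rightarrow> real^3 \<Rightarrow> real^3" where
  "weak_grad \<Omega> u = (SOME G. is_weak_grad \<Omega> u G)"

definition weak_curl :: "(real^3) set \<Rightarrow> (real^3 \<Rightarrow> real^3) \<Rightarrow> real^3 \<Rightarrow> real^3" where
  "weak_curl \<Omega> v = (SOME w. is_weak_curl \<Omega> v w)"

definition weak_div :: "(real^3) set \<Rightarrow> (real^3 \<Rightarrow> real^3) \<Rightarrow> real^3 \<Rightarrow> real" where
  "weak_div \<Omega> v = (SOME d. is_weak_div \<Omega> v d)"

definition H_grad :: "(real^3) set \<Rightarrow> (real^3 \<Rightarrow> real) set" where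
  "H_grad \<Omega> = {u. \<exists>G. is_weak_grad \<Omega> u G}"

definition H_curl :: "(real^3) set \<Rightarrow> (real^3 \<Rightarrow> real^3) set" where
  "H_curl \<Omega> = {v. \<exists>w. is_weak_curl \<Omega> v w}"

definition H_div :: "(real^3) set \<Rightarrow> (real^3 \<Rightarrow> real^3) set" where
  "H_div \<Omega> = {v. \<exists>d. is_weak_div \<Omega> v d}"

definition norm_grad :: "(real^3) set \<Rightarrow> (real^3 \<Rightarrow> real) \<Rightarrow> real" where
  "norm_grad \<Omega> u = sqrt ((L2_norm \<Omega> u)\<^sup>2 + (L2_norm \<Omega> (weak_grad \<Omega> u))\<^sup>2)"

definition norm_curl :: "(real^3) set \<Rightarrow> (real^3 \<Rightarrow> real^3) \<Rightarrow> real" where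
  "norm_curl \<Omega> v = sqrt ((L2_norm \<Omega> v)\<^sup>2 + (L2_norm \<Omega> (weak_curl \<Omega> v))\<^sup>2)"

definition norm_div :: "(real^3) set \<Rightarrow> (real^3 \<Rightarrow> real^3) \<Rightarrow> real" where
  "norm_div \<Omega> v = sqrt ((L2_norm \<Omega> v)\<^sup>2 + (L2_norm \<Omega> (weak_div \<Omega> v))\<^sup>2)"

definition H0_grad :: "(real^3) set \<Rightarrow> (real^3) set \<Rightarrow> (real^3 \<Rightarrow> real) set" where
  "H0_grad \<gamma> \<Omega> =
     {u\<in>H_grad \<Omega>. \<forall>e>0. \<exists>\<phi>\<in>Cinf0 \<gamma> \<Omega>. norm_grad \<Omega> (\<lambda>x. u x - \<phi> x) < e}"

definition H0_curl :: "(real^3) set \<Rightarrow> (real^3) set \<Rightarrow> (real^3 \<Rightarrow> real^3) set" where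
  "H0_curl \<gamma> \<Omega> =
     {v\<in>H_curl \<Omega>. \<forall>e>0. \<exists>\<Phi>\<in>Cinf0_field \<gamma> \<Omega>. norm_curl \<Omega> (\<lambda>x. v x - \<Phi> x) < e}"

definition H0_div :: "(real^3) set \<Rightarrow> (real^3) set \<Rightarrow> (real^3 \<Rightarrow> real^3) set" where
  "H0_div \<gamma> \<Omega> =
     {v\<in>H_div \<Omega>. \<forall>e>0. \<exists>\<Phi>\<in>Cinf0_field \<gamma> \<Omega>. norm_div \<Omega> (\<lambda>x. v x - \<Phi> x) < e}"

definition H0_curl0 :: "(real^3) set \<Rightarrow> (real^3) set \<Rightarrow> (real^3 \<Rightarrow> real^3) set" where
  "H0_curl0 \<gamma> \<Omega> = {v\<in>H0_curl \<gamma> \<Omega>. is_weak_curl \<Omega> v (\<lambda>x. 0)}"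

definition H0_div0 :: "(real^3) set \<Rightarrow> (real^3) set \<Rightarrow> (real^3 \<Rightarrow> real^3) set" where
  "H0_div0 \<gamma> \<Omega> = {v\<in>H0_div \<gamma> \<Omega>. is_weak_div \<Omega> v (\<lambda>x. 0)}"

text \<open>\<open>A $ i\<close> is the \<open>i\<close>-th row of a matrix \<open>A\<close>.\<close>

definition H0_Curl :: "(real^3) set \<Rightarrow> (real^3) set \<Rightarrow> (real^3 \<Rightarrow> real^3^3) set" where
  "H0_Curl \<gamma> \<Omega> = {T. \<forall>i. (\<lambda>x. T x $ i) \<in> H0_curl \<gamma> \<Omega>}"

definition H0_Curl0 :: "(real^3) set \<Rightarrow> (real^3) set \<Rightarrow> (real^3 \<Rightarrow> real^3^3) set" where
  "H0_Curl0 \<gamma> \<Omega> = {T. \<forall>i. (\<lambda>x. T x $ i) \<in> H0_curl0 \<gamma> \<Omega>}"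

definition Gamma_n :: "(real^3) set \<Rightarrow> (real^3) set \<Rightarrow> (real^3) set" where
  "Gamma_n \<Omega> \<Gamma>t = frontier \<Omega> - closure \<Gamma>t"

definition harmonic_fields :: "(real^3) set \<Rightarrow> (real^3) set \<Rightarrow> (real^3 \<Rightarrow> real^3) set" where
  "harmonic_fields \<Omega> \<Gamma>t = H0_curl0 \<Gamma>t \<Omega> \<inter> H0_div0 (Gamma_n \<Omega> \<Gamma>t) \<Omega>"

definition maxwell_constant :: "(real^3) set \<Rightarrow> (real^3) set \<Rightarrow> real \<Rightarrow> bool" where
  "maxwell_constant \<Omega> \<Gamma>t c \<longleftrightarrow> c > 0 \<and>
     (\<forall>v \<in> H0_curl \<Gamma>t \<Omega> \<inter> H0_div (Gamma_n \<Omega> \<Gamma>t) \<Omega> \<inter> L2_orth \<Omega> (harmonic_fields \<Omega> \<Gamma>t).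
        L2_norm \<Omega> v \<le> c * sqrt ((L2_norm \<Omega> (weak_curl \<Omega> v))\<^sup>2 + (L2_norm \<Omega> (weak_div \<Omega> v))\<^sup>2))"

definition sym_part :: "real^3^3 \<Rightarrow> real^3^3" where
  "sym_part A = (1/2) *\<^sub>R (A + transpose A)"

definition irrot_korn_constant :: "(real^3) set \<Rightarrow> (real^3) set \<Rightarrow> real \<Rightarrow> bool" where
  "irrot_korn_constant \<Omega> \<Gamma>t c \<longleftrightarrow> c > 0 \<and>
     (\<forall>T \<in> H0_Curl0 \<Gamma>t \<Omega>. L2_norm \<Omega> T \<le> c * L2_norm \<Omega> (\<lambda>x. sym_part (T x)))"

definition T_of :: "(real^3 \<Rightarrow> real) \<Rightarrow> real^3 \<Rightarrow> real^3^3" where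
  "T_of u x = vector [vector [0, 0, u x], vector [0, 0, 0], vector [- u x, 0, 0]]"

end

theory Submission
  imports Defs
begin

text \<open>
  The Poincare inequality holds even with the constant \<open>c\<^sub>m\<close>. Given \<open>g\<close> vanishing on \<open>\<Gamma>\<^sub>t\<close>, project
  \<open>(0, g)\<close> onto the closure of the pairs \<open>(\<surd>\<epsilon> \<Phi>, div \<Phi>)\<close> with \<open>\<Phi>\<close> vanishing near \<open>\<Gamma>\<^sub>n\<close>. This produces
  \<open>v\<close> in the strong \<open>div\<close>-space such that \<open>p = g - div v\<close> has gradient \<open>- \<epsilon> v\<close> and vanishes weakly on
  \<open>\<Gamma>\<^sub>t\<close>. Hence \<open>v\<close> is an admissible field without curl for the Maxwell inequality, orthogonal to the
  harmonic fields, so \<open>\<parallel>v\<parallel> \<le> c\<^sub>m \<parallel>div v\<parallel> \<le> c\<^sub>m \<parallel>g\<parallel>\<close>, and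
  \<open>\<parallel>g\<parallel>\<^sup>2 = \<langle>p, g\<rangle> - \<langle>v, grad g\<rangle>\<close>. Korn's inequality, applied to an infinitesimal rotation times a
  scalar, gives some Poincare constant; with it \<open>p\<close> tends to \<open>0\<close> as \<open>\<epsilon> \<rightarrow> 0\<close>.

  What makes this work, and what also characterises the \<open>u\<close> with \<open>T\<^sub>u\<close> in the \<open>Curl\<close>-space, is that
  weak and strong boundary conditions agree for the gradient. Away from the interface of \<open>\<Gamma>\<^sub>t\<close> and
  \<open>\<Gamma>\<^sub>n\<close> one translates along a direction transversal to the boundary and mollifies: inwards or
  outwards according to the boundary condition. The interface is a Lipschitz curve, hence of
  codimension two and of capacity zero, so bounded functions can be cut off there at no cost; and
  \<open>M sin (u / M)\<close> is a smooth substitute for truncation.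
\<close>

section \<open>Smooth functions\<close>

text \<open>The field v solves a regularised mixed Laplace problem: formally - \<Delta>p +
  \<epsilon>p = \<epsilon>g with p = 0 on \<Gamma>t and zero normal derivative on \<Gamma>n, and v =
  - grad p / \<epsilon>. Aiming at div v = g directly would presuppose that the divergence is onto.
  The penalised least squares problem is solvable by completeness of L2 alone, and its defect p is
  small as soon as some Poincare constant is known; that constant only multiplies \<epsilon> and
  disappears in the limit. The obstacle is the boundary condition. Orthogonality yields p = 0 on
  \<Gamma>t only in the weak sense, while the Maxwell inequality speaks of limits of smooth fields
  vanishing near \<Gamma>t. The same gap lies between the rows of \<open>T_of u\<close>, whose
  smooth approximations need not have the shape of \<open>T_of\<close>, and the gradient space. It
  is closed for scalar functions, because these can be truncated, and truncation is what allows
  cutoffs at the interface: their gradients are small in L2 only and must meet a bounded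
  factor.\<close>

lemma pderiv3_eq:
  assumes "(f has_derivative f') (at x)"
  shows "pderiv3 i f x = f' (axis i 1)"
  using frechet_derivative_at[OF assms] by (simp add: pderiv3_def)

lemma has_derivative_pderiv3:
  assumes "f differentiable (at x)"
  shows "(f has_derivative (\<lambda>h. \<Sum>i\<in>UNIV. h $ i * pderiv3 i f x)) (at x)"
proof -
  let ?D = "frechet_derivative f (at x)"
  have D: "(f has_derivative ?D) (at x)"
    using assms by (simp add: frechet_derivative_works)
  then interpret bounded_linear ?D by (rule has_derivative_bounded_linear)
  have "?D h = (\<Sum>i\<in>UNIV. h $ i * pderiv3 i f x)" for h
  proof -
    have "h = (\<Sum>i\<in>UNIV. h $ i *\<^sub>R axis i 1)"
      by (subst basis_expansion[of h, symmetric]) (simp add: scalar_mult_eq_scaleR)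
    then have "?D h = ?D (\<Sum>i\<in>UNIV. h $ i *\<^sub>R axis i 1)" by simp
    then show ?thesis by (simp add: sum scaleR pderiv3_def)
  qed
  then have "?D = (\<lambda>h. \<Sum>i\<in>UNIV. h $ i * pderiv3 i f x)" by blast
  with D show ?thesis by simp
qed

lemma pderiv3_cong_open:
  assumes "open U" "x \<in> U" "\<And>y. y \<in> U \<Longrightarrow> f y = g y"
  shows "pderiv3 i f x = pderiv3 i g x" "f differentiable (at x) \<longleftrightarrow> g differentiable (at x)"
proof -
  have *: "(f has_derivative D) (at x) \<longleftrightarrow> (g has_derivative D) (at x)" for D
    using assms has_derivative_transform_within_open[of f D x UNIV U g]
      has_derivative_transform_within_open[of g D x UNIV U f] by auto
  then show "pderiv3 i f x = pderiv3 i g x"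
    by (simp add: pderiv3_def frechet_derivative_def)
  show "f differentiable (at x) \<longleftrightarrow> g differentiable (at x)"
    using * by (simp add: differentiable_def)
qed

lemma C_k_SucD:
  assumes "C_k (Suc k) f" shows "C_k k f"
  using assms
proof (induction k arbitrary: f)
  case 0
  then show ?case
    by (auto simp: continuous_on_eq_continuous_within intro: differentiable_imp_continuous_within)
next
  case (Suc k)
  then show ?case by (metis C_k.simps(2))
qed

lemma C_k_add: "C_k k f \<Longrightarrow> C_k k g \<Longrightarrow> C_k k (\<lambda>x. f x + g x)"
proof (induction k arbitrary: f g)
  case 0 then show ?case by (auto intro: continuous_intros)
next
  case (Suc k)
  have "pderiv3 i (\<lambda>x. f x + g x) = (\<lambda>x. pderiv3 i f x + pderiv3 i g x)" for i
    using Suc.prems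
    by (intro ext, subst pderiv3_eq[OF has_derivative_add[OF has_derivative_pderiv3 has_derivative_pderiv3]])
       (auto simp: pderiv3_eq[OF has_derivative_pderiv3])
  then show ?case using Suc by auto
qed

lemma pderiv3_mult:
  assumes "f differentiable (at x)" "g differentiable (at x)"
  shows "pderiv3 i (\<lambda>x. f x * g x) x = f x * pderiv3 i g x + pderiv3 i f x * g x"
  using assms
  by (subst pderiv3_eq[OF has_derivative_mult[OF has_derivative_pderiv3 has_derivative_pderiv3]])
     (auto simp: pderiv3_eq[OF has_derivative_pderiv3])

lemma pderiv3_add:
  assumes "f differentiable (at x)" "g differentiable (at x)"
  shows "pderiv3 i (\<lambda>x. f x + g x) x = pderiv3 i f x + pderiv3 i g x"
  using assms
  by (subst pderiv3_eq[OF has_derivative_add[OF has_derivative_pderiv3 has_derivative_pderiv3]])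
     (auto simp: pderiv3_eq[OF has_derivative_pderiv3])

lemma C_k_mult: "C_k k f \<Longrightarrow> C_k k g \<Longrightarrow> C_k k (\<lambda>x. f x * g x)"
proof (induction k arbitrary: f g)
  case 0 then show ?case by (auto intro: continuous_intros)
next
  case (Suc k)
  have "pderiv3 i (\<lambda>x. f x * g x) = (\<lambda>x. f x * pderiv3 i g x + pderiv3 i f x * g x)" for i
    using Suc.prems by (intro ext pderiv3_mult) auto
  moreover have "C_k k (\<lambda>x. f x * pderiv3 i g x + pderiv3 i f x * g x)" for i
    using Suc.prems C_k_SucD[OF Suc.prems(1)] C_k_SucD[OF Suc.prems(2)]
    by (intro C_k_add Suc.IH) auto
  ultimately show ?case using Suc.prems by auto
qed

text \<open>Differentiability already yields continuity, so one level of the recursion in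
  \<open>C_k\<close> can be peeled off. \<open>smooth_differentiable\<close>,
  \<open>smooth_pderiv3\<close> and \<open>smooth_nth\<close> rest on this.\<close>

lemma smooth_iff: "smooth f \<longleftrightarrow> (\<forall>x. f differentiable (at x)) \<and> (\<forall>i. smooth (pderiv3 i f))"
proof
  show "smooth f \<Longrightarrow> (\<forall>x. f differentiable (at x)) \<and> (\<forall>i. smooth (pderiv3 i f))"
    unfolding smooth_def by (metis C_k.simps(2))
  assume r: "(\<forall>x. f differentiable (at x)) \<and> (\<forall>i. smooth (pderiv3 i f))"
  show "smooth f"
    unfolding smooth_def
  proof
    fix k show "C_k k f"
      using r by (cases k)
        (auto simp: smooth_def continuous_on_eq_continuous_within
          intro: differentiable_imp_continuous_within)
  qed
qed

lemma smooth_differentiable: "smooth f \<Longrightarrow> f differentiable (at x)"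
  by (simp add: smooth_iff[of f])

lemma smooth_pderiv3: "smooth f \<Longrightarrow> smooth (pderiv3 i f)"
  by (simp add: smooth_iff[of f])

lemma smooth_continuous: "smooth f \<Longrightarrow> continuous_on A f"
  unfolding smooth_def by (metis C_k.simps(1) continuous_on_subset subset_UNIV)

lemma smooth_const [simp]: "smooth (\<lambda>x. c)"
proof -
  have "C_k k (\<lambda>x. c)" for k c
  proof (induction k arbitrary: c)
    case (Suc k)
    have "pderiv3 i (\<lambda>x. c) = (\<lambda>x. 0)" for i
      by (intro ext) (simp add: pderiv3_eq[OF has_derivative_const])
    with Suc show ?case by auto
  qed auto
  then show ?thesis by (simp add: smooth_def)
qed

lemma pderiv3_const [simp]: "pderiv3 i (\<lambda>x. c) x = 0"
  by (simp add: pderiv3_eq[OF has_derivative_const])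

lemma smooth_add: "smooth f \<Longrightarrow> smooth g \<Longrightarrow> smooth (\<lambda>x. f x + g x)"
  by (simp add: smooth_def C_k_add)

lemma smooth_mult: "smooth f \<Longrightarrow> smooth g \<Longrightarrow> smooth (\<lambda>x. f x * g x)"
  by (simp add: smooth_def C_k_mult)

lemma smooth_cmult: "smooth f \<Longrightarrow> smooth (\<lambda>x. c * f x)"
  by (simp add: smooth_mult)

lemma smooth_minus: "smooth f \<Longrightarrow> smooth (\<lambda>x. - f x)"
  using smooth_cmult[of f "-1"] by simp

lemma smooth_diff: "smooth f \<Longrightarrow> smooth g \<Longrightarrow> smooth (\<lambda>x. f x - g x)"
  using smooth_add[of f "\<lambda>x. - g x"] by (simp add: smooth_minus)

lemma pderiv3_cmult:
  "f differentiable (at x) \<Longrightarrow> pderiv3 i (\<lambda>x. c * f x) x = c * pderiv3 i f x"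
  by (subst pderiv3_mult) auto

lemma pderiv3_minus:
  "f differentiable (at x) \<Longrightarrow> pderiv3 i (\<lambda>x. - f x) x = - pderiv3 i f x"
  using pderiv3_cmult[of f x i "-1"] by simp

lemma pderiv3_diff:
  assumes "f differentiable (at x)" "g differentiable (at x)"
  shows "pderiv3 i (\<lambda>x. f x - g x) x = pderiv3 i f x - pderiv3 i g x"
  using pderiv3_add[of f x "\<lambda>x. - g x" i] assms by (simp add: pderiv3_minus)

lemma smooth_sum: "(\<And>i. i \<in> I \<Longrightarrow> smooth (f i)) \<Longrightarrow> smooth (\<lambda>x. \<Sum>i\<in>I. f i x)"
  by (induction I rule: infinite_finite_induct) (simp_all add: smooth_add)

lemma pderiv3_sum:
  "(\<And>j. j \<in> I \<Longrightarrow> smooth (f j)) \<Longrightarrow>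
    pderiv3 i (\<lambda>x. \<Sum>j\<in>I. f j x) x = (\<Sum>j\<in>I. pderiv3 i (f j) x)"
  by (induction I rule: infinite_finite_induct)
     (auto simp: pderiv3_add smooth_differentiable smooth_sum)

lemma smooth_prod: "(\<And>i. i \<in> I \<Longrightarrow> smooth (f i)) \<Longrightarrow> smooth (\<lambda>x. \<Prod>i\<in>I. f i x)"
  by (induction I rule: infinite_finite_induct) (simp_all add: smooth_mult)

lemma pderiv3_nth [simp]: "pderiv3 i (\<lambda>x. x $ j) x = (if i = j then 1 else 0)"
proof -
  have "((\<lambda>x. x $ j) has_derivative (\<lambda>x. x $ j)) (at x)"
    by (intro bounded_linear_imp_has_derivative bounded_linear_vec_nth)
  from pderiv3_eq[OF this] show ?thesis by (simp add: axis_def)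
qed

lemma smooth_nth [simp]: "smooth (\<lambda>x. x $ j)"
proof -
  have "(\<lambda>x::real^3. x $ j) differentiable (at x)" for x
    using bounded_linear_imp_has_derivative[OF bounded_linear_vec_nth] differentiable_def by blast
  moreover have "pderiv3 i (\<lambda>x. x $ j) = (\<lambda>x. if i = j then 1 else 0)" for i by auto
  ultimately show ?thesis by (subst smooth_iff) auto
qed

text \<open>Functions that agree on an open set have the same partial derivatives there, so local
  smooth models pass through the recursion of \<open>C_k\<close>. This is how functions are glued,
  in particular with zero across the boundary.\<close>

lemma C_k_local:
  assumes "\<And>x. \<exists>U g. open U \<and> x \<in> U \<and> C_k k g \<and> (\<forall>y\<in>U. f y = g y)"
  shows "C_k k f"
  using assms
proof (induction k arbitrary: f)
  case 0
  have "isCont f x" for x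
  proof -
    obtain U g where U: "open U" "x \<in> U" "continuous_on UNIV g" "\<forall>y\<in>U. f y = g y"
      using 0[of x] by auto
    then have "continuous_on U f"
      by (metis continuous_on_cong continuous_on_subset subset_UNIV)
    with U show ?thesis using continuous_on_eq_continuous_at by blast
  qed
  then show ?case by (simp add: continuous_on_eq_continuous_at)
next
  case (Suc k)
  have "f differentiable (at x)" for x
    using Suc.prems[of x] pderiv3_cong_open(2) by (metis C_k.simps(2))
  moreover have "C_k k (pderiv3 i f)" for i
  proof (rule Suc.IH)
    fix x
    obtain U g where U: "open U" "x \<in> U" "C_k (Suc k) g" "\<forall>y\<in>U. f y = g y"
      using Suc.prems[of x] by auto
    then have "\<forall>y\<in>U. pderiv3 i f y = pderiv3 i g y"
      using pderiv3_cong_open(1)[of U _ f g] by blast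
    with U show "\<exists>U g. open U \<and> x \<in> U \<and> C_k k g \<and> (\<forall>y\<in>U. pderiv3 i f y = g y)"
      by (intro exI[of _ U] exI[of _ "pderiv3 i g"]) simp
  qed
  ultimately show ?case by auto
qed

lemma smooth_local:
  assumes "\<And>x. \<exists>U g. open U \<and> x \<in> U \<and> smooth g \<and> (\<forall>y\<in>U. f y = g y)"
  shows "smooth f"
  unfolding smooth_def using assms by (meson C_k_local smooth_def)

text \<open>In a convolution the kernel enters as \<open>K (x - y)\<close> and serves as a test
  function of \<open>y\<close>; each derivative in \<open>y\<close> then costs a sign.\<close>

lemma pderiv3_reflect:
  assumes "f differentiable (at (a - x))"
  shows "pderiv3 i (\<lambda>y. f (a - y)) x = - pderiv3 i f (a - x)"
    "(\<lambda>y. f (a - y)) differentiable (at x)"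
proof -
  have "((\<lambda>y. a - y) has_derivative (\<lambda>h. - h)) (at x)"
    by (auto intro!: derivative_eq_intros)
  from has_derivative_compose[OF this has_derivative_pderiv3[OF assms]]
  have *: "((\<lambda>y. f (a - y)) has_derivative (\<lambda>h. \<Sum>i\<in>UNIV. (- h) $ i * pderiv3 i f (a - x))) (at x)" .
  from pderiv3_eq[OF this] show "pderiv3 i (\<lambda>y. f (a - y)) x = - pderiv3 i f (a - x)"
    by (simp add: axis_def if_distrib[of "\<lambda>u. u * _"] if_distrib[of uminus] cong: if_cong)
  show "(\<lambda>y. f (a - y)) differentiable (at x)" using * differentiable_def by blast
qed

lemma smooth_reflect:
  assumes "smooth f" shows "smooth (\<lambda>y. f (a - y))"
proof -
  have "C_k k (\<lambda>y. f (a - y))" if "smooth f" for k f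
    using that
  proof (induction k arbitrary: f)
    case 0
    then show ?case
      using smooth_continuous[of f UNIV] continuous_on_compose2[of UNIV f UNIV "\<lambda>y. a - y"]
      by (simp add: continuous_on_diff)
  next
    case (Suc k)
    have "pderiv3 i (\<lambda>y. f (a - y)) = (\<lambda>y. - 1 * pderiv3 i f (a - y))" for i
      using Suc.prems by (auto simp: pderiv3_reflect smooth_differentiable)
    moreover have "C_k k (\<lambda>y. - 1 * pderiv3 i f (a - y))" for i
      using Suc by (intro C_k_mult Suc.IH) (auto intro: smooth_pderiv3 simp: smooth_const[unfolded smooth_def])
    moreover have "(\<lambda>y. f (a - y)) differentiable (at x)" for x
      by (rule pderiv3_reflect(2)) (rule smooth_differentiable[OF Suc.prems])
    ultimately show ?case by simp
  qed
  with assms show ?thesis by (simp add: smooth_def)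
qed

section \<open>Composition with real functions and the flat exponential\<close>

lemma pderiv3_compose_real:
  assumes "(F has_real_derivative F') (at (q x))" "q differentiable (at x)"
  shows "pderiv3 i (\<lambda>x. F (q x)) x = F' * pderiv3 i q x" "(\<lambda>x. F (q x)) differentiable (at x)"
proof -
  have *: "((\<lambda>x. F (q x)) has_derivative (\<lambda>h. F' * (\<Sum>i\<in>UNIV. h $ i * pderiv3 i q x))) (at x)"
    using has_derivative_compose[OF has_derivative_pderiv3[OF assms(2)]
        assms(1)[unfolded has_field_derivative_def]] .
  show "pderiv3 i (\<lambda>x. F (q x)) x = F' * pderiv3 i q x"
    unfolding pderiv3_eq[OF *] by (simp add: pderiv3_eq[OF has_derivative_pderiv3[OF assms(2)], symmetric])
  show "(\<lambda>x. F (q x)) differentiable (at x)" using * differentiable_def by blast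
qed

text \<open>A class \<open>A\<close> closed under differentiation stands in for the smoothness of
  \<open>F\<close> on the line: each level of the recursion produces F'(q) times a derivative of q,
  and F' lies in \<open>A\<close> again. It is used with the four functions generated by the sine
  and with the flat exponentials.\<close>

lemma smooth_compose_real:
  assumes D: "\<And>F. F \<in> A \<Longrightarrow> \<exists>F'\<in>A. \<forall>t. (F has_real_derivative F' t) (at t)"
    and "F \<in> A" "smooth q"
  shows "smooth (\<lambda>x. F (q x))"
proof -
  have "C_k k (\<lambda>x. F (q x))" if "F \<in> A" for k F
    using that
  proof (induction k arbitrary: F)
    case 0
    then obtain F' where "\<forall>t. (F has_real_derivative F' t) (at t)" using D by blast
    then have "continuous_on UNIV F"
      by (meson DERIV_isCont continuous_at_imp_continuous_on)
    then show ?case using smooth_continuous[OF assms(3)] continuous_on_compose2 by fastforce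
  next
    case (Suc k)
    obtain F' where F': "F' \<in> A" "\<forall>t. (F has_real_derivative F' t) (at t)"
      using D[OF Suc.prems] by blast
    have "pderiv3 i (\<lambda>x. F (q x)) = (\<lambda>x. F' (q x) * pderiv3 i q x)" for i
      by (rule ext, rule pderiv3_compose_real(1)[OF F'(2)[rule_format] smooth_differentiable[OF assms(3)]])
    moreover have "C_k k (\<lambda>x. F' (q x) * pderiv3 i q x)" for i
      using Suc.IH[OF F'(1)] smooth_pderiv3[OF assms(3)] by (intro C_k_mult) (auto simp: smooth_def)
    moreover have "(\<lambda>x. F (q x)) differentiable (at x)" for x
      by (rule pderiv3_compose_real(2)[OF F'(2)[rule_format] smooth_differentiable[OF assms(3)]])
    ultimately show ?case by simp
  qed
  with assms show ?thesis by (simp add: smooth_def)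
qed

lemma smooth_sin:
  assumes "smooth q" shows "smooth (\<lambda>x. sin (q x))"
proof (rule smooth_compose_real[where F = sin and A = "{sin, cos, \<lambda>x. - sin x, \<lambda>x. - cos x}"])
  show "\<exists>F'\<in>{sin, cos, \<lambda>x. - sin x, \<lambda>x. - cos x}. \<forall>t. (F has_real_derivative F' t) (at t)"
    if "F \<in> {sin, cos, \<lambda>x. - sin x, \<lambda>x. - cos x}" for F :: "real \<Rightarrow> real"
    using that by (auto intro!: derivative_eq_intros)
qed (use assms in auto)

text \<open>For \<open>p = 1\<close> this is the classical exp(-1/t), flat at 0. The polynomial in
  1/t makes the family closed under differentiation.\<close>

definition flat_exp :: "real poly \<Rightarrow> real \<Rightarrow> real" where
  "flat_exp p t = (if t > 0 then poly p (1 / t) * exp (- (1 / t)) else 0)"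

lemma poly_mult_exp_minus_tendsto_0:
  fixes p :: "real poly" shows "((\<lambda>x. poly p x * exp (- x)) \<longlongrightarrow> 0) at_top"
proof -
  have "((\<lambda>x. \<Sum>i\<le>degree p. coeff p i * (x ^ i / exp x)) \<longlongrightarrow> (\<Sum>i\<le>degree p. coeff p i * 0)) at_top"
    by (intro tendsto_sum tendsto_mult tendsto_const tendsto_power_div_exp_0)
  moreover have "(\<lambda>x. poly p x * exp (- x)) = (\<lambda>x. \<Sum>i\<le>degree p. coeff p i * (x ^ i / exp x))"
    by (auto simp: poly_altdef exp_minus sum_distrib_right divide_inverse mult.assoc)
  ultimately show ?thesis by simp
qed

text \<open>For t > 0 the derivative of p(1/t) exp(-1/t) is (1/t^2) (p - p')(1/t) exp(-1/t), and
  \<open>[:0, 0, 1:]\<close> is the factor 1/t^2.\<close>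

lemma flat_exp_DERIV:
  "(flat_exp p has_real_derivative flat_exp ([:0, 0, 1:] * (p - pderiv p)) t) (at t)"
proof (cases t "0::real" rule: linorder_cases)
  case less
  have "((\<lambda>x. 0) has_real_derivative 0) (at t)" by simp
  then have "(flat_exp p has_real_derivative 0) (at t)"
    by (rule DERIV_cong_ev[THEN iffD1, OF refl _ refl, rotated])
       (use less in \<open>auto simp: flat_exp_def eventually_nhds intro!: exI[of _ "{..<0}"]\<close>)
  then show ?thesis using less by (simp add: flat_exp_def)
next
  case greater
  have "((\<lambda>x. poly p (1 / x) * exp (- (1 / x))) has_real_derivative
      poly p (1 / t) * (exp (- (1 / t)) * (1 / t^2)) + poly (pderiv p) (1 / t) * (- 1 / t^2) * exp (- (1 / t))) (at t)"
    using greater by (auto intro!: derivative_eq_intros DERIV_chain2[OF poly_DERIV] simp: power2_eq_square field_simps)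
  then have "(flat_exp p has_real_derivative
      poly p (1 / t) * (exp (- (1 / t)) * (1 / t^2)) + poly (pderiv p) (1 / t) * (- 1 / t^2) * exp (- (1 / t))) (at t)"
    by (rule DERIV_cong_ev[THEN iffD1, OF refl _ refl, rotated])
       (use greater in \<open>auto simp: flat_exp_def eventually_nhds intro!: exI[of _ "{0<..}"]\<close>)
  then show ?thesis using greater
    by (simp add: flat_exp_def field_simps power2_eq_square)
next
  case equal
  have "((\<lambda>h. flat_exp p h / h) \<longlongrightarrow> 0) (at_right 0)"
  proof -
    \<comment> \<open>Dividing by h amounts to multiplying \<open>p\<close> by the monomial
      \<open>[:0, 1:]\<close>, evaluated at 1/h; the exponential decay beats every
      polynomial.\<close>
    have "((\<lambda>h. poly (p * [:0, 1:]) (inverse h) * exp (- inverse h)) \<longlongrightarrow> 0) (at_right 0)"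
      by (rule filterlim_compose[OF poly_mult_exp_minus_tendsto_0 filterlim_inverse_at_top_right])
    then show ?thesis
      by (rule Lim_transform_eventually)
         (auto simp: eventually_at_filter flat_exp_def field_simps intro!: always_eventually)
  qed
  moreover have "((\<lambda>h. flat_exp p h / h) \<longlongrightarrow> 0) (at_left 0)"
    by (rule Lim_transform_eventually[OF tendsto_const])
       (auto simp: eventually_at_filter flat_exp_def)
  ultimately have "((\<lambda>h. flat_exp p h / h) \<longlongrightarrow> 0) (at 0)"
    by (simp add: filterlim_split_at)
  then show ?thesis using equal by (simp add: flat_exp_def DERIV_def)
qed

lemma smooth_flat_exp:
  assumes "smooth q" shows "smooth (\<lambda>x. flat_exp p (q x))"
  by (rule smooth_compose_real[where F = "flat_exp p" and A = "range flat_exp"]) (use assms flat_exp_DERIV in auto)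

lemma smooth_norm_sq: "smooth (\<lambda>x. (norm (x - c))\<^sup>2)"
proof -
  have "(norm (x - c))\<^sup>2 = (\<Sum>i\<in>UNIV. (x $ i - c $ i) * (x $ i - c $ i))" for x
    by (simp add: power2_norm_eq_inner inner_vec_def)
  then show ?thesis
    by (simp only:) (intro smooth_sum smooth_mult smooth_diff smooth_nth smooth_const)
qed

section \<open>The space of square-integrable functions\<close>

lemma L2_measurable: "f \<in> L2 \<Omega> \<Longrightarrow> f \<in> borel_measurable (lebesgue_on \<Omega>)"
  by (simp add: L2_def)

lemma L2_integrable_sq: "f \<in> L2 \<Omega> \<Longrightarrow> integrable (lebesgue_on \<Omega>) (\<lambda>x. (norm (f x))\<^sup>2)"
  by (simp add: L2_def)

lemma L2_norm_nonneg [simp]: "0 \<le> L2_norm \<Omega> f"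
  by (simp add: L2_norm_def)

lemma L2_norm_sq: "(L2_norm \<Omega> f)\<^sup>2 = (\<integral>x. (norm (f x))\<^sup>2 \<partial>lebesgue_on \<Omega>)"
  by (simp add: L2_norm_def)

lemma L2_norm_sq_inner: "(L2_norm \<Omega> f)\<^sup>2 = L2_inner \<Omega> f f"
  by (simp add: L2_norm_sq L2_inner_def power2_norm_eq_inner)

lemma L2_inner_commute: "L2_inner \<Omega> f g = L2_inner \<Omega> g f"
  by (simp add: L2_inner_def inner_commute)

lemma L2_cong:
  assumes "\<And>x. x \<in> \<Omega> \<Longrightarrow> f x = g x"
  shows "f \<in> L2 \<Omega> \<longleftrightarrow> g \<in> L2 \<Omega>" "L2_norm \<Omega> f = L2_norm \<Omega> g" "L2_inner \<Omega> f h = L2_inner \<Omega> g h"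
proof -
  show "f \<in> L2 \<Omega> \<longleftrightarrow> g \<in> L2 \<Omega>"
    unfolding L2_def mem_Collect_eq
    by (intro conj_cong measurable_cong Bochner_Integration.integrable_cong) (auto simp: assms)
  show "L2_norm \<Omega> f = L2_norm \<Omega> g"
    unfolding L2_norm_def
    by (intro arg_cong[where f=sqrt] Bochner_Integration.integral_cong) (auto simp: assms)
  show "L2_inner \<Omega> f h = L2_inner \<Omega> g h"
    unfolding L2_inner_def
    by (intro Bochner_Integration.integral_cong) (auto simp: assms)
qed

lemma L2_bounded_by:
  assumes "f \<in> borel_measurable (lebesgue_on \<Omega>)" "g \<in> L2 \<Omega>"
    and le: "\<And>x. x \<in> \<Omega> \<Longrightarrow> norm (f x) \<le> B * norm (g x)" and "0 \<le> B"
  shows "f \<in> L2 \<Omega>" "L2_norm \<Omega> f \<le> B * L2_norm \<Omega> g"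
proof -
  have le2: "(norm (f x))\<^sup>2 \<le> B\<^sup>2 * (norm (g x))\<^sup>2" if "x \<in> \<Omega>" for x
    using power_mono[OF le[OF that] norm_ge_zero, of 2] by (simp add: power_mult_distrib)
  have ig: "integrable (lebesgue_on \<Omega>) (\<lambda>x. B\<^sup>2 * (norm (g x))\<^sup>2)"
    using L2_integrable_sq[OF assms(2)] by simp
  have "integrable (lebesgue_on \<Omega>) (\<lambda>x. (norm (f x))\<^sup>2)"
    by (rule Bochner_Integration.integrable_bound[OF ig]) (use assms le2 in auto)
  then show "f \<in> L2 \<Omega>" using assms by (simp add: L2_def)
  have "(L2_norm \<Omega> f)\<^sup>2 \<le> (\<integral>x. B\<^sup>2 * (norm (g x))\<^sup>2 \<partial>lebesgue_on \<Omega>)"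
    unfolding L2_norm_sq
    by (rule integral_mono[OF \<open>integrable _ (\<lambda>x. (norm (f x))\<^sup>2)\<close> ig]) (use le2 in auto)
  also have "\<dots> = (B * L2_norm \<Omega> g)\<^sup>2" by (simp add: L2_norm_sq power_mult_distrib)
  finally show "L2_norm \<Omega> f \<le> B * L2_norm \<Omega> g"
    using assms(4) by (meson L2_norm_nonneg mult_nonneg_nonneg power2_le_imp_le)
qed

lemma L2_add:
  assumes "f \<in> L2 \<Omega>" "g \<in> L2 \<Omega>" shows "(\<lambda>x. f x + g x) \<in> L2 \<Omega>"
proof -
  have le: "(norm (a + b))\<^sup>2 \<le> 2 * (norm a)\<^sup>2 + 2 * (norm b)\<^sup>2" for a b :: 'a
  proof -
    have "(norm (a + b))\<^sup>2 \<le> (norm a + norm b)\<^sup>2"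
      by (intro power_mono norm_triangle_ineq) auto
    also have "\<dots> \<le> 2 * (norm a)\<^sup>2 + 2 * (norm b)\<^sup>2"
      using sum_squares_bound[of "norm a" "norm b"] by (simp add: power2_sum)
    finally show ?thesis .
  qed
  have i: "integrable (lebesgue_on \<Omega>) (\<lambda>x. 2 * (norm (f x))\<^sup>2 + 2 * (norm (g x))\<^sup>2)"
    using assms by (simp add: L2_def)
  have m: "(\<lambda>x. f x + g x) \<in> borel_measurable (lebesgue_on \<Omega>)"
    using assms by (auto simp: L2_def)
  have "integrable (lebesgue_on \<Omega>) (\<lambda>x. (norm (f x + g x))\<^sup>2)"
    by (rule Bochner_Integration.integrable_bound[OF i]) (use m le in auto)
  with m show ?thesis by (simp add: L2_def)
qed

lemma L2_scaleR: "f \<in> L2 \<Omega> \<Longrightarrow> (\<lambda>x. c *\<^sub>R f x) \<in> L2 \<Omega>"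
  by (rule L2_bounded_by(1)[of _ \<Omega> f "\<bar>c\<bar>"]) (auto simp: L2_def)

lemma L2_minus: "f \<in> L2 \<Omega> \<Longrightarrow> (\<lambda>x. - f x) \<in> L2 \<Omega>"
  using L2_scaleR[of f \<Omega> "-1"] by simp

lemma L2_diff: "f \<in> L2 \<Omega> \<Longrightarrow> g \<in> L2 \<Omega> \<Longrightarrow> (\<lambda>x. f x - g x) \<in> L2 \<Omega>"
  using L2_add[of f \<Omega> "\<lambda>x. - g x"] by (simp add: L2_minus)

lemma L2_zero [simp]: "(\<lambda>x. 0) \<in> L2 \<Omega>"
  by (simp add: L2_def)

lemma L2_sum: "(\<And>i. i \<in> I \<Longrightarrow> f i \<in> L2 \<Omega>) \<Longrightarrow> (\<lambda>x. \<Sum>i\<in>I. f i x) \<in> L2 \<Omega>"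
  by (induction I rule: infinite_finite_induct) (simp_all add: L2_add)

section \<open>Inner product and norm\<close>

lemma L2_inner_integrable:
  assumes "f \<in> L2 \<Omega>" "g \<in> L2 \<Omega>"
  shows "integrable (lebesgue_on \<Omega>) (\<lambda>x. f x \<bullet> g x)"
proof -
  have i: "integrable (lebesgue_on \<Omega>) (\<lambda>x. (norm (f x))\<^sup>2 + (norm (g x))\<^sup>2)"
    using assms by (simp add: L2_def)
  have "\<bar>a \<bullet> b\<bar> \<le> (norm a)\<^sup>2 + (norm b)\<^sup>2" for a b :: 'a
    using Cauchy_Schwarz_ineq2[of a b] sum_squares_bound[of "norm a" "norm b"]
      mult_nonneg_nonneg[OF norm_ge_zero[of a] norm_ge_zero[of b]] by linarith
  moreover have "(\<lambda>x. f x \<bullet> g x) \<in> borel_measurable (lebesgue_on \<Omega>)"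
    using assms by (auto simp: L2_def)
  ultimately show ?thesis
    by (intro Bochner_Integration.integrable_bound[OF i]) auto
qed

lemma L2_inner_add_left:
  "f \<in> L2 \<Omega> \<Longrightarrow> g \<in> L2 \<Omega> \<Longrightarrow> h \<in> L2 \<Omega> \<Longrightarrow>
    L2_inner \<Omega> (\<lambda>x. f x + g x) h = L2_inner \<Omega> f h + L2_inner \<Omega> g h"
  by (simp add: L2_inner_def inner_add_left L2_inner_integrable)

lemma L2_inner_diff_left:
  "f \<in> L2 \<Omega> \<Longrightarrow> g \<in> L2 \<Omega> \<Longrightarrow> h \<in> L2 \<Omega> \<Longrightarrow>
    L2_inner \<Omega> (\<lambda>x. f x - g x) h = L2_inner \<Omega> f h - L2_inner \<Omega> g h"
  by (simp add: L2_inner_def inner_diff_left L2_inner_integrable)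

lemma L2_inner_scaleR_left: "L2_inner \<Omega> (\<lambda>x. c *\<^sub>R f x) h = c * L2_inner \<Omega> f h"
  by (simp add: L2_inner_def)

lemma L2_inner_minus_left: "L2_inner \<Omega> (\<lambda>x. - f x) h = - L2_inner \<Omega> f h"
  using L2_inner_scaleR_left[of \<Omega> "-1" f h] by simp

lemma L2_inner_zero [simp]: "L2_inner \<Omega> (\<lambda>x. 0) h = 0" "L2_inner \<Omega> h (\<lambda>x. 0) = 0"
  by (simp_all add: L2_inner_def)

lemma L2_inner_add_right:
  "f \<in> L2 \<Omega> \<Longrightarrow> g \<in> L2 \<Omega> \<Longrightarrow> h \<in> L2 \<Omega> \<Longrightarrow>
    L2_inner \<Omega> h (\<lambda>x. f x + g x) = L2_inner \<Omega> h f + L2_inner \<Omega> h g"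
  by (simp add: L2_inner_def inner_add_right L2_inner_integrable)

lemma L2_inner_diff_right:
  "f \<in> L2 \<Omega> \<Longrightarrow> g \<in> L2 \<Omega> \<Longrightarrow> h \<in> L2 \<Omega> \<Longrightarrow>
    L2_inner \<Omega> h (\<lambda>x. f x - g x) = L2_inner \<Omega> h f - L2_inner \<Omega> h g"
  by (simp add: L2_inner_def inner_diff_right L2_inner_integrable)

lemma L2_inner_scaleR_right: "L2_inner \<Omega> h (\<lambda>x. c *\<^sub>R f x) = c * L2_inner \<Omega> h f"
  by (simp add: L2_inner_def)

text \<open>Evaluation at the vertex - b/c gives the claim. It serves twice: for Cauchy-Schwarz, and
  with \<open>a = 0\<close> to see that the linear term vanishes at a minimiser.\<close>

lemma quadratic_nonneg_discriminant:
  fixes a b c :: real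
  assumes "\<And>t. 0 \<le> a + 2 * b * t + c * t\<^sup>2" "0 \<le> a" "0 \<le> c"
  shows "b\<^sup>2 \<le> a * c"
proof (cases "c = 0")
  case True
  have "b = 0"
  proof (rule ccontr)
    assume "b \<noteq> 0"
    \<comment> \<open>At this \<open>t\<close> the affine function equals -1.\<close>
    then show False using assms(1)[of "- (a + 1) / (2 * b)"] True by simp
  qed
  with True show ?thesis by simp
next
  case False
  then have "0 \<le> a + 2 * b * (- b / c) + c * (- b / c)\<^sup>2" using assms(1) by blast
  also have "\<dots> = a - b\<^sup>2 / c" using False by (simp add: power2_eq_square field_simps)
  finally show ?thesis using False assms(3) by (simp add: field_simps)
qed

lemma L2_norm_add_scaleR_sq:
  assumes "f \<in> L2 \<Omega>" "g \<in> L2 \<Omega>"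
  shows "(L2_norm \<Omega> (\<lambda>x. f x + t *\<^sub>R g x))\<^sup>2
    = (L2_norm \<Omega> f)\<^sup>2 + 2 * L2_inner \<Omega> f g * t + (L2_norm \<Omega> g)\<^sup>2 * t\<^sup>2"
proof -
  note t = L2_scaleR[OF assms(2), of t]
  have "L2_inner \<Omega> (\<lambda>x. f x + t *\<^sub>R g x) (\<lambda>x. f x + t *\<^sub>R g x)
      = L2_inner \<Omega> f f + t * L2_inner \<Omega> f g + (t * L2_inner \<Omega> g f + t * (t * L2_inner \<Omega> g g))"
    unfolding L2_inner_add_left[OF assms(1) t L2_add[OF assms(1) t]] L2_inner_add_right[OF assms(1) t assms(1)]
      L2_inner_add_right[OF assms(1) t t] by (simp add: L2_inner_scaleR_left L2_inner_scaleR_right)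
  then show ?thesis
    by (simp add: L2_norm_sq_inner L2_inner_commute[of _ g f]) (simp add: power2_eq_square)
qed

lemma L2_Cauchy_Schwarz:
  assumes "f \<in> L2 \<Omega>" "g \<in> L2 \<Omega>"
  shows "\<bar>L2_inner \<Omega> f g\<bar> \<le> L2_norm \<Omega> f * L2_norm \<Omega> g"
proof -
  have "(L2_inner \<Omega> f g)\<^sup>2 \<le> (L2_norm \<Omega> f)\<^sup>2 * (L2_norm \<Omega> g)\<^sup>2"
    by (intro quadratic_nonneg_discriminant) (auto simp flip: L2_norm_add_scaleR_sq[OF assms])
  then have "(L2_inner \<Omega> f g)\<^sup>2 \<le> (L2_norm \<Omega> f * L2_norm \<Omega> g)\<^sup>2"
    by (simp add: power_mult_distrib)
  then show ?thesis using abs_le_square_iff[of "L2_inner \<Omega> f g" "L2_norm \<Omega> f * L2_norm \<Omega> g"] by (simp add: abs_mult)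
qed

lemma L2_norm_triangle:
  assumes "f \<in> L2 \<Omega>" "g \<in> L2 \<Omega>"
  shows "L2_norm \<Omega> (\<lambda>x. f x + g x) \<le> L2_norm \<Omega> f + L2_norm \<Omega> g"
proof (rule power2_le_imp_le)
  show "(L2_norm \<Omega> (\<lambda>x. f x + g x))\<^sup>2 \<le> (L2_norm \<Omega> f + L2_norm \<Omega> g)\<^sup>2"
    using L2_norm_add_scaleR_sq[OF assms, of 1] L2_Cauchy_Schwarz[OF assms]
    by (simp add: power2_sum)
qed simp

lemma L2_norm_scaleR: "L2_norm \<Omega> (\<lambda>x. c *\<^sub>R f x) = \<bar>c\<bar> * L2_norm \<Omega> f"
  by (simp add: L2_norm_def power_mult_distrib real_sqrt_mult)

lemma L2_norm_minus: "L2_norm \<Omega> (\<lambda>x. - f x) = L2_norm \<Omega> f"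
  using L2_norm_scaleR[of \<Omega> "-1" f] by simp

lemma L2_norm_zero [simp]: "L2_norm \<Omega> (\<lambda>x. 0) = 0"
  by (simp add: L2_norm_def)

lemma L2_norm_diff_commute: "L2_norm \<Omega> (\<lambda>x. f x - g x) = L2_norm \<Omega> (\<lambda>x. g x - f x)"
  using L2_norm_minus[of \<Omega> "\<lambda>x. f x - g x"] by simp

lemma L2_norm_triangle_diff:
  assumes "f \<in> L2 \<Omega>" "g \<in> L2 \<Omega>" "h \<in> L2 \<Omega>"
  shows "L2_norm \<Omega> (\<lambda>x. f x - h x) \<le> L2_norm \<Omega> (\<lambda>x. f x - g x) + L2_norm \<Omega> (\<lambda>x. g x - h x)"
  using L2_norm_triangle[OF L2_diff[OF assms(1,2)] L2_diff[OF assms(2,3)]] by simp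

lemma L2_norm_le_add_diff:
  assumes "f \<in> L2 \<Omega>" "g \<in> L2 \<Omega>"
  shows "L2_norm \<Omega> f \<le> L2_norm \<Omega> g + L2_norm \<Omega> (\<lambda>x. f x - g x)"
  using L2_norm_triangle[OF assms(2) L2_diff[OF assms]] by simp

lemma L2_mult_bounded:
  fixes h :: "real^3 \<Rightarrow> real"
  assumes "f \<in> L2 \<Omega>" "h \<in> borel_measurable (lebesgue_on \<Omega>)" "\<And>x. x \<in> \<Omega> \<Longrightarrow> \<bar>h x\<bar> \<le> B" "0 \<le> B"
  shows "(\<lambda>x. h x *\<^sub>R f x) \<in> L2 \<Omega>" "L2_norm \<Omega> (\<lambda>x. h x *\<^sub>R f x) \<le> B * L2_norm \<Omega> f"
  by (rule L2_bounded_by[OF _ assms(1) _ assms(4)];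
      use assms in \<open>auto simp: L2_def intro!: mult_right_mono\<close>)+

lemma continuous_measurable_on:
  assumes "continuous_on UNIV f" "\<Omega> \<in> sets lebesgue"
  shows "f \<in> borel_measurable (lebesgue_on \<Omega>)"
  using assms continuous_imp_measurable_on_sets_lebesgue continuous_on_subset by blast

lemma continuous_bounded_on_bounded:
  fixes f :: "real^3 \<Rightarrow> 'b::real_normed_vector"
  assumes "continuous_on UNIV f" "bounded \<Omega>"
  shows "\<exists>B>0. \<forall>x\<in>\<Omega>. norm (f x) \<le> B"
proof -
  have "compact (closure \<Omega>)" using assms(2) by simp
  then have "bounded (f ` closure \<Omega>)"
    by (intro compact_imp_bounded compact_continuous_image)
       (use assms(1) continuous_on_subset in blast)+
  then obtain B where "B > 0" "\<forall>y\<in>f ` closure \<Omega>. norm y \<le> B"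
    using bounded_pos by blast
  then show ?thesis using closure_subset by blast
qed

lemma L2_bounded_measurable:
  assumes "\<Omega> \<in> lmeasurable" "f \<in> borel_measurable (lebesgue_on \<Omega>)" "\<And>x. x \<in> \<Omega> \<Longrightarrow> norm (f x) \<le> B"
  shows "f \<in> L2 \<Omega>" "(L2_norm \<Omega> f)\<^sup>2 \<le> B\<^sup>2 * measure lebesgue \<Omega>"
proof -
  have i: "integrable (lebesgue_on \<Omega>) (\<lambda>x. B\<^sup>2)"
    using finite_measure.integrable_const[OF finite_measure_lebesgue_on[OF assms(1)]] .
  have le: "(norm (f x))\<^sup>2 \<le> B\<^sup>2" if "x \<in> \<Omega>" for x
    using assms(3)[OF that] by (intro power_mono) auto
  have *: "integrable (lebesgue_on \<Omega>) (\<lambda>x. (norm (f x))\<^sup>2)"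
    by (rule Bochner_Integration.integrable_bound[OF i]) (use assms le in auto)
  then show "f \<in> L2 \<Omega>" using assms by (simp add: L2_def)
  have "(L2_norm \<Omega> f)\<^sup>2 \<le> (\<integral>x. B\<^sup>2 \<partial>lebesgue_on \<Omega>)"
    unfolding L2_norm_sq by (rule integral_mono[OF * i]) (use le in auto)
  also have "\<dots> = B\<^sup>2 * measure lebesgue \<Omega>"
    using assms(1) by (simp add: measure_restrict_space fmeasurableD)
  finally show "(L2_norm \<Omega> f)\<^sup>2 \<le> B\<^sup>2 * measure lebesgue \<Omega>" .
qed

lemma bounded_open_lmeasurable:
  fixes \<Omega> :: "(real^3) set"
  shows "open \<Omega> \<Longrightarrow> bounded \<Omega> \<Longrightarrow> \<Omega> \<in> lmeasurable"
  by (simp add: lmeasurable_open)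

lemma L2_continuous:
  fixes f :: "real^3 \<Rightarrow> 'b::euclidean_space"
  assumes "\<Omega> \<in> lmeasurable" "bounded \<Omega>" "continuous_on UNIV f"
  shows "f \<in> L2 \<Omega>"
proof -
  obtain B where "\<forall>x\<in>\<Omega>. norm (f x) \<le> B"
    using continuous_bounded_on_bounded[OF assms(3,2)] by blast
  then show ?thesis
    using assms by (intro L2_bounded_measurable(1)[of \<Omega> f B]) (auto intro: continuous_measurable_on)
qed

lemma L2_dominated:
  fixes f :: "nat \<Rightarrow> real^3 \<Rightarrow> 'b::euclidean_space"
  assumes "\<And>n. f n \<in> borel_measurable (lebesgue_on \<Omega>)" "g \<in> L2 \<Omega>"
    and le: "\<And>n x. x \<in> \<Omega> \<Longrightarrow> norm (f n x) \<le> norm (g x)"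
    and lim: "AE x in lebesgue_on \<Omega>. (\<lambda>n. f n x) \<longlonglongrightarrow> 0"
  shows "(\<lambda>n. L2_norm \<Omega> (f n)) \<longlonglongrightarrow> 0"
proof -
  have "(\<lambda>n. \<integral>x. (norm (f n x))\<^sup>2 \<partial>lebesgue_on \<Omega>) \<longlonglongrightarrow> (\<integral>x. 0 \<partial>lebesgue_on \<Omega>)"
  proof (rule integral_dominated_convergence)
    show "integrable (lebesgue_on \<Omega>) (\<lambda>x. (norm (g x))\<^sup>2)"
      using assms(2) by (rule L2_integrable_sq)
    show "AE x in lebesgue_on \<Omega>. norm ((norm (f n x))\<^sup>2) \<le> (norm (g x))\<^sup>2" for n
      using le by (intro AE_I2) (auto intro!: power_mono)
    show "AE x in lebesgue_on \<Omega>. (\<lambda>n. (norm (f n x))\<^sup>2) \<longlonglongrightarrow> 0"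
      using lim
    proof eventually_elim
      case (elim x)
      from tendsto_power[OF tendsto_norm[OF elim], of 2] show ?case by simp
    qed
  qed (use assms(1) in auto)
  from tendsto_real_sqrt[OF this] show ?thesis by (simp add: L2_norm_def)
qed

lemma L2_vec_iff:
  fixes f :: "real^3 \<Rightarrow> 'b::euclidean_space^'n"
  shows "f \<in> L2 \<Omega> \<longleftrightarrow> (\<forall>i. (\<lambda>x. f x $ i) \<in> L2 \<Omega>)"
proof
  assume f: "f \<in> L2 \<Omega>"
  show "\<forall>i. (\<lambda>x. f x $ i) \<in> L2 \<Omega>"
  proof
    fix i
    have "(\<lambda>x. f x $ i) \<in> borel_measurable (lebesgue_on \<Omega>)"
      using measurable_compose[OF L2_measurable[OF f] borel_measurable_continuous_onI[of "\<lambda>x. x $ i"]]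
      by (simp add: continuous_on_component)
    then show "(\<lambda>x. f x $ i) \<in> L2 \<Omega>"
      by (rule L2_bounded_by(1)[OF _ f, of _ 1]) (auto simp: Finite_Cartesian_Product.norm_nth_le)
  qed
next
  assume f: "\<forall>i. (\<lambda>x. f x $ i) \<in> L2 \<Omega>"
  have "(\<lambda>x. axis i (f x $ i)) \<in> L2 \<Omega>" for i
  proof (rule L2_bounded_by(1)[of _ \<Omega> "\<lambda>x. f x $ i" 1])
    have "continuous_on UNIV (axis i :: 'b \<Rightarrow> 'b^'n)"
      unfolding axis_def
    proof (rule continuous_on_vec_lambda)
      fix j show "continuous_on UNIV (\<lambda>x::'b. if j = i then x else 0)"
        by (cases "j = i") auto
    qed
    then show "(\<lambda>x. axis i (f x $ i)) \<in> borel_measurable (lebesgue_on \<Omega>)"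
      using measurable_compose[OF L2_measurable[OF f[rule_format, of i]] borel_measurable_continuous_onI]
      by blast
  qed (use f in \<open>auto simp: norm_eq_sqrt_inner inner_axis_axis\<close>)
  then have "(\<lambda>x. \<Sum>i\<in>UNIV. axis i (f x $ i)) \<in> L2 \<Omega>" by (intro L2_sum) auto
  moreover have "(\<Sum>i\<in>UNIV. axis i (f x $ i)) = f x" for x
    by (simp add: vec_eq_iff axis_def if_distrib cong: if_cong)
  ultimately show "f \<in> L2 \<Omega>" by simp
qed

lemma L2_inner_vec:
  fixes f :: "real^3 \<Rightarrow> 'b::euclidean_space^'n"
  assumes "f \<in> L2 \<Omega>" "g \<in> L2 \<Omega>"
  shows "L2_inner \<Omega> f g = (\<Sum>i\<in>UNIV. L2_inner \<Omega> (\<lambda>x. f x $ i) (\<lambda>x. g x $ i))"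
  using assms unfolding L2_inner_def inner_vec_def
  by (subst Bochner_Integration.integral_sum) (auto simp: L2_vec_iff intro: L2_inner_integrable)

lemma L2_norm_vec_sq:
  fixes f :: "real^3 \<Rightarrow> 'b::euclidean_space^'n"
  assumes "f \<in> L2 \<Omega>"
  shows "(L2_norm \<Omega> f)\<^sup>2 = (\<Sum>i\<in>UNIV. (L2_norm \<Omega> (\<lambda>x. f x $ i))\<^sup>2)"
  using assms by (simp add: L2_norm_sq_inner L2_inner_vec)

lemma L2_norm_nth_le:
  fixes f :: "real^3 \<Rightarrow> 'b::euclidean_space^'n"
  assumes "f \<in> L2 \<Omega>"
  shows "L2_norm \<Omega> (\<lambda>x. f x $ i) \<le> L2_norm \<Omega> f"
proof (rule power2_le_imp_le)
  show "(L2_norm \<Omega> (\<lambda>x. f x $ i))\<^sup>2 \<le> (L2_norm \<Omega> f)\<^sup>2"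
    unfolding L2_norm_vec_sq[OF assms] by (rule member_le_sum) auto
qed simp

lemma L2_norm_vec_le:
  fixes f :: "real^3 \<Rightarrow> 'b::euclidean_space^'n"
  assumes "f \<in> L2 \<Omega>"
  shows "L2_norm \<Omega> f \<le> (\<Sum>i\<in>UNIV. L2_norm \<Omega> (\<lambda>x. f x $ i))"
proof (rule power2_le_imp_le)
  show "(L2_norm \<Omega> f)\<^sup>2 \<le> (\<Sum>i\<in>UNIV. L2_norm \<Omega> (\<lambda>x. f x $ i))\<^sup>2"
    unfolding L2_norm_vec_sq[OF assms] power2_eq_square[of "sum _ _"] sum_product
    unfolding power2_eq_square
    by (intro sum_mono) (auto intro!: member_le_sum[where f = "\<lambda>j. _ * L2_norm \<Omega> (\<lambda>x. f x $ j)"])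
qed (simp add: sum_nonneg)

section \<open>Completeness and orthogonal projection\<close>

lemma L2_complete_fast:
  fixes f :: "nat \<Rightarrow> real^3 \<Rightarrow> 'b::euclidean_space"
  assumes fin: "\<Omega> \<in> lmeasurable" and f: "\<And>n. f n \<in> L2 \<Omega>"
    and fast: "\<And>m n. m \<le> n \<Longrightarrow> L2_norm \<Omega> (\<lambda>x. f n x - f m x) \<le> (1/2) ^ m"
  shows "\<exists>g\<in>L2 \<Omega>. (\<lambda>n. L2_norm \<Omega> (\<lambda>x. f n x - g x)) \<longlonglongrightarrow> 0"
proof -
  let ?M = "lebesgue_on \<Omega>"
  define c where "c = sqrt (measure lebesgue \<Omega>)"
  note [measurable] = L2_measurable[OF f]
  \<comment> \<open>On a set of finite measure, Cauchy-Schwarz against the constant 1 turns the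
    geometric rate in L2 into summable increments in L1, so the sequence converges almost everywhere
    without passing to a subsequence.\<close>
  have one: "(\<lambda>x. 1::real) \<in> L2 \<Omega>"
    by (rule L2_bounded_measurable(1)[OF fin, of _ 1]) auto
  have L1: "(\<integral>\<^sup>+ x. ennreal (norm (f (Suc n) x - f n x)) \<partial>?M) \<le> ennreal (c * (1/2) ^ n)" for n
  proof -
    have d: "(\<lambda>x. norm (f (Suc n) x - f n x)) \<in> L2 \<Omega>"
      by (rule L2_bounded_by(1)[OF _ L2_diff[OF f[of "Suc n"] f[of n]], of _ 1]) auto
    have i: "integrable ?M (\<lambda>x. norm (f (Suc n) x - f n x))"
      using L2_inner_integrable[OF d one] by simp
    have n1: "L2_norm \<Omega> (\<lambda>x. 1::real) = c"
      using fin by (simp add: L2_norm_def c_def measure_restrict_space fmeasurableD)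
    have "(\<integral>x. norm (f (Suc n) x - f n x) \<partial>?M) \<le> L2_norm \<Omega> (\<lambda>x. norm (f (Suc n) x - f n x)) * c"
      using L2_Cauchy_Schwarz[OF d one] unfolding n1 by (simp add: L2_inner_def)
    also have "L2_norm \<Omega> (\<lambda>x. norm (f (Suc n) x - f n x)) = L2_norm \<Omega> (\<lambda>x. f (Suc n) x - f n x)"
      by (simp add: L2_norm_def)
    also have "\<dots> * c \<le> (1/2) ^ n * c"
      by (intro mult_right_mono fast) (auto simp: c_def)
    finally have "(\<integral>x. norm (f (Suc n) x - f n x) \<partial>?M) \<le> c * (1/2) ^ n" by (simp add: mult.commute)
    then show ?thesis by (subst nn_integral_eq_integral[OF i]) (auto intro: ennreal_leI)
  qed
  have "(\<integral>\<^sup>+ x. (\<Sum>n. ennreal (norm (f (Suc n) x - f n x))) \<partial>?M)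
      = (\<Sum>n. \<integral>\<^sup>+ x. ennreal (norm (f (Suc n) x - f n x)) \<partial>?M)"
    by (rule nn_integral_suminf) auto
  also have "\<dots> \<le> (\<Sum>n. ennreal (c * (1/2) ^ n))"
    by (intro suminf_le L1) auto
  also have "\<dots> = ennreal (\<Sum>n. c * (1/2) ^ n)"
    by (rule suminf_ennreal2) (auto simp: c_def intro!: summable_mult summable_geometric)
  also have "\<dots> < \<infinity>" by simp
  finally have "(\<integral>\<^sup>+ x. (\<Sum>n. ennreal (norm (f (Suc n) x - f n x))) \<partial>?M) \<noteq> \<infinity>" by simp
  then have fin_AE: "AE x in ?M. (\<Sum>n. ennreal (norm (f (Suc n) x - f n x))) \<noteq> \<infinity>"
    by (intro nn_integral_PInf_AE) measurable
  have conv: "AE x in ?M. convergent (\<lambda>n. f n x)"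
    using fin_AE
  proof eventually_elim
    case (elim x)
    then have "summable (\<lambda>n. norm (f (Suc n) x - f n x))"
      by (intro summable_suminf_not_top) auto
    then have "summable (\<lambda>n. f (Suc n) x - f n x)" by (rule summable_norm_cancel)
    then have "convergent (\<lambda>n. \<Sum>i<n. f (Suc i) x - f i x)" by (simp add: summable_iff_convergent)
    then have "convergent (\<lambda>n. f n x - f 0 x)"
      by (simp only: sum_lessThan_telescope[of "\<lambda>n. f n x"])
    then have "convergent (\<lambda>n. (f n x - f 0 x) + f 0 x)"
      by (intro convergent_add convergent_const)
    then show ?case by simp
  qed
  define g where "g x = lim (\<lambda>n. f n x)" for x
  have gm: "g \<in> borel_measurable ?M"
    unfolding g_def by (rule borel_measurable_lim_metric) auto
  note [measurable] = gm
  \<comment> \<open>Fatou's lemma in \<open>n\<close> with \<open>m\<close> fixed keeps the rate for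
    the limit and shows at the same time that \<open>g - f m\<close> is square integrable.\<close>
  have fatou: "(\<integral>\<^sup>+ x. ennreal ((norm (g x - f m x))\<^sup>2) \<partial>?M) \<le> ennreal (((1/2) ^ m)\<^sup>2)" for m
  proof -
    have "(\<integral>\<^sup>+ x. ennreal ((norm (g x - f m x))\<^sup>2) \<partial>?M)
        = (\<integral>\<^sup>+ x. liminf (\<lambda>n. ennreal ((norm (f n x - f m x))\<^sup>2)) \<partial>?M)"
      using conv
    proof (intro nn_integral_cong_AE, eventually_elim)
      case (elim x)
      then have "(\<lambda>n. f n x) \<longlonglongrightarrow> g x" by (simp add: g_def convergent_LIMSEQ_iff)
      then have "(\<lambda>n. ennreal ((norm (f n x - f m x))\<^sup>2)) \<longlonglongrightarrow> ennreal ((norm (g x - f m x))\<^sup>2)"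
        by (intro tendsto_ennrealI tendsto_intros)
      then show ?case by (rule lim_imp_Liminf[OF sequentially_bot, symmetric])
    qed
    also have "\<dots> \<le> liminf (\<lambda>n. \<integral>\<^sup>+ x. ennreal ((norm (f n x - f m x))\<^sup>2) \<partial>?M)"
      by (rule nn_integral_liminf) auto
    also have "\<dots> \<le> ennreal (((1/2) ^ m)\<^sup>2)"
    proof (rule Liminf_le)
      show "eventually (\<lambda>n. (\<integral>\<^sup>+ x. ennreal ((norm (f n x - f m x))\<^sup>2) \<partial>?M) \<le> ennreal (((1/2) ^ m)\<^sup>2)) sequentially"
        unfolding eventually_sequentially
      proof (intro exI allI impI)
        fix n assume "m \<le> n"
        then have "(L2_norm \<Omega> (\<lambda>x. f n x - f m x))\<^sup>2 \<le> ((1/2) ^ m)\<^sup>2"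
          by (intro power_mono fast) auto
        then show "(\<integral>\<^sup>+ x. ennreal ((norm (f n x - f m x))\<^sup>2) \<partial>?M) \<le> ennreal (((1/2) ^ m)\<^sup>2)"
          unfolding L2_norm_sq
          by (subst nn_integral_eq_integral) (auto intro!: L2_integrable_sq L2_diff f ennreal_leI)
      qed
    qed simp
    finally show ?thesis .
  qed
  have diff: "(\<lambda>x. g x - f m x) \<in> L2 \<Omega>" for m
    unfolding L2_def mem_Collect_eq
  proof
    show "integrable ?M (\<lambda>x. (norm (g x - f m x))\<^sup>2)"
      using le_less_trans[OF fatou[of m]] by (intro integrableI_nonneg) auto
  qed auto
  have "g \<in> L2 \<Omega>" using L2_add[OF diff[of 0] f[of 0]] by simp
  moreover have "L2_norm \<Omega> (\<lambda>x. f m x - g x) \<le> (1/2) ^ m" for m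
  proof (rule power2_le_imp_le)
    have "ennreal ((L2_norm \<Omega> (\<lambda>x. g x - f m x))\<^sup>2) \<le> ennreal (((1/2) ^ m)\<^sup>2)"
      unfolding L2_norm_sq using fatou[of m]
      by (subst (asm) nn_integral_eq_integral) (auto intro!: L2_integrable_sq diff)
    then show "(L2_norm \<Omega> (\<lambda>x. f m x - g x))\<^sup>2 \<le> ((1/2) ^ m)\<^sup>2"
      by (subst L2_norm_diff_commute) simp
  qed simp
  then have "(\<lambda>n. L2_norm \<Omega> (\<lambda>x. f n x - g x)) \<longlonglongrightarrow> 0"
    by (intro tendsto_sandwich[OF _ _ tendsto_const LIMSEQ_power_zero[of "1/2::real"]])
       (auto intro!: always_eventually)
  ultimately show ?thesis by blast
qed

text \<open>\<open>A\<close> is a linear family, not a closed subspace, and functions are not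
  identified almost everywhere; hence \<open>m\<close> is only a limit of members of
  \<open>A\<close>, while the orthogonality to \<open>A\<close> is exact. A minimising sequence is
  Cauchy by the parallelogram law, and the minimiser satisfies the variational equation.\<close>

lemma L2_projection:
  fixes F :: "real^3 \<Rightarrow> 'b::euclidean_space"
  assumes fin: "\<Omega> \<in> lmeasurable" and F: "F \<in> L2 \<Omega>" and sub: "A \<subseteq> L2 \<Omega>" and ne: "A \<noteq> {}"
    and add: "\<And>f g. f \<in> A \<Longrightarrow> g \<in> A \<Longrightarrow> (\<lambda>x. f x + g x) \<in> A"
    and scale: "\<And>f c. f \<in> A \<Longrightarrow> (\<lambda>x. c *\<^sub>R f x) \<in> A"
  shows "\<exists>m\<in>L2 \<Omega>. (\<forall>e>0. \<exists>f\<in>A. L2_norm \<Omega> (\<lambda>x. f x - m x) < e) \<and>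
      (\<forall>f\<in>A. L2_inner \<Omega> (\<lambda>x. F x - m x) f = 0)"
proof -
  define d where "d = (INF f\<in>A. (L2_norm \<Omega> (\<lambda>x. F x - f x))\<^sup>2)"
  have bdd: "bdd_below ((\<lambda>f. (L2_norm \<Omega> (\<lambda>x. F x - f x))\<^sup>2) ` A)"
    by (rule bdd_belowI2[of _ 0]) auto
  have d_le: "d \<le> (L2_norm \<Omega> (\<lambda>x. F x - f x))\<^sup>2" if "f \<in> A" for f
    unfolding d_def by (rule cINF_lower[OF bdd that])
  have "\<exists>f\<in>A. (L2_norm \<Omega> (\<lambda>x. F x - f x))\<^sup>2 < d + e" if "e > 0" for e
    using cINF_less_iff[OF ne bdd, of "d + e"] that by (simp add: d_def)
  \<comment> \<open>The excess (1/4)^n / 4 is fitted to the rate in \<open>L2_complete_fast\<close>: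
    the parallelogram law yields twice the excesses at m and n, in all at most (1/4)^m, the square
    of (1/2)^m.\<close>
  then have "\<forall>n::nat. \<exists>f\<in>A. (L2_norm \<Omega> (\<lambda>x. F x - f x))\<^sup>2 < d + (1/4) ^ n / 4" by simp
  then obtain w where w: "\<And>n. w n \<in> A" and wd: "\<And>n. (L2_norm \<Omega> (\<lambda>x. F x - w n x))\<^sup>2 < d + (1/4) ^ n / 4"
    by metis
  have wL: "w n \<in> L2 \<Omega>" for n using w sub by blast
  have fast: "L2_norm \<Omega> (\<lambda>x. w n x - w m x) \<le> (1/2) ^ m" if "m \<le> n" for m n
  proof (rule power2_le_imp_le)
    let ?a = "\<lambda>x. F x - w m x" and ?b = "\<lambda>x. F x - w n x" and ?h = "\<lambda>x. (1/2) *\<^sub>R (w m x + w n x)"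
    have ab: "?a \<in> L2 \<Omega>" "?b \<in> L2 \<Omega>" using wL F L2_diff by blast+
    \<comment> \<open>The midpoint of two members of \<open>A\<close> lies in \<open>A\<close>, so
      its distance from \<open>F\<close> is at least the infimum.\<close>
    have "?h \<in> A" by (intro scale add w)
    from d_le[OF this] have "4 * d \<le> (2 * L2_norm \<Omega> (\<lambda>x. F x - ?h x))\<^sup>2" by (simp add: power_mult_distrib)
    also have "2 * L2_norm \<Omega> (\<lambda>x. F x - ?h x) = L2_norm \<Omega> (\<lambda>x. ?a x + 1 *\<^sub>R ?b x)"
      using L2_norm_scaleR[of \<Omega> 2 "\<lambda>x. F x - ?h x"]
      by (simp add: algebra_simps scaleR_2)
    finally have 1: "4 * d \<le> (L2_norm \<Omega> ?a)\<^sup>2 + 2 * L2_inner \<Omega> ?a ?b + (L2_norm \<Omega> ?b)\<^sup>2"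
      unfolding L2_norm_add_scaleR_sq[OF ab] by simp
    have "(L2_norm \<Omega> (\<lambda>x. w n x - w m x))\<^sup>2 = (L2_norm \<Omega> (\<lambda>x. ?a x + (-1) *\<^sub>R ?b x))\<^sup>2" by simp
    also have "\<dots> = (L2_norm \<Omega> ?a)\<^sup>2 - 2 * L2_inner \<Omega> ?a ?b + (L2_norm \<Omega> ?b)\<^sup>2"
      unfolding L2_norm_add_scaleR_sq[OF ab] by simp
    also have "\<dots> \<le> 2 * (L2_norm \<Omega> ?a)\<^sup>2 + 2 * (L2_norm \<Omega> ?b)\<^sup>2 - 4 * d" using 1 by simp
    also have "\<dots> \<le> (1/4) ^ m / 2 + (1/4) ^ n / 2" using wd[of m] wd[of n] by simp
    also have "\<dots> \<le> (1/4) ^ m" using power_decreasing[OF that, of "1/4::real"] by linarith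
    also have "\<dots> = ((1/2) ^ m)\<^sup>2" by (simp add: power2_eq_square power_mult_distrib[symmetric])
    finally show "(L2_norm \<Omega> (\<lambda>x. w n x - w m x))\<^sup>2 \<le> ((1/2) ^ m)\<^sup>2" .
  qed simp
  obtain m where m: "m \<in> L2 \<Omega>" and lim: "(\<lambda>n. L2_norm \<Omega> (\<lambda>x. w n x - m x)) \<longlonglongrightarrow> 0"
    using L2_complete_fast[OF fin wL fast] by blast
  have approx: "\<exists>f\<in>A. L2_norm \<Omega> (\<lambda>x. f x - m x) < e" if "e > 0" for e
    using order_tendstoD(2)[OF lim that] w by (auto simp: eventually_sequentially)
  have Fm: "(\<lambda>x. F x - m x) \<in> L2 \<Omega>" using F m by (rule L2_diff)
  have "(L2_norm \<Omega> (\<lambda>x. F x - m x))\<^sup>2 \<le> d"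
  proof (rule LIMSEQ_le_const)
    show "(\<lambda>n. (sqrt (d + (1/4) ^ n / 4) + L2_norm \<Omega> (\<lambda>x. w n x - m x))\<^sup>2) \<longlonglongrightarrow> d"
    proof -
      have "(\<lambda>n. (sqrt (d + (1/4) ^ n / 4) + L2_norm \<Omega> (\<lambda>x. w n x - m x))\<^sup>2) \<longlonglongrightarrow> (sqrt (d + 0 / 4) + 0)\<^sup>2"
        by (intro tendsto_intros lim LIMSEQ_power_zero) auto
      moreover have "0 \<le> d" unfolding d_def by (rule cINF_greatest[OF ne]) auto
      ultimately show ?thesis by simp
    qed
    have "(L2_norm \<Omega> (\<lambda>x. F x - m x))\<^sup>2 \<le> (sqrt (d + (1/4) ^ n / 4) + L2_norm \<Omega> (\<lambda>x. w n x - m x))\<^sup>2" for n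
      using L2_norm_triangle_diff[OF F wL m, of n] real_le_rsqrt[OF less_imp_le[OF wd[of n]]]
      by (intro power_mono) auto
    then show "\<exists>N. \<forall>n\<ge>N. (L2_norm \<Omega> (\<lambda>x. F x - m x))\<^sup>2
        \<le> (sqrt (d + (1/4) ^ n / 4) + L2_norm \<Omega> (\<lambda>x. w n x - m x))\<^sup>2" by blast
  qed
  \<comment> \<open>Minimality against perturbations of \<open>m\<close>. As \<open>m\<close> itself
    need not lie in \<open>A\<close>, the bound is taken at \<open>w n - t f\<close> and carried to
    the limit.\<close>
  moreover have min: "d \<le> (L2_norm \<Omega> (\<lambda>x. (F x - m x) + t *\<^sub>R f x))\<^sup>2" if f: "f \<in> A" for t f
  proof (rule LIMSEQ_le_const)
    have fL: "f \<in> L2 \<Omega>" using f sub by blast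
    let ?g = "\<lambda>x. (F x - m x) + t *\<^sub>R f x"
    have g: "?g \<in> L2 \<Omega>" by (intro L2_add Fm L2_scaleR fL)
    show "(\<lambda>n. (L2_norm \<Omega> ?g + L2_norm \<Omega> (\<lambda>x. w n x - m x))\<^sup>2) \<longlonglongrightarrow> (L2_norm \<Omega> ?g)\<^sup>2"
      using tendsto_power[OF tendsto_add[OF tendsto_const[of "L2_norm \<Omega> ?g"] lim], of 2] by simp
    have "d \<le> (L2_norm \<Omega> ?g + L2_norm \<Omega> (\<lambda>x. w n x - m x))\<^sup>2" for n
    proof -
      have "(\<lambda>x. w n x + (- t) *\<^sub>R f x) \<in> A" by (intro add scale w f)
      from d_le[OF this] have "d \<le> (L2_norm \<Omega> (\<lambda>x. F x - (w n x + (- t) *\<^sub>R f x)))\<^sup>2" .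
      also have "\<dots> \<le> (L2_norm \<Omega> ?g + L2_norm \<Omega> (\<lambda>x. w n x - m x))\<^sup>2"
        using L2_norm_triangle[OF g L2_minus[OF L2_diff[OF wL[of n] m]]]
        by (intro power_mono) (auto simp: L2_norm_minus[of \<Omega> "\<lambda>x. w n x - m x", simplified] L2_norm_diff_commute[of \<Omega> m] algebra_simps)
      finally show ?thesis .
    qed
    then show "\<exists>N. \<forall>n\<ge>N. d \<le> (L2_norm \<Omega> ?g + L2_norm \<Omega> (\<lambda>x. w n x - m x))\<^sup>2" by blast
  qed
  moreover have "L2_inner \<Omega> (\<lambda>x. F x - m x) f = 0" if f: "f \<in> A" for f
  proof -
    have fL: "f \<in> L2 \<Omega>" using f sub by blast
    have "0 \<le> 0 + 2 * L2_inner \<Omega> (\<lambda>x. F x - m x) f * t + (L2_norm \<Omega> f)\<^sup>2 * t\<^sup>2" for t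
      using min[OF f, of t] calculation unfolding L2_norm_add_scaleR_sq[OF Fm fL] by simp
    from quadratic_nonneg_discriminant[OF this] show ?thesis by simp
  qed
  ultimately show ?thesis using m approx by blast
qed

section \<open>Mollification\<close>

text \<open>The reflection is the affine map with all factors -1, whose Jacobian has absolute value
  1.\<close>

lemma
  fixes a :: "real^3"
  shows lebesgue_reflect_measurable: "(\<lambda>y. a - y) \<in> lebesgue \<rightarrow>\<^sub>M lebesgue"
    and lebesgue_reflect: "distr lebesgue lebesgue (\<lambda>y. a - y) = lebesgue"
proof -
  have eq: "(\<lambda>x. a + (\<Sum>j\<in>Basis. (- 1 * (x \<bullet> j)) *\<^sub>R j)) = (\<lambda>y. a - y)"
    by (rule ext) (simp add: sum_negf euclidean_representation)
  show "(\<lambda>y. a - y) \<in> lebesgue \<rightarrow>\<^sub>M lebesgue"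
    using lebesgue_affine_measurable[of "\<lambda>_. -1" a] unfolding eq by simp
  show "distr lebesgue lebesgue (\<lambda>y. a - y) = lebesgue"
    using lebesgue_affine_euclidean[of "\<lambda>_. -1" a] unfolding eq by (simp add: density_1)
qed

lemma
  fixes f :: "real^3 \<Rightarrow> real"
  shows integrable_reflect: "integrable lebesgue f \<Longrightarrow> integrable lebesgue (\<lambda>y. f (a - y))"
    and integral_reflect: "integrable lebesgue f \<Longrightarrow> integral\<^sup>L lebesgue (\<lambda>y. f (a - y)) = integral\<^sup>L lebesgue f"
proof -
  assume f: "integrable lebesgue f"
  then have m: "f \<in> borel_measurable lebesgue" by (rule borel_measurable_integrable)
  show "integrable lebesgue (\<lambda>y. f (a - y))"
    using integrable_distr_eq[OF lebesgue_reflect_measurable m, of a] f by (simp add: lebesgue_reflect)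
  show "integral\<^sup>L lebesgue (\<lambda>y. f (a - y)) = integral\<^sup>L lebesgue f"
    using integral_distr[OF lebesgue_reflect_measurable m, of a] by (simp add: lebesgue_reflect)
qed

lemma continuous_lebesgue_measurable:
  "continuous_on UNIV f \<Longrightarrow> f \<in> borel_measurable lebesgue"
  using continuous_measurable_on[of f UNIV] by (simp add: lebesgue_on_UNIV_eq)

section \<open>Convolution with a smooth kernel of bounded support\<close>

definition bounded_support :: "(real^3 \<Rightarrow> real) \<Rightarrow> bool" where
  "bounded_support f \<longleftrightarrow> (\<exists>R. \<forall>x. R < norm x \<longrightarrow> f x = 0)"

lemma bounded_support_pderiv3:
  assumes "bounded_support f" shows "bounded_support (pderiv3 i f)"
proof -
  obtain R where R: "\<And>x. R < norm x \<Longrightarrow> f x = 0" using assms bounded_support_def by auto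
  have "open {x::real^3. R < norm x}" by (intro open_Collect_less continuous_intros)
  then have "pderiv3 i f x = 0" if "R < norm x" for x
    using pderiv3_cong_open(1)[of "{x. R < norm x}" x f "\<lambda>x. 0" i] R that by simp
  then show ?thesis by (auto simp: bounded_support_def)
qed

lemma bounded_support_bounded:
  assumes "bounded_support f" "continuous_on UNIV f"
  shows "\<exists>B>0. \<forall>x. \<bar>f x\<bar> \<le> B"
proof -
  obtain R where R: "\<And>x. R < norm x \<Longrightarrow> f x = 0" using assms bounded_support_def by auto
  obtain B where B: "B > 0" "\<forall>x\<in>cball 0 R. norm (f x) \<le> B"
    using continuous_bounded_on_bounded[OF assms(2) bounded_cball] by blast
  then have "\<bar>f x\<bar> \<le> B" for x by (cases "R < norm x") (use B R in auto)
  then show ?thesis using B(1) by blast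
qed

lemma bounded_support_integrable:
  assumes "bounded_support f" "continuous_on UNIV f"
  shows "integrable lebesgue f"
proof -
  obtain R where R: "\<And>x. R < norm x \<Longrightarrow> f x = 0" using assms bounded_support_def by auto
  have eq: "(\<lambda>x. indicator (cball 0 R) x *\<^sub>R f x) = f"
    by (rule ext) (auto simp: indicator_def R)
  have "integrable lborel (\<lambda>x. indicator (cball 0 R) x *\<^sub>R f x)"
    by (intro borel_integrable_compact compact_cball continuous_on_subset[OF assms(2)]) auto
  then have "integrable lborel f" unfolding eq .
  then show ?thesis by (subst integrable_completion) auto
qed

lemma onorm_partials_le:
  assumes "\<And>i. \<bar>d i\<bar> \<le> B"
  shows "onorm (\<lambda>h::real^3. \<Sum>i\<in>UNIV. h $ i * d i) \<le> 3 * B"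
proof (rule onorm_le)
  fix h :: "real^3"
  have "norm (\<Sum>i\<in>UNIV. h $ i * d i) \<le> (\<Sum>i\<in>UNIV. \<bar>h $ i\<bar> * \<bar>d i\<bar>)"
    using sum_abs[of "\<lambda>i. h $ i * d i"] by (simp add: abs_mult)
  also have "\<dots> \<le> (\<Sum>i\<in>(UNIV::3 set). norm h * B)"
    by (intro sum_mono mult_mono assms component_le_norm_cart) auto
  finally show "norm (\<Sum>i\<in>UNIV. h $ i * d i) \<le> 3 * B * norm h" by (simp add: mult_ac)
qed

lemma lipschitz_of_pderiv3_bound:
  assumes "\<And>x. f differentiable (at x)" "\<And>x i. \<bar>pderiv3 i f x\<bar> \<le> B"
  shows "\<bar>f x - f y\<bar> \<le> 3 * B * norm (x - y)"
  using differentiable_bound[of UNIV f "\<lambda>x h. \<Sum>i\<in>UNIV. h $ i * pderiv3 i f x" "3 * B" x y]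
    has_derivative_pderiv3[OF assms(1)] onorm_partials_le[OF assms(2)] by simp

text \<open>The second partial derivatives are bounded, so the gradient is Lipschitz; the mean value
  inequality for \<open>K\<close> minus its linear part at \<open>x\<close> gives a Taylor remainder
  whose constant does not depend on \<open>x\<close>. Differentiation under the integral sign needs
  exactly this uniformity.\<close>

lemma quadratic_remainder:
  assumes "smooth K" "bounded_support K"
  shows "\<exists>C\<ge>0. \<forall>x h. \<bar>K (x + h) - K x - (\<Sum>i\<in>UNIV. h $ i * pderiv3 i K x)\<bar> \<le> C * (norm h)\<^sup>2"
proof -
  have "\<exists>B>0. \<forall>x. \<bar>pderiv3 j (pderiv3 i K) x\<bar> \<le> B" for i j
    using assms by (intro bounded_support_bounded bounded_support_pderiv3 smooth_continuous smooth_pderiv3)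
  then have "\<forall>i j. \<exists>B>0. \<forall>x. \<bar>pderiv3 j (pderiv3 i K) x\<bar> \<le> B" by blast
  then obtain b where "\<forall>i j. b i j > 0 \<and> (\<forall>x. \<bar>pderiv3 j (pderiv3 i K) x\<bar> \<le> b i j)"
    unfolding choice_iff by (auto simp: Bex_def)
  then have b: "\<And>i j. b i j > 0" "\<And>i j x. \<bar>pderiv3 j (pderiv3 i K) x\<bar> \<le> b i j" by auto
  define B where "B = (\<Sum>i\<in>UNIV. \<Sum>j\<in>UNIV. b i j)"
  have "b i j \<le> B" for i j
  proof -
    have "b i j \<le> (\<Sum>j\<in>UNIV. b i j)" by (rule member_le_sum) (use b(1) less_imp_le in auto)
    also have "\<dots> \<le> B" unfolding B_def
      by (rule member_le_sum) (use b(1) less_imp_le in \<open>auto intro!: sum_nonneg\<close>)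
    finally show ?thesis .
  qed
  then have B: "\<bar>pderiv3 j (pderiv3 i K) x\<bar> \<le> B" for i j x using b(2) order_trans by blast
  have "0 \<le> B" using B[of 1 1 0] by linarith
  have lip: "\<bar>pderiv3 i K x - pderiv3 i K y\<bar> \<le> 3 * B * norm (x - y)" for i x y
    by (rule lipschitz_of_pderiv3_bound) (use assms B in \<open>auto intro: smooth_differentiable smooth_pderiv3\<close>)
  have "\<bar>K (x + h) - K x - (\<Sum>i\<in>UNIV. h $ i * pderiv3 i K x)\<bar> \<le> 9 * B * (norm h)\<^sup>2" for x h
  proof -
    define g where "g y = K y - (\<Sum>i\<in>UNIV. y $ i * pderiv3 i K x)" for y
    have dg: "(g has_derivative (\<lambda>h. \<Sum>i\<in>UNIV. h $ i * (pderiv3 i K y - pderiv3 i K x))) (at y within cball x (norm h))" for y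
    proof -
      have "((\<lambda>y. \<Sum>i\<in>UNIV. y $ i * pderiv3 i K x) has_derivative (\<lambda>h. \<Sum>i\<in>UNIV. h $ i * pderiv3 i K x)) (at y)"
        by (intro has_derivative_sum has_derivative_mult_left bounded_linear_imp_has_derivative bounded_linear_vec_nth)
      from has_derivative_diff[OF has_derivative_pderiv3[OF smooth_differentiable[OF assms(1)]] this]
      have "(g has_derivative (\<lambda>h. \<Sum>i\<in>UNIV. h $ i * (pderiv3 i K y - pderiv3 i K x))) (at y)"
        unfolding g_def by (simp add: sum_subtractf right_diff_distrib)
      then show ?thesis by (rule has_derivative_at_withinI)
    qed
    have on: "onorm (\<lambda>h. \<Sum>i\<in>UNIV. h $ i * (pderiv3 i K y - pderiv3 i K x)) \<le> 3 * (3 * B * norm h)"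
      if "y \<in> cball x (norm h)" for y
    proof (rule onorm_partials_le)
      fix i
      have "norm (y - x) \<le> norm h" using that by (simp add: dist_norm norm_minus_commute)
      then have "3 * B * norm (y - x) \<le> 3 * B * norm h" using \<open>0 \<le> B\<close> by (intro mult_left_mono) auto
      then show "\<bar>pderiv3 i K y - pderiv3 i K x\<bar> \<le> 3 * B * norm h"
        using lip[of i y x] by linarith
    qed
    have "norm (g (x + h) - g x) \<le> 3 * (3 * B * norm h) * norm (x + h - x)"
      by (rule differentiable_bound[OF convex_cball[of x "norm h"] dg on]) (auto simp: dist_norm)
    moreover have "g (x + h) - g x = K (x + h) - K x - (\<Sum>i\<in>UNIV. h $ i * pderiv3 i K x)"
      by (simp add: g_def distrib_right sum.distrib)
    ultimately show ?thesis by (simp add: power2_eq_square)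
  qed
  then show ?thesis using \<open>0 \<le> B\<close> by (intro exI[of _ "9 * B"]) auto
qed

lemma has_derivative_of_quadratic_remainder:
  fixes f :: "'a::real_normed_vector \<Rightarrow> real"
  assumes "bounded_linear D" and le: "\<And>h. \<bar>f (x + h) - f x - D h\<bar> \<le> C * (norm h)\<^sup>2"
  shows "(f has_derivative D) (at x)"
  unfolding has_derivative_at
proof
  show "(\<lambda>h. norm (f (x + h) - f x - D h) / norm h) \<midarrow>0\<rightarrow> 0"
  proof (rule tendsto_sandwich[OF _ _ tendsto_const])
    show "((\<lambda>h. C * norm h) \<longlongrightarrow> 0) (at 0)"
      using tendsto_mult[OF tendsto_const[of C] tendsto_norm_zero[OF tendsto_ident_at[of 0 UNIV]]] by simp
    show "\<forall>\<^sub>F h in at 0. norm (f (x + h) - f x - D h) / norm h \<le> C * norm h"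
      using le by (auto simp: eventually_at_filter divide_le_eq power2_eq_square mult.assoc intro!: always_eventually)
  qed auto
qed (rule assms)

definition conv :: "(real^3 \<Rightarrow> real) \<Rightarrow> (real^3 \<Rightarrow> real) \<Rightarrow> real^3 \<Rightarrow> real" where
  "conv K f x = (\<integral>y. K (x - y) * f y \<partial>lebesgue)"

lemma conv_integrable:
  assumes "bounded_support K" "continuous_on UNIV K" "integrable lebesgue f"
  shows "integrable lebesgue (\<lambda>y. K (x - y) * f y)"
proof -
  obtain B where B: "\<forall>x. \<bar>K x\<bar> \<le> B" using bounded_support_bounded[OF assms(1,2)] by blast
  have "continuous_on UNIV (\<lambda>y. K (x - y))"
    by (rule continuous_on_compose2[OF assms(2)]) (auto intro: continuous_intros)
  then have [measurable]: "(\<lambda>y. K (x - y)) \<in> borel_measurable lebesgue"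
    by (rule continuous_lebesgue_measurable)
  show ?thesis
  proof (rule Bochner_Integration.integrable_bound)
    show "integrable lebesgue (\<lambda>y. B * f y)" using assms(3) by simp
    show "AE y in lebesgue. norm (K (x - y) * f y) \<le> norm (B * f y)"
    proof (rule AE_I2)
      fix y
      have "\<bar>K (x - y)\<bar> \<le> \<bar>B\<bar>" using B abs_ge_self order_trans by blast
      then show "norm (K (x - y) * f y) \<le> norm (B * f y)"
        by (simp add: abs_mult mult_right_mono)
    qed
  qed (use assms(3) in measurable)
qed

text \<open>The uniform remainder of the kernel, integrated against |f|, bounds the error of the
  linearisation by a constant times |h|^2; no limit is exchanged with the integral.\<close>

lemma conv_has_derivative:
  assumes "smooth K" "bounded_support K" and f: "integrable lebesgue f"
  shows "(conv K f has_derivative (\<lambda>h. \<Sum>i\<in>UNIV. h $ i * conv (pderiv3 i K) f x)) (at x)"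
proof -
  obtain C where C: "C \<ge> 0"
      "\<And>x h. \<bar>K (x + h) - K x - (\<Sum>i\<in>UNIV. h $ i * pderiv3 i K x)\<bar> \<le> C * (norm h)\<^sup>2"
    using quadratic_remainder[OF assms(1,2)] by blast
  have i1: "integrable lebesgue (\<lambda>y. K (x - y) * f y)" for x
    by (intro conv_integrable assms smooth_continuous)
  have i2: "integrable lebesgue (\<lambda>y. pderiv3 i K (x - y) * f y)" for x i
    by (intro conv_integrable assms smooth_continuous smooth_pderiv3 bounded_support_pderiv3)
  show ?thesis
  proof (rule has_derivative_of_quadratic_remainder)
    show "bounded_linear (\<lambda>h::real^3. \<Sum>i\<in>UNIV. h $ i * conv (pderiv3 i K) f x)"
      by (intro bounded_linear_sum bounded_linear_compose[OF bounded_linear_mult_left bounded_linear_vec_nth])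
    fix h
    have "conv K f (x + h) - conv K f x - (\<Sum>i\<in>UNIV. h $ i * conv (pderiv3 i K) f x)
        = (\<integral>y. (K (x + h - y) * f y - K (x - y) * f y - (\<Sum>i\<in>UNIV. h $ i * (pderiv3 i K (x - y) * f y))) \<partial>lebesgue)"
      unfolding conv_def using i1 i2 by simp
    also have "\<dots> = (\<integral>y. (K ((x - y) + h) - K (x - y) - (\<Sum>i\<in>UNIV. h $ i * pderiv3 i K (x - y))) * f y \<partial>lebesgue)"
      by (rule Bochner_Integration.integral_cong) (auto simp: algebra_simps sum_distrib_left)
    also have "\<bar>\<dots>\<bar> \<le> (\<integral>y. (C * (norm h)\<^sup>2) * \<bar>f y\<bar> \<partial>lebesgue)"
      unfolding real_norm_def[symmetric]
    proof (rule Bochner_Integration.integral_norm_bound_integral)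
      have "integrable lebesgue (\<lambda>y. K (x + h - y) * f y - K (x - y) * f y - (\<Sum>i\<in>UNIV. h $ i * (pderiv3 i K (x - y) * f y)))"
        using i1 i2 by simp
      then show "integrable lebesgue (\<lambda>y. (K ((x - y) + h) - K (x - y) - (\<Sum>i\<in>UNIV. h $ i * pderiv3 i K (x - y))) * f y)"
        by (rule Bochner_Integration.integrable_cong[THEN iffD1, OF refl, rotated])
           (auto simp: algebra_simps sum_distrib_left)
      show "integrable lebesgue (\<lambda>y. (C * (norm h)\<^sup>2) * norm (f y))" using f by simp
      show "norm ((K ((x - y) + h) - K (x - y) - (\<Sum>i\<in>UNIV. h $ i * pderiv3 i K (x - y))) * f y)
          \<le> (C * (norm h)\<^sup>2) * norm (f y)" for y
        unfolding norm_mult by (intro mult_right_mono) (use C in auto)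
    qed
    also have "\<dots> = (C * (\<integral>y. \<bar>f y\<bar> \<partial>lebesgue)) * (norm h)\<^sup>2" by simp
    finally show "\<bar>conv K f (x + h) - conv K f x - (\<Sum>i\<in>UNIV. h $ i * conv (pderiv3 i K) f x)\<bar>
        \<le> (C * (\<integral>y. \<bar>f y\<bar> \<partial>lebesgue)) * (norm h)\<^sup>2" .
  qed
qed

lemma pderiv3_conv:
  assumes "smooth K" "bounded_support K" "integrable lebesgue f"
  shows "pderiv3 i (conv K f) x = conv (pderiv3 i K) f x"
  using pderiv3_eq[OF conv_has_derivative[OF assms]]
  by (simp add: axis_def if_distrib[of "\<lambda>u. u * _"] cong: if_cong)

lemma smooth_conv:
  assumes "smooth K" "bounded_support K" "integrable lebesgue f"
  shows "smooth (conv K f)"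
proof -
  have "C_k k (conv K f)" if "smooth K" "bounded_support K" for k K
    using that
  proof (induction k arbitrary: K)
    case 0
    have "isCont (conv K f) x" for x
      using has_derivative_continuous[OF conv_has_derivative[OF 0 assms(3)]] .
    then show ?case by (simp add: continuous_at_imp_continuous_on)
  next
    case (Suc k)
    have "pderiv3 i (conv K f) = conv (pderiv3 i K) f" for i
      using pderiv3_conv[OF Suc.prems assms(3)] by blast
    moreover have "conv K f differentiable (at x)" for x
      using conv_has_derivative[OF Suc.prems assms(3)] differentiable_def by blast
    moreover have "C_k k (conv (pderiv3 i K) f)" for i
      by (intro Suc.IH smooth_pderiv3 bounded_support_pderiv3 Suc.prems)
    ultimately show ?case by simp
  qed
  with assms show ?thesis by (simp add: smooth_def)
qed

section \<open>Mollifiers: contraction and approximation in L2\<close>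

definition mollifier :: "(real^3 \<Rightarrow> real) \<Rightarrow> real \<Rightarrow> bool" where
  "mollifier K d \<longleftrightarrow> smooth K \<and> (\<forall>x. 0 \<le> K x) \<and> (\<forall>x. K x \<noteq> 0 \<longrightarrow> norm x < d) \<and> integral\<^sup>L lebesgue K = 1"

lemma mollifier_bounded_support: "mollifier K d \<Longrightarrow> bounded_support K"
  by (auto simp: mollifier_def bounded_support_def intro!: exI[of _ d])

lemma mollifier_smooth: "mollifier K d \<Longrightarrow> smooth K"
  by (simp add: mollifier_def)

lemma mollifier_integrable: "mollifier K d \<Longrightarrow> integrable lebesgue K"
  by (intro bounded_support_integrable mollifier_bounded_support smooth_continuous mollifier_smooth)

text \<open>In \<open>mollifier K d\<close> the number \<open>d\<close> only bounds the support; the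
  kernel need not be centred at 0 or symmetric. Bumps around an arbitrary \<open>c\<close> are
  supplied because near the boundary the kernel has to shift the argument as well as smooth.\<close>

lemma ex_mollifier:
  fixes c :: "real^3"
  assumes "0 < r"
  shows "\<exists>K. mollifier K (norm c + r) \<and> (\<forall>x. K x \<noteq> 0 \<longrightarrow> dist x c < r)"
proof -
  define K0 where "K0 x = flat_exp 1 (r\<^sup>2 - (norm (x - c))\<^sup>2)" for x
  have sm: "smooth K0"
    unfolding K0_def by (intro smooth_flat_exp smooth_diff smooth_const smooth_norm_sq)
  have nn: "0 \<le> K0 x" for x by (simp add: K0_def flat_exp_def)
  have supp: "dist x c < r" if "K0 x \<noteq> 0" for x
  proof -
    have "(norm (x - c))\<^sup>2 < r\<^sup>2" using that by (auto simp: K0_def flat_exp_def split: if_splits)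
    then show ?thesis using assms by (simp add: dist_norm power2_less_imp_less)
  qed
  have supp': "norm x < norm c + r" if "K0 x \<noteq> 0" for x
    using supp[OF that] norm_triangle_sub[of x c] by (simp add: dist_norm)
  have bs: "bounded_support K0"
    unfolding bounded_support_def by (rule exI[of _ "norm c + r"]) (use supp' in force)
  have int: "integrable lebesgue K0" by (intro bounded_support_integrable bs smooth_continuous sm)
  have pos: "K0 x > 0" if "x \<in> ball c r" for x
  proof -
    have "(norm (x - c))\<^sup>2 < r\<^sup>2"
      using that by (intro power_strict_mono) (auto simp: dist_norm norm_minus_commute)
    then show ?thesis by (simp add: K0_def flat_exp_def)
  qed
  \<comment> \<open>\<open>K0\<close> is positive on a ball, and a ball is not negligible; this
    permits the normalisation.\<close>
  have "integral\<^sup>L lebesgue K0 \<noteq> 0"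
  proof
    assume "integral\<^sup>L lebesgue K0 = 0"
    then have "AE x in lebesgue. K0 x = 0"
      using integral_nonneg_eq_0_iff_AE[OF int] nn by auto
    then have "AE x in lebesgue. x \<notin> ball c r"
      by eventually_elim (use pos in force)
    then have "ball c r \<in> null_sets lebesgue"
      using AE_iff_null_sets[of "ball c r" lebesgue] by auto
    then have "negligible (ball c r)" by (simp add: negligible_iff_null_sets)
    then show False using assms open_not_negligible[of "ball c r"] by auto
  qed
  moreover have "integral\<^sup>L lebesgue K0 \<ge> 0" using nn by simp
  ultimately have I: "integral\<^sup>L lebesgue K0 > 0" by linarith
  have "mollifier (\<lambda>x. (1 / integral\<^sup>L lebesgue K0) * K0 x) (norm c + r)"
    unfolding mollifier_def using I nn supp' smooth_cmult[OF sm, of "1 / integral\<^sup>L lebesgue K0"] by auto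
  then show ?thesis using supp I by (intro exI[of _ "\<lambda>x. (1 / integral\<^sup>L lebesgue K0) * K0 x"]) auto
qed

text \<open>Jensen's inequality for the probability density \<open>K (x - y)\<close> in
  \<open>y\<close>, read off from the nonnegative variance of \<open>f\<close> under it.\<close>

lemma mollifier_conv_sq_le:
  assumes K: "mollifier K d" and f: "integrable lebesgue f" "integrable lebesgue (\<lambda>x. (f x)\<^sup>2)"
  shows "(conv K f x)\<^sup>2 \<le> (\<integral>y. K (x - y) * (f y)\<^sup>2 \<partial>lebesgue)"
proof -
  let ?m = "conv K f x"
  have c: "continuous_on UNIV K" "bounded_support K"
    using K mollifier_smooth smooth_continuous mollifier_bounded_support by blast+
  have i1: "integrable lebesgue (\<lambda>y. K (x - y) * (f y)\<^sup>2)"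
    by (rule conv_integrable[OF c(2,1) f(2)])
  have i2: "integrable lebesgue (\<lambda>y. K (x - y) * f y)"
    by (rule conv_integrable[OF c(2,1) f(1)])
  have i3: "integrable lebesgue (\<lambda>y. K (x - y))" "(\<integral>y. K (x - y) \<partial>lebesgue) = 1"
    using integrable_reflect[OF mollifier_integrable[OF K]] integral_reflect[OF mollifier_integrable[OF K]] K
    by (auto simp: mollifier_def)
  have "0 \<le> (\<integral>y. K (x - y) * (f y - ?m)\<^sup>2 \<partial>lebesgue)"
    using K by (intro integral_nonneg_AE AE_I2) (auto simp: mollifier_def)
  also have "\<dots> = (\<integral>y. K (x - y) * (f y)\<^sup>2 - 2 * ?m * (K (x - y) * f y) + ?m\<^sup>2 * K (x - y) \<partial>lebesgue)"
    by (rule Bochner_Integration.integral_cong) (auto simp: power2_eq_square algebra_simps)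
  also have "\<dots> = (\<integral>y. K (x - y) * (f y)\<^sup>2 \<partial>lebesgue) - 2 * ?m * ?m + ?m\<^sup>2"
    using i1 i2 i3 by (simp add: conv_def)
  finally show ?thesis by (simp add: power2_eq_square)
qed

text \<open>After interchanging the integrals, \<open>K (x - y)\<close> integrates to 1 in
  \<open>x\<close> for every \<open>y\<close>. Tonelli's theorem is applied to Borel functions, so
  \<open>f\<close> is first replaced by a Borel representative.\<close>

lemma nn_integral_mollifier_conv:
  assumes K: "mollifier K d" and f: "f \<in> borel_measurable lebesgue"
  shows "(\<integral>\<^sup>+ x. (\<integral>\<^sup>+ y. ennreal (K (x - y)) * f y \<partial>lebesgue) \<partial>lebesgue) = (\<integral>\<^sup>+ y. f y \<partial>lebesgue)"
proof -
  obtain g where g[measurable]: "g \<in> borel_measurable lborel" and fg: "AE x in lborel. f x = g x"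
    using completion_ex_borel_measurable[OF f] by blast
  have [measurable]: "K \<in> borel_measurable borel"
    using K mollifier_smooth smooth_continuous borel_measurable_continuous_onI by blast
  have K1: "(\<integral>\<^sup>+ x. ennreal (K (x - y)) \<partial>lborel) = 1" for y
  proof -
    have i: "integrable lebesgue (\<lambda>x. K (x - y))" "(\<integral>x. K (x - y) \<partial>lebesgue) = 1"
      using integrable_reflect[OF integrable_reflect[OF mollifier_integrable[OF K], of "- y"], of 0]
        integral_reflect[OF integrable_reflect[OF mollifier_integrable[OF K], of "- y"], of 0]
        integral_reflect[OF mollifier_integrable[OF K], of "- y"] K
      by (auto simp: mollifier_def add.commute)
    have "(\<integral>\<^sup>+ x. ennreal (K (x - y)) \<partial>lebesgue) = ennreal 1"
      using nn_integral_eq_integral[OF i(1)] i(2) K by (auto simp: mollifier_def)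
    then show ?thesis by (simp add: nn_integral_completion)
  qed
  have "(\<integral>\<^sup>+ x. (\<integral>\<^sup>+ y. ennreal (K (x - y)) * f y \<partial>lebesgue) \<partial>lebesgue)
      = (\<integral>\<^sup>+ x. (\<integral>\<^sup>+ y. ennreal (K (x - y)) * g y \<partial>lborel) \<partial>lborel)"
    unfolding nn_integral_completion
    by (intro nn_integral_cong nn_integral_cong_AE) (use fg in \<open>auto elim!: eventually_mono\<close>)
  also have "\<dots> = (\<integral>\<^sup>+ y. (\<integral>\<^sup>+ x. ennreal (K (x - y)) * g y \<partial>lborel) \<partial>lborel)"
    by (rule lborel_pair.Fubini'[symmetric]) measurable
  also have "\<dots> = (\<integral>\<^sup>+ y. g y \<partial>lborel)"
    by (simp add: nn_integral_multc K1)
  also have "\<dots> = (\<integral>\<^sup>+ y. f y \<partial>lebesgue)"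
    unfolding nn_integral_completion by (rule nn_integral_cong_AE) (use fg in \<open>auto elim!: eventually_mono\<close>)
  finally show ?thesis .
qed

lemma L2_UNIV_real_iff:
  fixes f :: "real^3 \<Rightarrow> real"
  shows "f \<in> L2 UNIV \<longleftrightarrow> f \<in> borel_measurable lebesgue \<and> integrable lebesgue (\<lambda>x. (f x)\<^sup>2)"
  by (simp add: L2_def lebesgue_on_UNIV_eq)

lemma mollifier_conv_contraction:
  assumes K: "mollifier K d" and f: "integrable lebesgue f" "f \<in> L2 UNIV"
  shows "conv K f \<in> L2 UNIV" "L2_norm UNIV (conv K f) \<le> L2_norm UNIV f"
proof -
  have sq: "integrable lebesgue (\<lambda>x. (f x)\<^sup>2)" using f by (simp add: L2_UNIV_real_iff)
  have m: "conv K f \<in> borel_measurable lebesgue"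
    by (intro measurable_completion) (use smooth_conv[OF mollifier_smooth[OF K] mollifier_bounded_support[OF K] f(1)]
        smooth_continuous borel_measurable_continuous_onI in fastforce)
  have fm: "f \<in> borel_measurable lebesgue" using f(1) by simp
  have "(\<integral>\<^sup>+ x. ennreal ((conv K f x)\<^sup>2) \<partial>lebesgue)
      \<le> (\<integral>\<^sup>+ x. (\<integral>\<^sup>+ y. ennreal (K (x - y)) * ennreal ((f y)\<^sup>2) \<partial>lebesgue) \<partial>lebesgue)"
  proof (rule nn_integral_mono)
    fix x
    have i: "integrable lebesgue (\<lambda>y. K (x - y) * (f y)\<^sup>2)"
      using K by (intro conv_integrable mollifier_bounded_support smooth_continuous mollifier_smooth sq)
    have "ennreal ((conv K f x)\<^sup>2) \<le> ennreal (\<integral>y. K (x - y) * (f y)\<^sup>2 \<partial>lebesgue)"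
      by (intro ennreal_leI mollifier_conv_sq_le[OF K f(1) sq])
    also have "\<dots> = (\<integral>\<^sup>+ y. ennreal (K (x - y) * (f y)\<^sup>2) \<partial>lebesgue)"
      using K by (intro nn_integral_eq_integral[symmetric] i) (auto simp: mollifier_def)
    also have "\<dots> = (\<integral>\<^sup>+ y. ennreal (K (x - y)) * ennreal ((f y)\<^sup>2) \<partial>lebesgue)"
      using K by (intro nn_integral_cong ennreal_mult) (auto simp: mollifier_def)
    finally show "ennreal ((conv K f x)\<^sup>2) \<le> \<dots>" .
  qed
  also have "\<dots> = (\<integral>\<^sup>+ y. ennreal ((f y)\<^sup>2) \<partial>lebesgue)"
    by (rule nn_integral_mollifier_conv[OF K]) (use fm in measurable)
  also have "\<dots> = ennreal ((L2_norm UNIV f)\<^sup>2)"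
    unfolding L2_norm_sq lebesgue_on_UNIV_eq by (subst nn_integral_eq_integral) (use sq in auto)
  finally have le: "(\<integral>\<^sup>+ x. ennreal ((conv K f x)\<^sup>2) \<partial>lebesgue) \<le> ennreal ((L2_norm UNIV f)\<^sup>2)" .
  have i: "integrable lebesgue (\<lambda>x. (conv K f x)\<^sup>2)"
    using m le_less_trans[OF le] by (intro integrableI_nonneg) auto
  then show "conv K f \<in> L2 UNIV" using m by (simp add: L2_UNIV_real_iff)
  have "ennreal ((L2_norm UNIV (conv K f))\<^sup>2) \<le> ennreal ((L2_norm UNIV f)\<^sup>2)"
    using le i unfolding L2_norm_sq lebesgue_on_UNIV_eq by (subst (asm) nn_integral_eq_integral) auto
  then have "(L2_norm UNIV (conv K f))\<^sup>2 \<le> (L2_norm UNIV f)\<^sup>2" by simp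
  then show "L2_norm UNIV (conv K f) \<le> L2_norm UNIV f"
    by (rule power2_le_imp_le) simp
qed

lemma integrable_indicator_cball:
  "integrable lebesgue (\<lambda>x::real^3. b * indicat_real (cball 0 R) x)"
proof (intro integrable_mult_right integrable_real_indicator)
  show "emeasure lebesgue (cball (0::real^3) R) < \<infinity>"
    using emeasure_bounded_finite[OF bounded_cball[of "0::real^3" R]] by simp
qed auto

lemma bounded_support_L2:
  assumes "bounded_support g" "g \<in> borel_measurable lebesgue" "\<And>x. \<bar>g x\<bar> \<le> B"
  shows "g \<in> L2 UNIV"
proof -
  obtain R where R: "\<And>x. R < norm x \<Longrightarrow> g x = 0" using assms bounded_support_def by auto
  have i: "integrable lebesgue (\<lambda>x::real^3. B\<^sup>2 * indicator (cball 0 R) x)"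
    by (rule integrable_indicator_cball)
  have "integrable lebesgue (\<lambda>x. (g x)\<^sup>2)"
  proof (rule Bochner_Integration.integrable_bound[OF i])
    show "AE x in lebesgue. norm ((g x)\<^sup>2) \<le> norm (B\<^sup>2 * indicator (cball 0 R) x)"
    proof (rule AE_I2)
      fix x
      have "\<bar>g x\<bar>\<^sup>2 \<le> B\<^sup>2" by (intro power_mono assms(3)) auto
      then show "norm ((g x)\<^sup>2) \<le> norm (B\<^sup>2 * indicator (cball 0 R) x)"
        using R[of x] by (cases "R < norm x") (auto simp: indicator_def)
    qed
  qed (use assms(2) in measurable)
  then show ?thesis using assms(2) by (simp add: L2_UNIV_real_iff)
qed

text \<open>Truncation in size and in space makes \<open>f\<close> bounded with bounded support. A
  measurable function is an almost everywhere limit of continuous ones, and clipping these in the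
  same manner provides a dominating function.\<close>

lemma continuous_dense_L2:
  fixes f :: "real^3 \<Rightarrow> real"
  assumes f: "f \<in> L2 UNIV" and "e > 0"
  shows "\<exists>g. continuous_on UNIV g \<and> bounded_support g \<and> L2_norm UNIV (\<lambda>x. f x - g x) < e"
proof -
  have fm[measurable]: "f \<in> borel_measurable lebesgue" using f by (simp add: L2_UNIV_real_iff)
  define t where "t n x = (if \<bar>f x\<bar> \<le> real n \<and> norm x \<le> real n then f x else 0)" for n :: nat and x
  have [measurable]: "(\<lambda>x::real^3. x) \<in> borel_measurable lebesgue"
    by (rule continuous_lebesgue_measurable) auto
  have tm[measurable]: "t n \<in> borel_measurable lebesgue" for n
    unfolding t_def by measurable
  have "(\<lambda>n. L2_norm UNIV (\<lambda>x. f x - t n x)) \<longlonglongrightarrow> 0"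
  proof (rule L2_dominated[OF _ f])
    show "AE x in lebesgue_on UNIV. (\<lambda>n. f x - t n x) \<longlonglongrightarrow> 0"
    proof (rule AE_I2)
      fix x
      obtain N where N: "max \<bar>f x\<bar> (norm x) \<le> real N" using real_arch_simple by blast
      have "eventually (\<lambda>n. f x - t n x = 0) sequentially"
        unfolding eventually_sequentially
      proof (intro exI allI impI)
        fix n assume "N \<le> n"
        then have "real N \<le> real n" by simp
        with N show "f x - t n x = 0" by (simp add: t_def)
      qed
      then show "(\<lambda>n. f x - t n x) \<longlonglongrightarrow> 0" by (rule tendsto_eventually)
    qed
  qed (auto simp: t_def lebesgue_on_UNIV_eq)
  then obtain n where n: "L2_norm UNIV (\<lambda>x. f x - t n x) < e / 2"
    using order_tendstoD(2)[of _ 0 sequentially "e/2"] \<open>e > 0\<close> by (auto simp: eventually_sequentially)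
  have tL: "t n \<in> L2 UNIV"
    by (rule L2_bounded_by(1)[OF _ f, of _ 1]) (auto simp: t_def lebesgue_on_UNIV_eq)
  have "t n measurable_on UNIV"
    by (simp add: measurable_on_iff_borel_measurable lebesgue_on_UNIV_eq)
  then obtain N g where N: "negligible N" and g: "\<And>k. continuous_on UNIV (g k)"
      and lim: "\<And>x. x \<notin> N \<Longrightarrow> (\<lambda>k. g k x) \<longlonglongrightarrow> t n x"
    unfolding measurable_on_def by auto
  \<comment> \<open>\<open>s\<close> is 1 on the ball of radius \<open>n\<close>, outside of which
    \<open>t n\<close> vanishes, and 0 beyond radius \<open>n + 1\<close>; so the clipped functions
    still converge to \<open>t n\<close>.\<close>
  define s where "s = (\<lambda>x::real^3. max 0 (min 1 (real n + 1 - norm x)))"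
  define h where "h k x = max (- real n) (min (real n) (g k x)) * s x" for k x
  have hc: "continuous_on UNIV (h k)" for k
    unfolding h_def s_def by (intro continuous_intros g)
  have s01: "0 \<le> s x" "s x \<le> 1" for x by (auto simp: s_def)
  have hs: "h k x = 0" if "real n + 1 < norm x" for k x using that by (auto simp: h_def s_def)
  have hb: "\<bar>h k x\<bar> \<le> real n" for k x
  proof -
    have "\<bar>h k x\<bar> \<le> real n * 1" unfolding h_def abs_mult by (intro mult_mono) (use s01[of x] in auto)
    then show ?thesis by simp
  qed
  define G where "G = (\<lambda>x::real^3. 2 * real n * indicator (cball 0 (real n + 1)) x)"
  have GL: "G \<in> L2 UNIV"
  proof (rule bounded_support_L2[of _ "2 * real n"])
    show "G \<in> borel_measurable lebesgue"
      unfolding G_def by (intro borel_measurable_times borel_measurable_const borel_measurable_indicator) auto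
  qed (auto simp: G_def bounded_support_def indicator_def intro!: exI[of _ "real n + 1"])
  have hm: "h k \<in> borel_measurable lebesgue" for k
    by (intro measurable_completion) (use hc borel_measurable_continuous_onI in fastforce)
  have "(\<lambda>k. L2_norm UNIV (\<lambda>x. t n x - h k x)) \<longlonglongrightarrow> 0"
  proof (rule L2_dominated[OF _ GL])
    show "(\<lambda>x. t n x - h k x) \<in> borel_measurable (lebesgue_on UNIV)" for k
      using hm tm by (simp add: lebesgue_on_UNIV_eq)
    show "norm (t n x - h k x) \<le> norm (G x)" for k x
    proof (cases "real n + 1 < norm x")
      case True
      then show ?thesis using hs by (simp add: t_def)
    next
      case False
      have "\<bar>t n x\<bar> \<le> real n" by (simp add: t_def)
      then show ?thesis using hb[of k x] False by (simp add: G_def)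
    qed
    have "AE x in lebesgue. x \<notin> N" using N by (simp add: negligible_iff_null_sets AE_not_in)
    then show "AE x in lebesgue_on UNIV. (\<lambda>k. t n x - h k x) \<longlonglongrightarrow> 0"
      unfolding lebesgue_on_UNIV_eq
    proof eventually_elim
      case (elim x)
      have "(\<lambda>k. t n x - h k x) \<longlonglongrightarrow> t n x - max (- real n) (min (real n) (t n x)) * s x"
        unfolding h_def by (intro tendsto_intros lim elim)
      also have "t n x - max (- real n) (min (real n) (t n x)) * s x = 0"
        by (auto simp: t_def s_def)
      finally show ?case .
    qed
  qed
  then obtain k where k: "L2_norm UNIV (\<lambda>x. t n x - h k x) < e / 2"
    using order_tendstoD(2)[of _ 0 sequentially "e/2"] \<open>e > 0\<close> by (auto simp: eventually_sequentially)
  have bs: "bounded_support (h k)" using hs by (auto simp: bounded_support_def)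
  have hL: "h k \<in> L2 UNIV" by (rule bounded_support_L2[OF bs hm hb])
  have "L2_norm UNIV (\<lambda>x. f x - h k x) < e"
    using L2_norm_triangle_diff[OF f tL hL] n k by linarith
  then show ?thesis using hc bs by blast
qed

lemma bounded_support_L2_integrable:
  assumes "bounded_support f" "f \<in> L2 UNIV" shows "integrable lebesgue f"
proof -
  obtain R where R: "\<And>x. R < norm x \<Longrightarrow> f x = 0" using assms bounded_support_def by auto
  have "(\<lambda>x::real^3. indicator (cball 0 R) x :: real) \<in> L2 UNIV"
  proof (rule bounded_support_L2[of _ 1])
    show "(\<lambda>x::real^3. indicat_real (cball 0 R) x) \<in> borel_measurable lebesgue"
      by (intro borel_measurable_indicator) auto
  qed (auto simp: bounded_support_def indicator_def intro!: exI[of _ R])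
  from L2_inner_integrable[OF assms(2) this]
  have "integrable lebesgue (\<lambda>x. f x * indicator (cball 0 R) x)" by (simp add: lebesgue_on_UNIV_eq)
  also have "(\<lambda>x. f x * indicator (cball 0 R) x) = f"
    by (rule ext) (auto simp: indicator_def R)
  finally show ?thesis .
qed

text \<open>Kernels of radius at most 1 keep the error inside a fixed ball of volume
  \<open>V\<close>, and uniform continuity on a slightly larger ball makes it at most
  \<open>b\<close> pointwise; \<open>b\<close> is chosen with b sqrt V < e. Only the size of the
  support of \<open>K\<close> enters, so off-centre kernels are covered.\<close>

lemma conv_approx_continuous:
  assumes g: "continuous_on UNIV g" "bounded_support g" and "e > 0"
  shows "\<exists>d>0. \<forall>K. mollifier K d \<longrightarrow> L2_norm UNIV (\<lambda>x. conv K g x - g x) < e"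
proof -
  obtain R where R: "\<And>x. R < norm x \<Longrightarrow> g x = 0" using g bounded_support_def by auto
  define V where "V = measure lebesgue (cball (0::real^3) (\<bar>R\<bar> + 1))"
  define b where "b = e / 2 / (sqrt V + 1)"
  have V: "0 \<le> sqrt V" by (simp add: V_def)
  then have b: "b > 0" using \<open>e > 0\<close> unfolding b_def by (intro divide_pos_pos add_nonneg_pos) auto
  have "uniformly_continuous_on (cball 0 (\<bar>R\<bar> + 2)) g"
    by (intro compact_uniformly_continuous compact_cball continuous_on_subset[OF g(1)]) auto
  then obtain d0 where d0: "d0 > 0"
      "\<And>x y. x \<in> cball 0 (\<bar>R\<bar> + 2) \<Longrightarrow> y \<in> cball 0 (\<bar>R\<bar> + 2) \<Longrightarrow> dist y x < d0 \<Longrightarrow> dist (g y) (g x) < b"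
    using b unfolding uniformly_continuous_on_def by metis
  have gi: "integrable lebesgue g" by (rule bounded_support_integrable[OF g(2,1)])
  have "L2_norm UNIV (\<lambda>x. conv K g x - g x) < e" if K: "mollifier K (min d0 1)" for K
  proof -
    have K0: "K z = 0" if "min d0 1 \<le> norm z" for z using K that by (auto simp: mollifier_def)
    have near: "\<bar>g y - g x\<bar> \<le> b" if "dist y x < min d0 1" for x y
    proof (cases "norm x \<le> \<bar>R\<bar> + 1")
      case True
      have "norm y \<le> norm x + norm (y - x)" by (metis add.commute norm_triangle_sub)
      then have "norm y \<le> \<bar>R\<bar> + 2" using True that by (simp add: dist_norm)
      then show ?thesis using d0(2)[of x y] True that by (simp add: dist_real_def)
    next
      case False
      have "norm x \<le> norm y + norm (x - y)" by (metis add.commute norm_triangle_sub)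
      then have "norm y > \<bar>R\<bar>" using False that by (simp add: dist_norm norm_minus_commute)
      then show ?thesis using R[of x] R[of y] False b by auto
    qed
    have i3: "integrable lebesgue (\<lambda>y. K (x - y))" "(\<integral>y. K (x - y) \<partial>lebesgue) = 1" for x
      using integrable_reflect[OF mollifier_integrable[OF K]] integral_reflect[OF mollifier_integrable[OF K]] K
      by (auto simp: mollifier_def)
    have i1: "integrable lebesgue (\<lambda>y. K (x - y) * g y)" for x
      using K by (intro conv_integrable mollifier_bounded_support smooth_continuous mollifier_smooth gi)
    have le: "\<bar>conv K g x - g x\<bar> \<le> b" for x
    proof -
      have "conv K g x - g x = (\<integral>y. K (x - y) * g y - g x * K (x - y) \<partial>lebesgue)"
        using i1 i3 by (simp add: conv_def)
      also have "\<bar>\<dots>\<bar> \<le> (\<integral>y. b * K (x - y) \<partial>lebesgue)"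
        unfolding real_norm_def[symmetric]
      proof (rule Bochner_Integration.integral_norm_bound_integral)
        show "norm (K (x - y) * g y - g x * K (x - y)) \<le> b * K (x - y)" for y
        proof (cases "dist y x < min d0 1")
          case True
          have "norm (K (x - y) * g y - g x * K (x - y)) = \<bar>g y - g x\<bar> * K (x - y)"
            using K by (simp add: mollifier_def abs_mult flip: left_diff_distrib mult.commute[of "g y"])
          also have "\<dots> \<le> b * K (x - y)"
            using K by (intro mult_right_mono near True) (auto simp: mollifier_def)
          finally show ?thesis .
        next
          case False
          then have "min d0 1 \<le> norm (x - y)" unfolding dist_norm norm_minus_commute[of y x] by linarith
          from K0[OF this] show ?thesis by simp
        qed
      qed (use i1 i3 in auto)
      also have "\<dots> = b" using i3 by simp
      finally show ?thesis .
    qed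
    have zero: "conv K g x - g x = 0" if "\<bar>R\<bar> + 1 < norm x" for x
    proof -
      have "K (x - y) * g y = 0" for y
      proof (cases "R < norm y")
        case False
        have "norm x \<le> norm y + norm (x - y)" by (metis add.commute norm_triangle_sub)
        then have "min d0 1 \<le> norm (x - y)" using False that by linarith
        then show ?thesis using K0 by simp
      qed (simp add: R)
      then have "conv K g x = 0" unfolding conv_def by (simp only: Bochner_Integration.integral_zero)
      then show ?thesis using R[of x] that by simp
    qed
    let ?B = "cball (0::real^3) (\<bar>R\<bar> + 1)"
    have "(L2_norm UNIV (\<lambda>x. conv K g x - g x))\<^sup>2 = (\<integral>x. (conv K g x - g x)\<^sup>2 \<partial>lebesgue)"
      by (simp add: L2_norm_sq lebesgue_on_UNIV_eq)
    also have "\<dots> \<le> (\<integral>x. b\<^sup>2 * indicator ?B x \<partial>lebesgue)"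
    proof (rule integral_mono_AE')
      show "integrable lebesgue (\<lambda>x. b\<^sup>2 * indicat_real ?B x)"
        by (rule integrable_indicator_cball)
      show "AE x in lebesgue. (conv K g x - g x)\<^sup>2 \<le> b\<^sup>2 * indicator ?B x"
      proof (rule AE_I2)
        fix x
        have "\<bar>conv K g x - g x\<bar>\<^sup>2 \<le> b\<^sup>2" by (intro power_mono le) auto
        then show "(conv K g x - g x)\<^sup>2 \<le> b\<^sup>2 * indicator ?B x"
          using zero[of x] by (cases "\<bar>R\<bar> + 1 < norm x") (auto simp: indicator_def)
      qed
    qed auto
    also have "\<dots> = (b * sqrt V)\<^sup>2" by (simp add: V_def power_mult_distrib)
    finally have "L2_norm UNIV (\<lambda>x. conv K g x - g x) \<le> b * sqrt V"
      using b V by (meson less_imp_le mult_nonneg_nonneg power2_le_imp_le)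
    also have "\<dots> < e"
    proof -
      have "b * sqrt V \<le> b * (sqrt V + 1)" using b by simp
      also have "\<dots> = e / 2"
      proof -
        have "sqrt V + 1 \<noteq> 0" using V by linarith
        then show ?thesis unfolding b_def by (metis nonzero_eq_divide_eq)
      qed
      finally show ?thesis using \<open>e > 0\<close> by linarith
    qed
    finally show ?thesis .
  qed
  then show ?thesis using d0(1) by (intro exI[of _ "min d0 1"]) auto
qed

lemma conv_diff:
  assumes "mollifier K d" "integrable lebesgue f" "integrable lebesgue g"
  shows "conv K (\<lambda>x. f x - g x) x = conv K f x - conv K g x"
  using conv_integrable[OF mollifier_bounded_support[OF assms(1)] smooth_continuous[OF mollifier_smooth[OF assms(1)]]] assms
  by (simp add: conv_def right_diff_distrib)

lemma conv_diff_fun: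
  assumes "mollifier K d" "integrable lebesgue f" "integrable lebesgue g"
  shows "conv K (\<lambda>x. f x - g x) = (\<lambda>x. conv K f x - conv K g x)"
  using conv_diff[OF assms] by blast

text \<open>Continuous functions of bounded support are dense, and their approximation carries over
  to \<open>f\<close> because mollification is an L2 contraction.\<close>

lemma conv_approx:
  assumes f: "f \<in> L2 UNIV" "bounded_support f" and "e > 0"
  shows "\<exists>d>0. \<forall>K. mollifier K d \<longrightarrow> L2_norm UNIV (\<lambda>x. conv K f x - f x) < e"
proof -
  obtain g where g: "continuous_on UNIV g" "bounded_support g" "L2_norm UNIV (\<lambda>x. f x - g x) < e / 3"
    using continuous_dense_L2[OF f(1), of "e / 3"] \<open>e > 0\<close> by auto
  obtain d where d: "d > 0" "\<And>K. mollifier K d \<Longrightarrow> L2_norm UNIV (\<lambda>x. conv K g x - g x) < e / 3"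
    using conv_approx_continuous[OF g(1,2), of "e / 3"] \<open>e > 0\<close> by auto
  have fi: "integrable lebesgue f" by (rule bounded_support_L2_integrable[OF f(2,1)])
  have gi: "integrable lebesgue g" by (rule bounded_support_integrable[OF g(2,1)])
  obtain B where B: "\<forall>x. \<bar>g x\<bar> \<le> B" using bounded_support_bounded[OF g(2,1)] by blast
  have gL: "g \<in> L2 UNIV"
    using B gi by (intro bounded_support_L2[OF g(2), of B]) auto
  have "L2_norm UNIV (\<lambda>x. conv K f x - f x) < e" if K: "mollifier K d" for K
  proof -
    have cf: "conv K f \<in> L2 UNIV" and cg: "conv K g \<in> L2 UNIV"
      using mollifier_conv_contraction(1)[OF K] fi gi f gL by auto
    have "L2_norm UNIV (\<lambda>x. conv K f x - f x)
        \<le> L2_norm UNIV (\<lambda>x. conv K f x - conv K g x) + L2_norm UNIV (\<lambda>x. conv K g x - f x)"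
      by (rule L2_norm_triangle_diff[OF cf cg f(1)])
    also have "L2_norm UNIV (\<lambda>x. conv K f x - conv K g x) \<le> L2_norm UNIV (\<lambda>x. f x - g x)"
      using mollifier_conv_contraction(2)[OF K, of "\<lambda>x. f x - g x"] fi gi f gL
      by (simp add: L2_diff conv_diff_fun[OF K])
    also have "L2_norm UNIV (\<lambda>x. conv K g x - f x)
        \<le> L2_norm UNIV (\<lambda>x. conv K g x - g x) + L2_norm UNIV (\<lambda>x. g x - f x)"
      by (rule L2_norm_triangle_diff[OF cg gL f(1)])
    finally show ?thesis
      using g(3) d(2)[OF K] L2_norm_diff_commute[of UNIV g f] by linarith
  qed
  then show ?thesis using d(1) by blast
qed

section \<open>Integration by parts and uniqueness of weak derivatives\<close>

text \<open>The convolution of \<open>f\<close> with the indicator of a large ball is constant near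
  0, with the integral of \<open>f\<close> as its value. Its derivative at 0 therefore vanishes; on
  the other hand it is the integral of the derivative of \<open>f\<close>. Iterated integrals are
  avoided in this way.\<close>

lemma integral_pderiv3_zero:
  assumes f: "smooth f" "bounded_support f"
  shows "(\<integral>x. pderiv3 i f x \<partial>lebesgue) = 0"
proof -
  obtain R0 where R0: "\<And>x. R0 < norm x \<Longrightarrow> f x = 0" using f(2) bounded_support_def by auto
  define R where "R = \<bar>R0\<bar> + 1"
  define B where "B = cball (0::real^3) (R + 1)"
  have df: "pderiv3 i f x = 0" if "R < norm x" for x
  proof -
    have "open {x::real^3. R0 < norm x}" by (intro open_Collect_less continuous_intros)
    moreover have "R0 < norm x" using that by (simp add: R_def)
    ultimately show ?thesis
      using pderiv3_cong_open(1)[of "{x. R0 < norm x}" x f "\<lambda>x. 0" i] R0 by simp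
  qed
  have iB: "integrable lebesgue (indicat_real B)"
    using integrable_indicator_cball[of 1 "R + 1"] by (simp add: B_def)
  have eq: "conv f (indicat_real B) x = (\<integral>y. f y \<partial>lebesgue)" if "x \<in> ball 0 1" for x
  proof -
    have "f (x - y) * indicat_real B y = f (x - y)" for y
    proof (cases "y \<in> B")
      case False
      then have "R + 1 < norm y" by (simp add: B_def)
      moreover have "norm y \<le> norm (x - y) + norm x"
        using norm_triangle_ineq4[of x "x - y"] by simp
      ultimately have "R0 < norm (x - y)" using that by (simp add: R_def)
      then show ?thesis by (simp add: R0)
    qed simp
    then show ?thesis
      unfolding conv_def
      by (simp only: integral_reflect[OF bounded_support_integrable[OF f(2) smooth_continuous[OF f(1)]]])
  qed
  have "pderiv3 i (conv f (indicat_real B)) 0 = pderiv3 i (\<lambda>x. \<integral>y. f y \<partial>lebesgue) 0"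
    by (rule pderiv3_cong_open(1)[of "ball 0 1"]) (use eq in auto)
  then have "conv (pderiv3 i f) (indicat_real B) 0 = 0"
    by (simp add: pderiv3_conv[OF f iB])
  moreover have "pderiv3 i f (0 - y) * indicat_real B y = pderiv3 i f (0 - y)" for y
    using df[of "0 - y"] by (cases "y \<in> B") (auto simp: B_def)
  ultimately have "(\<integral>y. pderiv3 i f (0 - y) \<partial>lebesgue) = 0" by (simp only: conv_def)
  then show ?thesis
    using integral_reflect[where a = 0, OF bounded_support_integrable[OF bounded_support_pderiv3[OF f(2)]
          smooth_continuous[OF smooth_pderiv3[OF f(1)]]]] by simp
qed

section \<open>Symmetry of second derivatives\<close>

lemma pderiv3_line:
  assumes "smooth f"
  shows "((\<lambda>t. f (a + t *\<^sub>R axis i 1)) has_real_derivative pderiv3 i f (a + t *\<^sub>R axis i 1)) (at t)"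
proof -
  have "((\<lambda>t. a + t *\<^sub>R axis i 1) has_derivative (\<lambda>s. s *\<^sub>R axis i 1)) (at t)"
    by (auto intro!: derivative_eq_intros)
  from has_derivative_compose[OF this has_derivative_pderiv3[OF smooth_differentiable[OF assms]]]
  have "((\<lambda>t. f (a + t *\<^sub>R axis i 1)) has_derivative
      (\<lambda>s. \<Sum>j\<in>UNIV. (s *\<^sub>R axis i 1) $ j * pderiv3 j f (a + t *\<^sub>R axis i 1))) (at t)" .
  moreover have "(\<lambda>s. \<Sum>j\<in>UNIV. (s *\<^sub>R axis i 1) $ j * pderiv3 j f (a + t *\<^sub>R axis i 1))
      = (*) (pderiv3 i f (a + t *\<^sub>R axis i 1))"
    by (rule ext) (simp add: axis_def if_distrib[of "\<lambda>u. u * _"] if_distrib[of "\<lambda>u. _ * u"] cong: if_cong)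
  ultimately show ?thesis by (simp add: has_field_derivative_def)
qed

text \<open>Two applications of the mean value theorem: along \<open>i\<close> to the increment of
  \<open>f\<close> in direction \<open>j\<close>, then along \<open>j\<close> to the resulting
  derivative.\<close>

lemma second_difference_MVT:
  assumes "smooth f" "0 < h"
  shows "\<exists>p. dist p x \<le> 2 * h \<and>
    f (x + h *\<^sub>R axis i 1 + h *\<^sub>R axis j 1) - f (x + h *\<^sub>R axis i 1) - f (x + h *\<^sub>R axis j 1) + f x
      = h * h * pderiv3 j (pderiv3 i f) p"
proof -
  define g where "g t = f ((x + h *\<^sub>R axis j 1) + t *\<^sub>R axis i 1) - f (x + t *\<^sub>R axis i 1)" for t
  obtain z where z: "0 < z" "z < h" and
    gz: "g h - g 0 = (h - 0) * (pderiv3 i f ((x + h *\<^sub>R axis j 1) + z *\<^sub>R axis i 1) - pderiv3 i f (x + z *\<^sub>R axis i 1))"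
    using MVT2[OF assms(2), of g "\<lambda>t. pderiv3 i f ((x + h *\<^sub>R axis j 1) + t *\<^sub>R axis i 1) - pderiv3 i f (x + t *\<^sub>R axis i 1)"]
    unfolding g_def using DERIV_diff[OF pderiv3_line[OF assms(1)] pderiv3_line[OF assms(1)]] by blast
  obtain w where w: "0 < w" "w < h" and
    gw: "pderiv3 i f ((x + z *\<^sub>R axis i 1) + h *\<^sub>R axis j 1) - pderiv3 i f ((x + z *\<^sub>R axis i 1) + 0 *\<^sub>R axis j 1)
      = (h - 0) * pderiv3 j (pderiv3 i f) ((x + z *\<^sub>R axis i 1) + w *\<^sub>R axis j 1)"
    using MVT2[OF assms(2), of "\<lambda>t. pderiv3 i f ((x + z *\<^sub>R axis i 1) + t *\<^sub>R axis j 1)"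
        "\<lambda>t. pderiv3 j (pderiv3 i f) ((x + z *\<^sub>R axis i 1) + t *\<^sub>R axis j 1)"]
      pderiv3_line[OF smooth_pderiv3[OF assms(1)]] by blast
  let ?p = "(x + z *\<^sub>R axis i 1) + w *\<^sub>R axis j 1"
  have "dist ?p x \<le> norm (z *\<^sub>R (axis i 1 :: real^3)) + norm (w *\<^sub>R (axis j 1 :: real^3))"
    unfolding dist_norm using norm_triangle_ineq[of "z *\<^sub>R axis i 1" "w *\<^sub>R (axis j 1 :: real^3)"]
    by (simp add: algebra_simps)
  then have "dist ?p x \<le> 2 * h" using z w by simp
  moreover have "f (x + h *\<^sub>R axis i 1 + h *\<^sub>R axis j 1) - f (x + h *\<^sub>R axis i 1) - f (x + h *\<^sub>R axis j 1) + f x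
      = g h - g 0"
    unfolding g_def by (simp add: ac_simps)
  moreover have "g h - g 0 = h * h * pderiv3 j (pderiv3 i f) ?p"
    unfolding gz using gw by (simp add: ac_simps)
  ultimately show ?thesis by auto
qed

text \<open>The second difference is symmetric in \<open>i\<close> and \<open>j\<close>, so the two
  mixed derivatives take equal values at points \<open>p\<close> and \<open>q\<close> that tend to
  \<open>x\<close>; continuity finishes the argument.\<close>

lemma pderiv3_commute:
  assumes f: "smooth f"
  shows "pderiv3 i (pderiv3 j f) x = pderiv3 j (pderiv3 i f) x"
proof -
  have "\<exists>p. dist p x \<le> 2 * h \<and> (\<exists>q. dist q x \<le> 2 * h \<and> pderiv3 j (pderiv3 i f) p = pderiv3 i (pderiv3 j f) q)"
    if h: "h > 0" for h
  proof -
    obtain p where p: "dist p x \<le> 2 * h"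
      "f (x + h *\<^sub>R axis i 1 + h *\<^sub>R axis j 1) - f (x + h *\<^sub>R axis i 1) - f (x + h *\<^sub>R axis j 1) + f x
        = h * h * pderiv3 j (pderiv3 i f) p"
      using second_difference_MVT[OF f h] by blast
    obtain q where q: "dist q x \<le> 2 * h"
      "f (x + h *\<^sub>R axis j 1 + h *\<^sub>R axis i 1) - f (x + h *\<^sub>R axis j 1) - f (x + h *\<^sub>R axis i 1) + f x
        = h * h * pderiv3 i (pderiv3 j f) q"
      using second_difference_MVT[OF f h] by blast
    have "h * h * pderiv3 j (pderiv3 i f) p = h * h * pderiv3 i (pderiv3 j f) q"
      unfolding p(2)[symmetric] q(2)[symmetric] by (simp add: ac_simps)
    then show ?thesis using p(1) q(1) h by auto
  qed
  then have "\<forall>n. \<exists>p q. dist p x \<le> 2 * inverse (real (Suc n)) \<and> dist q x \<le> 2 * inverse (real (Suc n)) \<and>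
      pderiv3 j (pderiv3 i f) p = pderiv3 i (pderiv3 j f) q"
    by (metis inverse_positive_iff_positive of_nat_0_less_iff zero_less_Suc)
  then obtain p q where pq: "\<And>n. dist (p n) x \<le> 2 * inverse (real (Suc n))"
      "\<And>n. dist (q n) x \<le> 2 * inverse (real (Suc n))"
      "\<And>n. pderiv3 j (pderiv3 i f) (p n) = pderiv3 i (pderiv3 j f) (q n)"
    by metis
  have lim0: "(\<lambda>n. 2 * inverse (real (Suc n))) \<longlonglongrightarrow> 0"
    using tendsto_mult[OF tendsto_const[of 2] LIMSEQ_inverse_real_of_nat] by simp
  have lim: "r \<longlonglongrightarrow> x" if "\<And>n. dist (r n) x \<le> 2 * inverse (real (Suc n))" for r
    unfolding tendsto_dist_iff[of r]
    by (rule tendsto_sandwich[OF _ _ tendsto_const lim0]) (use that in \<open>auto intro!: always_eventually\<close>)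
  have c: "isCont (pderiv3 j (pderiv3 i f)) x" "isCont (pderiv3 i (pderiv3 j f)) x"
    using smooth_continuous[OF smooth_pderiv3[OF smooth_pderiv3[OF f]], of UNIV]
    by (auto simp: continuous_on_eq_continuous_at)
  have "(\<lambda>n. pderiv3 j (pderiv3 i f) (p n)) \<longlonglongrightarrow> pderiv3 j (pderiv3 i f) x"
    by (rule isCont_tendsto_compose[OF c(1) lim[OF pq(1)]])
  moreover have "(\<lambda>n. pderiv3 j (pderiv3 i f) (p n)) \<longlonglongrightarrow> pderiv3 i (pderiv3 j f) x"
    unfolding pq(3) by (rule isCont_tendsto_compose[OF c(2) lim[OF pq(2)]])
  ultimately show ?thesis using LIMSEQ_unique by blast
qed

section \<open>Sets at positive distance and functions vanishing near part of the boundary\<close>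

definition apart :: "(real^3) set \<Rightarrow> (real^3) set \<Rightarrow> bool" where
  "apart A B \<longleftrightarrow> (\<exists>d>0. \<forall>x\<in>A. \<forall>y\<in>B. d \<le> dist x y)"

lemma apart_mono: "apart A B \<Longrightarrow> A' \<subseteq> A \<Longrightarrow> B' \<subseteq> B \<Longrightarrow> apart A' B'"
  unfolding apart_def by (meson subset_eq)

lemma apart_closure_left: "apart (closure A) B \<longleftrightarrow> apart A B"
proof
  show "apart (closure A) B \<Longrightarrow> apart A B" by (rule apart_mono[OF _ closure_subset]) auto
  assume "apart A B"
  then obtain d where d: "d > 0" "\<forall>x\<in>A. \<forall>y\<in>B. d \<le> dist x y" unfolding apart_def by blast
  have "d \<le> dist x y" if "x \<in> closure A" "y \<in> B" for x y
  proof -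
    have "closed {x. d \<le> dist x y}" by (intro closed_Collect_le continuous_intros)
    moreover have "A \<subseteq> {x. d \<le> dist x y}" using d that by auto
    ultimately show ?thesis using closure_minimal that by blast
  qed
  then show "apart (closure A) B" using d unfolding apart_def by blast
qed

lemma apart_commute: "apart A B \<longleftrightarrow> apart B A"
  unfolding apart_def by (metis dist_commute)

lemma apart_closure_right: "apart A (closure B) \<longleftrightarrow> apart A B"
  using apart_closure_left apart_commute by blast

lemma apart_Un_right: "apart A (B \<union> C) \<longleftrightarrow> apart A B \<and> apart A C"
proof
  assume "apart A B \<and> apart A C"
  then obtain d e where "d > 0" "\<forall>x\<in>A. \<forall>y\<in>B. d \<le> dist x y" "e > 0" "\<forall>x\<in>A. \<forall>y\<in>C. e \<le> dist x y"
    unfolding apart_def by blast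
  then show "apart A (B \<union> C)"
    unfolding apart_def by (intro exI[of _ "min d e"]) (auto simp: min_le_iff_disj)
qed (auto elim: apart_mono)

lemma apart_Un_left: "apart (A \<union> B) C \<longleftrightarrow> apart A C \<and> apart B C"
  using apart_Un_right apart_commute by blast

text \<open>A positive distance survives the closure of the support, so only the set where
  \<open>u\<close> is nonzero inside \<Omega> has to be watched; the values of \<open>u\<close>
  outside are free.\<close>

lemma Cinf0_iff: "u \<in> Cinf0 \<gamma> \<Omega> \<longleftrightarrow> smooth u \<and> apart {x\<in>\<Omega>. u x \<noteq> 0} \<gamma>"
  unfolding Cinf0_def mem_Collect_eq using apart_closure_left unfolding apart_def by blast

lemma Cinf0_smooth: "u \<in> Cinf0 \<gamma> \<Omega> \<Longrightarrow> smooth u"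
  by (simp add: Cinf0_iff)

lemma Cinf0_zero [simp]: "(\<lambda>x. 0) \<in> Cinf0 \<gamma> \<Omega>"
  by (auto simp: Cinf0_iff apart_def intro: exI[of _ 1])

lemma Cinf0_mult: "u \<in> Cinf0 \<gamma> \<Omega> \<Longrightarrow> smooth v \<Longrightarrow> (\<lambda>x. v x * u x) \<in> Cinf0 \<gamma> \<Omega>"
  by (auto simp: Cinf0_iff smooth_mult elim!: apart_mono)

lemma Cinf0_cmult: "u \<in> Cinf0 \<gamma> \<Omega> \<Longrightarrow> (\<lambda>x. c * u x) \<in> Cinf0 \<gamma> \<Omega>"
  by (simp add: Cinf0_mult)

lemma Cinf0_add:
  assumes "u \<in> Cinf0 \<gamma> \<Omega>" "v \<in> Cinf0 \<gamma> \<Omega>"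
  shows "(\<lambda>x. u x + v x) \<in> Cinf0 \<gamma> \<Omega>"
proof -
  have "apart ({x\<in>\<Omega>. u x \<noteq> 0} \<union> {x\<in>\<Omega>. v x \<noteq> 0}) \<gamma>"
    using assms by (simp add: Cinf0_iff apart_Un_left)
  then have "apart {x\<in>\<Omega>. u x + v x \<noteq> 0} \<gamma>" by (rule apart_mono) auto
  with assms show ?thesis by (simp add: Cinf0_iff smooth_add)
qed

lemma Cinf0_minus: "u \<in> Cinf0 \<gamma> \<Omega> \<Longrightarrow> (\<lambda>x. - u x) \<in> Cinf0 \<gamma> \<Omega>"
  using Cinf0_cmult[of u \<gamma> \<Omega> "-1"] by simp

lemma segment_meets_frontier:
  fixes y x :: "real^3"
  assumes "y \<in> \<Omega>" "x \<notin> \<Omega>"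
  shows "\<exists>z\<in>frontier \<Omega>. dist y z \<le> dist y x"
proof -
  have "closed_segment y x \<inter> frontier \<Omega> \<noteq> {}"
    by (rule connected_Int_frontier) (use assms in auto)
  then obtain z where z: "z \<in> closed_segment y x" "z \<in> frontier \<Omega>" by blast
  then show ?thesis using dist_in_closed_segment[of z y x] by (metis dist_commute)
qed

text \<open>Openness makes derivatives on \<Omega> depend on the values there alone; boundedness
  puts all smooth functions into L2 and gives the finite measure that the completeness argument
  uses. Regularity of the boundary is added only where charts occur.\<close>

locale bounded_open_set =
  fixes \<Omega> :: "(real^3) set"
  assumes open_\<Omega>: "open \<Omega>" and bounded_\<Omega>: "bounded \<Omega>"
begin

lemma lmeasurable_\<Omega>: "\<Omega> \<in> lmeasurable"
  using open_\<Omega> bounded_\<Omega> by (rule bounded_open_lmeasurable)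

lemma sets_\<Omega>: "\<Omega> \<in> sets lebesgue"
  using lmeasurable_\<Omega> by (rule fmeasurableD)

lemma smooth_L2: "smooth f \<Longrightarrow> f \<in> L2 \<Omega>"
  by (intro L2_continuous lmeasurable_\<Omega> bounded_\<Omega> smooth_continuous)

lemma smooth_measurable: "smooth f \<Longrightarrow> f \<in> borel_measurable (lebesgue_on \<Omega>)"
  by (rule L2_measurable[OF smooth_L2])

lemma Cinf0_pderiv3:
  assumes "u \<in> Cinf0 \<gamma> \<Omega>" shows "pderiv3 i u \<in> Cinf0 \<gamma> \<Omega>"
proof -
  have "apart (closure {x\<in>\<Omega>. u x \<noteq> 0}) \<gamma>" using assms by (simp add: Cinf0_iff apart_closure_left)
  moreover have "{x\<in>\<Omega>. pderiv3 i u x \<noteq> 0} \<subseteq> closure {x\<in>\<Omega>. u x \<noteq> 0}"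
  proof (safe, rule ccontr)
    fix x assume x: "x \<in> \<Omega>" "pderiv3 i u x \<noteq> 0" "x \<notin> closure {x\<in>\<Omega>. u x \<noteq> 0}"
    have "pderiv3 i u x = pderiv3 i (\<lambda>x. 0) x"
      by (rule pderiv3_cong_open(1)[of "\<Omega> - closure {x\<in>\<Omega>. u x \<noteq> 0}"])
         (use x open_\<Omega> closure_subset[of "{x\<in>\<Omega>. u x \<noteq> 0}"] in auto)
    with x show False by simp
  qed
  ultimately have "apart {x\<in>\<Omega>. pderiv3 i u x \<noteq> 0} \<gamma>" by (rule apart_mono) auto
  with assms show ?thesis by (simp add: Cinf0_iff smooth_pderiv3)
qed

text \<open>In a bounded open set, compact support inside \<Omega> amounts to a positive distance
  from the frontier. Test functions thus become the case of \<open>Cinf0\<close> where \<gamma> is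
  the whole frontier, with zero values outside.\<close>

lemma test_fun_iff:
  "\<phi> \<in> test_fun \<Omega> \<longleftrightarrow> smooth \<phi> \<and> {x. \<phi> x \<noteq> 0} \<subseteq> \<Omega> \<and> apart {x. \<phi> x \<noteq> 0} (frontier \<Omega>)"
proof safe
  assume t: "\<phi> \<in> test_fun \<Omega>"
  then show "smooth \<phi>" by (simp add: test_fun_def)
  have c: "compact (closure {x. \<phi> x \<noteq> 0})" "closure {x. \<phi> x \<noteq> 0} \<subseteq> \<Omega>"
    using t by (auto simp: test_fun_def)
  show "x \<in> \<Omega>" if "\<phi> x \<noteq> 0" for x using c(2) closure_subset[of "{x. \<phi> x \<noteq> 0}"] that by blast
  have "frontier \<Omega> \<inter> \<Omega> = {}" using open_\<Omega> by (auto simp: frontier_def interior_open)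
  then have "closure {x. \<phi> x \<noteq> 0} \<inter> frontier \<Omega> = {}" using c(2) by blast
  from separate_compact_closed[OF c(1) frontier_closed this]
  have "apart (closure {x. \<phi> x \<noteq> 0}) (frontier \<Omega>)" unfolding apart_def .
  then show "apart {x. \<phi> x \<noteq> 0} (frontier \<Omega>)" by (simp add: apart_closure_left)
next
  assume s: "smooth \<phi>" "{x. \<phi> x \<noteq> 0} \<subseteq> \<Omega>" "apart {x. \<phi> x \<noteq> 0} (frontier \<Omega>)"
  have "apart (closure {x. \<phi> x \<noteq> 0}) (frontier \<Omega>)" using s(3) by (simp add: apart_closure_left)
  then have "closure {x. \<phi> x \<noteq> 0} \<inter> frontier \<Omega> = {}" unfolding apart_def by fastforce
  moreover have "closure {x. \<phi> x \<noteq> 0} \<subseteq> closure \<Omega>" using s(2) by (rule closure_mono)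
  moreover have "closure \<Omega> = \<Omega> \<union> frontier \<Omega>"
    using open_\<Omega> by (simp add: closure_Un_frontier)
  ultimately have "closure {x. \<phi> x \<noteq> 0} \<subseteq> \<Omega>" by blast
  moreover have "compact (closure {x. \<phi> x \<noteq> 0})"
    using bounded_subset[OF bounded_\<Omega> s(2)] by simp
  ultimately show "\<phi> \<in> test_fun \<Omega>" using s(1) by (simp add: test_fun_def)
qed

lemma test_fun_smooth: "\<phi> \<in> test_fun \<Omega> \<Longrightarrow> smooth \<phi>"
  by (simp add: test_fun_def)

lemma test_fun_subset_Cinf0: "\<gamma> \<subseteq> frontier \<Omega> \<Longrightarrow> test_fun \<Omega> \<subseteq> Cinf0 \<gamma> \<Omega>"
  by (auto simp: test_fun_iff Cinf0_iff elim!: apart_mono)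

text \<open>The values of \<open>f\<close> outside \<Omega> are discarded. Around an outside point
  the extension vanishes on a ball of radius \<open>d\<close>, since the segment from a point of
  \<Omega> in this ball to the centre meets the frontier at a distance below
  \<open>d\<close>.\<close>

lemma zero_extension:
  assumes f: "smooth f" and a: "apart {x\<in>\<Omega>. f x \<noteq> 0} (frontier \<Omega>)"
  shows "smooth (\<lambda>x. if x \<in> \<Omega> then f x else 0)" (is "smooth ?g")
    and "pderiv3 i (\<lambda>x. if x \<in> \<Omega> then f x else 0) x = (if x \<in> \<Omega> then pderiv3 i f x else 0)"
proof -
  obtain d where d: "d > 0" "\<And>x y. x \<in> \<Omega> \<Longrightarrow> f x \<noteq> 0 \<Longrightarrow> y \<in> frontier \<Omega> \<Longrightarrow> d \<le> dist x y"
    using a unfolding apart_def by blast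
  have out: "?g y = 0" if x: "x \<notin> \<Omega>" and y: "y \<in> ball x d" for x y
  proof (cases "y \<in> \<Omega>")
    case True
    obtain z where "z \<in> frontier \<Omega>" "dist y z \<le> dist y x" using segment_meets_frontier[OF True x] by blast
    moreover have "dist y x < d" using y by (simp add: dist_commute)
    ultimately show ?thesis using d(2)[OF True] by force
  qed simp
  have loc: "\<exists>U g. open U \<and> x \<in> U \<and> smooth g \<and> (\<forall>y\<in>U. ?g y = g y)" for x
  proof (cases "x \<in> \<Omega>")
    case True
    then show ?thesis using open_\<Omega> f by (intro exI[of _ \<Omega>] exI[of _ f]) auto
  next
    case False
    then show ?thesis using d(1) out[OF False] by (intro exI[of _ "ball x d"] exI[of _ "\<lambda>x. 0"]) auto
  qed
  show "smooth ?g" by (rule smooth_local[OF loc])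
  show "pderiv3 i ?g x = (if x \<in> \<Omega> then pderiv3 i f x else 0)"
  proof (cases "x \<in> \<Omega>")
    case True
    then show ?thesis using pderiv3_cong_open(1)[OF open_\<Omega> True, of ?g f i] by simp
  next
    case False
    then show ?thesis
      using pderiv3_cong_open(1)[of "ball x d" x ?g "\<lambda>x. 0" i] out[OF False] d(1) by simp
  qed
qed

lemma zero_extension_bounded_support:
  "bounded_support (\<lambda>x. if x \<in> \<Omega> then f x else 0)"
proof -
  obtain R where "\<forall>x\<in>\<Omega>. norm x \<le> R" using bounded_\<Omega> bounded_iff by blast
  then show ?thesis unfolding bounded_support_def by (intro exI[of _ R]) force
qed

section \<open>Green's formulas for smooth functions\<close>

lemma integral_pderiv3_\<Omega>:
  assumes f: "smooth f" and a: "apart {x\<in>\<Omega>. f x \<noteq> 0} (frontier \<Omega>)"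
  shows "(\<integral>x. pderiv3 i f x \<partial>lebesgue_on \<Omega>) = 0"
proof -
  have "(\<integral>x. pderiv3 i f x \<partial>lebesgue_on \<Omega>) = (\<integral>x. (if x \<in> \<Omega> then pderiv3 i f x else 0) \<partial>lebesgue)"
    by (rule Lebesgue_Measure.integral_restrict_UNIV[OF sets_\<Omega>, symmetric])
  also have "\<dots> = (\<integral>x. pderiv3 i (\<lambda>x. if x \<in> \<Omega> then f x else 0) x \<partial>lebesgue)"
    unfolding zero_extension(2)[OF assms] ..
  also have "\<dots> = 0"
    by (rule integral_pderiv3_zero[OF zero_extension(1)[OF assms] zero_extension_bounded_support])
  finally show ?thesis .
qed

text \<open>Only the product has to vanish near the frontier, which allows the two factors to vanish
  near complementary parts of it.\<close>

lemma Green: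
  assumes f: "smooth f" "smooth g" and a: "apart {x\<in>\<Omega>. f x \<noteq> 0 \<and> g x \<noteq> 0} (frontier \<Omega>)"
  shows "L2_inner \<Omega> f (pderiv3 i g) = - L2_inner \<Omega> (pderiv3 i f) g"
proof -
  have "{x\<in>\<Omega>. f x * g x \<noteq> 0} = {x\<in>\<Omega>. f x \<noteq> 0 \<and> g x \<noteq> 0}" by auto
  then have "(\<integral>x. pderiv3 i (\<lambda>x. f x * g x) x \<partial>lebesgue_on \<Omega>) = 0"
    using a f by (intro integral_pderiv3_\<Omega>) (auto intro: smooth_mult)
  moreover have "pderiv3 i (\<lambda>x. f x * g x) x = f x * pderiv3 i g x + pderiv3 i f x * g x" for x
    using f by (intro pderiv3_mult smooth_differentiable)
  moreover have "integrable (lebesgue_on \<Omega>) (\<lambda>x. f x * pderiv3 i g x)"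
      "integrable (lebesgue_on \<Omega>) (\<lambda>x. pderiv3 i f x * g x)"
    using L2_inner_integrable[of f \<Omega> "pderiv3 i g"] L2_inner_integrable[of "pderiv3 i f" \<Omega> g] f
    by (auto simp: smooth_L2 smooth_pderiv3)
  ultimately show ?thesis by (simp add: L2_inner_def)
qed

lemma smooth_field_L2: "(\<And>i. smooth (\<lambda>x. \<Phi> x $ i)) \<Longrightarrow> \<Phi> \<in> L2 \<Omega>" for \<Phi> :: "real^3 \<Rightarrow> real^3"
  by (simp add: L2_vec_iff smooth_L2)

lemma smooth_curl: "(\<And>i. smooth (\<lambda>x. \<Phi> x $ i)) \<Longrightarrow> smooth (\<lambda>x. curl \<Phi> x $ i)"
proof -
  assume s: "\<And>i. smooth (\<lambda>x. \<Phi> x $ i)"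
  have "i = 1 \<or> i = 2 \<or> i = 3" using exhaust_3 by blast
  then show "smooth (\<lambda>x. curl \<Phi> x $ i)"
    by (auto simp: curl_def intro!: smooth_diff[OF smooth_pderiv3[OF s] smooth_pderiv3[OF s]])
qed

lemma smooth_div3: "(\<And>i. smooth (\<lambda>x. \<Phi> x $ i)) \<Longrightarrow> smooth (div3 \<Phi>)"
  unfolding div3_def by (intro smooth_sum smooth_pderiv3)

lemma grad_nth [simp]: "grad f x $ i = pderiv3 i f x"
  by (simp add: grad_def)

lemma smooth_grad_L2: "smooth f \<Longrightarrow> grad f \<in> L2 \<Omega>"
  by (simp add: L2_vec_iff smooth_L2 smooth_pderiv3)

lemma Green_div:
  assumes f: "smooth f" "\<And>i. smooth (\<lambda>x. \<Phi> x $ i)"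
    and a: "\<And>i. apart {x\<in>\<Omega>. f x \<noteq> 0 \<and> \<Phi> x $ i \<noteq> 0} (frontier \<Omega>)"
  shows "L2_inner \<Omega> f (div3 \<Phi>) = - L2_inner \<Omega> (grad f) \<Phi>"
proof -
  have "L2_inner \<Omega> f (div3 \<Phi>) = (\<Sum>i\<in>UNIV. L2_inner \<Omega> f (pderiv3 i (\<lambda>x. \<Phi> x $ i)))"
    unfolding L2_inner_def div3_def inner_sum_right
    using f by (intro Bochner_Integration.integral_sum L2_inner_integrable smooth_L2 smooth_pderiv3)
  also have "\<dots> = (\<Sum>i\<in>UNIV. - L2_inner \<Omega> (\<lambda>x. grad f x $ i) (\<lambda>x. \<Phi> x $ i))"
    using Green[OF f(1) f(2) a] by (intro sum.cong refl) simp
  also have "\<dots> = - L2_inner \<Omega> (grad f) \<Phi>"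
    using L2_inner_vec[OF smooth_grad_L2[OF f(1)] smooth_field_L2[OF f(2)]] by (simp add: sum_negf)
  finally show ?thesis .
qed

lemma Green_curl:
  assumes \<Phi>: "\<And>i. smooth (\<lambda>x. \<Phi> x $ i)" and \<Psi>: "\<And>i. smooth (\<lambda>x. \<Psi> x $ i)"
    and a: "\<And>i j. apart {x\<in>\<Omega>. \<Phi> x $ i \<noteq> 0 \<and> \<Psi> x $ j \<noteq> 0} (frontier \<Omega>)"
  shows "L2_inner \<Omega> \<Phi> (curl \<Psi>) = L2_inner \<Omega> (curl \<Phi>) \<Psi>"
proof -
  let ?I = "\<lambda>i j k. L2_inner \<Omega> (\<lambda>x. \<Phi> x $ i) (pderiv3 k (\<lambda>x. \<Psi> x $ j))"
  let ?J = "\<lambda>i j k. L2_inner \<Omega> (pderiv3 k (\<lambda>x. \<Phi> x $ i)) (\<lambda>x. \<Psi> x $ j)"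
  have IJ: "?I i j k = - ?J i j k" for i j k by (rule Green[OF \<Phi> \<Psi> a])
  have cL: "curl \<Phi> \<in> L2 \<Omega>" "curl \<Psi> \<in> L2 \<Omega>"
    using smooth_curl[OF \<Phi>] smooth_curl[OF \<Psi>] smooth_field_L2 by blast+
  have pL: "pderiv3 k (\<lambda>x. \<Phi> x $ i) \<in> L2 \<Omega>" "pderiv3 k (\<lambda>x. \<Psi> x $ i) \<in> L2 \<Omega>"
      "(\<lambda>x. \<Phi> x $ i) \<in> L2 \<Omega>" "(\<lambda>x. \<Psi> x $ i) \<in> L2 \<Omega>" for i k
    by (intro smooth_L2 smooth_pderiv3 \<Phi> \<Psi>)+
  have "L2_inner \<Omega> \<Phi> (curl \<Psi>) = (?I 1 3 2 - ?I 1 2 3) + (?I 2 1 3 - ?I 2 3 1) + (?I 3 2 1 - ?I 3 1 2)"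
    unfolding L2_inner_vec[OF smooth_field_L2[OF \<Phi>] cL(2)] sum_3
    by (simp add: curl_def L2_inner_diff_right pL)
  moreover have "L2_inner \<Omega> (curl \<Phi>) \<Psi> = (?J 3 1 2 - ?J 2 1 3) + (?J 1 2 3 - ?J 3 2 1) + (?J 2 3 1 - ?J 1 3 2)"
    unfolding L2_inner_vec[OF cL(1) smooth_field_L2[OF \<Psi>]] sum_3
    by (simp add: curl_def L2_inner_diff_left pL)
  ultimately show ?thesis by (simp add: IJ)
qed

section \<open>Density of test functions and uniqueness of weak derivatives\<close>

lemma L2_zero_extension:
  assumes "u \<in> L2 \<Omega>"
  shows "(\<lambda>x. if x \<in> \<Omega> then u x else 0) \<in> L2 UNIV"
proof -
  have "(\<lambda>x. if x \<in> \<Omega> then u x else 0) \<in> borel_measurable lebesgue"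
    by (rule borel_measurable_if_I[OF L2_measurable[OF assms] sets_\<Omega>])
  moreover have "integrable lebesgue (\<lambda>x. if x \<in> \<Omega> then (norm (u x))\<^sup>2 else 0)"
    by (rule Lebesgue_Measure.integrable_restrict_UNIV[OF sets_\<Omega>, THEN iffD2, OF L2_integrable_sq[OF assms]])
  then have "integrable lebesgue (\<lambda>x. (norm (if x \<in> \<Omega> then u x else 0))\<^sup>2)"
    by (rule Bochner_Integration.integrable_cong[THEN iffD1, OF refl, rotated]) auto
  ultimately show ?thesis by (simp add: L2_def lebesgue_on_UNIV_eq)
qed

lemma L2_UNIV_restrict:
  assumes "f \<in> L2 UNIV"
  shows "f \<in> L2 \<Omega>" "L2_norm \<Omega> f \<le> L2_norm UNIV f"
proof -
  have fm: "f \<in> borel_measurable lebesgue" and fi: "integrable lebesgue (\<lambda>x. (norm (f x))\<^sup>2)"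
    using assms by (auto simp: L2_def lebesgue_on_UNIV_eq)
  have i: "integrable lebesgue (\<lambda>x. if x \<in> \<Omega> then (norm (f x))\<^sup>2 else 0)"
  proof (rule Bochner_Integration.integrable_bound[OF fi])
    show "(\<lambda>x. if x \<in> \<Omega> then (norm (f x))\<^sup>2 else 0) \<in> borel_measurable lebesgue"
    proof (rule borel_measurable_if_I[OF measurable_restrict_space1 sets_\<Omega>])
      show "(\<lambda>x. (norm (f x))\<^sup>2) \<in> borel_measurable lebesgue" using fm by auto
    qed
  qed auto
  show "f \<in> L2 \<Omega>"
    unfolding L2_def mem_Collect_eq
    by (intro conjI measurable_restrict_space1[OF fm] Lebesgue_Measure.integrable_restrict_UNIV[OF sets_\<Omega>, THEN iffD1, OF i])
  have "(L2_norm \<Omega> f)\<^sup>2 = (\<integral>x. (if x \<in> \<Omega> then (norm (f x))\<^sup>2 else 0) \<partial>lebesgue)"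
    unfolding L2_norm_sq by (rule Lebesgue_Measure.integral_restrict_UNIV[OF sets_\<Omega>, symmetric])
  also have "\<dots> \<le> (\<integral>x. (norm (f x))\<^sup>2 \<partial>lebesgue)"
    by (rule integral_mono[OF i fi]) auto
  finally show "L2_norm \<Omega> f \<le> L2_norm UNIV f"
    unfolding L2_norm_sq[of UNIV, unfolded lebesgue_on_UNIV_eq, symmetric] by (rule power2_le_imp_le) simp
qed

text \<open>\<open>C n\<close> is the part of \<Omega> at distance at least 1/(n+1) from the
  frontier. Restricting \<open>w\<close> to it costs little for large \<open>n\<close>, and a
  mollifier of radius at most half this distance keeps the support away from the frontier.\<close>

lemma test_fun_dense:
  assumes w: "w \<in> L2 \<Omega>" and "e > 0"
  shows "\<exists>\<phi>\<in>test_fun \<Omega>. L2_norm \<Omega> (\<lambda>x. w x - \<phi> x) < e"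
proof -
  define C where "C n = \<Omega> \<inter> (\<Inter>y\<in>frontier \<Omega>. {x. inverse (real (Suc n)) \<le> dist x y})" for n :: nat
  have Cs: "C n \<in> sets lebesgue" for n
  proof -
    have "closed (\<Inter>y\<in>frontier \<Omega>. {x. inverse (real (Suc n)) \<le> dist x y})"
      by (intro closed_INT ballI closed_Collect_le continuous_intros)
    then show ?thesis unfolding C_def using sets_\<Omega> by (intro sets.Int) auto
  qed
  define v where "v n x = (if x \<in> C n then w x else 0)" for n x
  have vm: "v n \<in> borel_measurable (lebesgue_on \<Omega>)" for n
  proof -
    have "(\<lambda>x. indicat_real (C n) x * w x) \<in> borel_measurable (lebesgue_on \<Omega>)"
      by (intro borel_measurable_times L2_measurable[OF w] measurable_restrict_space1 borel_measurable_indicator Cs)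
    moreover have "(\<lambda>x. indicat_real (C n) x * w x) = v n" by (auto simp: v_def indicator_def)
    ultimately show ?thesis by simp
  qed
  have "(\<lambda>n. L2_norm \<Omega> (\<lambda>x. w x - v n x)) \<longlonglongrightarrow> 0"
  proof (rule L2_dominated[OF _ w])
    show "(\<lambda>x. w x - v n x) \<in> borel_measurable (lebesgue_on \<Omega>)" for n
      using vm L2_measurable[OF w] by auto
    show "AE x in lebesgue_on \<Omega>. (\<lambda>n. w x - v n x) \<longlonglongrightarrow> 0"
    proof (rule AE_I2)
      fix x assume "x \<in> space (lebesgue_on \<Omega>)"
      then have x: "x \<in> \<Omega>" by simp
      then obtain r where r: "r > 0" "ball x r \<subseteq> \<Omega>" using open_\<Omega> open_contains_ball by blast
      obtain N where N: "inverse (real (Suc N)) < r" using reals_Archimedean[OF r(1)] by blast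
      have fr: "r \<le> dist x y" if "y \<in> frontier \<Omega>" for y
      proof (rule ccontr)
        assume "\<not> r \<le> dist x y"
        then have "y \<in> \<Omega>" using r by auto
        then show False using that open_\<Omega> by (simp add: frontier_def interior_open)
      qed
      have "eventually (\<lambda>n. w x - v n x = 0) sequentially"
        unfolding eventually_sequentially
      proof (intro exI allI impI)
        fix n assume "N \<le> n"
        then have "inverse (real (Suc n)) \<le> inverse (real (Suc N))" by (intro le_imp_inverse_le) auto
        then have "inverse (real (Suc n)) \<le> dist x y" if "y \<in> frontier \<Omega>" for y
          using fr[OF that] N by linarith
        then have "x \<in> C n" using x unfolding C_def by blast
        then show "w x - v n x = 0" by (simp add: v_def)
      qed
      then show "(\<lambda>n. w x - v n x) \<longlonglongrightarrow> 0" by (rule tendsto_eventually)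
    qed
  qed (auto simp: v_def)
  then obtain n where n: "L2_norm \<Omega> (\<lambda>x. w x - v n x) < e / 2"
    using order_tendstoD(2)[of _ 0 sequentially "e/2"] \<open>e > 0\<close> by (auto simp: eventually_sequentially)
  have vL\<Omega>: "v n \<in> L2 \<Omega>"
    by (rule L2_bounded_by(1)[OF vm w, of _ 1]) (auto simp: v_def)
  have veq: "(\<lambda>x. if x \<in> \<Omega> then v n x else 0) = v n" by (auto simp: v_def C_def)
  have vL: "v n \<in> L2 UNIV" using L2_zero_extension[OF vL\<Omega>] unfolding veq .
  have vb: "bounded_support (v n)" using zero_extension_bounded_support[of "v n"] unfolding veq .
  obtain d where d: "d > 0" "\<And>K. mollifier K d \<Longrightarrow> L2_norm UNIV (\<lambda>x. conv K (v n) x - v n x) < e / 2"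
    using conv_approx[OF vL vb, of "e / 2"] \<open>e > 0\<close> by auto
  define r where "r = min d (inverse (real (Suc n)) / 2)"
  have "r > 0" using d by (simp add: r_def)
  obtain K where K: "mollifier K (norm (0::real^3) + r)" using ex_mollifier[OF \<open>r > 0\<close>, of 0] by blast
  have Kd: "mollifier K d" using K by (auto simp: mollifier_def r_def)
  have vi: "integrable lebesgue (v n)" by (rule bounded_support_L2_integrable[OF vb vL])
  have near: "\<exists>y\<in>C n. dist y x < r" if "conv K (v n) x \<noteq> 0" for x
  proof (rule ccontr)
    assume "\<not> ?thesis"
    then have far: "\<not> norm (x - y) < r" if "y \<in> C n" for y
      using that by (auto simp: dist_norm norm_minus_commute[of x])
    have "K (x - y) * v n y = 0" for y
      using K far[of y] by (cases "y \<in> C n") (auto simp: v_def mollifier_def)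
    then have "conv K (v n) x = 0" unfolding conv_def by (simp only: Bochner_Integration.integral_zero)
    with that show False by simp
  qed
  have "conv K (v n) \<in> test_fun \<Omega>"
    unfolding test_fun_iff
  proof (intro conjI)
    show "smooth (conv K (v n))"
      by (rule smooth_conv[OF mollifier_smooth[OF K] mollifier_bounded_support[OF K] vi])
    show "{x. conv K (v n) x \<noteq> 0} \<subseteq> \<Omega>"
    proof (safe, rule ccontr)
      fix x assume x: "conv K (v n) x \<noteq> 0" "x \<notin> \<Omega>"
      obtain y where y: "y \<in> C n" "dist y x < r" using near[OF x(1)] by blast
      obtain z where "z \<in> frontier \<Omega>" "dist y z \<le> dist y x"
        using segment_meets_frontier[OF _ x(2)] y by (auto simp: C_def)
      then have "inverse (real (Suc n)) < r" using y unfolding C_def by fastforce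
      then have "inverse (real (Suc n)) < inverse (real (Suc n)) / 2" by (simp add: r_def)
      moreover have "inverse (real (Suc n)) > 0" by simp
      ultimately show False by linarith
    qed
    show "apart {x. conv K (v n) x \<noteq> 0} (frontier \<Omega>)"
      unfolding apart_def
    proof (intro exI conjI ballI)
      show "0 < inverse (real (Suc n)) / 2" by simp
      fix x z assume x: "x \<in> {x. conv K (v n) x \<noteq> 0}" and z: "z \<in> frontier \<Omega>"
      obtain y where y: "y \<in> C n" "dist y x < r" using near x by blast
      have "inverse (real (Suc n)) \<le> dist y z" using y z by (auto simp: C_def)
      also have "\<dots> \<le> dist y x + dist x z" by (rule dist_triangle)
      finally have "inverse (real (Suc n)) - r \<le> dist x z" using y by linarith
      moreover have "r \<le> inverse (real (Suc n)) / 2" by (simp add: r_def)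
      ultimately show "inverse (real (Suc n)) / 2 \<le> dist x z" by linarith
    qed
  qed
  moreover have "L2_norm \<Omega> (\<lambda>x. w x - conv K (v n) x) < e"
  proof -
    have cL: "conv K (v n) \<in> L2 UNIV" by (rule mollifier_conv_contraction(1)[OF K vi vL])
    have "L2_norm \<Omega> (\<lambda>x. w x - conv K (v n) x)
        \<le> L2_norm \<Omega> (\<lambda>x. w x - v n x) + L2_norm \<Omega> (\<lambda>x. v n x - conv K (v n) x)"
      by (rule L2_norm_triangle_diff[OF w vL\<Omega> L2_UNIV_restrict(1)[OF cL]])
    moreover have "L2_norm \<Omega> (\<lambda>x. v n x - conv K (v n) x) \<le> L2_norm UNIV (\<lambda>x. v n x - conv K (v n) x)"
      by (rule L2_UNIV_restrict(2)[OF L2_diff[OF vL cL]])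
    ultimately show ?thesis using n d(2)[OF Kd] L2_norm_diff_commute[of UNIV "v n" "conv K (v n)"] by linarith
  qed
  ultimately show ?thesis by blast
qed

text \<open>Density provides a test function closer to \<open>w\<close> than the norm of
  \<open>w\<close>; orthogonality to it then contradicts Cauchy-Schwarz.\<close>

lemma weak_zero_scalar:
  assumes w: "w \<in> L2 \<Omega>" and "\<And>\<phi>. \<phi> \<in> test_fun \<Omega> \<Longrightarrow> L2_inner \<Omega> w \<phi> = 0"
  shows "L2_norm \<Omega> w = 0"
proof (rule ccontr)
  assume "L2_norm \<Omega> w \<noteq> 0"
  then have pos: "L2_norm \<Omega> w > 0" using L2_norm_nonneg[of \<Omega> w] by linarith
  obtain \<phi> where \<phi>: "\<phi> \<in> test_fun \<Omega>" "L2_norm \<Omega> (\<lambda>x. w x - \<phi> x) < L2_norm \<Omega> w"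
    using test_fun_dense[OF w pos] by blast
  have \<phi>L: "\<phi> \<in> L2 \<Omega>" using \<phi> by (intro smooth_L2 test_fun_smooth)
  have "(L2_norm \<Omega> w)\<^sup>2 = L2_inner \<Omega> w (\<lambda>x. w x - \<phi> x)"
    using assms(2)[OF \<phi>(1)] by (simp add: L2_norm_sq_inner L2_inner_diff_right w \<phi>L)
  also have "\<dots> \<le> L2_norm \<Omega> w * L2_norm \<Omega> (\<lambda>x. w x - \<phi> x)"
    using L2_Cauchy_Schwarz[OF w L2_diff[OF w \<phi>L]] by linarith
  also have "\<dots> < L2_norm \<Omega> w * L2_norm \<Omega> w" using \<phi>(2) pos by (rule mult_strict_left_mono)
  finally show False by (simp add: power2_eq_square)
qed

lemma test_fun_zero [simp]: "(\<lambda>x. 0) \<in> test_fun \<Omega>"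
  by (auto simp: test_fun_iff apart_def intro: exI[of _ 1])

lemma axis_nth_fun: "(\<lambda>x. axis i (\<phi> x) $ j) = (if j = i then \<phi> else (\<lambda>x. 0))"
  by (auto simp: axis_def)

lemma L2_inner_axis: "L2_inner \<Omega> G (\<lambda>x. axis i (\<phi> x)) = L2_inner \<Omega> (\<lambda>x. G x $ i) \<phi>" for G :: "real^3 \<Rightarrow> real^3"
  by (simp add: L2_inner_def inner_axis)

lemma weak_zero_field:
  fixes w :: "real^3 \<Rightarrow> real^3"
  assumes w: "w \<in> L2 \<Omega>" and "\<And>\<Phi>. \<Phi> \<in> test_field \<Omega> \<Longrightarrow> L2_inner \<Omega> w \<Phi> = 0"
  shows "L2_norm \<Omega> w = 0"
proof -
  have "L2_norm \<Omega> (\<lambda>x. w x $ i) = 0" for i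
  proof (rule weak_zero_scalar)
    show "(\<lambda>x. w x $ i) \<in> L2 \<Omega>" using w by (simp add: L2_vec_iff)
    fix \<phi> assume "\<phi> \<in> test_fun \<Omega>"
    then have "(\<lambda>x. axis i (\<phi> x)) \<in> test_field \<Omega>"
      by (simp add: test_field_def axis_nth_fun)
    from assms(2)[OF this] show "L2_inner \<Omega> (\<lambda>x. w x $ i) \<phi> = 0" by (simp add: L2_inner_axis)
  qed
  then show ?thesis using L2_norm_vec_sq[OF w] by simp
qed

end

section \<open>Strong approximation near a boundary point\<close>

text \<open>The test class is a parameter because it encodes the boundary condition: if the
  functions in \<open>T\<close> have to vanish only near one part of the boundary, the identity also
  says that \<open>u\<close> has zero trace, in the weak sense, on the remaining part.\<close>

definition weak_grad_on ::
    "(real^3 \<Rightarrow> real) set \<Rightarrow> (real^3) set \<Rightarrow> (real^3 \<Rightarrow> real) \<Rightarrow> (real^3 \<Rightarrow> real^3) \<Rightarrow> bool" where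
  "weak_grad_on T \<Omega> u G \<longleftrightarrow> u \<in> L2 \<Omega> \<and> G \<in> L2 \<Omega> \<and>
     (\<forall>i. \<forall>\<phi>\<in>T. L2_inner \<Omega> u (pderiv3 i \<phi>) = - L2_inner \<Omega> (\<lambda>x. G x $ i) \<phi>)"

text \<open>The gradient is carried as an explicit second component, so that closures are taken of
  pairs and the choice in \<open>weak_grad\<close> stays out of the estimates.\<close>

definition strong_grad ::
    "(real^3) set \<Rightarrow> (real^3) set \<Rightarrow> (real^3 \<Rightarrow> real) \<Rightarrow> (real^3 \<Rightarrow> real^3) \<Rightarrow> bool" where
  "strong_grad \<gamma> \<Omega> u G \<longleftrightarrow> u \<in> L2 \<Omega> \<and> G \<in> L2 \<Omega> \<and>
     (\<forall>e>0. \<exists>\<phi>\<in>Cinf0 \<gamma> \<Omega>. L2_norm \<Omega> (\<lambda>x. u x - \<phi> x) < e \<and> L2_norm \<Omega> (\<lambda>x. G x - grad \<phi> x) < e)"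

lemma strong_grad_cong:
  assumes "\<And>x. x \<in> \<Omega> \<Longrightarrow> u x = v x" "\<And>x. x \<in> \<Omega> \<Longrightarrow> G x = H x"
  shows "strong_grad \<gamma> \<Omega> u G \<longleftrightarrow> strong_grad \<gamma> \<Omega> v H"
proof -
  have "L2_norm \<Omega> (\<lambda>x. u x - \<phi> x) = L2_norm \<Omega> (\<lambda>x. v x - \<phi> x)"
    "L2_norm \<Omega> (\<lambda>x. G x - grad \<phi> x) = L2_norm \<Omega> (\<lambda>x. H x - grad \<phi> x)" for \<phi>
    by (rule L2_cong(2), simp add: assms)+
  then show ?thesis
    unfolding strong_grad_def using L2_cong(1)[of \<Omega> u v] L2_cong(1)[of \<Omega> G H] assms by simp
qed

text \<open>\<open>h\<close> is the signed height \<open>Q x $ 3 - g (Q x $ 1, Q x $ 2)\<close> over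
  the boundary graph and \<open>e\<close> its vertical direction. A translation along
  \<open>e\<close> changes the height by exactly its length, any other perturbation by at most
  \<Lambda> = 1 + 2L times its size. The local shifts use nothing else of the chart.\<close>

lemma lipschitz_boundary_height:
  assumes "lipschitz_boundary \<Omega>" "p \<in> frontier \<Omega>"
  shows "\<exists>N h (e::real^3) \<Lambda>. open N \<and> p \<in> N \<and> norm e = 1 \<and> \<Lambda> > 0 \<and>
    (\<forall>x y. \<bar>h x - h y\<bar> \<le> \<Lambda> * dist x y) \<and> (\<forall>x s. h (x + s *\<^sub>R e) = h x + s) \<and>
    (\<forall>x\<in>N. (x \<in> \<Omega> \<longleftrightarrow> h x < (0::real)) \<and> (x \<in> frontier \<Omega> \<longleftrightarrow> h x = 0))"
proof -
  from bspec[OF assms(1)[unfolded lipschitz_boundary_def] assms(2)]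
  obtain N L and Q :: "real^3 \<Rightarrow> real^3" and g :: "real \<times> real \<Rightarrow> real"
    where *: "open N \<and> p \<in> N \<and> orthogonal_transformation Q \<and> L-lipschitz_on UNIV g \<and>
        (\<forall>x\<in>N. (x \<in> \<Omega> \<longleftrightarrow> Q x $ 3 < g (Q x $ 1, Q x $ 2)) \<and>
               (x \<in> frontier \<Omega> \<longleftrightarrow> Q x $ 3 = g (Q x $ 1, Q x $ 2)))"
    by (elim exE)
  then have N: "open N" "p \<in> N" and Q: "orthogonal_transformation Q" and g: "L-lipschitz_on UNIV g"
    by simp_all
  have iff: "(x \<in> \<Omega> \<longleftrightarrow> Q x $ 3 < g (Q x $ 1, Q x $ 2)) \<and>
      (x \<in> frontier \<Omega> \<longleftrightarrow> Q x $ 3 = g (Q x $ 1, Q x $ 2))" if "x \<in> N" for x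
    using * that by simp
  have lin: "linear Q" using Q by (rule orthogonal_transformation_linear)
  have L: "0 \<le> L" using g by (rule lipschitz_on_nonneg)
  obtain e where e: "Q e = axis 3 1"
    using orthogonal_transformation_surj[OF Q] by (metis surjD)
  have "norm e = 1" using orthogonal_transformation_norm[OF Q, of e] by (simp add: e)
  define h where "h x = Q x $ 3 - g (Q x $ 1, Q x $ 2)" for x
  have "h (x + s *\<^sub>R e) = h x + s" for x s
    by (simp add: h_def linear_add[OF lin] linear_scale[OF lin] e axis_def)
  moreover have "\<bar>h x - h y\<bar> \<le> (1 + 2 * L) * dist x y" for x y
  proof -
    have c: "\<bar>Q x $ i - Q y $ i\<bar> \<le> dist x y" for i
      using component_le_norm_cart[of "Q (x - y)" i] orthogonal_transformation_norm[OF Q, of "x - y"]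
      by (simp add: linear_diff[OF lin] dist_norm)
    have "\<bar>g (Q x $ 1, Q x $ 2) - g (Q y $ 1, Q y $ 2)\<bar> \<le> L * dist (Q x $ 1, Q x $ 2) (Q y $ 1, Q y $ 2)"
      using lipschitz_onD[OF g, of "(Q x $ 1, Q x $ 2)" "(Q y $ 1, Q y $ 2)"] by (simp add: dist_real_def)
    also have "dist (Q x $ 1, Q x $ 2) (Q y $ 1, Q y $ 2) \<le> 2 * dist x y"
      using c[of 1] c[of 2] sqrt_sum_squares_le_sum_abs[of "Q x $ 1 - Q y $ 1" "Q x $ 2 - Q y $ 2"]
      by (simp add: dist_Pair_Pair dist_real_def)
    finally have "\<bar>g (Q x $ 1, Q x $ 2) - g (Q y $ 1, Q y $ 2)\<bar> \<le> L * (2 * dist x y)"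
      using L by (simp add: mult_left_mono)
    then show ?thesis using c[of 3] unfolding h_def by (simp add: algebra_simps)
  qed
  moreover have "(x \<in> \<Omega> \<longleftrightarrow> h x < 0) \<and> (x \<in> frontier \<Omega> \<longleftrightarrow> h x = 0)" if "x \<in> N" for x
    using iff[OF that] by (auto simp: h_def)
  ultimately show ?thesis
    using N \<open>norm e = 1\<close> L by (intro exI[of _ N] exI[of _ h] exI[of _ e] exI[of _ "1 + 2 * L"]) auto
qed

context bounded_open_set
begin

lemma Cinf0_L2: "\<phi> \<in> Cinf0 \<gamma> \<Omega> \<Longrightarrow> \<phi> \<in> L2 \<Omega>"
  by (simp add: smooth_L2 Cinf0_smooth)

lemma Cinf0_grad_L2: "\<phi> \<in> Cinf0 \<gamma> \<Omega> \<Longrightarrow> grad \<phi> \<in> L2 \<Omega>"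
  by (simp add: smooth_grad_L2 Cinf0_smooth)

lemma grad_add: "smooth f \<Longrightarrow> smooth g \<Longrightarrow> grad (\<lambda>x. f x + g x) x = grad f x + grad g x"
  by (simp add: vec_eq_iff pderiv3_add smooth_differentiable)

lemma grad_mult: "smooth f \<Longrightarrow> smooth g \<Longrightarrow> grad (\<lambda>x. f x * g x) x = f x *\<^sub>R grad g x + g x *\<^sub>R grad f x"
  by (simp add: vec_eq_iff pderiv3_mult smooth_differentiable)

lemma smooth_mult_L2:
  fixes f :: "real^3 \<Rightarrow> 'b::euclidean_space"
  assumes "smooth \<zeta>" "f \<in> L2 \<Omega>" shows "(\<lambda>x. \<zeta> x *\<^sub>R f x) \<in> L2 \<Omega>"
proof -
  obtain B where "B > 0" "\<forall>x\<in>\<Omega>. norm (\<zeta> x) \<le> B"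
    using continuous_bounded_on_bounded[OF smooth_continuous[OF assms(1)] bounded_\<Omega>] by blast
  then show ?thesis
    by (intro L2_mult_bounded(1)[OF assms(2) smooth_measurable[OF assms(1)], of B]) auto
qed

lemma strong_grad_smooth:
  assumes "\<phi> \<in> Cinf0 \<gamma> \<Omega>" shows "strong_grad \<gamma> \<Omega> \<phi> (grad \<phi>)"
  unfolding strong_grad_def using assms
  by (auto simp: Cinf0_L2 Cinf0_grad_L2 intro!: bexI[of _ \<phi>])

lemma strong_grad_add:
  assumes u: "strong_grad \<gamma> \<Omega> u G" and v: "strong_grad \<gamma> \<Omega> v H"
  shows "strong_grad \<gamma> \<Omega> (\<lambda>x. u x + v x) (\<lambda>x. G x + H x)"
proof -
  have L: "u \<in> L2 \<Omega>" "G \<in> L2 \<Omega>" "v \<in> L2 \<Omega>" "H \<in> L2 \<Omega>" using u v by (auto simp: strong_grad_def)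
  have "\<exists>\<phi>\<in>Cinf0 \<gamma> \<Omega>. L2_norm \<Omega> (\<lambda>x. (u x + v x) - \<phi> x) < e \<and> L2_norm \<Omega> (\<lambda>x. (G x + H x) - grad \<phi> x) < e"
    if "e > 0" for e
  proof -
    have e2: "e / 2 > 0" using that by simp
    obtain \<phi> where \<phi>: "\<phi> \<in> Cinf0 \<gamma> \<Omega>" "L2_norm \<Omega> (\<lambda>x. u x - \<phi> x) < e/2" "L2_norm \<Omega> (\<lambda>x. G x - grad \<phi> x) < e/2"
      using u e2 unfolding strong_grad_def by blast
    obtain \<psi> where \<psi>: "\<psi> \<in> Cinf0 \<gamma> \<Omega>" "L2_norm \<Omega> (\<lambda>x. v x - \<psi> x) < e/2" "L2_norm \<Omega> (\<lambda>x. H x - grad \<psi> x) < e/2"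
      using v e2 unfolding strong_grad_def by blast
    note sL = Cinf0_L2[OF \<phi>(1)] Cinf0_L2[OF \<psi>(1)] Cinf0_grad_L2[OF \<phi>(1)] Cinf0_grad_L2[OF \<psi>(1)]
    have "L2_norm \<Omega> (\<lambda>x. (u x + v x) - (\<phi> x + \<psi> x)) < e"
      using L2_norm_triangle[OF L2_diff[OF L(1) sL(1)] L2_diff[OF L(3) sL(2)]] \<phi> \<psi>
      by (simp add: algebra_simps)
    moreover have "L2_norm \<Omega> (\<lambda>x. (G x + H x) - grad (\<lambda>x. \<phi> x + \<psi> x) x) < e"
      using L2_norm_triangle[OF L2_diff[OF L(2) sL(3)] L2_diff[OF L(4) sL(4)]] \<phi> \<psi>
      by (simp add: algebra_simps grad_add Cinf0_smooth)
    ultimately show ?thesis using Cinf0_add[OF \<phi>(1) \<psi>(1)] by (intro bexI[of _ "\<lambda>x. \<phi> x + \<psi> x"]) auto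
  qed
  with L show ?thesis by (auto simp: strong_grad_def L2_add)
qed

lemma strong_grad_closed:
  assumes L: "u \<in> L2 \<Omega>" "G \<in> L2 \<Omega>"
    and ap: "\<And>e. e > 0 \<Longrightarrow> \<exists>v H. strong_grad \<gamma> \<Omega> v H \<and> L2_norm \<Omega> (\<lambda>x. u x - v x) < e \<and> L2_norm \<Omega> (\<lambda>x. G x - H x) < e"
  shows "strong_grad \<gamma> \<Omega> u G"
  unfolding strong_grad_def
proof (intro conjI L allI impI)
  fix e :: real assume "e > 0"
  then have e2: "e / 2 > 0" by simp
  obtain v H where v: "strong_grad \<gamma> \<Omega> v H" "L2_norm \<Omega> (\<lambda>x. u x - v x) < e/2" "L2_norm \<Omega> (\<lambda>x. G x - H x) < e/2"
    using ap[OF e2] by blast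
  have vL: "v \<in> L2 \<Omega>" "H \<in> L2 \<Omega>" using v by (auto simp: strong_grad_def)
  obtain \<phi> where \<phi>: "\<phi> \<in> Cinf0 \<gamma> \<Omega>" "L2_norm \<Omega> (\<lambda>x. v x - \<phi> x) < e/2" "L2_norm \<Omega> (\<lambda>x. H x - grad \<phi> x) < e/2"
    using v(1) e2 unfolding strong_grad_def by blast
  have "L2_norm \<Omega> (\<lambda>x. u x - \<phi> x) < e"
    using L2_norm_triangle_diff[OF L(1) vL(1) Cinf0_L2[OF \<phi>(1)]] v \<phi> by linarith
  moreover have "L2_norm \<Omega> (\<lambda>x. G x - grad \<phi> x) < e"
    using L2_norm_triangle_diff[OF L(2) vL(2) Cinf0_grad_L2[OF \<phi>(1)]] v \<phi> by linarith
  ultimately show "\<exists>\<phi>\<in>Cinf0 \<gamma> \<Omega>. L2_norm \<Omega> (\<lambda>x. u x - \<phi> x) < e \<and> L2_norm \<Omega> (\<lambda>x. G x - grad \<phi> x) < e"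
    using \<phi>(1) by blast
qed

lemma weak_grad_on_field_iff:
  assumes T: "\<And>\<phi>. \<phi> \<in> T \<Longrightarrow> smooth \<phi>" "(\<lambda>x. 0) \<in> T" and L: "u \<in> L2 \<Omega>" "G \<in> L2 \<Omega>"
  shows "(\<forall>\<Phi>. (\<forall>i. (\<lambda>x. \<Phi> x $ i) \<in> T) \<longrightarrow> L2_inner \<Omega> u (div3 \<Phi>) = - L2_inner \<Omega> G \<Phi>)
    \<longleftrightarrow> weak_grad_on T \<Omega> u G"
proof
  assume F: "\<forall>\<Phi>. (\<forall>i. (\<lambda>x. \<Phi> x $ i) \<in> T) \<longrightarrow> L2_inner \<Omega> u (div3 \<Phi>) = - L2_inner \<Omega> G \<Phi>"
  have "L2_inner \<Omega> u (pderiv3 i \<phi>) = - L2_inner \<Omega> (\<lambda>x. G x $ i) \<phi>" if "\<phi> \<in> T" for i \<phi>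
  proof -
    have "\<forall>j. (\<lambda>x. axis i (\<phi> x) $ j) \<in> T" using T that by (simp add: axis_nth_fun)
    then have "L2_inner \<Omega> u (div3 (\<lambda>x. axis i (\<phi> x))) = - L2_inner \<Omega> G (\<lambda>x. axis i (\<phi> x))"
      by (rule F[THEN spec, THEN mp])
    moreover have "div3 (\<lambda>x. axis i (\<phi> x)) = pderiv3 i \<phi>"
    proof
      fix x
      have "div3 (\<lambda>x. axis i (\<phi> x)) x = (\<Sum>j\<in>UNIV. if j = i then pderiv3 i \<phi> x else 0)"
        unfolding div3_def by (intro sum.cong refl) (auto simp: axis_nth_fun)
      then show "div3 (\<lambda>x. axis i (\<phi> x)) x = pderiv3 i \<phi> x" by simp
    qed
    ultimately show ?thesis by (simp add: L2_inner_axis)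
  qed
  with L show "weak_grad_on T \<Omega> u G" by (simp add: weak_grad_on_def)
next
  assume W: "weak_grad_on T \<Omega> u G"
  show "\<forall>\<Phi>. (\<forall>i. (\<lambda>x. \<Phi> x $ i) \<in> T) \<longrightarrow> L2_inner \<Omega> u (div3 \<Phi>) = - L2_inner \<Omega> G \<Phi>"
  proof (intro allI impI)
    fix \<Phi> :: "real^3 \<Rightarrow> real^3" assume \<Phi>: "\<forall>i. (\<lambda>x. \<Phi> x $ i) \<in> T"
    have s: "smooth (\<lambda>x. \<Phi> x $ i)" for i using \<Phi> T by blast
    have "L2_inner \<Omega> u (div3 \<Phi>) = (\<Sum>i\<in>UNIV. L2_inner \<Omega> u (pderiv3 i (\<lambda>x. \<Phi> x $ i)))"
      unfolding L2_inner_def div3_def inner_sum_right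
      by (intro Bochner_Integration.integral_sum L2_inner_integrable smooth_L2 smooth_pderiv3 s L(1))
    also have "\<dots> = (\<Sum>i\<in>UNIV. - L2_inner \<Omega> (\<lambda>x. G x $ i) (\<lambda>x. \<Phi> x $ i))"
      using W \<Phi> by (intro sum.cong refl) (simp add: weak_grad_on_def)
    also have "\<dots> = - L2_inner \<Omega> G \<Phi>"
      using L2_inner_vec[OF L(2) smooth_field_L2[OF s]] by (simp add: sum_negf)
    finally show "L2_inner \<Omega> u (div3 \<Phi>) = - L2_inner \<Omega> G \<Phi>" .
  qed
qed

lemma conv_zero_extension:
  "conv K (\<lambda>y. if y \<in> \<Omega> then f y else 0) x = L2_inner \<Omega> f (\<lambda>y. K (x - y))"
proof -
  have "conv K (\<lambda>y. if y \<in> \<Omega> then f y else 0) x = (\<integral>y. (if y \<in> \<Omega> then f y * K (x - y) else 0) \<partial>lebesgue)"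
    unfolding conv_def by (rule Bochner_Integration.integral_cong) auto
  also have "\<dots> = L2_inner \<Omega> f (\<lambda>y. K (x - y))"
    unfolding L2_inner_def by (subst Lebesgue_Measure.integral_restrict_UNIV[OF sets_\<Omega>]) simp
  finally show ?thesis .
qed

lemma conv_zero_extension_nonzero:
  assumes "conv K (\<lambda>y. if y \<in> \<Omega> then f y else 0) x \<noteq> 0"
  shows "\<exists>y\<in>\<Omega>. f y \<noteq> 0 \<and> K (x - y) \<noteq> 0"
proof (rule ccontr)
  assume "\<not> ?thesis"
  then have "K (x - y) * (if y \<in> \<Omega> then f y else 0) = 0" for y by auto
  then have "conv K (\<lambda>y. if y \<in> \<Omega> then f y else 0) x = 0"
    unfolding conv_def by (simp only: Bochner_Integration.integral_zero)
  with assms show False by simp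
qed

text \<open>A product rule in which only the product of \<zeta> and \<psi> has to be an admissible
  test function, not \<psi> itself: the translated kernels are known to be admissible only after
  multiplication by the cutoff.\<close>

lemma weak_grad_on_mult:
  assumes W: "weak_grad_on (Cinf0 \<gamma> \<Omega>) \<Omega> u G" and \<zeta>: "smooth \<zeta>" and \<psi>: "smooth \<psi>"
    and "(\<lambda>y. \<zeta> y * \<psi> y) \<in> Cinf0 \<gamma> \<Omega>"
  shows "L2_inner \<Omega> (\<lambda>x. \<zeta> x * u x) (pderiv3 i \<psi>)
    = - L2_inner \<Omega> (\<lambda>x. (\<zeta> x *\<^sub>R G x + u x *\<^sub>R grad \<zeta> x) $ i) \<psi>"
proof -
  have L: "u \<in> L2 \<Omega>" "(\<lambda>x. G x $ i) \<in> L2 \<Omega>" using W by (auto simp: weak_grad_on_def L2_vec_iff)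
  have I: "integrable (lebesgue_on \<Omega>) (\<lambda>x. (u x * \<zeta> x) * pderiv3 i \<psi> x)"
    "integrable (lebesgue_on \<Omega>) (\<lambda>x. (u x * pderiv3 i \<zeta> x) * \<psi> x)"
    "integrable (lebesgue_on \<Omega>) (\<lambda>x. (G x $ i * \<zeta> x) * \<psi> x)"
    using L2_inner_integrable[OF smooth_mult_L2[OF \<zeta> L(1)] smooth_L2[OF smooth_pderiv3[OF \<psi>]]]
      L2_inner_integrable[OF smooth_mult_L2[OF smooth_pderiv3[OF \<zeta>] L(1)] smooth_L2[OF \<psi>]]
      L2_inner_integrable[OF smooth_mult_L2[OF \<zeta> L(2)] smooth_L2[OF \<psi>]]
    by (simp_all add: mult_ac)
  have "L2_inner \<Omega> u (pderiv3 i (\<lambda>y. \<zeta> y * \<psi> y)) = - L2_inner \<Omega> (\<lambda>x. G x $ i) (\<lambda>y. \<zeta> y * \<psi> y)"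
    using W assms(4) by (simp add: weak_grad_on_def)
  moreover have "L2_inner \<Omega> u (pderiv3 i (\<lambda>y. \<zeta> y * \<psi> y))
      = (\<integral>x. (u x * \<zeta> x) * pderiv3 i \<psi> x \<partial>lebesgue_on \<Omega>) + (\<integral>x. (u x * pderiv3 i \<zeta> x) * \<psi> x \<partial>lebesgue_on \<Omega>)"
    unfolding Bochner_Integration.integral_add[OF I(1,2), symmetric] L2_inner_def
    by (rule Bochner_Integration.integral_cong)
       (simp_all add: pderiv3_mult smooth_differentiable \<zeta> \<psi> algebra_simps)
  moreover have "L2_inner \<Omega> (\<lambda>x. G x $ i) (\<lambda>y. \<zeta> y * \<psi> y) = (\<integral>x. (G x $ i * \<zeta> x) * \<psi> x \<partial>lebesgue_on \<Omega>)"
    unfolding L2_inner_def by (rule Bochner_Integration.integral_cong) simp_all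
  moreover have "L2_inner \<Omega> (\<lambda>x. \<zeta> x * u x) (pderiv3 i \<psi>) = (\<integral>x. (u x * \<zeta> x) * pderiv3 i \<psi> x \<partial>lebesgue_on \<Omega>)"
    unfolding L2_inner_def by (rule Bochner_Integration.integral_cong) simp_all
  moreover have "L2_inner \<Omega> (\<lambda>x. (\<zeta> x *\<^sub>R G x + u x *\<^sub>R grad \<zeta> x) $ i) \<psi>
      = (\<integral>x. (G x $ i * \<zeta> x) * \<psi> x \<partial>lebesgue_on \<Omega>) + (\<integral>x. (u x * pderiv3 i \<zeta> x) * \<psi> x \<partial>lebesgue_on \<Omega>)"
    unfolding Bochner_Integration.integral_add[OF I(3,2), symmetric] L2_inner_def
    by (rule Bochner_Integration.integral_cong) (simp_all add: algebra_simps)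
  ultimately show ?thesis by simp
qed

lemma product_grad_L2:
  assumes "u \<in> L2 \<Omega>" "G \<in> L2 \<Omega>" "smooth \<zeta>"
  shows "(\<lambda>x. \<zeta> x * u x) \<in> L2 \<Omega>" "(\<lambda>x. \<zeta> x *\<^sub>R G x + u x *\<^sub>R grad \<zeta> x) \<in> L2 \<Omega>"
proof -
  show "(\<lambda>x. \<zeta> x * u x) \<in> L2 \<Omega>" using smooth_mult_L2[OF assms(3,1)] by simp
  have "(\<lambda>x. u x *\<^sub>R grad \<zeta> x) \<in> L2 \<Omega>"
    unfolding L2_vec_iff
  proof
    fix i
    show "(\<lambda>x. (u x *\<^sub>R grad \<zeta> x) $ i) \<in> L2 \<Omega>"
      using smooth_mult_L2[OF smooth_pderiv3[OF assms(3)] assms(1), of i] by (simp add: mult.commute)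
  qed
  then show "(\<lambda>x. \<zeta> x *\<^sub>R G x + u x *\<^sub>R grad \<zeta> x) \<in> L2 \<Omega>"
    by (rule L2_add[OF smooth_mult_L2[OF assms(3,2)]])
qed

text \<open>The two conditions on the kernel separate analysis from geometry. The first makes
  \<open>\<zeta> y * K (x - y)\<close> an admissible test function, so that on \<Omega> the gradient
  of the mollified \<open>\<zeta> u\<close> is the mollification of the product-rule gradient; the
  second makes the result vanish near \<open>\<gamma>t\<close>.\<close>

lemma strong_grad_by_mollification:
  assumes W: "weak_grad_on (Cinf0 \<gamma>n \<Omega>) \<Omega> u G" and \<zeta>: "smooth \<zeta>"
    and ex: "\<And>e. e > 0 \<Longrightarrow> \<exists>K. mollifier K e \<and> (\<forall>x\<in>\<Omega>. (\<lambda>y. \<zeta> y * K (x - y)) \<in> Cinf0 \<gamma>n \<Omega>) \<and>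
      apart {x\<in>\<Omega>. \<exists>y\<in>\<Omega>. \<zeta> y \<noteq> 0 \<and> K (x - y) \<noteq> 0} \<gamma>t"
  shows "strong_grad \<gamma>t \<Omega> (\<lambda>x. \<zeta> x * u x) (\<lambda>x. \<zeta> x *\<^sub>R G x + u x *\<^sub>R grad \<zeta> x)"
proof -
  define v where "v = (\<lambda>x. \<zeta> x * u x)"
  define H where "H = (\<lambda>x. \<zeta> x *\<^sub>R G x + u x *\<^sub>R grad \<zeta> x)"
  define v' where "v' = (\<lambda>y. if y \<in> \<Omega> then v y else 0)"
  define H' where "H' i = (\<lambda>y. if y \<in> \<Omega> then H y $ i else 0)" for i
  have uL: "u \<in> L2 \<Omega>" "G \<in> L2 \<Omega>" using W by (auto simp: weak_grad_on_def)
  have vL: "v \<in> L2 \<Omega>" and HL: "H \<in> L2 \<Omega>"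
    using product_grad_L2[OF uL \<zeta>] by (simp_all add: v_def H_def)
  have HiL: "(\<lambda>x. H x $ i) \<in> L2 \<Omega>" for i using HL by (simp add: L2_vec_iff)
  have v'L: "v' \<in> L2 UNIV" "bounded_support v'"
    unfolding v'_def by (rule L2_zero_extension[OF vL], rule zero_extension_bounded_support)
  have H'L: "H' i \<in> L2 UNIV" "bounded_support (H' i)" for i
    unfolding H'_def by (rule L2_zero_extension[OF HiL], rule zero_extension_bounded_support)
  have v'i: "integrable lebesgue v'" by (rule bounded_support_L2_integrable[OF v'L(2,1)])
  have H'i: "integrable lebesgue (H' i)" for i by (rule bounded_support_L2_integrable[OF H'L(2,1)])
  have "strong_grad \<gamma>t \<Omega> v H"
    unfolding strong_grad_def
  proof (intro conjI vL HL allI impI)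
    fix e :: real assume "e > 0"
    obtain d0 where d0: "d0 > 0" "\<And>K. mollifier K d0 \<Longrightarrow> L2_norm UNIV (\<lambda>x. conv K v' x - v' x) < e"
      using conv_approx[OF v'L \<open>e > 0\<close>] by blast
    have "\<forall>i. \<exists>d>0. \<forall>K. mollifier K d \<longrightarrow> L2_norm UNIV (\<lambda>x. conv K (H' i) x - H' i x) < e / 3"
      using conv_approx[OF H'L, of "e / 3"] \<open>e > 0\<close> by simp
    then obtain d where d: "\<And>i. d i > 0"
        "\<And>i K. mollifier K (d i) \<Longrightarrow> L2_norm UNIV (\<lambda>x. conv K (H' i) x - H' i x) < e / 3"
      by metis
    define r where "r = min d0 (Min (range d))"
    have "r > 0" using d0(1) d(1) by (simp add: r_def)
    then obtain K where K: "mollifier K r" and C1: "\<And>x. x \<in> \<Omega> \<Longrightarrow> (\<lambda>y. \<zeta> y * K (x - y)) \<in> Cinf0 \<gamma>n \<Omega>"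
      and C2: "apart {x\<in>\<Omega>. \<exists>y\<in>\<Omega>. \<zeta> y \<noteq> 0 \<and> K (x - y) \<noteq> 0} \<gamma>t"
      using ex by blast
    have Kmono: "mollifier K s" if "r \<le> s" for s using K that by (force simp: mollifier_def)
    have K0: "mollifier K d0" by (rule Kmono) (simp add: r_def)
    have Ki: "mollifier K (d i)" for i by (rule Kmono) (simp add: r_def min.coboundedI2)
    let ?\<phi> = "conv K v'"
    have sm: "smooth ?\<phi>" by (rule smooth_conv[OF mollifier_smooth[OF K] mollifier_bounded_support[OF K] v'i])
    have "{x\<in>\<Omega>. ?\<phi> x \<noteq> 0} \<subseteq> {x\<in>\<Omega>. \<exists>y\<in>\<Omega>. \<zeta> y \<noteq> 0 \<and> K (x - y) \<noteq> 0}"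
      using conv_zero_extension_nonzero[of K v] by (fastforce simp: v'_def v_def)
    then have \<phi>C: "?\<phi> \<in> Cinf0 \<gamma>t \<Omega>"
      unfolding Cinf0_iff using sm C2 apart_mono by blast
    have cL: "?\<phi> \<in> L2 UNIV" by (rule mollifier_conv_contraction(1)[OF K v'i v'L(1)])
    have "L2_norm \<Omega> (\<lambda>x. v x - ?\<phi> x) = L2_norm \<Omega> (\<lambda>x. v' x - ?\<phi> x)"
      by (rule L2_cong(2)) (simp add: v'_def)
    also have "\<dots> \<le> L2_norm UNIV (\<lambda>x. v' x - ?\<phi> x)"
      by (rule L2_UNIV_restrict(2)[OF L2_diff[OF v'L(1) cL]])
    also have "\<dots> < e" using d0(2)[OF K0] by (simp add: L2_norm_diff_commute[of UNIV v'])
    finally have a: "L2_norm \<Omega> (\<lambda>x. v x - ?\<phi> x) < e" .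
    \<comment> \<open>The derivative sits on the kernel, becomes a derivative in \<open>y\<close> at
      the cost of a sign, and passes to \<open>u\<close> by the weak identity.\<close>
    have der: "pderiv3 i ?\<phi> x = conv K (H' i) x" if x: "x \<in> \<Omega>" for i x
    proof -
      have "pderiv3 i ?\<phi> x = conv (pderiv3 i K) v' x"
        by (rule pderiv3_conv[OF mollifier_smooth[OF K] mollifier_bounded_support[OF K] v'i])
      also have "\<dots> = L2_inner \<Omega> v (\<lambda>y. pderiv3 i K (x - y))"
        unfolding v'_def by (rule conv_zero_extension)
      also have "\<dots> = - L2_inner \<Omega> v (pderiv3 i (\<lambda>y. K (x - y)))"
        by (simp add: L2_inner_def pderiv3_reflect(1)[OF smooth_differentiable[OF mollifier_smooth[OF K]]])
      also have "\<dots> = L2_inner \<Omega> (\<lambda>x. H x $ i) (\<lambda>y. K (x - y))"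
        unfolding v_def H_def
        by (subst weak_grad_on_mult[OF W \<zeta> smooth_reflect[OF mollifier_smooth[OF K]] C1[OF x]]) simp
      also have "\<dots> = conv K (H' i) x" unfolding H'_def by (rule conv_zero_extension[symmetric])
      finally show ?thesis .
    qed
    have b: "L2_norm \<Omega> (\<lambda>x. (H x - grad ?\<phi> x) $ i) < e / 3" for i
    proof -
      have cHL: "conv K (H' i) \<in> L2 UNIV" by (rule mollifier_conv_contraction(1)[OF K H'i H'L(1)])
      have "L2_norm \<Omega> (\<lambda>x. (H x - grad ?\<phi> x) $ i) = L2_norm \<Omega> (\<lambda>x. H' i x - conv K (H' i) x)"
        by (rule L2_cong(2)) (simp add: H'_def der[unfolded H'_def])
      also have "\<dots> \<le> L2_norm UNIV (\<lambda>x. H' i x - conv K (H' i) x)"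
        by (rule L2_UNIV_restrict(2)[OF L2_diff[OF H'L(1) cHL]])
      also have "\<dots> < e / 3" using d(2)[OF Ki] by (simp add: L2_norm_diff_commute[of UNIV "H' i"])
      finally show ?thesis .
    qed
    have "L2_norm \<Omega> (\<lambda>x. H x - grad ?\<phi> x) \<le> (\<Sum>i\<in>UNIV. L2_norm \<Omega> (\<lambda>x. (H x - grad ?\<phi> x) $ i))"
      by (rule L2_norm_vec_le[OF L2_diff[OF HL Cinf0_grad_L2[OF \<phi>C]]])
    also have "\<dots> < e" using b[of 1] b[of 2] b[of 3] unfolding sum_3 by linarith
    finally show "\<exists>\<phi>\<in>Cinf0 \<gamma>t \<Omega>. L2_norm \<Omega> (\<lambda>x. v x - \<phi> x) < e \<and> L2_norm \<Omega> (\<lambda>x. H x - grad \<phi> x) < e"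
      using a \<phi>C by blast
  qed
  then show ?thesis by (simp add: v_def H_def)
qed

text \<open>Away from the interface at most one boundary condition is present. Inside \<Omega> any
  small kernel works. Off the closure of \<open>\<gamma>t\<close> the kernel is centred at
  \<open>t e\<^sub>3\<close>: values at x come from points shifted inwards, and the kernels stay
  away from the boundary as test functions. Near \<open>\<gamma>t\<close> it is centred at
  \<open>- t e\<^sub>3\<close>: the support of the result is shifted inwards, and extension by zero
  across the boundary is legitimate by the weak condition.\<close>

lemma strong_grad_local:
  assumes lip: "lipschitz_boundary \<Omega>" and \<gamma>: "\<gamma>t \<subseteq> frontier \<Omega>" "\<gamma>n \<subseteq> frontier \<Omega>"
    and W: "weak_grad_on (Cinf0 \<gamma>n \<Omega>) \<Omega> u G"
    and p: "p \<in> closure \<Omega>" "p \<notin> closure \<gamma>t \<inter> closure \<gamma>n"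
  shows "\<exists>r>0. \<forall>\<zeta>. smooth \<zeta> \<and> {x. \<zeta> x \<noteq> 0} \<subseteq> ball p r \<longrightarrow>
    strong_grad \<gamma>t \<Omega> (\<lambda>x. \<zeta> x * u x) (\<lambda>x. \<zeta> x *\<^sub>R G x + u x *\<^sub>R grad \<zeta> x)"
proof (cases "p \<in> \<Omega>")
  case True
  then obtain \<rho> where \<rho>: "\<rho> > 0" "ball p \<rho> \<subseteq> \<Omega>" using open_\<Omega> open_contains_ball by blast
  define r where "r = \<rho> / 3"
  have far: "3 * r \<le> dist p q" if "q \<in> frontier \<Omega>" for q
  proof (rule ccontr)
    assume "\<not> 3 * r \<le> dist p q"
    then have "q \<in> \<Omega>" using \<rho> by (auto simp: r_def)
    then show False using that open_\<Omega> by (simp add: frontier_def interior_open)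
  qed
  have r: "r > 0" using \<rho> by (simp add: r_def)
  show ?thesis
  proof (intro exI[of _ r] conjI allI impI r)
    fix \<zeta> assume \<zeta>: "smooth \<zeta> \<and> {x. \<zeta> x \<noteq> 0} \<subseteq> ball p r"
    then have supp: "dist p y < r" if "\<zeta> y \<noteq> 0" for y using that by auto
    show "strong_grad \<gamma>t \<Omega> (\<lambda>x. \<zeta> x * u x) (\<lambda>x. \<zeta> x *\<^sub>R G x + u x *\<^sub>R grad \<zeta> x)"
    proof (rule strong_grad_by_mollification[OF W])
      fix e :: real assume "e > 0"
      then have "min e r > 0" using r by simp
      then obtain K where K: "mollifier K (norm (0::real^3) + min e r)" using ex_mollifier by blast
      then have Ke: "mollifier K e" and Kr: "\<And>z. K z \<noteq> 0 \<Longrightarrow> norm z < r" by (auto simp: mollifier_def)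
      have 1: "(\<lambda>y. \<zeta> y * K (x - y)) \<in> Cinf0 \<gamma>n \<Omega>" for x
        unfolding Cinf0_iff
      proof
        show "smooth (\<lambda>y. \<zeta> y * K (x - y))" using \<zeta> by (intro smooth_mult smooth_reflect mollifier_smooth[OF K]) auto
        have "r \<le> dist y q" if "\<zeta> y \<noteq> 0" "q \<in> \<gamma>n" for y q
          using supp[OF that(1)] far[of q] that(2) \<gamma> dist_triangle[of p q y] r by (force simp: dist_commute)
        then show "apart {y\<in>\<Omega>. \<zeta> y * K (x - y) \<noteq> 0} \<gamma>n"
          unfolding apart_def using r by (intro exI[of _ r]) auto
      qed
      have "r \<le> dist x q" if "\<zeta> y \<noteq> 0" "K (x - y) \<noteq> 0" "q \<in> \<gamma>t" for x y q
      proof -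
        have "3 * r \<le> dist p q" using that \<gamma> far by blast
        moreover have "dist p q \<le> dist p y + dist y x + dist x q"
          using dist_triangle[of p q y] dist_triangle[of y q x] by linarith
        moreover have "dist y x < r" using Kr[OF that(2)] by (simp add: dist_norm norm_minus_commute)
        ultimately show ?thesis using supp[OF that(1)] by linarith
      qed
      then have 2: "apart {x\<in>\<Omega>. \<exists>y\<in>\<Omega>. \<zeta> y \<noteq> 0 \<and> K (x - y) \<noteq> 0} \<gamma>t"
        unfolding apart_def using r by (intro exI[of _ r]) auto
      show "\<exists>K. mollifier K e \<and> (\<forall>x\<in>\<Omega>. (\<lambda>y. \<zeta> y * K (x - y)) \<in> Cinf0 \<gamma>n \<Omega>) \<and>
          apart {x\<in>\<Omega>. \<exists>y\<in>\<Omega>. \<zeta> y \<noteq> 0 \<and> K (x - y) \<noteq> 0} \<gamma>t"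
        using Ke 1 2 by blast
    qed (use \<zeta> in auto)
  qed
next
  case False
  then have pf: "p \<in> frontier \<Omega>" using p(1) open_\<Omega> by (simp add: frontier_def interior_open)
  obtain N h e\<^sub>3 \<Lambda> where N: "open N" "p \<in> N" and e3: "norm (e\<^sub>3::real^3) = 1" and \<Lambda>: "\<Lambda> > 0"
    and hl: "\<And>x y. \<bar>h x - h y\<bar> \<le> \<Lambda> * dist x y" and hs: "\<And>x s. h (x + s *\<^sub>R e\<^sub>3) = h x + s"
    and iff: "\<And>x. x \<in> N \<Longrightarrow> (x \<in> \<Omega> \<longleftrightarrow> h x < (0::real)) \<and> (x \<in> frontier \<Omega> \<longleftrightarrow> h x = 0)"
    using lipschitz_boundary_height[OF lip pf] by metis
  obtain \<rho>1 where \<rho>1: "\<rho>1 > 0" "ball p \<rho>1 \<subseteq> N" using N open_contains_ball by blast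
  \<comment> \<open>A shift by \<open>- t e\<^sub>3\<close> pushes the part of \<open>\<Omega>\<close> near \<open>p\<close> away from the boundary, also after
    a perturbation of size \<open>\<delta> = t / (\<Lambda> + 1)\<close>.\<close>
  have push: "min r (\<delta> / \<Lambda>) \<le> dist y q"
    if "x \<in> \<Omega>" "dist p x < 3 * r" "dist p y < 3 * r" "dist (x - y) (t *\<^sub>R e\<^sub>3) < \<delta>" "q \<in> frontier \<Omega>"
      "\<delta> * (\<Lambda> + 1) = t" "4 * r \<le> \<rho>1" for x y q r t \<delta>
  proof (rule ccontr)
    assume "\<not> ?thesis"
    then have q: "dist y q < r" "dist y q < \<delta> / \<Lambda>" by auto
    have "0 < r" using q(1) zero_le_dist[of y q] by linarith
    then have "x \<in> ball p \<rho>1" using that by auto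
    then have "h x < 0" using \<rho>1 iff that by blast
    have "dist p q < \<rho>1" using dist_triangle[of p q y] q that by linarith
    then have hq: "h q = 0" using \<rho>1 iff that by (metis mem_ball subsetD)
    have "h y \<le> h (x + (- t) *\<^sub>R e\<^sub>3) + \<Lambda> * dist y (x + (- t) *\<^sub>R e\<^sub>3)"
      using hl[of y "x + (- t) *\<^sub>R e\<^sub>3"] by linarith
    also have "dist y (x + (- t) *\<^sub>R e\<^sub>3) = dist (x - y) (t *\<^sub>R e\<^sub>3)"
      unfolding dist_norm by (subst norm_minus_commute) (simp add: algebra_simps)
    also have "h (x + (- t) *\<^sub>R e\<^sub>3) = h x - t" unfolding hs by simp
    finally have "h y \<le> h x - t + \<Lambda> * dist (x - y) (t *\<^sub>R e\<^sub>3)" .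
    moreover have "\<Lambda> * dist (x - y) (t *\<^sub>R e\<^sub>3) \<le> \<Lambda> * \<delta>" using \<Lambda> that by (intro mult_left_mono) auto
    ultimately have "h y < - \<delta>" using \<open>h x < 0\<close> that by (simp add: algebra_simps)
    moreover have "\<Lambda> * dist y q < \<delta>" using q(2) \<Lambda> by (simp add: field_simps)
    ultimately show False using hl[of y q] hq by linarith
  qed
  show ?thesis
  proof (cases "p \<in> closure \<gamma>t")
    case False
    then obtain \<rho>2 where \<rho>2: "\<rho>2 > 0" "\<And>q. q \<in> \<gamma>t \<Longrightarrow> \<rho>2 \<le> dist p q"
      unfolding closure_approachable by (metis dist_commute not_le)
    define r where "r = min \<rho>1 \<rho>2 / 4"
    have r: "r > 0" "4 * r \<le> \<rho>1" "4 * r \<le> \<rho>2" using \<rho>1 \<rho>2 by (auto simp: r_def)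
    show ?thesis
    proof (intro exI[of _ r] conjI allI impI r(1))
      fix \<zeta> assume \<zeta>: "smooth \<zeta> \<and> {x. \<zeta> x \<noteq> 0} \<subseteq> ball p r"
      then have supp: "dist p y < r" if "\<zeta> y \<noteq> 0" for y using that by auto
      show "strong_grad \<gamma>t \<Omega> (\<lambda>x. \<zeta> x * u x) (\<lambda>x. \<zeta> x *\<^sub>R G x + u x *\<^sub>R grad \<zeta> x)"
      proof (rule strong_grad_by_mollification[OF W])
        fix e :: real assume "e > 0"
        \<comment> \<open>The kernel lives in the ball of radius \<delta> around the shift, hence
          within t + \<delta> \<le> 2t = min e r of 0. With \<delta> (\<Lambda> + 1) = t, the
          perturbation loses at most \<Lambda>\<delta> of the height t, so \<delta> remains.\<close>
        define t where "t = min e r / 2"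
        define \<delta> where "\<delta> = t / (\<Lambda> + 1)"
        have t: "t > 0" "t + t \<le> e" "t + t \<le> r" using \<open>e > 0\<close> r by (auto simp: t_def)
        have \<delta>: "\<delta> > 0" "\<delta> \<le> t" "\<delta> * (\<Lambda> + 1) = t" using t \<Lambda> by (auto simp: \<delta>_def field_simps)
        obtain K where K: "mollifier K (norm (t *\<^sub>R e\<^sub>3) + \<delta>)" and Kc: "\<And>z. K z \<noteq> 0 \<Longrightarrow> dist z (t *\<^sub>R e\<^sub>3) < \<delta>"
          using ex_mollifier[OF \<delta>(1), of "t *\<^sub>R e\<^sub>3"] by blast
        have Ksupp: "norm z < t + \<delta>" if "K z \<noteq> 0" for z using K that t e3 by (simp add: mollifier_def)
        have "norm z < e" if "K z \<noteq> 0" for z using Ksupp[OF that] t \<delta> by linarith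
        then have Ke: "mollifier K e" using K by (simp add: mollifier_def)
        have Kr: "dist x y < r" if "K (x - y) \<noteq> 0" for x y
          using Ksupp[OF that] t \<delta> by (simp add: dist_norm)
        have 1: "(\<lambda>y. \<zeta> y * K (x - y)) \<in> Cinf0 \<gamma>n \<Omega>" if x: "x \<in> \<Omega>" for x
          unfolding Cinf0_iff
        proof
          show "smooth (\<lambda>y. \<zeta> y * K (x - y))" using \<zeta> by (intro smooth_mult smooth_reflect mollifier_smooth[OF K]) auto
          have "min r (\<delta> / \<Lambda>) \<le> dist y q" if "\<zeta> y \<noteq> 0" "K (x - y) \<noteq> 0" "q \<in> \<gamma>n" for y q
          proof (rule push[OF x])
            show "dist p x < 3 * r" using supp[OF that(1)] Kr[OF that(2)] dist_triangle[of p x y] r by (simp add: dist_commute)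
            show "dist p y < 3 * r" using supp[OF that(1)] r by simp
          qed (use Kc that \<gamma> \<delta> r in auto)
          then show "apart {y\<in>\<Omega>. \<zeta> y * K (x - y) \<noteq> 0} \<gamma>n"
            unfolding apart_def using r \<delta> \<Lambda> by (intro exI[of _ "min r (\<delta> / \<Lambda>)"]) auto
        qed
        have "r \<le> dist x q" if "\<zeta> y \<noteq> 0" "K (x - y) \<noteq> 0" "q \<in> \<gamma>t" for x y q
        proof -
          have "4 * r \<le> dist p q" using that \<rho>2 r by force
          moreover have "dist p q \<le> dist p y + dist y x + dist x q"
            using dist_triangle[of p q y] dist_triangle[of y q x] by linarith
          ultimately show ?thesis using supp[OF that(1)] Kr[OF that(2)] r by (simp add: dist_commute)
        qed
        then have 2: "apart {x\<in>\<Omega>. \<exists>y\<in>\<Omega>. \<zeta> y \<noteq> 0 \<and> K (x - y) \<noteq> 0} \<gamma>t"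
          unfolding apart_def using r by (intro exI[of _ r]) auto
        show "\<exists>K. mollifier K e \<and> (\<forall>x\<in>\<Omega>. (\<lambda>y. \<zeta> y * K (x - y)) \<in> Cinf0 \<gamma>n \<Omega>) \<and>
            apart {x\<in>\<Omega>. \<exists>y\<in>\<Omega>. \<zeta> y \<noteq> 0 \<and> K (x - y) \<noteq> 0} \<gamma>t"
          using Ke 1 2 by blast
      qed (use \<zeta> in auto)
    qed
  next
    case True
    then have "p \<notin> closure \<gamma>n" using p(2) by blast
    then obtain \<rho>2 where \<rho>2: "\<rho>2 > 0" "\<And>q. q \<in> \<gamma>n \<Longrightarrow> \<rho>2 \<le> dist p q"
      unfolding closure_approachable by (metis dist_commute not_le)
    define r where "r = min \<rho>1 \<rho>2 / 4"
    have r: "r > 0" "4 * r \<le> \<rho>1" "4 * r \<le> \<rho>2" using \<rho>1 \<rho>2 by (auto simp: r_def)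
    show ?thesis
    proof (intro exI[of _ r] conjI allI impI r(1))
      fix \<zeta> assume \<zeta>: "smooth \<zeta> \<and> {x. \<zeta> x \<noteq> 0} \<subseteq> ball p r"
      then have supp: "dist p y < r" if "\<zeta> y \<noteq> 0" for y using that by auto
      show "strong_grad \<gamma>t \<Omega> (\<lambda>x. \<zeta> x * u x) (\<lambda>x. \<zeta> x *\<^sub>R G x + u x *\<^sub>R grad \<zeta> x)"
      proof (rule strong_grad_by_mollification[OF W])
        fix e :: real assume "e > 0"
        define t where "t = min e r / 2"
        define \<delta> where "\<delta> = t / (\<Lambda> + 1)"
        have t: "t > 0" "t + t \<le> e" "t + t \<le> r" using \<open>e > 0\<close> r by (auto simp: t_def)
        have \<delta>: "\<delta> > 0" "\<delta> \<le> t" "\<delta> * (\<Lambda> + 1) = t" using t \<Lambda> by (auto simp: \<delta>_def field_simps)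
        obtain K where K: "mollifier K (norm (- (t *\<^sub>R e\<^sub>3)) + \<delta>)" and Kc: "\<And>z. K z \<noteq> 0 \<Longrightarrow> dist z (- (t *\<^sub>R e\<^sub>3)) < \<delta>"
          using ex_mollifier[OF \<delta>(1), of "- (t *\<^sub>R e\<^sub>3)"] by blast
        have Ksupp: "norm z < t + \<delta>" if "K z \<noteq> 0" for z using K that t e3 by (simp add: mollifier_def)
        have "norm z < e" if "K z \<noteq> 0" for z using Ksupp[OF that] t \<delta> by linarith
        then have Ke: "mollifier K e" using K by (simp add: mollifier_def)
        have Kr: "dist x y < r" if "K (x - y) \<noteq> 0" for x y
          using Ksupp[OF that] t \<delta> by (simp add: dist_norm)
        have 1: "(\<lambda>y. \<zeta> y * K (x - y)) \<in> Cinf0 \<gamma>n \<Omega>" for x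
          unfolding Cinf0_iff
        proof
          show "smooth (\<lambda>y. \<zeta> y * K (x - y))" using \<zeta> by (intro smooth_mult smooth_reflect mollifier_smooth[OF K]) auto
          have "r \<le> dist y q" if "\<zeta> y \<noteq> 0" "q \<in> \<gamma>n" for y q
            using supp[OF that(1)] \<rho>2(2)[OF that(2)] dist_triangle[of p q y] r by linarith
          then show "apart {y\<in>\<Omega>. \<zeta> y * K (x - y) \<noteq> 0} \<gamma>n"
            unfolding apart_def using r by (intro exI[of _ r]) auto
        qed
        \<comment> \<open>\<open>push\<close> is used with the roles of x and y exchanged: here x is
          the shifted point.\<close>
        have "min r (\<delta> / \<Lambda>) \<le> dist x q" if "y \<in> \<Omega>" "\<zeta> y \<noteq> 0" "K (x - y) \<noteq> 0" "q \<in> \<gamma>t" for x y q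
        proof (rule push[OF that(1)])
          show "dist p y < 3 * r" using supp[OF that(2)] r by simp
          show "dist p x < 3 * r" using supp[OF that(2)] Kr[OF that(3)] dist_triangle[of p x y] r by (simp add: dist_commute)
          have "dist (x - y) (- (t *\<^sub>R e\<^sub>3)) = dist (y - x) (t *\<^sub>R e\<^sub>3)"
            unfolding dist_norm by (subst norm_minus_commute) (simp add: algebra_simps)
          then show "dist (y - x) (t *\<^sub>R e\<^sub>3) < \<delta>" using Kc[OF that(3)] by simp
        qed (use that \<gamma> \<delta> r in auto)
        then have 2: "apart {x\<in>\<Omega>. \<exists>y\<in>\<Omega>. \<zeta> y \<noteq> 0 \<and> K (x - y) \<noteq> 0} \<gamma>t"
          unfolding apart_def using r \<delta> \<Lambda> by (intro exI[of _ "min r (\<delta> / \<Lambda>)"]) auto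
        show "\<exists>K. mollifier K e \<and> (\<forall>x\<in>\<Omega>. (\<lambda>y. \<zeta> y * K (x - y)) \<in> Cinf0 \<gamma>n \<Omega>) \<and>
            apart {x\<in>\<Omega>. \<exists>y\<in>\<Omega>. \<zeta> y \<noteq> 0 \<and> K (x - y) \<noteq> 0} \<gamma>t"
          using Ke 1 2 by blast
      qed (use \<zeta> in auto)
    qed
  qed
qed

end

section \<open>Cutoffs and partitions of unity\<close>

lemma abs_sin_diff_le: "\<bar>sin a - sin b\<bar> \<le> \<bar>a - b\<bar>" for a b :: real
proof -
  have "\<bar>sin a - sin b\<bar> = 2 * (\<bar>sin ((a - b) / 2)\<bar> * \<bar>cos ((a + b) / 2)\<bar>)"
    by (simp add: sin_diff_sin abs_mult)
  also have "\<bar>sin ((a - b) / 2)\<bar> * \<bar>cos ((a + b) / 2)\<bar> \<le> \<bar>(a - b) / 2\<bar> * 1"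
    by (intro mult_mono abs_sin_x_le_abs_x) auto
  finally show ?thesis by simp
qed

lemma abs_cos_diff_le: "\<bar>cos a - cos b\<bar> \<le> \<bar>a - b\<bar>" for a b :: real
proof -
  have "\<bar>cos a - cos b\<bar> = 2 * (\<bar>sin ((a + b) / 2)\<bar> * \<bar>sin ((b - a) / 2)\<bar>)"
    by (simp add: cos_diff_cos abs_mult)
  also have "\<bar>sin ((a + b) / 2)\<bar> * \<bar>sin ((b - a) / 2)\<bar> \<le> 1 * \<bar>(b - a) / 2\<bar>"
    by (intro mult_mono abs_sin_x_le_abs_x) auto
  finally show ?thesis by simp
qed

lemma pderiv3_le_lipschitz:
  assumes g: "smooth g" and lip: "\<And>x y. \<bar>g x - g y\<bar> \<le> L * dist x y"
  shows "\<bar>pderiv3 i g x\<bar> \<le> L"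
proof -
  have "((\<lambda>t. g (x + t *\<^sub>R axis i 1)) has_real_derivative pderiv3 i g (x + 0 *\<^sub>R axis i 1)) (at 0)"
    by (rule pderiv3_line[OF g])
  then have "((\<lambda>h. (g (x + h *\<^sub>R axis i 1) - g x) / h) \<longlongrightarrow> pderiv3 i g x) (at 0)"
    by (simp add: DERIV_def)
  then have "((\<lambda>h. \<bar>(g (x + h *\<^sub>R axis i 1) - g x) / h\<bar>) \<longlongrightarrow> \<bar>pderiv3 i g x\<bar>) (at 0)"
    by (rule tendsto_rabs)
  moreover have "eventually (\<lambda>h. \<bar>(g (x + h *\<^sub>R axis i 1) - g x) / h\<bar> \<le> L) (at 0)"
    unfolding eventually_at_filter
  proof (rule always_eventually, safe)
    fix h :: real assume "h \<noteq> 0"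
    have "\<bar>g (x + h *\<^sub>R axis i 1) - g x\<bar> \<le> L * \<bar>h\<bar>"
      using lip[of "x + h *\<^sub>R axis i 1" x] by (simp add: dist_norm)
    then show "\<bar>(g (x + h *\<^sub>R axis i 1) - g x) / h\<bar> \<le> L"
      using \<open>h \<noteq> 0\<close> by (simp add: abs_divide divide_le_eq)
  qed
  ultimately show ?thesis by (rule tendsto_upperbound) simp
qed

text \<open>A piecewise linear function of the distance, 1 up to r and 0 from 2r on, is mollified at
  scale r/2; hence the margins r/2 and 5r/2. Averaging does not increase the Lipschitz constant 1/r,
  which bounds each partial derivative.\<close>

lemma ex_cutoff:
  fixes S :: "(real^3) set"
  assumes S: "bounded S" "S \<noteq> {}" and r: "r > 0"
  shows "\<exists>\<eta>. smooth \<eta> \<and> (\<forall>x. 0 \<le> \<eta> x \<and> \<eta> x \<le> 1) \<and> (\<forall>x. infdist x S < r / 2 \<longrightarrow> \<eta> x = 1) \<and>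
    (\<forall>x. 5 * r / 2 < infdist x S \<longrightarrow> \<eta> x = 0) \<and> (\<forall>i x. \<bar>pderiv3 i \<eta> x\<bar> \<le> 1 / r)"
proof -
  define f where "f x = max 0 (min 1 (2 - infdist x S / r))" for x
  have fc: "continuous_on UNIV f" unfolding f_def by (intro continuous_intros) (use r in auto)
  have f01: "0 \<le> f x" "f x \<le> 1" for x by (auto simp: f_def)
  have f1: "f x = 1" if "infdist x S \<le> r" for x
  proof -
    have "infdist x S / r \<le> 1" using that r by simp
    then show ?thesis by (simp add: f_def)
  qed
  have f0: "f x = 0" if "2 * r \<le> infdist x S" for x
  proof -
    have "2 \<le> infdist x S / r" using that r by (simp add: field_simps)
    then show ?thesis by (simp add: f_def)
  qed
  have flip: "\<bar>f x - f y\<bar> \<le> dist x y / r" for x y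
  proof -
    have "\<bar>infdist x S - infdist y S\<bar> \<le> dist x y"
      using infdist_triangle[of x S y] infdist_triangle[of y S x] by (simp add: dist_commute)
    then have "\<bar>infdist x S / r - infdist y S / r\<bar> \<le> dist x y / r"
      using r by (simp add: diff_divide_distrib[symmetric] divide_right_mono)
    then show ?thesis unfolding f_def by linarith
  qed
  have fb: "bounded_support f"
  proof -
    obtain R where R: "\<And>y. y \<in> S \<Longrightarrow> norm y \<le> R" using S(1) bounded_iff by blast
    have "f x = 0" if "R + 2 * r < norm x" for x
    proof (rule f0)
      have "2 * r \<le> dist x y" if "y \<in> S" for y
        using R[OF that] norm_triangle_sub[of x y] \<open>R + 2 * r < norm x\<close> by (simp add: dist_norm)
      then show "2 * r \<le> infdist x S"
        using S(2) unfolding infdist_def by (auto intro!: cINF_greatest)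
    qed
    then show ?thesis by (auto simp: bounded_support_def)
  qed
  have fi: "integrable lebesgue f" by (rule bounded_support_integrable[OF fb fc])
  obtain K where K: "mollifier K (r / 2)" using ex_mollifier[of "r / 2" 0] r by auto
  have Knn: "0 \<le> K x" for x using K by (simp add: mollifier_def)
  have K0: "K (x - y) = 0" if "r / 2 \<le> dist x y" for x y
    using K that unfolding mollifier_def dist_norm by force
  define \<eta> where "\<eta> = conv K f"
  have sm: "smooth \<eta>" unfolding \<eta>_def
    by (rule smooth_conv[OF mollifier_smooth[OF K] mollifier_bounded_support[OF K] fi])
  have Ki: "integrable lebesgue (\<lambda>y. K (x - y))" "(\<integral>y. K (x - y) \<partial>lebesgue) = 1" for x
    using integrable_reflect[OF mollifier_integrable[OF K]] integral_reflect[OF mollifier_integrable[OF K]] K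
    by (auto simp: mollifier_def)
  have Kfi: "integrable lebesgue (\<lambda>y. K (x - y) * f y)" for x
    by (intro conv_integrable mollifier_bounded_support[OF K] smooth_continuous mollifier_smooth[OF K] fi)
  have "0 \<le> \<eta> x" for x unfolding \<eta>_def conv_def using Knn f01 by (intro integral_nonneg_AE AE_I2) auto
  moreover have "\<eta> x \<le> 1" for x
  proof -
    have "\<eta> x \<le> (\<integral>y. K (x - y) \<partial>lebesgue)" unfolding \<eta>_def conv_def
      by (rule integral_mono[OF Kfi Ki(1)]) (use Knn f01 in \<open>auto intro: mult_left_le\<close>)
    then show ?thesis using Ki by simp
  qed
  moreover have "\<eta> x = 1" if "infdist x S < r / 2" for x
  proof -
    have "K (x - y) * f y = K (x - y)" for y
    proof (cases "r / 2 \<le> dist x y")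
      case False
      then have "infdist y S \<le> r" using infdist_triangle[of y S x] that by (simp add: dist_commute)
      then show ?thesis by (simp add: f1)
    qed (simp add: K0)
    then show ?thesis unfolding \<eta>_def conv_def by (simp only: Ki)
  qed
  moreover have "\<eta> x = 0" if "5 * r / 2 < infdist x S" for x
  proof -
    have "K (x - y) * f y = 0" for y
    proof (cases "r / 2 \<le> dist x y")
      case False
      then have "2 * r \<le> infdist y S" using infdist_triangle[of x S y] that by simp
      then show ?thesis by (simp add: f0)
    qed (simp add: K0)
    then show ?thesis unfolding \<eta>_def conv_def by (simp only: Bochner_Integration.integral_zero)
  qed
  moreover have "\<bar>pderiv3 i \<eta> x\<bar> \<le> 1 / r" for i x
  proof (rule pderiv3_le_lipschitz[OF sm])
    fix x y
    \<comment> \<open>After a change of variables the point x occurs only in \<open>f\<close>, where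
      the Lipschitz bound is available.\<close>
    have alt: "integrable lebesgue (\<lambda>z. K z * f (x - z))" "\<eta> x = (\<integral>z. K z * f (x - z) \<partial>lebesgue)" for x
      using integrable_reflect[OF Kfi[of x], of x] integral_reflect[OF Kfi[of x], of x]
      by (simp_all add: \<eta>_def conv_def)
    have "\<eta> x - \<eta> y = (\<integral>z. K z * f (x - z) - K z * f (y - z) \<partial>lebesgue)"
      using alt by simp
    also have "\<bar>\<dots>\<bar> \<le> (\<integral>z. (dist x y / r) * K z \<partial>lebesgue)"
      unfolding real_norm_def[symmetric]
    proof (rule Bochner_Integration.integral_norm_bound_integral)
      show "norm (K z * f (x - z) - K z * f (y - z)) \<le> dist x y / r * K z" for z
      proof -
        have "norm (K z * f (x - z) - K z * f (y - z)) = \<bar>f (x - z) - f (y - z)\<bar> * K z"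
          using Knn[of z] by (simp add: right_diff_distrib[symmetric] abs_mult)
        also have "\<dots> \<le> dist x y / r * K z"
          using flip[of "x - z" "y - z"] by (intro mult_right_mono Knn) (simp add: dist_norm)
        finally show ?thesis .
      qed
    qed (use alt mollifier_integrable[OF K] in auto)
    also have "\<dots> = 1 / r * dist x y" using K by (simp add: mollifier_def)
    finally show "\<bar>\<eta> x - \<eta> y\<bar> \<le> 1 / r * dist x y" .
  qed
  ultimately show ?thesis using sm by blast
qed

context bounded_open_set
begin

text \<open>The local statements are glued by \<open>1 - (\<Prod>p\<in>F. 1 - \<zeta> p x)\<close>,
  which equals 1 wherever some \<open>\<zeta> p\<close> does. Adding a factor changes it by a
  function supported in a single ball, so additivity of \<open>SG\<close> suffices and no
  normalising division occurs.\<close>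

lemma strong_grad_partition:
  assumes loc: "\<And>p. p \<in> C \<Longrightarrow> \<exists>r>0. \<forall>\<zeta>. smooth \<zeta> \<and> {x. \<zeta> x \<noteq> 0} \<subseteq> ball p r \<longrightarrow>
      strong_grad \<gamma> \<Omega> (\<lambda>x. \<zeta> x * u x) (\<lambda>x. \<zeta> x *\<^sub>R G x + u x *\<^sub>R grad \<zeta> x)"
    and C: "compact C" and \<eta>: "smooth \<eta>" "{x\<in>\<Omega>. \<eta> x \<noteq> 0} \<subseteq> C"
  shows "strong_grad \<gamma> \<Omega> (\<lambda>x. \<eta> x * u x) (\<lambda>x. \<eta> x *\<^sub>R G x + u x *\<^sub>R grad \<eta> x)"
proof -
  define SG where "SG \<zeta> \<longleftrightarrow> strong_grad \<gamma> \<Omega> (\<lambda>x. \<zeta> x * u x) (\<lambda>x. \<zeta> x *\<^sub>R G x + u x *\<^sub>R grad \<zeta> x)" for \<zeta>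
  have SG_add: "SG (\<lambda>x. \<zeta> x + \<xi> x)" if "SG \<zeta>" "SG \<xi>" "smooth \<zeta>" "smooth \<xi>" for \<zeta> \<xi>
    using strong_grad_add[OF that(1,2)[unfolded SG_def]] that(3,4)
    by (simp add: SG_def grad_add algebra_simps)
  obtain r where r: "\<And>p. p \<in> C \<Longrightarrow> r p > 0"
      "\<And>p \<zeta>. p \<in> C \<Longrightarrow> smooth \<zeta> \<Longrightarrow> {x. \<zeta> x \<noteq> 0} \<subseteq> ball p (r p) \<Longrightarrow> SG \<zeta>"
  proof -
    have "\<forall>p. \<exists>r. p \<in> C \<longrightarrow> r > 0 \<and> (\<forall>\<zeta>. smooth \<zeta> \<and> {x. \<zeta> x \<noteq> 0} \<subseteq> ball p r \<longrightarrow> SG \<zeta>)"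
      using loc unfolding SG_def by blast
    then obtain r where "\<forall>p. p \<in> C \<longrightarrow> r p > 0 \<and> (\<forall>\<zeta>. smooth \<zeta> \<and> {x. \<zeta> x \<noteq> 0} \<subseteq> ball p (r p) \<longrightarrow> SG \<zeta>)"
      unfolding choice_iff by (elim exE)
    then show ?thesis by (intro that[of r]) simp_all
  qed
  have "C \<subseteq> (\<Union>p\<in>C. ball p (r p / 6))" using r(1) by force
  then obtain F where F: "F \<subseteq> C" "finite F" "C \<subseteq> (\<Union>p\<in>F. ball p (r p / 6))"
    using compactE_image[OF C, of C "\<lambda>p. ball p (r p / 6)"] by auto
  have "\<exists>\<zeta>. smooth \<zeta> \<and> (\<forall>x. dist p x < r p / 6 \<longrightarrow> \<zeta> x = 1) \<and> {x. \<zeta> x \<noteq> 0} \<subseteq> ball p (r p)" if "p \<in> C" for p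
  proof -
    have pos: "r p / 3 > 0" using r(1)[OF that] by simp
    obtain \<zeta> where \<zeta>: "smooth \<zeta>" "\<And>x. infdist x {p} < r p / 3 / 2 \<Longrightarrow> \<zeta> x = 1"
        "\<And>x. 5 * (r p / 3) / 2 < infdist x {p} \<Longrightarrow> \<zeta> x = 0"
      using ex_cutoff[OF _ _ pos, of "{p}"] by auto
    have "x \<in> ball p (r p)" if "\<zeta> x \<noteq> 0" for x
    proof -
      have "dist x p \<le> 5 * (r p / 3) / 2" using \<zeta>(3)[of x] that by (metis infdist_singleton not_le)
      then show ?thesis using pos by (simp add: dist_commute)
    qed
    then show ?thesis using \<zeta> by (intro exI[of _ \<zeta>]) (auto simp: dist_commute)
  qed
  then have "\<forall>p. \<exists>\<zeta>. p \<in> C \<longrightarrow> smooth \<zeta> \<and> (\<forall>x. dist p x < r p / 6 \<longrightarrow> \<zeta> x = 1) \<and> {x. \<zeta> x \<noteq> 0} \<subseteq> ball p (r p)"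
    by blast
  then obtain \<zeta> where "\<forall>p. p \<in> C \<longrightarrow> smooth (\<zeta> p) \<and> (\<forall>x. dist p x < r p / 6 \<longrightarrow> \<zeta> p x = 1) \<and> {x. \<zeta> p x \<noteq> 0} \<subseteq> ball p (r p)"
    unfolding choice_iff by (elim exE)
  then have \<zeta>: "\<And>p. p \<in> C \<Longrightarrow> smooth (\<zeta> p)" "\<And>p x. p \<in> C \<Longrightarrow> dist p x < r p / 6 \<Longrightarrow> \<zeta> p x = 1"
      "\<And>p. p \<in> C \<Longrightarrow> {x. \<zeta> p x \<noteq> 0} \<subseteq> ball p (r p)" by simp_all
  have "SG (\<lambda>x. \<eta> x * (1 - (\<Prod>p\<in>F'. 1 - \<zeta> p x)))" if "F' \<subseteq> C" "finite F'" "p0 \<in> C" for F' p0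
    using that(2,1)
  proof (induction F' rule: finite_induct)
    case empty
    have "SG (\<lambda>x. 0)" by (rule r(2)[OF that(3)]) auto
    then show ?case by simp
  next
    case (insert p F')
    let ?P = "\<lambda>x. \<Prod>p\<in>F'. 1 - \<zeta> p x"
    have sP: "smooth ?P" using insert by (intro smooth_prod smooth_diff smooth_const \<zeta>(1)) auto
    have p: "p \<in> C" using insert by simp
    \<comment> \<open>With P the old product, 1 - (1 - \<zeta>) P = \<zeta> P + (1 - P), and the
      first term is supported in the ball of \<open>p\<close>.\<close>
    have "SG (\<lambda>x. \<eta> x * \<zeta> p x * ?P x)"
      using \<zeta>(3)[OF p] by (intro r(2)[OF p] smooth_mult \<eta>(1) \<zeta>(1)[OF p] sP) auto
    moreover have "SG (\<lambda>x. \<eta> x * (1 - ?P x))" using insert by simp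
    ultimately have "SG (\<lambda>x. \<eta> x * \<zeta> p x * ?P x + \<eta> x * (1 - ?P x))"
      by (rule SG_add) (intro smooth_mult smooth_diff smooth_const \<eta>(1) \<zeta>(1)[OF p] sP)+
    also have "(\<lambda>x. \<eta> x * \<zeta> p x * ?P x + \<eta> x * (1 - ?P x)) = (\<lambda>x. \<eta> x * (1 - (\<Prod>p\<in>insert p F'. 1 - \<zeta> p x)))"
      using insert by (simp add: algebra_simps)
    finally show ?case .
  qed
  note step = this
  show ?thesis
  proof (cases "C = {}")
    case True
    then have z: "\<eta> x = 0" if "x \<in> \<Omega>" for x using \<eta>(2) that by auto
    have "grad \<eta> x = 0" if "x \<in> \<Omega>" for x
      using pderiv3_cong_open(1)[OF open_\<Omega> that, of \<eta> "\<lambda>x. 0"] z by (simp add: vec_eq_iff)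
    then show ?thesis
      using strong_grad_cong[of \<Omega> "\<lambda>x. \<eta> x * u x" "\<lambda>x. 0" "\<lambda>x. \<eta> x *\<^sub>R G x + u x *\<^sub>R grad \<eta> x" "grad (\<lambda>x. 0)" \<gamma>]
        strong_grad_smooth[of "\<lambda>x. 0" \<gamma>] z by (simp add: vec_eq_iff)
  next
    case False
    then obtain p0 where "p0 \<in> C" by blast
    let ?P = "\<lambda>x. \<Prod>p\<in>F. 1 - \<zeta> p x"
    have eq: "\<eta> x * (1 - ?P x) = \<eta> x" if "x \<in> \<Omega>" for x
    proof (cases "\<eta> x = 0")
      case False
      then have "x \<in> C" using \<eta>(2) that by blast
      then obtain p where p: "p \<in> F" "dist p x < r p / 6" using F(3) by auto
      then have "1 - \<zeta> p x = 0" using \<zeta>(2) F(1) by auto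
      then have "?P x = 0" using p(1) F(2) by (intro prod_zero) auto
      then show ?thesis by simp
    qed simp
    have "grad (\<lambda>x. \<eta> x * (1 - ?P x)) x = grad \<eta> x" if "x \<in> \<Omega>" for x
      using pderiv3_cong_open(1)[OF open_\<Omega> that, of "\<lambda>x. \<eta> x * (1 - ?P x)" \<eta>] eq by (simp add: vec_eq_iff)
    then show ?thesis
      using step[OF F(1,2) \<open>p0 \<in> C\<close>] eq unfolding SG_def
      by (subst (asm) strong_grad_cong[of \<Omega> _ "\<lambda>x. \<eta> x * u x" _ "\<lambda>x. \<eta> x *\<^sub>R G x + u x *\<^sub>R grad \<eta> x"]) auto
  qed
qed

text \<open>Closeness of w and \<phi> in L2 controls the difference of the cosines only in L2, which
  is too weak against an unbounded factor. Hence \<open>h\<close> is replaced by a bounded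
  \<open>k\<close>: the difference h - k costs at most twice its norm, and on \<open>k\<close> the
  Lipschitz bound of the cosine applies.\<close>

lemma cos_mult_continuity:
  fixes w h :: "real^3 \<Rightarrow> real"
  assumes w: "w \<in> L2 \<Omega>" and h: "h \<in> L2 \<Omega>" and "e > 0" "M > 0"
  shows "\<exists>a>0. \<forall>\<phi>\<in>L2 \<Omega>. L2_norm \<Omega> (\<lambda>x. w x - \<phi> x) < a \<longrightarrow>
    L2_norm \<Omega> (\<lambda>x. (cos (w x / M) - cos (\<phi> x / M)) * h x) < e"
proof -
  obtain k where k: "k \<in> test_fun \<Omega>" "L2_norm \<Omega> (\<lambda>x. h x - k x) < e / 4"
    using test_fun_dense[OF h, of "e / 4"] \<open>e > 0\<close> by auto
  have ks: "smooth k" and kL: "k \<in> L2 \<Omega>" using k test_fun_smooth smooth_L2 by auto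
  obtain R where R: "R > 0" "\<forall>x\<in>\<Omega>. norm (k x) \<le> R"
    using continuous_bounded_on_bounded[OF smooth_continuous[OF ks] bounded_\<Omega>] by blast
  have hk: "(\<lambda>x. h x - k x) \<in> L2 \<Omega>" by (rule L2_diff[OF h kL])
  have "L2_norm \<Omega> (\<lambda>x. (cos (w x / M) - cos (\<phi> x / M)) * h x) < e"
    if \<phi>: "\<phi> \<in> L2 \<Omega>" "L2_norm \<Omega> (\<lambda>x. w x - \<phi> x) < e * M / (2 * R)" for \<phi>
  proof -
    let ?c = "\<lambda>x. cos (w x / M) - cos (\<phi> x / M)"
    note [measurable] = L2_measurable[OF w] L2_measurable[OF \<phi>(1)] L2_measurable[OF kL] L2_measurable[OF hk]
    have 1: "(\<lambda>x. ?c x * (h x - k x)) \<in> L2 \<Omega>"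
      "L2_norm \<Omega> (\<lambda>x. ?c x * (h x - k x)) \<le> 2 * L2_norm \<Omega> (\<lambda>x. h x - k x)"
    proof -
      have "\<bar>?c x\<bar> \<le> 2" for x
        using abs_cos_le_one[of "w x / M"] abs_cos_le_one[of "\<phi> x / M"] by linarith
      then show "(\<lambda>x. ?c x * (h x - k x)) \<in> L2 \<Omega>"
        "L2_norm \<Omega> (\<lambda>x. ?c x * (h x - k x)) \<le> 2 * L2_norm \<Omega> (\<lambda>x. h x - k x)"
        using L2_mult_bounded[OF hk, of ?c 2] by simp_all
    qed
    have "norm (?c x * k x) \<le> R / M * norm (w x - \<phi> x)" if "x \<in> \<Omega>" for x
    proof -
      have "\<bar>?c x\<bar> \<le> \<bar>w x / M - \<phi> x / M\<bar>" by (rule abs_cos_diff_le)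
      also have "\<dots> = \<bar>w x - \<phi> x\<bar> / M" using \<open>M > 0\<close> by (simp add: diff_divide_distrib[symmetric] abs_divide)
      finally have "\<bar>?c x\<bar> * \<bar>k x\<bar> \<le> \<bar>w x - \<phi> x\<bar> / M * R"
        using R that \<open>M > 0\<close> by (intro mult_mono) auto
      then show ?thesis by (simp add: abs_mult mult.commute)
    qed
    then have 2: "(\<lambda>x. ?c x * k x) \<in> L2 \<Omega>" "L2_norm \<Omega> (\<lambda>x. ?c x * k x) \<le> R / M * L2_norm \<Omega> (\<lambda>x. w x - \<phi> x)"
      using L2_bounded_by[OF _ L2_diff[OF w \<phi>(1)], of "\<lambda>x. ?c x * k x" "R / M"] R \<open>M > 0\<close> by simp_all
    have "R / M * L2_norm \<Omega> (\<lambda>x. w x - \<phi> x) < R / M * (e * M / (2 * R))"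
      using \<phi>(2) R \<open>M > 0\<close> by (intro mult_strict_left_mono) auto
    also have "\<dots> = e / 2" using R \<open>M > 0\<close> by simp
    finally have "R / M * L2_norm \<Omega> (\<lambda>x. w x - \<phi> x) < e / 2" .
    moreover have "L2_norm \<Omega> (\<lambda>x. ?c x * h x)
        \<le> L2_norm \<Omega> (\<lambda>x. ?c x * (h x - k x)) + L2_norm \<Omega> (\<lambda>x. ?c x * k x)"
      using L2_norm_triangle[OF 1(1) 2(1)] by (simp add: right_diff_distrib)
    ultimately show ?thesis using 1(2) 2(2) k(2) by linarith
  qed
  then show ?thesis using \<open>e > 0\<close> \<open>M > 0\<close> R by (intro exI[of _ "e * M / (2 * R)"]) auto
qed

end

section \<open>Truncation and removal of the interface\<close>

lemma infdist_less_ex: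
  assumes "infdist x S < r" "S \<noteq> {}"
  shows "\<exists>y\<in>S. dist x y < r"
proof -
  have "bdd_below (dist x ` S)" by (rule bdd_belowI2[of _ 0]) auto
  from cINF_less_iff[OF assms(2) this] show ?thesis using assms by (simp add: infdist_notempty)
qed

context bounded_open_set
begin

lemma smooth_grad_bounded: "smooth f \<Longrightarrow> \<exists>B>0. \<forall>x\<in>\<Omega>. norm (grad f x) \<le> B"
proof (rule continuous_bounded_on_bounded[OF _ bounded_\<Omega>])
  assume "smooth f"
  then show "continuous_on UNIV (grad f)"
    unfolding grad_def by (intro continuous_on_vec_lambda smooth_continuous smooth_pderiv3)
qed

lemma smooth_M_sin:
  assumes "smooth f" "M > 0"
  shows "smooth (\<lambda>x. M * sin (f x / M))" "grad (\<lambda>x. M * sin (f x / M)) x = cos (f x / M) *\<^sub>R grad f x"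
proof -
  have "smooth (\<lambda>x. inverse M * f x)" by (rule smooth_cmult[OF assms(1)])
  then have "smooth (\<lambda>x. f x / M)" by (simp add: divide_inverse mult.commute)
  then show "smooth (\<lambda>x. M * sin (f x / M))" by (intro smooth_cmult smooth_sin)
  have "((\<lambda>s. M * sin (s / M)) has_real_derivative cos (f x / M)) (at (f x))"
    using assms(2) by (auto intro!: derivative_eq_intros)
  from pderiv3_compose_real(1)[OF this smooth_differentiable[OF assms(1)]]
  show "grad (\<lambda>x. M * sin (f x / M)) x = cos (f x / M) *\<^sub>R grad f x" by (simp add: vec_eq_iff)
qed

lemma M_sin_lipschitz: "M > 0 \<Longrightarrow> \<bar>M * sin (a / M) - M * sin (b / M)\<bar> \<le> \<bar>a - b\<bar>" for M a b :: real
proof -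
  assume M: "M > 0"
  have "\<bar>M * sin (a / M) - M * sin (b / M)\<bar> = M * \<bar>sin (a / M) - sin (b / M)\<bar>"
    using M by (simp add: right_diff_distrib[symmetric] abs_mult)
  also have "\<dots> \<le> M * \<bar>a / M - b / M\<bar>" using M by (intro mult_left_mono abs_sin_diff_le) auto
  also have "\<dots> = \<bar>a - b\<bar>" using M by (simp add: diff_divide_distrib[symmetric] abs_divide)
  finally show ?thesis .
qed

text \<open>Chain rule in the closure. The approximations are \<eta> M sin(\<phi>/M) with \<phi>
  approximating w; they vanish where \<phi> does, because sin 0 = 0, so the boundary condition is
  kept.\<close>

lemma strong_grad_M_sin:
  assumes w: "strong_grad \<gamma> \<Omega> w H" and \<eta>: "smooth \<eta>" and M: "M > 0"
  shows "strong_grad \<gamma> \<Omega> (\<lambda>x. \<eta> x * (M * sin (w x / M)))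
    (\<lambda>x. \<eta> x *\<^sub>R (cos (w x / M) *\<^sub>R H x) + (M * sin (w x / M)) *\<^sub>R grad \<eta> x)"
proof -
  let ?F = "\<lambda>s. M * sin (s / M)"
  have wL: "w \<in> L2 \<Omega>" and HL: "H \<in> L2 \<Omega>" using w by (auto simp: strong_grad_def)
  note [measurable] = L2_measurable[OF wL] L2_measurable[OF HL]
  obtain B where B: "B > 0" "\<And>x. x \<in> \<Omega> \<Longrightarrow> \<bar>\<eta> x\<bar> \<le> B"
    using continuous_bounded_on_bounded[OF smooth_continuous[OF \<eta>] bounded_\<Omega>] by auto
  obtain B' where B': "B' > 0" "\<And>x. x \<in> \<Omega> \<Longrightarrow> norm (grad \<eta> x) \<le> B'"
    using smooth_grad_bounded[OF \<eta>] by auto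
  have FL: "(\<lambda>x. ?F (w x)) \<in> L2 \<Omega>"
    using M_sin_lipschitz[OF M, of _ 0] by (intro L2_bounded_by(1)[OF _ wL, of _ 1]) auto
  have cH: "(\<lambda>x. cos (w x / M) *\<^sub>R H x) \<in> L2 \<Omega>"
    by (rule L2_mult_bounded(1)[OF HL, of _ 1]) auto
  note L = product_grad_L2[OF FL cH \<eta>]
  show ?thesis
    unfolding strong_grad_def
  proof (intro conjI L allI impI)
    fix e :: real assume e: "e > 0"
    have "\<forall>i. \<exists>a>0. \<forall>\<phi>\<in>L2 \<Omega>. L2_norm \<Omega> (\<lambda>x. w x - \<phi> x) < a \<longrightarrow>
        L2_norm \<Omega> (\<lambda>x. (cos (w x / M) - cos (\<phi> x / M)) * H x $ i) < e / (4 * B) / 3"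
    proof
      fix i
      have "(\<lambda>x. H x $ i) \<in> L2 \<Omega>" using HL by (simp add: L2_vec_iff)
      then show "\<exists>a>0. \<forall>\<phi>\<in>L2 \<Omega>. L2_norm \<Omega> (\<lambda>x. w x - \<phi> x) < a \<longrightarrow>
        L2_norm \<Omega> (\<lambda>x. (cos (w x / M) - cos (\<phi> x / M)) * H x $ i) < e / (4 * B) / 3"
        using e B M by (intro cos_mult_continuity[OF wL]) auto
    qed
    then obtain a where "\<forall>i. a i > 0 \<and> (\<forall>\<phi>\<in>L2 \<Omega>. L2_norm \<Omega> (\<lambda>x. w x - \<phi> x) < a i \<longrightarrow>
        L2_norm \<Omega> (\<lambda>x. (cos (w x / M) - cos (\<phi> x / M)) * H x $ i) < e / (4 * B) / 3)"
      unfolding choice_iff by (elim exE)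
    then have a: "\<And>i. a i > 0"
      "\<And>i \<phi>. \<phi> \<in> L2 \<Omega> \<Longrightarrow> L2_norm \<Omega> (\<lambda>x. w x - \<phi> x) < a i \<Longrightarrow>
        L2_norm \<Omega> (\<lambda>x. (cos (w x / M) - cos (\<phi> x / M)) * H x $ i) < e / (4 * B) / 3"
      by blast+
    define b where "b = min (Min (range a)) (min (e / (4 * B)) (e / (4 * B')))"
    have b: "b > 0" "b \<le> e / (4 * B)" "b \<le> e / (4 * B')" using a(1) e B B' by (auto simp: b_def)
    have ba: "b \<le> a i" for i unfolding b_def by (intro min.coboundedI1 Min_le) auto
    have bB: "B * b \<le> e / 4" "B' * b \<le> e / 4" using b B B' by (auto simp: field_simps)
    obtain \<phi> where \<phi>: "\<phi> \<in> Cinf0 \<gamma> \<Omega>" "L2_norm \<Omega> (\<lambda>x. w x - \<phi> x) < b" "L2_norm \<Omega> (\<lambda>x. H x - grad \<phi> x) < b"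
      using w b(1) unfolding strong_grad_def by blast
    have \<phi>s: "smooth \<phi>" and \<phi>L: "\<phi> \<in> L2 \<Omega>" and g\<phi>L: "grad \<phi> \<in> L2 \<Omega>"
      using \<phi>(1) by (auto simp: Cinf0_smooth Cinf0_L2 Cinf0_grad_L2)
    note [measurable] = L2_measurable[OF \<phi>L] L2_measurable[OF g\<phi>L] smooth_measurable[OF \<eta>]
      L2_measurable[OF smooth_grad_L2[OF \<eta>]]
    note Fs = smooth_M_sin[OF \<phi>s M]
    let ?\<psi> = "\<lambda>x. \<eta> x * ?F (\<phi> x)"
    have "?\<psi> \<in> Cinf0 \<gamma> \<Omega>"
    proof (rule Cinf0_mult[OF _ \<eta>])
      have "apart {x\<in>\<Omega>. ?F (\<phi> x) \<noteq> 0} \<gamma>"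
        by (rule apart_mono[of "{x\<in>\<Omega>. \<phi> x \<noteq> 0}" \<gamma>]) (use \<phi>(1) in \<open>auto simp: Cinf0_iff\<close>)
      then show "(\<lambda>x. ?F (\<phi> x)) \<in> Cinf0 \<gamma> \<Omega>" using Fs(1) by (simp add: Cinf0_iff)
    qed
    moreover have "L2_norm \<Omega> (\<lambda>x. \<eta> x * ?F (w x) - ?\<psi> x) < e"
    proof -
      have "L2_norm \<Omega> (\<lambda>x. \<eta> x * ?F (w x) - ?\<psi> x) \<le> B * L2_norm \<Omega> (\<lambda>x. w x - \<phi> x)"
      proof (rule L2_bounded_by(2)[OF _ L2_diff[OF wL \<phi>L]])
        show "norm (\<eta> x * ?F (w x) - ?\<psi> x) \<le> B * norm (w x - \<phi> x)" if "x \<in> \<Omega>" for x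
        proof -
          have "norm (\<eta> x * ?F (w x) - ?\<psi> x) = \<bar>\<eta> x\<bar> * \<bar>?F (w x) - ?F (\<phi> x)\<bar>"
            by (simp only: real_norm_def abs_mult[symmetric] right_diff_distrib)
          also have "\<dots> \<le> B * \<bar>w x - \<phi> x\<bar>"
            using B(2)[OF that] M_sin_lipschitz[OF M] B(1) by (intro mult_mono) auto
          finally show ?thesis by simp
        qed
      qed (use B in auto)
      also have "\<dots> \<le> B * b" using \<phi>(2) B by (intro mult_left_mono) auto
      finally show ?thesis using bB e by linarith
    qed
    moreover have "L2_norm \<Omega> (\<lambda>x. (\<eta> x *\<^sub>R (cos (w x / M) *\<^sub>R H x) + ?F (w x) *\<^sub>R grad \<eta> x) - grad ?\<psi> x) < e"
    proof -
      let ?c = "\<lambda>x. cos (w x / M) - cos (\<phi> x / M)"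
      \<comment> \<open>The error is split into the replacement of \<open>H\<close> by the gradient
        of \<phi>, of the cosine of w by that of \<phi>, and of the factor in front of the gradient
        of \<eta>. The middle term is the one that needs \<open>cos_mult_continuity\<close>.\<close>
      let ?t1 = "\<lambda>x. \<eta> x *\<^sub>R (cos (\<phi> x / M) *\<^sub>R (H x - grad \<phi> x))"
      let ?t2 = "\<lambda>x. \<eta> x *\<^sub>R (?c x *\<^sub>R H x)"
      let ?t3 = "\<lambda>x. (?F (w x) - ?F (\<phi> x)) *\<^sub>R grad \<eta> x"
      have eq: "(\<eta> x *\<^sub>R (cos (w x / M) *\<^sub>R H x) + ?F (w x) *\<^sub>R grad \<eta> x) - grad ?\<psi> x = ?t1 x + (?t2 x + ?t3 x)" for x
        unfolding grad_mult[OF \<eta> Fs(1)] Fs(2) by (simp add: algebra_simps)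
      have HgL: "(\<lambda>x. H x - grad \<phi> x) \<in> L2 \<Omega>" by (rule L2_diff[OF HL g\<phi>L])
      have wgL: "(\<lambda>x. w x - \<phi> x) \<in> L2 \<Omega>" by (rule L2_diff[OF wL \<phi>L])
      have le1: "norm (?t1 x) \<le> B * norm (H x - grad \<phi> x)" if "x \<in> \<Omega>" for x
      proof -
        have "\<bar>\<eta> x\<bar> * (\<bar>cos (\<phi> x / M)\<bar> * norm (H x - grad \<phi> x)) \<le> B * (1 * norm (H x - grad \<phi> x))"
          using B that by (intro mult_mono) auto
        then show ?thesis by (simp add: abs_mult mult.assoc)
      qed
      have m1: "?t1 \<in> borel_measurable (lebesgue_on \<Omega>)" by measurable
      note 1 = L2_bounded_by[OF m1 HgL le1 less_imp_le[OF B(1)]]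
      have cHL: "(\<lambda>x. ?c x *\<^sub>R H x) \<in> L2 \<Omega>"
      proof (rule L2_mult_bounded(1)[OF HL, of _ 2])
        show "\<bar>?c x\<bar> \<le> 2" for x
          using abs_cos_le_one[of "w x / M"] abs_cos_le_one[of "\<phi> x / M"] by linarith
      qed auto
      have "L2_norm \<Omega> (\<lambda>x. ?c x *\<^sub>R H x) \<le> (\<Sum>i\<in>UNIV. L2_norm \<Omega> (\<lambda>x. (?c x *\<^sub>R H x) $ i))"
        by (rule L2_norm_vec_le[OF cHL])
      also have "\<dots> < (\<Sum>i\<in>(UNIV::3 set). e / (4 * B) / 3)"
        using a(2)[OF \<phi>L] \<phi>(2) ba by (intro sum_strict_mono) (auto intro: less_le_trans)
      also have "\<dots> = e / (4 * B)" by simp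
      finally have c2: "L2_norm \<Omega> (\<lambda>x. ?c x *\<^sub>R H x) < e / (4 * B)" .
      note 2 = L2_mult_bounded[OF cHL smooth_measurable[OF \<eta>] B(2) less_imp_le[OF B(1)]]
      have le3: "norm (?t3 x) \<le> B' * norm (w x - \<phi> x)" if "x \<in> \<Omega>" for x
      proof -
        have "\<bar>?F (w x) - ?F (\<phi> x)\<bar> * norm (grad \<eta> x) \<le> \<bar>w x - \<phi> x\<bar> * B'"
          using B'(2)[OF that] by (intro mult_mono M_sin_lipschitz M) auto
        then show ?thesis by (simp add: mult.commute)
      qed
      have m3: "?t3 \<in> borel_measurable (lebesgue_on \<Omega>)" by measurable
      note 3 = L2_bounded_by[OF m3 wgL le3 less_imp_le[OF B'(1)]]
      have "L2_norm \<Omega> (\<lambda>x. ?t1 x + (?t2 x + ?t3 x)) \<le> L2_norm \<Omega> ?t1 + L2_norm \<Omega> (\<lambda>x. ?t2 x + ?t3 x)"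
        by (rule L2_norm_triangle[OF 1(1) L2_add[OF 2(1) 3(1)]])
      also have "L2_norm \<Omega> (\<lambda>x. ?t2 x + ?t3 x) \<le> L2_norm \<Omega> ?t2 + L2_norm \<Omega> ?t3"
        by (rule L2_norm_triangle[OF 2(1) 3(1)])
      finally have sum3: "L2_norm \<Omega> (\<lambda>x. ?t1 x + (?t2 x + ?t3 x)) \<le> L2_norm \<Omega> ?t1 + (L2_norm \<Omega> ?t2 + L2_norm \<Omega> ?t3)"
        by simp
      have "L2_norm \<Omega> ?t1 \<le> B * b"
        using 1(2) mult_left_mono[OF less_imp_le[OF \<phi>(3)] less_imp_le[OF B(1)]] by linarith
      moreover have "L2_norm \<Omega> ?t2 \<le> e / 4"
      proof -
        have "B * L2_norm \<Omega> (\<lambda>x. ?c x *\<^sub>R H x) \<le> B * (e / (4 * B))"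
          using c2 B(1) by (intro mult_left_mono) auto
        then show ?thesis using 2(2) B(1) by simp
      qed
      moreover have "L2_norm \<Omega> ?t3 \<le> B' * b"
        using 3(2) mult_left_mono[OF less_imp_le[OF \<phi>(2)] less_imp_le[OF B'(1)]] by linarith
      ultimately show ?thesis unfolding eq using sum3 bB e by linarith
    qed
    ultimately show "\<exists>\<psi>\<in>Cinf0 \<gamma> \<Omega>. L2_norm \<Omega> (\<lambda>x. \<eta> x * ?F (w x) - \<psi> x) < e \<and>
        L2_norm \<Omega> (\<lambda>x. (\<eta> x *\<^sub>R (cos (w x / M) *\<^sub>R H x) + ?F (w x) *\<^sub>R grad \<eta> x) - grad \<psi> x) < e"
      by (intro bexI[of _ ?\<psi>] conjI)
  qed
qed

text \<open>Since \<eta> stands outside the sine, \<open>strong_grad_M_sin\<close> cannot be applied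
  to the product of \<eta> and u. A second cutoff \<theta> vanishes closer to \<open>S\<close> and
  equals 1 wherever \<eta> can be nonzero, its transition lying between \<delta>/10 and \<delta>/2;
  the sine is applied to the product of \<theta> and u and then multiplied by \<eta>.\<close>

lemma strong_grad_truncate:
  assumes S: "bounded S" "S \<noteq> {}"
    and away: "\<And>\<eta> \<delta>. smooth \<eta> \<Longrightarrow> \<delta> > 0 \<Longrightarrow> (\<And>x. infdist x S < \<delta> \<Longrightarrow> \<eta> x = 0) \<Longrightarrow>
      strong_grad \<gamma> \<Omega> (\<lambda>x. \<eta> x * u x) (\<lambda>x. \<eta> x *\<^sub>R G x + u x *\<^sub>R grad \<eta> x)"
    and M: "M > 0" and \<eta>: "smooth \<eta>" "\<delta> > 0" "\<And>x. infdist x S < \<delta> \<Longrightarrow> \<eta> x = 0"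
  shows "strong_grad \<gamma> \<Omega> (\<lambda>x. \<eta> x * (M * sin (u x / M)))
    (\<lambda>x. \<eta> x *\<^sub>R (cos (u x / M) *\<^sub>R G x) + (M * sin (u x / M)) *\<^sub>R grad \<eta> x)"
proof -
  have d5: "\<delta> / 5 > 0" using \<eta>(2) by simp
  obtain \<kappa> where \<kappa>: "smooth \<kappa>" "\<And>x. infdist x S < \<delta> / 5 / 2 \<Longrightarrow> \<kappa> x = 1"
      "\<And>x. 5 * (\<delta> / 5) / 2 < infdist x S \<Longrightarrow> \<kappa> x = 0"
    using ex_cutoff[OF S d5] by auto
  define \<theta> where "\<theta> = (\<lambda>x. 1 - \<kappa> x)"
  have \<theta>s: "smooth \<theta>" unfolding \<theta>_def by (intro smooth_diff smooth_const \<kappa>)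
  define w where "w = (\<lambda>x. \<theta> x * u x)"
  define H where "H = (\<lambda>x. \<theta> x *\<^sub>R G x + u x *\<^sub>R grad \<theta> x)"
  have "strong_grad \<gamma> \<Omega> w H"
    unfolding w_def H_def by (rule away[OF \<theta>s, of "\<delta> / 5 / 2"]) (use \<eta>(2) \<kappa>(2) in \<open>auto simp: \<theta>_def\<close>)
  from strong_grad_M_sin[OF this \<eta>(1) M]
  have *: "strong_grad \<gamma> \<Omega> (\<lambda>x. \<eta> x * (M * sin (w x / M)))
    (\<lambda>x. \<eta> x *\<^sub>R (cos (w x / M) *\<^sub>R H x) + (M * sin (w x / M)) *\<^sub>R grad \<eta> x)" .
  have zero: "\<eta> x = 0 \<and> grad \<eta> x = 0" if "infdist x S < \<delta>" for x
  proof -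
    have "open {x. infdist x S < \<delta>}" by (intro open_Collect_less continuous_intros)
    then have "pderiv3 i \<eta> x = 0" for i
      using pderiv3_cong_open(1)[of "{x. infdist x S < \<delta>}" x \<eta> "\<lambda>x. 0" i] \<eta>(3) that by simp
    then show ?thesis using \<eta>(3)[OF that] by (simp add: vec_eq_iff)
  qed
  have same: "w x = u x \<and> H x = G x" if "\<delta> / 2 < infdist x S" for x
  proof -
    have th1: "\<theta> y = 1" if "\<delta> / 2 < infdist y S" for y using \<kappa>(3)[of y] that by (simp add: \<theta>_def)
    have "open {x. \<delta> / 2 < infdist x S}" by (intro open_Collect_less continuous_intros)
    then have "pderiv3 i \<theta> x = 0" for i
      using pderiv3_cong_open(1)[of "{x. \<delta> / 2 < infdist x S}" x \<theta> "\<lambda>x. 1" i] th1 that by simp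
    then show ?thesis using th1[OF that] by (simp add: w_def H_def vec_eq_iff)
  qed
  have cases: "(w x = u x \<and> H x = G x) \<or> (\<eta> x = 0 \<and> grad \<eta> x = 0)" for x
    using zero[of x] same[of x] \<eta>(2) by (cases "infdist x S < \<delta>") auto
  have e1: "\<eta> x * (M * sin (w x / M)) = \<eta> x * (M * sin (u x / M))" for x
    using cases[of x] by auto
  have e2: "\<eta> x *\<^sub>R (cos (w x / M) *\<^sub>R H x) + (M * sin (w x / M)) *\<^sub>R grad \<eta> x
      = \<eta> x *\<^sub>R (cos (u x / M) *\<^sub>R G x) + (M * sin (u x / M)) *\<^sub>R grad \<eta> x" for x
    using cases[of x] by auto
  from * show ?thesis unfolding e1 e2 .
qed

section \<open>Cutoffs of small energy near a set of codimension two\<close>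

lemma L2_norm_sq_support_le:
  assumes f: "f \<in> L2 \<Omega>" and A: "A \<in> lmeasurable" and b: "\<And>x. \<bar>f x\<bar> \<le> b" "\<And>x. f x \<noteq> 0 \<Longrightarrow> x \<in> A"
  shows "(L2_norm \<Omega> f)\<^sup>2 \<le> b\<^sup>2 * measure lebesgue A"
proof -
  have "(L2_norm \<Omega> f)\<^sup>2 = (\<integral>x. (if x \<in> \<Omega> then (norm (f x))\<^sup>2 else 0) \<partial>lebesgue)"
    unfolding L2_norm_sq by (rule Lebesgue_Measure.integral_restrict_UNIV[OF sets_\<Omega>, symmetric])
  also have "\<dots> \<le> (\<integral>x. b\<^sup>2 * indicator A x \<partial>lebesgue)"
  proof (rule integral_mono_AE')
    show "integrable lebesgue (\<lambda>x. b\<^sup>2 * indicat_real A x)"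
      using A by (intro integrable_mult_right integrable_real_indicator) (auto simp: fmeasurable_def)
    show "AE x in lebesgue. (if x \<in> \<Omega> then (norm (f x))\<^sup>2 else 0) \<le> b\<^sup>2 * indicator A x"
    proof (rule AE_I2)
      fix x
      have "\<bar>f x\<bar>\<^sup>2 \<le> b\<^sup>2" by (intro power_mono b(1)) auto
      then show "(if x \<in> \<Omega> then (norm (f x))\<^sup>2 else 0) \<le> b\<^sup>2 * indicator A x"
        using b(2)[of x] by (cases "f x = 0") (auto simp: indicator_def)
    qed
  qed auto
  also have "\<dots> = b\<^sup>2 * measure lebesgue A" using A by (simp add: fmeasurableD)
  finally show ?thesis .
qed

lemma sum_square_disjoint:
  fixes a :: "'i \<Rightarrow> real"
  assumes "finite J" "\<And>j k. j \<in> J \<Longrightarrow> k \<in> J \<Longrightarrow> j \<noteq> k \<Longrightarrow> a j * a k = 0"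
  shows "(\<Sum>j\<in>J. a j)\<^sup>2 = (\<Sum>j\<in>J. (a j)\<^sup>2)"
proof -
  have "(\<Sum>j\<in>J. a j)\<^sup>2 = (\<Sum>j\<in>J. \<Sum>k\<in>J. a j * a k)" by (simp add: power2_eq_square sum_product)
  also have "\<dots> = (\<Sum>j\<in>J. \<Sum>k\<in>J. if k = j then (a j)\<^sup>2 else 0)"
    using assms by (intro sum.cong refl) (auto simp: power2_eq_square)
  also have "\<dots> = (\<Sum>j\<in>J. (a j)\<^sup>2)" using assms(1) by simp
  finally show ?thesis .
qed

text \<open>The tube condition says that \<open>S\<close> has codimension two. The cutoffs average \<open>N\<close> steps across
  disjoint shells around \<open>S\<close>; each step has bounded Dirichlet energy, so the average has
  energy of order \<open>1 / N\<close>.\<close>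

lemma ex_capacity_cutoffs:
  assumes S: "bounded S" "S \<noteq> {}"
    and tube: "\<And>r. 0 < r \<Longrightarrow> r \<le> 1 \<Longrightarrow> measure lebesgue {x::real^3. infdist x S < r} \<le> C * r\<^sup>2"
  shows "\<exists>\<eta> :: nat \<Rightarrow> real^3 \<Rightarrow> real. (\<forall>n. smooth (\<eta> n) \<and> (\<forall>x. 0 \<le> \<eta> n x \<and> \<eta> n x \<le> 1) \<and>
      (\<exists>\<delta>>0. \<forall>x. infdist x S < \<delta> \<longrightarrow> \<eta> n x = 0)) \<and>
    (\<forall>x. 0 < infdist x S \<longrightarrow> (\<lambda>n. \<eta> n x) \<longlonglongrightarrow> 1) \<and>
    (\<forall>i. (\<lambda>n. L2_norm \<Omega> (pderiv3 i (\<eta> n))) \<longlonglongrightarrow> 0)"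
proof -
  \<comment> \<open>The j-th step varies only at distances between d/2 and 5d/2 from
    \<open>S\<close>. The ratio 1/8 makes these shells disjoint, as 5/16 < 1/2.\<close>
  define d where "d j = (1/8::real) ^ j" for j :: nat
  have dpos: "d j > 0" for j by (simp add: d_def)
  have "\<forall>j. \<exists>\<kappa>. smooth \<kappa> \<and> (\<forall>x. 0 \<le> \<kappa> x \<and> \<kappa> x \<le> 1) \<and> (\<forall>x. infdist x S < d j / 2 \<longrightarrow> \<kappa> x = 1) \<and>
    (\<forall>x. 5 * d j / 2 < infdist x S \<longrightarrow> \<kappa> x = 0) \<and> (\<forall>i x. \<bar>pderiv3 i \<kappa> x\<bar> \<le> 1 / d j)"
    using ex_cutoff[OF S dpos] by blast
  then obtain c where "\<forall>j. smooth (c j) \<and> (\<forall>x. 0 \<le> c j x \<and> c j x \<le> 1) \<and> (\<forall>x. infdist x S < d j / 2 \<longrightarrow> c j x = 1) \<and>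
    (\<forall>x. 5 * d j / 2 < infdist x S \<longrightarrow> c j x = 0) \<and> (\<forall>i x. \<bar>pderiv3 i (c j) x\<bar> \<le> 1 / d j)"
    unfolding choice_iff by (elim exE)
  then have c: "\<And>j. smooth (c j)" "\<And>j x. 0 \<le> c j x" "\<And>j x. c j x \<le> 1" "\<And>j x. infdist x S < d j / 2 \<Longrightarrow> c j x = 1"
      "\<And>j x. 5 * d j / 2 < infdist x S \<Longrightarrow> c j x = 0" "\<And>j i x. \<bar>pderiv3 i (c j) x\<bar> \<le> 1 / d j" by simp_all
  have shell: "d j / 2 \<le> infdist x S \<and> infdist x S \<le> 5 * d j / 2" if "pderiv3 i (c j) x \<noteq> 0" for i j x
  proof -
    have "open {x. infdist x S < d j / 2}" "open {x. 5 * d j / 2 < infdist x S}"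
      by (intro open_Collect_less continuous_intros)+
    then have "pderiv3 i (c j) x = 0" if "infdist x S < d j / 2 \<or> 5 * d j / 2 < infdist x S"
      using pderiv3_cong_open(1)[of "{x. infdist x S < d j / 2}" x "c j" "\<lambda>x. 1" i]
        pderiv3_cong_open(1)[of "{x. 5 * d j / 2 < infdist x S}" x "c j" "\<lambda>x. 0" i] c(4,5) that by auto
    with that show ?thesis by force
  qed
  have disj: "pderiv3 i (c j) x * pderiv3 i (c k) x = 0" if "j \<noteq> k" for i j k x
  proof -
    have *: "pderiv3 i (c j) x = 0 \<or> pderiv3 i (c k) x = 0" if "j < k" for j k
    proof (rule ccontr)
      assume "\<not> ?thesis"
      then have "d j / 2 \<le> infdist x S" "infdist x S \<le> 5 * d k / 2" using shell by blast+
      moreover have "d k \<le> d (Suc j)" unfolding d_def using that by (intro power_decreasing) auto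
      then have "d k \<le> d j / 8" by (simp add: d_def)
      ultimately show False using dpos[of j] by linarith
    qed
    show ?thesis using *[of j k] *[of k j] that by (cases "j < k") auto
  qed
  \<comment> \<open>These are the n + 1 indices from n + 1 to 2n + 1. Starting beyond n lets the
    region where \<open>\<eta> n\<close> differs from 1 shrink to \<open>S\<close>, and j \<ge> 1
    keeps 3 d below 1, the range of the tube bound.\<close>
  define J where "J n = {Suc n..<2 * Suc n}" for n
  have J: "finite (J n)" "card (J n) = Suc n" for n by (simp_all add: J_def)
  define \<eta> where "\<eta> n x = 1 - (1 / real (Suc n)) * (\<Sum>j\<in>J n. c j x)" for n x
  have sm: "smooth (\<eta> n)" for n
    unfolding \<eta>_def by (intro smooth_diff smooth_const smooth_cmult smooth_sum c)
  have sum01: "0 \<le> (\<Sum>j\<in>J n. c j x)" "(\<Sum>j\<in>J n. c j x) \<le> real (Suc n)" for n x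
    using sum_nonneg[of "J n" "\<lambda>j. c j x"] sum_bounded_above[of "J n" "\<lambda>j. c j x" 1] c(2,3) J(2)[of n] by auto
  have b01: "0 \<le> \<eta> n x" "\<eta> n x \<le> 1" for n x
  proof -
    have "(1 / real (Suc n)) * (\<Sum>j\<in>J n. c j x) \<le> (1 / real (Suc n)) * real (Suc n)"
      by (intro mult_left_mono sum01) auto
    then show "0 \<le> \<eta> n x" by (simp add: \<eta>_def)
    have "0 \<le> (1 / real (Suc n)) * (\<Sum>j\<in>J n. c j x)" by (intro mult_nonneg_nonneg sum01) auto
    then show "\<eta> n x \<le> 1" by (simp add: \<eta>_def)
  qed
  have zero: "\<exists>\<delta>>0. \<forall>x. infdist x S < \<delta> \<longrightarrow> \<eta> n x = 0" for n
  proof (intro exI conjI allI impI)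
    show "d (2 * Suc n) / 2 > 0" using dpos by simp
    fix x assume x: "infdist x S < d (2 * Suc n) / 2"
    have "c j x = 1" if "j \<in> J n" for j
    proof -
      have "d (2 * Suc n) \<le> d j" unfolding d_def using that by (intro power_decreasing) (auto simp: J_def)
      then show ?thesis using x by (intro c(4)) linarith
    qed
    then have "(\<Sum>j\<in>J n. c j x) = real (Suc n)" using J by simp
    then show "\<eta> n x = 0" by (simp add: \<eta>_def)
  qed
  have lim: "(\<lambda>n. \<eta> n x) \<longlonglongrightarrow> 1" if x: "0 < infdist x S" for x
  proof (rule tendsto_eventually)
    have "(\<lambda>n. 5 * d n / 2) \<longlonglongrightarrow> 5 * 0 / 2"
      unfolding d_def by (intro tendsto_intros LIMSEQ_power_zero) auto
    then have "eventually (\<lambda>n. 5 * d n / 2 < infdist x S) sequentially"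
      using x by (intro order_tendstoD(2)) auto
    then obtain N where N: "\<And>n. n \<ge> N \<Longrightarrow> 5 * d n / 2 < infdist x S" by (auto simp: eventually_sequentially)
    have "\<eta> n x = 1" if "n \<ge> N" for n
    proof -
      have "c j x = 0" if "j \<in> J n" for j
        using \<open>n \<ge> N\<close> that by (intro c(5) N) (auto simp: J_def)
      then show ?thesis by (simp add: \<eta>_def)
    qed
    then show "eventually (\<lambda>n. \<eta> n x = 1) sequentially" by (auto simp: eventually_sequentially)
  qed
  have grad: "(L2_norm \<Omega> (pderiv3 i (\<eta> n)))\<^sup>2 \<le> 9 * C * inverse (real (Suc n))" for n i
  proof -
    have pd: "pderiv3 i (\<eta> n) x = - (1 / real (Suc n)) * (\<Sum>j\<in>J n. pderiv3 i (c j) x)" for x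
    proof -
      have s1: "smooth (\<lambda>x. \<Sum>j\<in>J n. c j x)" by (intro smooth_sum c)
      have "pderiv3 i (\<eta> n) x = pderiv3 i (\<lambda>x. 1) x - pderiv3 i (\<lambda>x. 1 / real (Suc n) * (\<Sum>j\<in>J n. c j x)) x"
        unfolding \<eta>_def
        by (rule pderiv3_diff[OF smooth_differentiable[OF smooth_const] smooth_differentiable[OF smooth_cmult[OF s1]]])
      also have "pderiv3 i (\<lambda>x. 1 / real (Suc n) * (\<Sum>j\<in>J n. c j x)) x
          = 1 / real (Suc n) * pderiv3 i (\<lambda>x. \<Sum>j\<in>J n. c j x) x"
        by (rule pderiv3_cmult[OF smooth_differentiable[OF s1]])
      also have "pderiv3 i (\<lambda>x. \<Sum>j\<in>J n. c j x) x = (\<Sum>j\<in>J n. pderiv3 i (c j) x)"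
        by (rule pderiv3_sum) (rule c(1))
      finally show ?thesis by simp
    qed
    \<comment> \<open>On disjoint shells the cross terms vanish and the squares add up; the
      prefactor 1/(n+1)^2 against n + 1 summands will leave 1/(n+1).\<close>
    have sq: "(pderiv3 i (\<eta> n) x)\<^sup>2 = (1 / real (Suc n))\<^sup>2 * (\<Sum>j\<in>J n. (pderiv3 i (c j) x)\<^sup>2)" for x
      unfolding pd power_mult_distrib using sum_square_disjoint[OF J(1), of n "\<lambda>j. pderiv3 i (c j) x"] disj
      by simp
    have pL: "pderiv3 i (c j) \<in> L2 \<Omega>" for j by (intro smooth_L2 smooth_pderiv3 c)
    \<comment> \<open>The squared derivative is at most 1/d^2 on a tube of volume at most C (3d)^2,
      so the scale cancels: codimension two is exactly what is needed.\<close>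
    have cj: "(L2_norm \<Omega> (pderiv3 i (c j)))\<^sup>2 \<le> 9 * C" if "j \<in> J n" for j
    proof -
      let ?A = "{x. infdist x S < 3 * d j}"
      have "open ?A" by (intro open_Collect_less continuous_intros)
      moreover have "bounded ?A"
      proof -
        obtain R where R: "\<And>y. y \<in> S \<Longrightarrow> norm y \<le> R" using S(1) bounded_iff by blast
        have "norm x \<le> R + 3 * d j" if x: "infdist x S < 3 * d j" for x
        proof -
          obtain y where "y \<in> S" "dist x y < 3 * d j"
            using infdist_less_ex[OF x S(2)] by blast
          then show ?thesis using R[of y] norm_triangle_sub[of x y] by (simp add: dist_norm)
        qed
        then show ?thesis unfolding bounded_iff by blast
      qed
      ultimately have A: "?A \<in> lmeasurable" by (intro lmeasurable_open)
      have "(L2_norm \<Omega> (pderiv3 i (c j)))\<^sup>2 \<le> (1 / d j)\<^sup>2 * measure lebesgue ?A"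
      proof (rule L2_norm_sq_support_le[OF pL A c(6)])
        fix x assume "pderiv3 i (c j) x \<noteq> 0"
        then show "x \<in> ?A" using shell[of i j x] dpos[of j] by simp
      qed
      also have "\<dots> \<le> (1 / d j)\<^sup>2 * (C * (3 * d j)\<^sup>2)"
      proof (intro mult_left_mono tube)
        have "d j \<le> d 1" unfolding d_def using that by (intro power_decreasing) (auto simp: J_def)
        then show "3 * d j \<le> 1" by (simp add: d_def)
      qed (use dpos[of j] in auto)
      also have "\<dots> = 9 * C" using dpos[of j] by (simp add: power_mult_distrib power_divide)
      finally show ?thesis .
    qed
    have "(L2_norm \<Omega> (pderiv3 i (\<eta> n)))\<^sup>2
        = (\<integral>x. (1 / real (Suc n))\<^sup>2 * (\<Sum>j\<in>J n. (norm (pderiv3 i (c j) x))\<^sup>2) \<partial>lebesgue_on \<Omega>)"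
      unfolding L2_norm_sq by (simp add: sq)
    also have "\<dots> = (1 / real (Suc n))\<^sup>2 * (\<Sum>j\<in>J n. (L2_norm \<Omega> (pderiv3 i (c j)))\<^sup>2)"
      unfolding L2_norm_sq using L2_integrable_sq[OF pL] by (simp add: Bochner_Integration.integral_sum)
    also have "\<dots> \<le> (1 / real (Suc n))\<^sup>2 * (\<Sum>j\<in>J n. 9 * C)"
      by (intro mult_left_mono sum_mono cj) auto
    also have "\<dots> = 9 * C * inverse (real (Suc n))"
    proof -
      have "(1 / N)\<^sup>2 * (N * (9 * C)) = 9 * C * inverse N" if "N \<noteq> 0" for N :: real
        using that by (simp add: power2_eq_square field_simps)
      from this[of "real (Suc n)"] show ?thesis using J(2)[of n] by (simp only: sum_constant)
    qed
    finally show ?thesis .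
  qed
  have "(\<lambda>n. L2_norm \<Omega> (pderiv3 i (\<eta> n))) \<longlonglongrightarrow> 0" for i
  proof -
    have "(\<lambda>n. 9 * C * inverse (real (Suc n))) \<longlonglongrightarrow> 9 * C * 0"
      by (intro tendsto_mult tendsto_const LIMSEQ_inverse_real_of_nat)
    then have lim9: "(\<lambda>n. 9 * C * inverse (real (Suc n))) \<longlonglongrightarrow> 0" by simp
    have "(\<lambda>n. (L2_norm \<Omega> (pderiv3 i (\<eta> n)))\<^sup>2) \<longlonglongrightarrow> 0"
      by (rule tendsto_sandwich[OF _ _ tendsto_const lim9]) (use grad in \<open>auto intro!: always_eventually simp del: of_nat_Suc\<close>)
    from tendsto_real_sqrt[OF this] show ?thesis by simp
  qed
  then show ?thesis using sm b01 zero lim by (intro exI[of _ \<eta>]) auto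
qed


lemma strong_grad_const_one:
  assumes "strong_grad \<gamma> \<Omega> (\<lambda>x. 1 * u x) (\<lambda>x. 1 *\<^sub>R G x + u x *\<^sub>R grad (\<lambda>x. 1) x)"
  shows "strong_grad \<gamma> \<Omega> u G"
proof -
  have "grad (\<lambda>x. 1) x = 0" for x by (simp add: vec_eq_iff)
  with assms show ?thesis by simp
qed

text \<open>Without an interface the local results are glued over the closure of \<Omega>. Otherwise
  gluing handles u times a cutoff \<eta> vanishing near the interface; removing \<eta> leaves u
  times the gradient of \<eta> as an error, which is controlled only for bounded functions. So the
  cutoffs are removed for M sin(u/M) with M fixed, and M tends to infinity afterwards.\<close>

theorem weak_grad_imp_strong_grad:
  assumes lip: "lipschitz_boundary \<Omega>" and \<gamma>: "\<gamma>t \<subseteq> frontier \<Omega>" "\<gamma>n \<subseteq> frontier \<Omega>"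
    and tube: "closure \<gamma>t \<inter> closure \<gamma>n \<noteq> {} \<Longrightarrow> \<exists>C. \<forall>r. 0 < r \<longrightarrow> r \<le> 1 \<longrightarrow>
      measure lebesgue {x. infdist x (closure \<gamma>t \<inter> closure \<gamma>n) < r} \<le> C * r\<^sup>2"
    and W: "weak_grad_on (Cinf0 \<gamma>n \<Omega>) \<Omega> u G"
  shows "strong_grad \<gamma>t \<Omega> u G"
proof (cases "closure \<gamma>t \<inter> closure \<gamma>n = {}")
  case True
  note loc = strong_grad_local[OF lip \<gamma> W]
  have "strong_grad \<gamma>t \<Omega> (\<lambda>x. (\<lambda>x. 1) x * u x) (\<lambda>x. (\<lambda>x. 1) x *\<^sub>R G x + u x *\<^sub>R grad (\<lambda>x. 1) x)"
  proof (rule strong_grad_partition[of "closure \<Omega>"])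
    show "compact (closure \<Omega>)" using bounded_\<Omega> by simp
    show "{x\<in>\<Omega>. (1::real) \<noteq> 0} \<subseteq> closure \<Omega>" using closure_subset by auto
  qed (use loc True in auto)
  then show ?thesis using strong_grad_const_one by simp
next
  case False
  define S where "S = closure \<gamma>t \<inter> closure \<gamma>n"
  have S: "S \<noteq> {}" "closed S" using False by (auto simp: S_def)
  have "bounded (frontier \<Omega>)" using bounded_closure[OF bounded_\<Omega>] by (rule bounded_subset) (auto simp: frontier_def)
  then have Sb: "bounded S" unfolding S_def using \<gamma>(1) by (meson bounded_Int bounded_closure bounded_subset)
  obtain C where C: "\<And>r. 0 < r \<Longrightarrow> r \<le> 1 \<Longrightarrow> measure lebesgue {x. infdist x S < r} \<le> C * r\<^sup>2"
    using tube[OF False] unfolding S_def by blast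
  have L: "u \<in> L2 \<Omega>" "G \<in> L2 \<Omega>" using W by (auto simp: weak_grad_on_def)
  note [measurable] = L2_measurable[OF L(1)] L2_measurable[OF L(2)]
  have infpos: "0 < infdist x S \<longleftrightarrow> x \<notin> S" for x
    using in_closed_iff_infdist_zero[OF S(2,1), of x] infdist_nonneg[of x S] by linarith
  have away: "strong_grad \<gamma>t \<Omega> (\<lambda>x. \<eta> x * u x) (\<lambda>x. \<eta> x *\<^sub>R G x + u x *\<^sub>R grad \<eta> x)"
    if \<eta>: "smooth \<eta>" "\<delta> > 0" "\<And>x. infdist x S < \<delta> \<Longrightarrow> \<eta> x = 0" for \<eta> \<delta>
  proof (rule strong_grad_partition[of "closure \<Omega> \<inter> {x. \<delta> \<le> infdist x S}"])
    have "closed {x. \<delta> \<le> infdist x S}" by (intro closed_Collect_le continuous_intros)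
    then show "compact (closure \<Omega> \<inter> {x. \<delta> \<le> infdist x S})"
      using bounded_\<Omega> by (intro compact_Int_closed) auto
    show "{x\<in>\<Omega>. \<eta> x \<noteq> 0} \<subseteq> closure \<Omega> \<inter> {x. \<delta> \<le> infdist x S}"
      using \<eta>(3) closure_subset[of \<Omega>] by force
    fix p assume p: "p \<in> closure \<Omega> \<inter> {x. \<delta> \<le> infdist x S}"
    then have "0 < infdist p S" using \<eta>(2) by auto
    then have "p \<notin> closure \<gamma>t \<inter> closure \<gamma>n" using infpos S_def by blast
    then show "\<exists>r>0. \<forall>\<zeta>. smooth \<zeta> \<and> {x. \<zeta> x \<noteq> 0} \<subseteq> ball p r \<longrightarrow>
        strong_grad \<gamma>t \<Omega> (\<lambda>x. \<zeta> x * u x) (\<lambda>x. \<zeta> x *\<^sub>R G x + u x *\<^sub>R grad \<zeta> x)"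
      using strong_grad_local[OF lip \<gamma> W] p by blast
  qed (rule \<eta>(1))
  \<comment> \<open>The tube bound forces the interface to be a null set, as the almost everywhere
    convergence of the cutoffs to 1 requires.\<close>
  have Snull: "AE x in lebesgue_on \<Omega>. x \<notin> S"
  proof -
    have Sm: "S \<in> lmeasurable" using Sb S(2) by (intro lmeasurable_compact) (simp add: compact_eq_bounded_closed)
    have Sr: "measure lebesgue S \<le> C * r\<^sup>2" if r: "0 < r" "r \<le> 1" for r
    proof -
      have "{x. infdist x S < r} \<in> lmeasurable"
      proof (rule lmeasurable_open)
        obtain R where R: "\<And>y. y \<in> S \<Longrightarrow> norm y \<le> R" using Sb bounded_iff by blast
        have "norm x \<le> R + r" if x: "infdist x S < r" for x
        proof -
          obtain y where "y \<in> S" "dist x y < r" using infdist_less_ex[OF x S(1)] by blast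
          then show ?thesis using R[of y] norm_triangle_sub[of x y] by (simp add: dist_norm)
        qed
        then show "bounded {x. infdist x S < r}" unfolding bounded_iff by blast
      qed (intro open_Collect_less continuous_intros)
      moreover have "S \<subseteq> {x. infdist x S < r}" using r by auto
      ultimately have "measure lebesgue S \<le> measure lebesgue {x. infdist x S < r}"
        using Sm by (intro measure_mono_fmeasurable) (auto simp: fmeasurableD)
      then show ?thesis using C[OF r] by linarith
    qed
    have le: "measure lebesgue S \<le> C * (inverse (real (Suc n)))\<^sup>2" for n
      by (rule Sr) (auto simp: field_simps)
    have "(\<lambda>n. C * (inverse (real (Suc n)))\<^sup>2) \<longlonglongrightarrow> C * 0\<^sup>2"
      by (intro tendsto_intros LIMSEQ_inverse_real_of_nat)
    then have "measure lebesgue S \<le> C * 0\<^sup>2" by (rule LIMSEQ_le_const) (use le in blast)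
    then have "measure lebesgue S = 0" using measure_nonneg[of lebesgue S] by simp
    then have "S \<in> null_sets lebesgue"
      using Sm by (simp add: null_sets_def fmeasurableD emeasure_eq_measure2)
    then have "AE x in lebesgue. x \<notin> S" by (rule AE_not_in)
    then have "AE x in lebesgue. x \<in> \<Omega> \<longrightarrow> x \<notin> S" by eventually_elim simp
    then show ?thesis by (simp add: AE_restrict_space_iff sets_\<Omega>)
  qed
  obtain \<eta> :: "nat \<Rightarrow> real^3 \<Rightarrow> real" where \<eta>: "\<And>n. smooth (\<eta> n)" "\<And>n x. 0 \<le> \<eta> n x" "\<And>n x. \<eta> n x \<le> 1"
      "\<And>n. \<exists>\<delta>>0. \<forall>x. infdist x S < \<delta> \<longrightarrow> \<eta> n x = 0" "\<And>x. 0 < infdist x S \<Longrightarrow> (\<lambda>n. \<eta> n x) \<longlonglongrightarrow> 1"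
      "\<And>i. (\<lambda>n. L2_norm \<Omega> (pderiv3 i (\<eta> n))) \<longlonglongrightarrow> 0"
    using ex_capacity_cutoffs[OF Sb S(1) C] by auto
  have trunc: "strong_grad \<gamma>t \<Omega> (\<lambda>x. M * sin (u x / M)) (\<lambda>x. cos (u x / M) *\<^sub>R G x)" if M: "M > 0" for M
  proof (rule strong_grad_closed)
    let ?F = "\<lambda>x. M * sin (u x / M)" and ?D = "\<lambda>x. cos (u x / M) *\<^sub>R G x"
    show FL: "?F \<in> L2 \<Omega>"
      using M_sin_lipschitz[OF M, of _ 0] by (intro L2_bounded_by(1)[OF _ L(1), of _ 1]) auto
    show DL: "?D \<in> L2 \<Omega>"
      by (rule L2_mult_bounded(1)[OF L(2), of _ 1]) auto
    have AEpt: "AE x in lebesgue_on \<Omega>. (\<lambda>n. (1 - \<eta> n x) *\<^sub>R h x) \<longlonglongrightarrow> 0" for h :: "real^3 \<Rightarrow> 'b::real_normed_vector"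
      using Snull
    proof eventually_elim
      case (elim x)
      have "(\<lambda>n. (1 - \<eta> n x) *\<^sub>R h x) \<longlonglongrightarrow> (1 - 1) *\<^sub>R h x"
        by (intro tendsto_intros \<eta>(5)) (use elim infpos in auto)
      then show ?case by simp
    qed
    have le: "norm ((1 - \<eta> n x) *\<^sub>R h) \<le> norm h" for n x and h :: "'b::real_normed_vector"
      using \<eta>(2,3)[of n x] by (simp add: mult_left_le_one_le)
    note [measurable] = smooth_measurable[OF \<eta>(1)] L2_measurable[OF FL] L2_measurable[OF DL]
    have l1: "(\<lambda>n. L2_norm \<Omega> (\<lambda>x. (1 - \<eta> n x) *\<^sub>R ?F x)) \<longlonglongrightarrow> 0"
      by (rule L2_dominated[OF _ FL le AEpt]) measurable
    have l2: "(\<lambda>n. L2_norm \<Omega> (\<lambda>x. (1 - \<eta> n x) *\<^sub>R ?D x)) \<longlonglongrightarrow> 0"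
      by (rule L2_dominated[OF _ DL le AEpt]) measurable
    have "(\<lambda>n. M * (\<Sum>i\<in>UNIV. L2_norm \<Omega> (pderiv3 i (\<eta> n)))) \<longlonglongrightarrow> M * (\<Sum>i\<in>(UNIV::3 set). 0)"
      by (intro tendsto_intros \<eta>(6))
    then have l3: "(\<lambda>n. M * (\<Sum>i\<in>UNIV. L2_norm \<Omega> (pderiv3 i (\<eta> n)))) \<longlonglongrightarrow> 0" by simp
    have gL: "grad (\<eta> n) \<in> L2 \<Omega>" for n by (rule smooth_grad_L2[OF \<eta>(1)])
    \<comment> \<open>The gradients of the cutoffs tend to 0 in L2 and the truncated function is
      bounded by \<open>M\<close>: this product is the term for which the truncation was
      introduced.\<close>
    have FgL: "(\<lambda>x. ?F x *\<^sub>R grad (\<eta> n) x) \<in> L2 \<Omega>"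
      and Fg: "L2_norm \<Omega> (\<lambda>x. ?F x *\<^sub>R grad (\<eta> n) x) \<le> M * (\<Sum>i\<in>UNIV. L2_norm \<Omega> (pderiv3 i (\<eta> n)))" for n
    proof -
      have b: "\<bar>?F x\<bar> \<le> M" for x
        using mult_left_mono[OF abs_sin_le_one[of "u x / M"], of M] M by (simp add: abs_mult)
      show "(\<lambda>x. ?F x *\<^sub>R grad (\<eta> n) x) \<in> L2 \<Omega>"
        by (rule L2_mult_bounded(1)[OF gL L2_measurable[OF FL] b]) (use M in auto)
      have "L2_norm \<Omega> (\<lambda>x. ?F x *\<^sub>R grad (\<eta> n) x) \<le> M * L2_norm \<Omega> (grad (\<eta> n))"
        by (rule L2_mult_bounded(2)[OF gL L2_measurable[OF FL] b]) (use M in auto)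
      also have "\<dots> \<le> M * (\<Sum>i\<in>UNIV. L2_norm \<Omega> (\<lambda>x. grad (\<eta> n) x $ i))"
        using M by (intro mult_left_mono L2_norm_vec_le gL) auto
      finally show "L2_norm \<Omega> (\<lambda>x. ?F x *\<^sub>R grad (\<eta> n) x) \<le> M * (\<Sum>i\<in>UNIV. L2_norm \<Omega> (pderiv3 i (\<eta> n)))"
        by simp
    qed
    fix e :: real assume e: "e > 0"
    have ev: "eventually (\<lambda>n. L2_norm \<Omega> (\<lambda>x. (1 - \<eta> n x) *\<^sub>R ?F x) < e \<and>
        L2_norm \<Omega> (\<lambda>x. (1 - \<eta> n x) *\<^sub>R ?D x) < e / 2 \<and>
        M * (\<Sum>i\<in>UNIV. L2_norm \<Omega> (pderiv3 i (\<eta> n))) < e / 2) sequentially"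
      using e by (intro eventually_conj order_tendstoD(2)[OF l1] order_tendstoD(2)[OF l2] order_tendstoD(2)[OF l3]) auto
    then obtain n where n: "L2_norm \<Omega> (\<lambda>x. (1 - \<eta> n x) *\<^sub>R ?F x) < e"
        "L2_norm \<Omega> (\<lambda>x. (1 - \<eta> n x) *\<^sub>R ?D x) < e / 2"
        "M * (\<Sum>i\<in>UNIV. L2_norm \<Omega> (pderiv3 i (\<eta> n))) < e / 2"
      using eventually_happens'[OF sequentially_bot ev] by blast
    obtain \<delta> where \<delta>: "\<delta> > 0" "\<And>x. infdist x S < \<delta> \<Longrightarrow> \<eta> n x = 0" using \<eta>(4) by blast
    have sg: "strong_grad \<gamma>t \<Omega> (\<lambda>x. \<eta> n x * ?F x) (\<lambda>x. \<eta> n x *\<^sub>R ?D x + ?F x *\<^sub>R grad (\<eta> n) x)"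
      by (rule strong_grad_truncate[OF Sb S(1) away M \<eta>(1) \<delta>])
    have d1: "(\<lambda>x. (1 - \<eta> n x) *\<^sub>R ?D x) \<in> L2 \<Omega>"
      by (rule L2_mult_bounded(1)[OF DL, of _ 1]) (use \<eta>(2,3) in \<open>auto simp: abs_le_iff\<close>)
    have "L2_norm \<Omega> (\<lambda>x. ?F x - \<eta> n x * ?F x) < e" using n(1) by (simp add: algebra_simps)
    moreover have "L2_norm \<Omega> (\<lambda>x. ?D x - (\<eta> n x *\<^sub>R ?D x + ?F x *\<^sub>R grad (\<eta> n) x)) < e"
    proof -
      have eq: "?D x - (\<eta> n x *\<^sub>R ?D x + ?F x *\<^sub>R grad (\<eta> n) x)
          = (1 - \<eta> n x) *\<^sub>R ?D x + - (?F x *\<^sub>R grad (\<eta> n) x)" for x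
        by (simp add: algebra_simps)
      show ?thesis unfolding eq
        using L2_norm_triangle[OF d1 L2_minus[OF FgL[of n]]] L2_norm_minus[of \<Omega> "\<lambda>x. ?F x *\<^sub>R grad (\<eta> n) x"] Fg[of n] n
        by linarith
    qed
    ultimately show "\<exists>v H. strong_grad \<gamma>t \<Omega> v H \<and> L2_norm \<Omega> (\<lambda>x. ?F x - v x) < e \<and> L2_norm \<Omega> (\<lambda>x. ?D x - H x) < e"
      using sg by blast
  qed
  show ?thesis
  proof (rule strong_grad_closed[OF L])
    let ?M = "\<lambda>n. real (Suc n)"
    have Minf: "(\<lambda>n. s / ?M n) \<longlonglongrightarrow> 0" for s
      using tendsto_mult[OF tendsto_const[of s] LIMSEQ_inverse_real_of_nat] by (simp add: divide_inverse)
    have cosl: "(\<lambda>n. cos (s / ?M n)) \<longlonglongrightarrow> 1" for s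
      using tendsto_cos[OF Minf[of s]] by simp
    have sinl: "(\<lambda>n. s - ?M n * sin (s / ?M n)) \<longlonglongrightarrow> 0" for s
    proof (cases "s = 0")
      case False
      have "((\<lambda>h::real. sin h / h) \<longlongrightarrow> 1) (at 0)" using DERIV_sin[of "0::real"] by (simp add: DERIV_def)
      moreover have "filterlim (\<lambda>n. s / ?M n) (at 0) sequentially"
        using Minf[of s] False by (auto simp: filterlim_at intro!: always_eventually)
      ultimately have "(\<lambda>n. sin (s / ?M n) / (s / ?M n)) \<longlonglongrightarrow> 1" by (rule filterlim_compose)
      then have "(\<lambda>n. s - s * (sin (s / ?M n) / (s / ?M n))) \<longlonglongrightarrow> s - s * 1"
        by (intro tendsto_intros)
      moreover have "s * (sin (s / ?M n) / (s / ?M n)) = ?M n * sin (s / ?M n)" for n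
        using False by (simp del: of_nat_Suc)
      ultimately show ?thesis by simp
    qed simp
    have l1: "(\<lambda>n. L2_norm \<Omega> (\<lambda>x. u x - ?M n * sin (u x / ?M n))) \<longlonglongrightarrow> 0"
    proof (rule L2_dominated[OF _ L2_scaleR[OF L(1), of 2]])
      show "norm (u x - ?M n * sin (u x / ?M n)) \<le> norm (2 *\<^sub>R u x)" for n x
        using M_sin_lipschitz[of "?M n" "u x" 0] abs_triangle_ineq4[of "u x" "?M n * sin (u x / ?M n)"]
        by (simp del: of_nat_Suc)
      show "AE x in lebesgue_on \<Omega>. (\<lambda>n. u x - ?M n * sin (u x / ?M n)) \<longlonglongrightarrow> 0"
        by (rule AE_I2) (rule sinl)
    qed measurable
    have l2: "(\<lambda>n. L2_norm \<Omega> (\<lambda>x. (1 - cos (u x / ?M n)) *\<^sub>R G x)) \<longlonglongrightarrow> 0"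
    proof (rule L2_dominated[OF _ L2_scaleR[OF L(2), of 2]])
      show "norm ((1 - cos (u x / ?M n)) *\<^sub>R G x) \<le> norm (2 *\<^sub>R G x)" for n x
      proof -
        have "\<bar>1 - cos (u x / ?M n)\<bar> \<le> 2" using abs_cos_le_one[of "u x / ?M n"] by linarith
        then show ?thesis by (simp add: mult_right_mono del: of_nat_Suc)
      qed
      show "AE x in lebesgue_on \<Omega>. (\<lambda>n. (1 - cos (u x / ?M n)) *\<^sub>R G x) \<longlonglongrightarrow> 0"
      proof (rule AE_I2)
        fix x
        have "(\<lambda>n. (1 - cos (u x / ?M n)) *\<^sub>R G x) \<longlonglongrightarrow> (1 - 1) *\<^sub>R G x" by (intro tendsto_intros cosl)
        then show "(\<lambda>n. (1 - cos (u x / ?M n)) *\<^sub>R G x) \<longlonglongrightarrow> 0" by simp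
      qed
    qed measurable
    fix e :: real assume e: "e > 0"
    have ev: "eventually (\<lambda>n. L2_norm \<Omega> (\<lambda>x. u x - ?M n * sin (u x / ?M n)) < e \<and>
        L2_norm \<Omega> (\<lambda>x. (1 - cos (u x / ?M n)) *\<^sub>R G x) < e) sequentially"
      using e by (intro eventually_conj order_tendstoD(2)[OF l1] order_tendstoD(2)[OF l2]) auto
    then obtain n where n: "L2_norm \<Omega> (\<lambda>x. u x - ?M n * sin (u x / ?M n)) < e"
        "L2_norm \<Omega> (\<lambda>x. (1 - cos (u x / ?M n)) *\<^sub>R G x) < e"
      using eventually_happens'[OF sequentially_bot ev] by blast
    have "L2_norm \<Omega> (\<lambda>x. G x - cos (u x / ?M n) *\<^sub>R G x) < e" using n(2) by (simp add: scaleR_left_diff_distrib)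
    then show "\<exists>v H. strong_grad \<gamma>t \<Omega> v H \<and> L2_norm \<Omega> (\<lambda>x. u x - v x) < e \<and> L2_norm \<Omega> (\<lambda>x. G x - H x) < e"
      using n(1) trunc[of "?M n"] by (intro exI conjI) auto
  qed
qed

end

section \<open>The volume of tubes around the interface\<close>

text \<open>At every scale r about C/r balls of radius L r suffice, so the set is no larger than a
  curve of finite length. Unlike a parametrisation, this property passes to finite unions.\<close>

definition linear_covering :: "(real^3) set \<Rightarrow> real \<Rightarrow> real \<Rightarrow> bool" where
  "linear_covering S L C \<longleftrightarrow> 0 \<le> L \<and> (\<forall>r. 0 < r \<longrightarrow> r \<le> 1 \<longrightarrow>
     (\<exists>P. finite P \<and> S \<subseteq> (\<Union>q\<in>P. cball q (L * r)) \<and> real (card P) * r \<le> C))"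

text \<open>Sampling the parameter interval with spacing r gives at most (b - a)/r + 1 centres, and
  each point lies within L r of the sample to its left; r \<le> 1 turns the extra centre into the
  summand 1.\<close>

lemma linear_covering_curve:
  fixes \<gamma> :: "real \<Rightarrow> real^3"
  assumes lip: "L-lipschitz_on {a..b} \<gamma>" and S: "S \<subseteq> \<gamma> ` {a..b}" and ab: "a \<le> b"
  shows "linear_covering S L (b - a + 1)"
  unfolding linear_covering_def
proof (intro conjI allI impI)
  have L: "0 \<le> L" using lip by (rule lipschitz_on_nonneg)
  then show "0 \<le> L" .
  fix r :: real assume r: "0 < r" "r \<le> 1"
  define N where "N = nat \<lfloor>(b - a) / r\<rfloor>"
  have fl0: "0 \<le> \<lfloor>(b - a) / r\<rfloor>" using ab r by simp
  have Nle: "real N \<le> (b - a) / r" using fl0 unfolding N_def by (simp add: of_nat_nat)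
  define P where "P = (\<lambda>k. \<gamma> (a + real k * r)) ` {..N}"
  have "S \<subseteq> (\<Union>q\<in>P. cball q (L * r))"
  proof
    fix x assume "x \<in> S"
    then obtain t where t: "t \<in> {a..b}" "x = \<gamma> t" using S by blast
    define k where "k = nat \<lfloor>(t - a) / r\<rfloor>"
    have f0: "0 \<le> \<lfloor>(t - a) / r\<rfloor>" using t r by simp
    have kr: "real k = real_of_int \<lfloor>(t - a) / r\<rfloor>" using f0 by (simp add: k_def of_nat_nat)
    have "k \<le> N" unfolding k_def N_def using t r by (intro nat_mono floor_mono divide_right_mono) auto
    have "real k \<le> (t - a) / r" "(t - a) / r < real k + 1" unfolding kr by linarith+
    then have kb: "real k * r \<le> t - a" "t - a < (real k + 1) * r" using r by (simp_all add: field_simps)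
    then have tk: "a + real k * r \<in> {a..b}" using t r by auto
    have "dist (\<gamma> (a + real k * r)) (\<gamma> t) \<le> L * dist (a + real k * r) t"
      by (rule lipschitz_onD[OF lip tk t(1)])
    also have "\<dots> \<le> L * r"
      using kb L by (intro mult_left_mono) (auto simp: dist_real_def algebra_simps)
    finally have "x \<in> cball (\<gamma> (a + real k * r)) (L * r)" using t by simp
    then show "x \<in> (\<Union>q\<in>P. cball q (L * r))" using \<open>k \<le> N\<close> by (auto simp: P_def)
  qed
  moreover have "real (card P) * r \<le> b - a + 1"
  proof -
    have "card P \<le> N + 1" unfolding P_def using card_image_le[of "{..N}" "\<lambda>k. \<gamma> (a + real k * r)"] by simp
    then have "real (card P) * r \<le> (real N + 1) * r" using r by (intro mult_right_mono) auto
    also have "\<dots> = real N * r + r" by (simp add: algebra_simps)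
    also have "\<dots> \<le> (b - a) / r * r + 1" using Nle r by (intro add_mono mult_right_mono) auto
    also have "\<dots> = b - a + 1" using r by simp
    finally show ?thesis .
  qed
  ultimately show "\<exists>P. finite P \<and> S \<subseteq> (\<Union>q\<in>P. cball q (L * r)) \<and> real (card P) * r \<le> b - a + 1"
    by (intro exI[of _ P]) (auto simp: P_def)
qed

lemma linear_covering_Un:
  assumes "linear_covering S L C" "linear_covering T L' C'"
  shows "linear_covering (S \<union> T) (max L L') (C + C')"
  unfolding linear_covering_def
proof (intro conjI allI impI)
  show "0 \<le> max L L'" using assms by (auto simp: linear_covering_def)
  fix r :: real assume r: "0 < r" "r \<le> 1"
  obtain P where P: "finite P" "S \<subseteq> (\<Union>q\<in>P. cball q (L * r))" "real (card P) * r \<le> C"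
    using assms(1) r unfolding linear_covering_def by blast
  obtain P' where P': "finite P'" "T \<subseteq> (\<Union>q\<in>P'. cball q (L' * r))" "real (card P') * r \<le> C'"
    using assms(2) r unfolding linear_covering_def by blast
  have "L * r \<le> max L L' * r" "L' * r \<le> max L L' * r" using r by (auto intro: mult_right_mono)
  then have mono: "cball q (L * r) \<subseteq> cball q (max L L' * r)" "cball q (L' * r) \<subseteq> cball q (max L L' * r)" for q :: "real^3"
    by (simp_all add: subset_cball)
  have "S \<union> T \<subseteq> (\<Union>q\<in>P \<union> P'. cball q (max L L' * r))"
  proof (rule Un_least)
    show "S \<subseteq> (\<Union>q\<in>P \<union> P'. cball q (max L L' * r))"
      by (rule order_trans[OF P(2) UN_mono[OF Un_upper1 mono(1)]])
    show "T \<subseteq> (\<Union>q\<in>P \<union> P'. cball q (max L L' * r))"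
      by (rule order_trans[OF P'(2) UN_mono[OF Un_upper2 mono(2)]])
  qed
  moreover have "real (card (P \<union> P')) * r \<le> C + C'"
  proof -
    have "real (card (P \<union> P')) * r \<le> (real (card P) + real (card P')) * r"
      using card_Un_le[of P P'] r by (intro mult_right_mono) linarith+
    then show ?thesis using P(3) P'(3) by (simp add: algebra_simps)
  qed
  ultimately show "\<exists>Q. finite Q \<and> S \<union> T \<subseteq> (\<Union>q\<in>Q. cball q (max L L' * r)) \<and> real (card Q) * r \<le> C + C'"
    using P(1) P'(1) by (intro exI[of _ "P \<union> P'"]) auto
qed

lemma linear_covering_compact:
  assumes S: "compact S"
    and loc: "\<And>p. p \<in> S \<Longrightarrow> \<exists>W L C. open W \<and> p \<in> W \<and> linear_covering (S \<inter> W) L C"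
  shows "\<exists>L C. linear_covering S L C"
proof -
  have "\<forall>p. \<exists>W. p \<in> S \<longrightarrow> open W \<and> p \<in> W \<and> (\<exists>L C. linear_covering (S \<inter> W) L C)"
  proof
    fix p
    show "\<exists>W. p \<in> S \<longrightarrow> open W \<and> p \<in> W \<and> (\<exists>L C. linear_covering (S \<inter> W) L C)"
    proof (cases "p \<in> S")
      case True
      obtain W L C where "open W" "p \<in> W" "linear_covering (S \<inter> W) L C"
        using loc[OF True] by (elim exE conjE) (rule that)
      then show ?thesis by (intro exI[of _ W]) auto
    qed simp
  qed
  then obtain W where "\<forall>p. p \<in> S \<longrightarrow> open (W p) \<and> p \<in> W p \<and> (\<exists>L C. linear_covering (S \<inter> W p) L C)"
    unfolding choice_iff by (elim exE)
  then have W: "\<And>p. p \<in> S \<Longrightarrow> open (W p)" "\<And>p. p \<in> S \<Longrightarrow> p \<in> W p"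
      "\<And>p. p \<in> S \<Longrightarrow> \<exists>L C. linear_covering (S \<inter> W p) L C" by simp_all
  have "S \<subseteq> (\<Union>p\<in>S. W p)" using W(2) by blast
  then obtain F where F: "F \<subseteq> S" "finite F" "S \<subseteq> (\<Union>p\<in>F. W p)"
    using compactE_image[OF S, of S W] W(1) by blast
  have "\<exists>L C. linear_covering (S \<inter> (\<Union>p\<in>F'. W p)) L C" if "finite F'" "F' \<subseteq> S" for F'
    using that
  proof (induction F' rule: finite_induct)
    case empty
    have "linear_covering {} 0 0" unfolding linear_covering_def by (auto intro!: exI[of _ "{}"])
    then show ?case by auto
  next
    case (insert p F')
    obtain L C where 1: "linear_covering (S \<inter> (\<Union>p\<in>F'. W p)) L C" using insert by auto
    obtain L' C' where 2: "linear_covering (S \<inter> W p) L' C'" using W(3)[of p] insert by auto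
    have "S \<inter> (\<Union>p\<in>insert p F'. W p) = (S \<inter> (\<Union>p\<in>F'. W p)) \<union> (S \<inter> W p)" by auto
    then show ?case using linear_covering_Un[OF 1 2] by auto
  qed
  from this[OF F(2,1)] show ?thesis using F(3) by (simp add: Int_absorb2)
qed

text \<open>The tube of radius r lies in the balls enlarged to radius (L + 1) r; about C/r of them,
  each of volume of order r^3, amount to order r^2.\<close>

lemma tube_volume:
  assumes cov: "linear_covering S L C" and ne: "S \<noteq> {}"
  shows "\<exists>D. \<forall>r. 0 < r \<longrightarrow> r \<le> 1 \<longrightarrow> measure lebesgue {x::real^3. infdist x S < r} \<le> D * r\<^sup>2"
proof (intro exI allI impI)
  fix r :: real assume r: "0 < r" "r \<le> 1"
  define v where "v = measure lebesgue (ball (0::real^3) 1)"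
  have v: "0 \<le> v" by (simp add: v_def)
  have L: "0 \<le> L" using cov by (simp add: linear_covering_def)
  obtain P where P: "finite P" "S \<subseteq> (\<Union>q\<in>P. cball q (L * r))" "real (card P) * r \<le> C"
    using cov r unfolding linear_covering_def by blast
  have sub: "{x. infdist x S < r} \<subseteq> (\<Union>q\<in>P. ball q ((L + 1) * r))"
  proof safe
    fix x assume "infdist x S < r"
    then obtain y where y: "y \<in> S" "dist x y < r" using infdist_less_ex[OF _ ne] by blast
    then obtain q where q: "q \<in> P" "dist q y \<le> L * r" using P(2) by auto
    have "dist q x < (L + 1) * r"
      using dist_triangle[of q x y] y q by (simp add: dist_commute algebra_simps)
    then show "x \<in> (\<Union>q\<in>P. ball q ((L + 1) * r))" using q(1) by auto
  qed
  have op: "open {x::real^3. infdist x S < r}" by (intro open_Collect_less continuous_intros)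
  have vol: "measure lebesgue (ball q ((L + 1) * r)) = ((L + 1) * r) ^ 3 * v" for q :: "real^3"
    using content_ball_conv_unit_ball[of "(L + 1) * r" q] L r by (simp add: v_def)
  have "measure lebesgue {x. infdist x S < r} \<le> measure lebesgue (\<Union>q\<in>P. ball q ((L + 1) * r))"
    using sub op P(1) by (intro measure_mono_fmeasurable) (auto intro!: lmeasurable_open)
  also have "\<dots> \<le> (\<Sum>q\<in>P. measure lebesgue (ball q ((L + 1) * r)))"
    using P(1) by (intro measure_UNION_le) auto
  also have "\<dots> = real (card P) * (((L + 1) * r) ^ 3 * v)"
    by (simp only: vol sum_constant)
  also have "\<dots> = (real (card P) * r) * ((L + 1) ^ 3 * v * r\<^sup>2)"
    by (simp add: power_mult_distrib power2_eq_square power3_eq_cube[of r] mult_ac)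
  also have "\<dots> \<le> C * ((L + 1) ^ 3 * v * r\<^sup>2)"
    using P(3) v L by (intro mult_right_mono mult_nonneg_nonneg) auto
  finally show "measure lebesgue {x. infdist x S < r} \<le> (C * ((L + 1) ^ 3 * v)) * r\<^sup>2"
    by (simp add: mult.assoc)
qed

text \<open>The separation by a curve is phrased for relative frontiers, whereas the gluing meets
  the intersection of the closures. A relatively open set is disjoint from the closure of the
  complement of its closure, so a common point of the two closures is interior to neither
  part.\<close>

lemma interface_subset_rel_frontiers:
  assumes cl: "closed \<Gamma>" and op: "openin (top_of_set \<Gamma>) \<Gamma>t"
  shows "closure \<Gamma>t \<inter> closure (\<Gamma> - closure \<Gamma>t)
    \<subseteq> (top_of_set \<Gamma> frontier_of \<Gamma>t) \<inter> (top_of_set \<Gamma> frontier_of (\<Gamma> - closure \<Gamma>t))"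
proof
  fix p assume p: "p \<in> closure \<Gamma>t \<inter> closure (\<Gamma> - closure \<Gamma>t)"
  obtain U where U: "open U" "\<Gamma>t = \<Gamma> \<inter> U" using op openin_open by metis
  have sub: "\<Gamma>t \<subseteq> \<Gamma>" using U by blast
  have p\<Gamma>: "p \<in> \<Gamma>" using p closure_minimal[OF sub cl] by blast
  have "p \<notin> \<Gamma>t"
  proof
    assume "p \<in> \<Gamma>t"
    then have "p \<in> U" using U by blast
    then have "U \<inter> (\<Gamma> - closure \<Gamma>t) \<noteq> {}" using p U(1) open_Int_closure_eq_empty[of U "\<Gamma> - closure \<Gamma>t"] by blast
    then obtain q where "q \<in> U" "q \<in> \<Gamma>" "q \<notin> closure \<Gamma>t" by blast
    then have "q \<in> \<Gamma>t" using U by blast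
    then show False using \<open>q \<notin> closure \<Gamma>t\<close> closure_subset[of \<Gamma>t] by blast
  qed
  then have 1: "p \<notin> top_of_set \<Gamma> interior_of \<Gamma>t" using interior_of_subset by fast
  have 2: "p \<notin> top_of_set \<Gamma> interior_of (\<Gamma> - closure \<Gamma>t)"
    using interior_of_subset[of "top_of_set \<Gamma>" "\<Gamma> - closure \<Gamma>t"] p by blast
  have "p \<in> top_of_set \<Gamma> closure_of \<Gamma>t" "p \<in> top_of_set \<Gamma> closure_of (\<Gamma> - closure \<Gamma>t)"
    using p p\<Gamma> sub by (auto simp: closure_of_subtopology Int_absorb1)
  with 1 2 show "p \<in> (top_of_set \<Gamma> frontier_of \<Gamma>t) \<inter> (top_of_set \<Gamma> frontier_of (\<Gamma> - closure \<Gamma>t))"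
    by (simp add: frontier_of_def)
qed

text \<open>In the chart the interface lies on the graph of \<open>g\<close>, so
  \<open>\<psi> (t, g t)\<close> traces a Lipschitz curve containing it locally; the constant L (1 +
  L) comes from the graph map followed by \<psi>. Compactness makes the covering global.\<close>

lemma interface_linear_covering:
  assumes cl: "compact \<Gamma>" and op: "openin (top_of_set \<Gamma>) \<Gamma>t"
    and sep: "separated_by_lipschitz_curve \<Gamma> \<Gamma>t (\<Gamma> - closure \<Gamma>t)"
  shows "\<exists>L C. linear_covering (closure \<Gamma>t \<inter> closure (\<Gamma> - closure \<Gamma>t)) L C"
proof (rule linear_covering_compact)
  let ?S = "closure \<Gamma>t \<inter> closure (\<Gamma> - closure \<Gamma>t)"
  let ?T = "(top_of_set \<Gamma> frontier_of \<Gamma>t) \<inter> (top_of_set \<Gamma> frontier_of (\<Gamma> - closure \<Gamma>t))"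
  have clo: "closed \<Gamma>" using cl by (rule compact_imp_closed)
  have sub: "?S \<subseteq> ?T" by (rule interface_subset_rel_frontiers[OF clo op])
  have T\<Gamma>: "?S \<subseteq> \<Gamma>" using closure_minimal[of \<Gamma>t \<Gamma>] clo op openin_imp_subset by blast
  have "compact (closure \<Gamma>t)"
    using cl clo closure_minimal[of \<Gamma>t \<Gamma>] op openin_imp_subset by (metis closed_closure compact_Int_closed inf.absorb2)
  then show "compact ?S" by (intro compact_Int_closed) auto
  fix p assume p: "p \<in> ?S"
  then have "p \<in> ?T" using sub by blast
  from bspec[OF sep[unfolded separated_by_lipschitz_curve_def Let_def] this]
  obtain U V L and \<phi> :: "real^3 \<Rightarrow> real \<times> real" and \<psi> :: "real \<times> real \<Rightarrow> real^3" and g :: "real \<Rightarrow> real"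
    where *: "openin (top_of_set \<Gamma>) U \<and> p \<in> U \<and> open V \<and> \<phi> ` U = V \<and>
        L-lipschitz_on U \<phi> \<and> L-lipschitz_on V \<psi> \<and> (\<forall>x\<in>U. \<psi> (\<phi> x) = x) \<and>
        L-lipschitz_on UNIV g \<and>
        (\<forall>x\<in>U. (x \<in> ?T \<longleftrightarrow> snd (\<phi> x) = g (fst (\<phi> x))) \<and>
               (x \<in> \<Gamma>t \<longleftrightarrow> snd (\<phi> x) < g (fst (\<phi> x))) \<and>
               (x \<in> \<Gamma> - closure \<Gamma>t \<longleftrightarrow> snd (\<phi> x) > g (fst (\<phi> x))))"
    by (elim exE)
  then have U: "openin (top_of_set \<Gamma>) U" "p \<in> U" and V: "open V" "\<phi> ` U = V"
    and \<phi>: "L-lipschitz_on U \<phi>" and \<psi>: "L-lipschitz_on V \<psi>" and g: "L-lipschitz_on UNIV g"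
    by simp_all
  have inv: "\<psi> (\<phi> x) = x" and graph: "x \<in> ?T \<Longrightarrow> snd (\<phi> x) = g (fst (\<phi> x))" if "x \<in> U" for x
    using * that by simp_all
  have L: "0 \<le> L" using g by (rule lipschitz_on_nonneg)
  obtain N where N: "open N" "U = \<Gamma> \<inter> N" using U(1) openin_open by metis
  define t0 where "t0 = fst (\<phi> p)"
  have "(t0, g t0) = \<phi> p" using graph[OF U(2)] \<open>p \<in> ?T\<close> by (simp add: t0_def prod_eq_iff)
  then have t0V: "(t0, g t0) \<in> V" using U V by blast
  have gc: "continuous_on UNIV (\<lambda>t. (t, g t))"
    using lipschitz_on_continuous_on[OF g] by (intro continuous_intros)
  have "open ((\<lambda>t. (t, g t)) -` V)" by (rule open_vimage[OF V(1) gc])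
  moreover have "t0 \<in> (\<lambda>t. (t, g t)) -` V" using t0V by simp
  ultimately obtain \<rho> where \<rho>: "\<rho> > 0" "cball t0 \<rho> \<subseteq> (\<lambda>t. (t, g t)) -` V"
    unfolding open_contains_cball by blast
  define \<gamma> where "\<gamma> t = \<psi> (t, g t)" for t
  have inV: "(t, g t) \<in> V" if "t \<in> {t0 - \<rho>..t0 + \<rho>}" for t
  proof -
    have "t \<in> cball t0 \<rho>" using that by (auto simp: dist_real_def)
    then show ?thesis using \<rho>(2) by blast
  qed
  have "(L * (1 + L))-lipschitz_on {t0 - \<rho>..t0 + \<rho>} \<gamma>"
  proof (rule lipschitz_onI)
    fix s t assume st: "s \<in> {t0 - \<rho>..t0 + \<rho>}" "t \<in> {t0 - \<rho>..t0 + \<rho>}"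
    have "dist (s, g s) (t, g t) \<le> dist s t + dist (g s) (g t)"
      using sqrt_sum_squares_le_sum_abs[of "dist s t" "dist (g s) (g t)"] by (simp add: dist_Pair_Pair)
    also have "dist (g s) (g t) \<le> L * dist s t" by (rule lipschitz_onD[OF g]) auto
    finally have "dist (s, g s) (t, g t) \<le> dist s t + L * dist s t" by simp
    from mult_left_mono[OF this L]
    have "L * dist (s, g s) (t, g t) \<le> L * (1 + L) * dist s t" by (simp add: algebra_simps)
    moreover have "dist (\<gamma> s) (\<gamma> t) \<le> L * dist (s, g s) (t, g t)"
      unfolding \<gamma>_def by (rule lipschitz_onD[OF \<psi> inV[OF st(1)] inV[OF st(2)]])
    ultimately show "dist (\<gamma> s) (\<gamma> t) \<le> L * (1 + L) * dist s t" by linarith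
  qed (use L in auto)
  \<comment> \<open>On this ball the value of \<phi> moves by at most \<rho>, so the parameter stays
    in the interval over which the graph lies in \<open>V\<close>.\<close>
  moreover define W where "W = N \<inter> ball p (\<rho> / (L + 1))"
  have "?S \<inter> W \<subseteq> \<gamma> ` {t0 - \<rho>..t0 + \<rho>}"
  proof
    fix x assume x: "x \<in> ?S \<inter> W"
    have xU: "x \<in> U" using x T\<Gamma> N by (auto simp: W_def)
    have xT: "x \<in> ?T" using x sub by blast
    let ?t = "fst (\<phi> x)"
    have "dist ?t t0 \<le> dist (\<phi> x) (\<phi> p)" unfolding t0_def by (rule dist_fst_le)
    also have "\<dots> \<le> L * dist x p" by (rule lipschitz_onD[OF \<phi> xU U(2)])
    also have "\<dots> \<le> L * (\<rho> / (L + 1))" using x L by (intro mult_left_mono) (auto simp: W_def dist_commute)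
    also have "\<dots> \<le> \<rho>" using L \<rho>(1) by (simp add: field_simps)
    finally have t: "?t \<in> {t0 - \<rho>..t0 + \<rho>}" by (auto simp: dist_real_def)
    have "\<phi> x = (?t, g ?t)" using graph[OF xU xT] by (simp add: prod_eq_iff)
    then have "x = \<gamma> ?t" unfolding \<gamma>_def using inv[OF xU] by simp
    then show "x \<in> \<gamma> ` {t0 - \<rho>..t0 + \<rho>}" using t by blast
  qed
  ultimately have "linear_covering (?S \<inter> W) (L * (1 + L)) ((t0 + \<rho>) - (t0 - \<rho>) + 1)"
    using \<rho>(1) by (intro linear_covering_curve) auto
  moreover have "open W" "p \<in> W" using N U \<rho>(1) L by (auto simp: W_def)
  ultimately show "\<exists>W L C. open W \<and> p \<in> W \<and> linear_covering (?S \<inter> W) L C" by blast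
qed

section \<open>Weak and strong operators\<close>

text \<open>Continuity of the inner product, prepared for carrying identities from smooth fields to
  their limits. The factor \<open>c\<close> is there because these occur with 1, -1, 0 and
  1/\<epsilon>.\<close>

lemma L2_inner_limit:
  assumes L: "A \<in> L2 \<Omega>" "P \<in> L2 \<Omega>" "B \<in> L2 \<Omega>" "Q \<in> L2 \<Omega>"
    and ap: "\<And>e. e > 0 \<Longrightarrow> \<exists>A' B'. A' \<in> L2 \<Omega> \<and> B' \<in> L2 \<Omega> \<and> L2_norm \<Omega> (\<lambda>x. A x - A' x) < e \<and>
      L2_norm \<Omega> (\<lambda>x. B x - B' x) < e \<and> L2_inner \<Omega> A' P = c * L2_inner \<Omega> B' Q"
  shows "L2_inner \<Omega> A P = c * L2_inner \<Omega> B Q"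
proof -
  \<comment> \<open>The summand 1 keeps the denominator positive when both norms vanish.\<close>
  let ?K = "L2_norm \<Omega> P + \<bar>c\<bar> * L2_norm \<Omega> Q + 1"
  have K: "?K > 0" by (intro add_nonneg_pos add_nonneg_nonneg mult_nonneg_nonneg) auto
  have "\<bar>L2_inner \<Omega> A P - c * L2_inner \<Omega> B Q\<bar> \<le> 0 + e" if "e > 0" for e
  proof -
    have "e / ?K > 0" using that K by simp
    then obtain A' B' where *: "A' \<in> L2 \<Omega>" "B' \<in> L2 \<Omega>" "L2_norm \<Omega> (\<lambda>x. A x - A' x) < e / ?K"
        "L2_norm \<Omega> (\<lambda>x. B x - B' x) < e / ?K" "L2_inner \<Omega> A' P = c * L2_inner \<Omega> B' Q"
      using ap by blast
    have "L2_inner \<Omega> A P - c * L2_inner \<Omega> B Q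
        = L2_inner \<Omega> (\<lambda>x. A x - A' x) P - c * L2_inner \<Omega> (\<lambda>x. B x - B' x) Q"
      using L * by (simp add: L2_inner_diff_left algebra_simps)
    also have "\<bar>\<dots>\<bar> \<le> \<bar>L2_inner \<Omega> (\<lambda>x. A x - A' x) P\<bar> + \<bar>c\<bar> * \<bar>L2_inner \<Omega> (\<lambda>x. B x - B' x) Q\<bar>"
      using abs_triangle_ineq4[of "L2_inner \<Omega> (\<lambda>x. A x - A' x) P" "c * L2_inner \<Omega> (\<lambda>x. B x - B' x) Q"]
      by (simp add: abs_mult)
    also have "\<bar>L2_inner \<Omega> (\<lambda>x. A x - A' x) P\<bar> \<le> e / ?K * L2_norm \<Omega> P"
      by (rule order_trans[OF L2_Cauchy_Schwarz[OF L2_diff[OF L(1) *(1)] L(2)]])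
         (intro mult_right_mono less_imp_le[OF *(3)] L2_norm_nonneg)
    also have "\<bar>L2_inner \<Omega> (\<lambda>x. B x - B' x) Q\<bar> \<le> e / ?K * L2_norm \<Omega> Q"
      by (rule order_trans[OF L2_Cauchy_Schwarz[OF L2_diff[OF L(3) *(2)] L(4)]])
         (intro mult_right_mono less_imp_le[OF *(4)] L2_norm_nonneg)
    finally have "\<bar>L2_inner \<Omega> A P - c * L2_inner \<Omega> B Q\<bar>
        \<le> e / ?K * L2_norm \<Omega> P + \<bar>c\<bar> * (e / ?K * L2_norm \<Omega> Q)"
      by (simp add: mult_left_mono)
    also have "\<dots> \<le> e / ?K * ?K"
    proof -
      have "k * a + b * (k * d) \<le> k * (a + b * d + 1)" if "k > 0" for k a b d :: real
        using that by (simp add: algebra_simps)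
      then show ?thesis using \<open>e / ?K > 0\<close> by blast
    qed
    also have "\<dots> = e" using K by simp
    finally show ?thesis by simp
  qed
  then have "\<bar>L2_inner \<Omega> A P - c * L2_inner \<Omega> B Q\<bar> \<le> 0" by (rule field_le_epsilon)
  then show ?thesis by simp
qed

lemma sqrt_sum_squares_less:
  assumes "0 \<le> a" "0 \<le> b" "a < e / 2" "b < e / 2"
  shows "sqrt (a\<^sup>2 + b\<^sup>2) < e"
  using sqrt_sum_squares_le_sum_abs[of a b] assms by simp

lemma sqrt_sum_squares_lessD:
  assumes "sqrt (a\<^sup>2 + b\<^sup>2) < e" "0 \<le> a" "0 \<le> b"
  shows "a < e" "b < e"
  using le_less_trans[OF real_sqrt_sum_squares_ge1 assms(1)] le_less_trans[OF real_sqrt_sum_squares_ge2 assms(1)]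
  by auto

definition strong_curl ::
    "(real^3) set \<Rightarrow> (real^3) set \<Rightarrow> (real^3 \<Rightarrow> real^3) \<Rightarrow> (real^3 \<Rightarrow> real^3) \<Rightarrow> bool" where
  "strong_curl \<gamma> \<Omega> v w \<longleftrightarrow> v \<in> L2 \<Omega> \<and> w \<in> L2 \<Omega> \<and>
     (\<forall>e>0. \<exists>\<Phi>\<in>Cinf0_field \<gamma> \<Omega>. L2_norm \<Omega> (\<lambda>x. v x - \<Phi> x) < e \<and> L2_norm \<Omega> (\<lambda>x. w x - curl \<Phi> x) < e)"

definition strong_div ::
    "(real^3) set \<Rightarrow> (real^3) set \<Rightarrow> (real^3 \<Rightarrow> real^3) \<Rightarrow> (real^3 \<Rightarrow> real) \<Rightarrow> bool" where
  "strong_div \<gamma> \<Omega> v d \<longleftrightarrow> v \<in> L2 \<Omega> \<and> d \<in> L2 \<Omega> \<and>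
     (\<forall>e>0. \<exists>\<Phi>\<in>Cinf0_field \<gamma> \<Omega>. L2_norm \<Omega> (\<lambda>x. v x - \<Phi> x) < e \<and> L2_norm \<Omega> (\<lambda>x. d x - div3 \<Phi> x) < e)"

context bounded_open_set
begin

section \<open>Green identities on the closures\<close>

lemma Cinf0_field_iff: "\<Phi> \<in> Cinf0_field \<gamma> \<Omega> \<longleftrightarrow> (\<forall>i. (\<lambda>x. \<Phi> x $ i) \<in> Cinf0 \<gamma> \<Omega>)"
  by (simp add: Cinf0_field_def)

lemma Cinf0_field_smooth: "\<Phi> \<in> Cinf0_field \<gamma> \<Omega> \<Longrightarrow> smooth (\<lambda>x. \<Phi> x $ i)"
  unfolding Cinf0_field_iff by (rule Cinf0_smooth) (rule spec)

lemma Cinf0_field_L2: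
  assumes "\<Phi> \<in> Cinf0_field \<gamma> \<Omega>"
  shows "\<Phi> \<in> L2 \<Omega>" "curl \<Phi> \<in> L2 \<Omega>" "div3 \<Phi> \<in> L2 \<Omega>"
proof -
  note s = Cinf0_field_smooth[OF assms]
  show "\<Phi> \<in> L2 \<Omega>" by (rule smooth_field_L2[OF s])
  show "curl \<Phi> \<in> L2 \<Omega>" by (rule smooth_field_L2[OF smooth_curl[OF s]])
  show "div3 \<Phi> \<in> L2 \<Omega>" by (rule smooth_L2[OF smooth_div3[OF s]])
qed

lemma test_field_Cinf0: "\<Phi> \<in> test_field \<Omega> \<Longrightarrow> \<Phi> \<in> Cinf0_field (frontier \<Omega>) \<Omega>"
  using test_fun_subset_Cinf0[of "frontier \<Omega>"] by (auto simp: test_field_def Cinf0_field_iff)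

text \<open>Where both functions are nonzero, the distance from \<gamma> and from
  \<open>\<gamma>'\<close> is bounded below; a positive distance extends to the closure of the
  union, which contains the frontier.\<close>

lemma apart_frontier:
  assumes "f \<in> Cinf0 \<gamma> \<Omega>" "g \<in> Cinf0 \<gamma>' \<Omega>" "frontier \<Omega> \<subseteq> closure (\<gamma> \<union> \<gamma>')"
  shows "apart {x\<in>\<Omega>. f x \<noteq> 0 \<and> g x \<noteq> 0} (frontier \<Omega>)"
proof -
  let ?A = "{x\<in>\<Omega>. f x \<noteq> 0 \<and> g x \<noteq> 0}"
  have "apart ?A \<gamma>" using assms(1) by (auto simp: Cinf0_iff elim!: apart_mono)
  moreover have "apart ?A \<gamma>'" using assms(2) by (auto simp: Cinf0_iff elim!: apart_mono)
  ultimately have "apart ?A (closure (\<gamma> \<union> \<gamma>'))" by (simp add: apart_closure_right apart_Un_right)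
  then show ?thesis using assms(3) by (rule apart_mono[OF _ order_refl])
qed

lemma frontier_cover: "frontier \<Omega> \<subseteq> closure (\<gamma> \<union> frontier \<Omega>)"
  using closure_subset[of "\<gamma> \<union> frontier \<Omega>"] by blast

lemma strong_grad_Green:
  assumes u: "strong_grad \<gamma> \<Omega> u G" and \<Phi>: "\<Phi> \<in> Cinf0_field \<gamma>' \<Omega>"
    and c: "frontier \<Omega> \<subseteq> closure (\<gamma> \<union> \<gamma>')"
  shows "L2_inner \<Omega> u (div3 \<Phi>) = - L2_inner \<Omega> G \<Phi>"
proof -
  have "L2_inner \<Omega> u (div3 \<Phi>) = (-1) * L2_inner \<Omega> G \<Phi>"
  proof (rule L2_inner_limit)
    fix e :: real assume "e > 0"
    then obtain \<phi> where \<phi>: "\<phi> \<in> Cinf0 \<gamma> \<Omega>" "L2_norm \<Omega> (\<lambda>x. u x - \<phi> x) < e" "L2_norm \<Omega> (\<lambda>x. G x - grad \<phi> x) < e"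
      using u unfolding strong_grad_def by blast
    have "L2_inner \<Omega> \<phi> (div3 \<Phi>) = - L2_inner \<Omega> (grad \<phi>) \<Phi>"
      using \<phi>(1) \<Phi> c
      by (intro Green_div Cinf0_smooth[OF \<phi>(1)] Cinf0_field_smooth[OF \<Phi>] apart_frontier[OF \<phi>(1)]) (auto simp: Cinf0_field_iff)
    then show "\<exists>A' B'. A' \<in> L2 \<Omega> \<and> B' \<in> L2 \<Omega> \<and> L2_norm \<Omega> (\<lambda>x. u x - A' x) < e \<and>
        L2_norm \<Omega> (\<lambda>x. G x - B' x) < e \<and> L2_inner \<Omega> A' (div3 \<Phi>) = (-1) * L2_inner \<Omega> B' \<Phi>"
      using \<phi> by (intro exI[of _ \<phi>] exI[of _ "grad \<phi>"]) (auto simp: Cinf0_L2 Cinf0_grad_L2)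
  qed (use u Cinf0_field_L2[OF \<Phi>] in \<open>auto simp: strong_grad_def\<close>)
  then show ?thesis by simp
qed

lemma strong_curl_Green:
  assumes v: "strong_curl \<gamma> \<Omega> v w" and \<Psi>: "\<Psi> \<in> Cinf0_field \<gamma>' \<Omega>"
    and c: "frontier \<Omega> \<subseteq> closure (\<gamma> \<union> \<gamma>')"
  shows "L2_inner \<Omega> v (curl \<Psi>) = L2_inner \<Omega> w \<Psi>"
proof -
  have "L2_inner \<Omega> v (curl \<Psi>) = 1 * L2_inner \<Omega> w \<Psi>"
  proof (rule L2_inner_limit)
    fix e :: real assume "e > 0"
    then obtain \<Phi> where \<Phi>: "\<Phi> \<in> Cinf0_field \<gamma> \<Omega>" "L2_norm \<Omega> (\<lambda>x. v x - \<Phi> x) < e" "L2_norm \<Omega> (\<lambda>x. w x - curl \<Phi> x) < e"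
      using v unfolding strong_curl_def by blast
    have "L2_inner \<Omega> \<Phi> (curl \<Psi>) = L2_inner \<Omega> (curl \<Phi>) \<Psi>"
      using \<Phi>(1) \<Psi> c
      by (intro Green_curl Cinf0_field_smooth[OF \<Phi>(1)] Cinf0_field_smooth[OF \<Psi>] apart_frontier) (auto simp: Cinf0_field_iff)
    then show "\<exists>A' B'. A' \<in> L2 \<Omega> \<and> B' \<in> L2 \<Omega> \<and> L2_norm \<Omega> (\<lambda>x. v x - A' x) < e \<and>
        L2_norm \<Omega> (\<lambda>x. w x - B' x) < e \<and> L2_inner \<Omega> A' (curl \<Psi>) = 1 * L2_inner \<Omega> B' \<Psi>"
      using \<Phi> by (intro exI[of _ \<Phi>] exI[of _ "curl \<Phi>"]) (auto simp: Cinf0_field_L2)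
  qed (use v Cinf0_field_L2[OF \<Psi>] in \<open>auto simp: strong_curl_def\<close>)
  then show ?thesis by simp
qed

text \<open>Smooth fields are inserted for \<open>v\<close> alone; the identity for them is
  \<open>strong_grad_Green\<close>, which has already taken the limit in \<open>u\<close>. Each
  passage to the limit thus has fixed factors on the other side.\<close>

lemma strong_div_Green:
  assumes v: "strong_div \<gamma>' \<Omega> v d" and u: "strong_grad \<gamma> \<Omega> u G"
    and c: "frontier \<Omega> \<subseteq> closure (\<gamma> \<union> \<gamma>')"
  shows "L2_inner \<Omega> v G = - L2_inner \<Omega> d u"
proof -
  have "L2_inner \<Omega> v G = (-1) * L2_inner \<Omega> d u"
  proof (rule L2_inner_limit)
    fix e :: real assume "e > 0"
    then obtain \<Phi> where \<Phi>: "\<Phi> \<in> Cinf0_field \<gamma>' \<Omega>" "L2_norm \<Omega> (\<lambda>x. v x - \<Phi> x) < e" "L2_norm \<Omega> (\<lambda>x. d x - div3 \<Phi> x) < e"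
      using v unfolding strong_div_def by blast
    have "L2_inner \<Omega> \<Phi> G = - L2_inner \<Omega> (div3 \<Phi>) u"
      using strong_grad_Green[OF u \<Phi>(1) c] by (simp add: L2_inner_commute[of _ \<Phi>] L2_inner_commute[of _ "div3 \<Phi>"])
    then show "\<exists>A' B'. A' \<in> L2 \<Omega> \<and> B' \<in> L2 \<Omega> \<and> L2_norm \<Omega> (\<lambda>x. v x - A' x) < e \<and>
        L2_norm \<Omega> (\<lambda>x. d x - B' x) < e \<and> L2_inner \<Omega> A' G = (-1) * L2_inner \<Omega> B' u"
      using \<Phi> by (intro exI[of _ \<Phi>] exI[of _ "div3 \<Phi>"]) (auto simp: Cinf0_field_L2)
  qed (use v u in \<open>auto simp: strong_div_def strong_grad_def\<close>)
  then show ?thesis by simp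
qed

lemma strong_grad_imp_weak: "strong_grad \<gamma> \<Omega> u G \<Longrightarrow> is_weak_grad \<Omega> u G"
  unfolding is_weak_grad_def
  using strong_grad_Green[OF _ test_field_Cinf0 frontier_cover] by (auto simp: strong_grad_def)

lemma strong_curl_imp_weak: "strong_curl \<gamma> \<Omega> v w \<Longrightarrow> is_weak_curl \<Omega> v w"
  unfolding is_weak_curl_def
  using strong_curl_Green[OF _ test_field_Cinf0 frontier_cover] by (auto simp: strong_curl_def)

lemma strong_div_imp_weak:
  assumes "strong_div \<gamma> \<Omega> v d" shows "is_weak_div \<Omega> v d"
  unfolding is_weak_div_def
proof (intro conjI ballI)
  fix \<phi> assume "\<phi> \<in> test_fun \<Omega>"
  then have "strong_grad (frontier \<Omega>) \<Omega> \<phi> (grad \<phi>)"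
    using test_fun_subset_Cinf0[of "frontier \<Omega>"] by (intro strong_grad_smooth) auto
  from strong_div_Green[OF assms this] frontier_cover
  show "L2_inner \<Omega> v (grad \<phi>) = - L2_inner \<Omega> d \<phi>" by (simp add: Un_commute)
qed (use assms in \<open>auto simp: strong_div_def\<close>)

lemma L2_norm_eq_of_inner_test_field:
  fixes A B :: "real^3 \<Rightarrow> real^3"
  assumes A: "A \<in> L2 \<Omega>" "B \<in> L2 \<Omega>" and eq: "\<And>\<Phi>. \<Phi> \<in> test_field \<Omega> \<Longrightarrow> L2_inner \<Omega> A \<Phi> = L2_inner \<Omega> B \<Phi>"
  shows "L2_norm \<Omega> A = L2_norm \<Omega> B"
proof -
  have "L2_norm \<Omega> (\<lambda>x. A x - B x) = 0"
  proof (rule weak_zero_field[OF L2_diff[OF A]])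
    fix \<Phi> assume "\<Phi> \<in> test_field \<Omega>"
    then show "L2_inner \<Omega> (\<lambda>x. A x - B x) \<Phi> = 0"
      using A eq[of \<Phi>] Cinf0_field_L2(1)[OF test_field_Cinf0] by (simp add: L2_inner_diff_left)
  qed
  then show ?thesis
    using L2_norm_le_add_diff[OF A] L2_norm_le_add_diff[OF A(2,1)] L2_norm_diff_commute[of \<Omega> A B] by simp
qed

lemma L2_norm_eq_of_inner_test_fun:
  assumes A: "A \<in> L2 \<Omega>" "B \<in> L2 \<Omega>" and eq: "\<And>\<phi>. \<phi> \<in> test_fun \<Omega> \<Longrightarrow> L2_inner \<Omega> A \<phi> = L2_inner \<Omega> B \<phi>"
  shows "L2_norm \<Omega> A = L2_norm \<Omega> B"
proof -
  have "L2_norm \<Omega> (\<lambda>x. A x - B x) = 0"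
  proof (rule weak_zero_scalar[OF L2_diff[OF A]])
    fix \<phi> assume "\<phi> \<in> test_fun \<Omega>"
    then show "L2_inner \<Omega> (\<lambda>x. A x - B x) \<phi> = 0"
      using A eq[of \<phi>] smooth_L2[OF test_fun_smooth] by (simp add: L2_inner_diff_left)
  qed
  then show ?thesis
    using L2_norm_le_add_diff[OF A] L2_norm_le_add_diff[OF A(2,1)] L2_norm_diff_commute[of \<Omega> A B] by simp
qed

text \<open>\<open>weak_grad\<close> returns an unspecified weak gradient. Any two of them have the
  same inner products with test fields, so the norm does not depend on the choice; curl and
  divergence are treated alike.\<close>

lemma L2_norm_weak_grad:
  assumes G: "is_weak_grad \<Omega> u G" shows "L2_norm \<Omega> (weak_grad \<Omega> u) = L2_norm \<Omega> G"
proof -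
  have W: "is_weak_grad \<Omega> u (weak_grad \<Omega> u)" unfolding weak_grad_def by (rule someI[where P = "is_weak_grad \<Omega> u", OF G])
  then have "L2_inner \<Omega> (weak_grad \<Omega> u) \<Phi> = L2_inner \<Omega> G \<Phi>" if "\<Phi> \<in> test_field \<Omega>" for \<Phi>
    using G that unfolding is_weak_grad_def by (metis neg_equal_iff_equal)
  then show ?thesis using W G by (intro L2_norm_eq_of_inner_test_field) (auto simp: is_weak_grad_def)
qed

lemma L2_norm_weak_curl:
  assumes w: "is_weak_curl \<Omega> v w" shows "L2_norm \<Omega> (weak_curl \<Omega> v) = L2_norm \<Omega> w"
proof -
  have W: "is_weak_curl \<Omega> v (weak_curl \<Omega> v)" unfolding weak_curl_def by (rule someI[where P = "is_weak_curl \<Omega> v", OF w])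
  then have "L2_inner \<Omega> (weak_curl \<Omega> v) \<Phi> = L2_inner \<Omega> w \<Phi>" if "\<Phi> \<in> test_field \<Omega>" for \<Phi>
    using w that unfolding is_weak_curl_def by metis
  then show ?thesis using W w by (intro L2_norm_eq_of_inner_test_field) (auto simp: is_weak_curl_def)
qed

lemma L2_norm_weak_div:
  assumes d: "is_weak_div \<Omega> v d" shows "L2_norm \<Omega> (weak_div \<Omega> v) = L2_norm \<Omega> d"
proof -
  have W: "is_weak_div \<Omega> v (weak_div \<Omega> v)" unfolding weak_div_def by (rule someI[where P = "is_weak_div \<Omega> v", OF d])
  then have "L2_inner \<Omega> (weak_div \<Omega> v) \<phi> = L2_inner \<Omega> d \<phi>" if "\<phi> \<in> test_fun \<Omega>" for \<phi>
    using d that unfolding is_weak_div_def by (metis neg_equal_iff_equal)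
  then show ?thesis using W d by (intro L2_norm_eq_of_inner_test_fun) (auto simp: is_weak_div_def)
qed

lemma is_weak_grad_diff:
  assumes "is_weak_grad \<Omega> u G" "is_weak_grad \<Omega> v H"
  shows "is_weak_grad \<Omega> (\<lambda>x. u x - v x) (\<lambda>x. G x - H x)"
  using assms unfolding is_weak_grad_def
  by (auto simp: L2_diff L2_inner_diff_left Cinf0_field_L2[OF test_field_Cinf0])

lemma is_weak_curl_diff:
  assumes "is_weak_curl \<Omega> u G" "is_weak_curl \<Omega> v H"
  shows "is_weak_curl \<Omega> (\<lambda>x. u x - v x) (\<lambda>x. G x - H x)"
  using assms unfolding is_weak_curl_def
  by (auto simp: L2_diff L2_inner_diff_left Cinf0_field_L2[OF test_field_Cinf0])

lemma is_weak_div_diff: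
  assumes "is_weak_div \<Omega> u G" "is_weak_div \<Omega> v H"
  shows "is_weak_div \<Omega> (\<lambda>x. u x - v x) (\<lambda>x. G x - H x)"
  using assms unfolding is_weak_div_def
  by (auto simp: L2_diff L2_inner_diff_left smooth_L2[OF test_fun_smooth] smooth_grad_L2[OF test_fun_smooth])

lemma strong_curl_smooth: "\<Phi> \<in> Cinf0_field \<gamma> \<Omega> \<Longrightarrow> strong_curl \<gamma> \<Omega> \<Phi> (curl \<Phi>)"
  unfolding strong_curl_def by (auto simp: Cinf0_field_L2 intro!: bexI[of _ \<Phi>])

lemma strong_div_smooth: "\<Phi> \<in> Cinf0_field \<gamma> \<Omega> \<Longrightarrow> strong_div \<gamma> \<Omega> \<Phi> (div3 \<Phi>)"
  unfolding strong_div_def by (auto simp: Cinf0_field_L2 intro!: bexI[of _ \<Phi>])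

text \<open>The graph norm uses the chosen weak gradient of u - \<phi>, whose norm is that of G -
  grad \<phi>; so closure in the graph norm and approximation of the pair (u, G) coincide.
  \<open>strong_curl_iff\<close> and \<open>strong_div_iff\<close> follow the same pattern.\<close>

lemma strong_grad_iff: "strong_grad \<gamma> \<Omega> u G \<longleftrightarrow> u \<in> H0_grad \<gamma> \<Omega> \<and> is_weak_grad \<Omega> u G"
proof -
  have ng: "norm_grad \<Omega> (\<lambda>x. u x - \<phi> x) = sqrt ((L2_norm \<Omega> (\<lambda>x. u x - \<phi> x))\<^sup>2 + (L2_norm \<Omega> (\<lambda>x. G x - grad \<phi> x))\<^sup>2)"
    if "is_weak_grad \<Omega> u G" "\<phi> \<in> Cinf0 \<gamma> \<Omega>" for \<phi>
    unfolding norm_grad_def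
    using L2_norm_weak_grad[OF is_weak_grad_diff[OF that(1) strong_grad_imp_weak[OF strong_grad_smooth[OF that(2)]]]] by simp
  show ?thesis
  proof
    assume s: "strong_grad \<gamma> \<Omega> u G"
    note w = strong_grad_imp_weak[OF s]
    have "\<exists>\<phi>\<in>Cinf0 \<gamma> \<Omega>. norm_grad \<Omega> (\<lambda>x. u x - \<phi> x) < e" if "e > 0" for e
    proof -
      have "e / 2 > 0" using that by simp
      then obtain \<phi> where \<phi>: "\<phi> \<in> Cinf0 \<gamma> \<Omega>" "L2_norm \<Omega> (\<lambda>x. u x - \<phi> x) < e / 2" "L2_norm \<Omega> (\<lambda>x. G x - grad \<phi> x) < e / 2"
        using s unfolding strong_grad_def by blast
      have "norm_grad \<Omega> (\<lambda>x. u x - \<phi> x) < e"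
        unfolding ng[OF w \<phi>(1)] by (rule sqrt_sum_squares_less[OF L2_norm_nonneg L2_norm_nonneg \<phi>(2,3)])
      then show ?thesis using \<phi>(1) by blast
    qed
    then show "u \<in> H0_grad \<gamma> \<Omega> \<and> is_weak_grad \<Omega> u G" using w by (auto simp: H0_grad_def H_grad_def)
  next
    assume a: "u \<in> H0_grad \<gamma> \<Omega> \<and> is_weak_grad \<Omega> u G"
    have "\<exists>\<phi>\<in>Cinf0 \<gamma> \<Omega>. L2_norm \<Omega> (\<lambda>x. u x - \<phi> x) < e \<and> L2_norm \<Omega> (\<lambda>x. G x - grad \<phi> x) < e" if "e > 0" for e
    proof -
      have "\<exists>\<phi>\<in>Cinf0 \<gamma> \<Omega>. norm_grad \<Omega> (\<lambda>x. u x - \<phi> x) < e" using a that by (simp add: H0_grad_def)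
      then obtain \<phi> where \<phi>: "\<phi> \<in> Cinf0 \<gamma> \<Omega>" "norm_grad \<Omega> (\<lambda>x. u x - \<phi> x) < e" by (elim bexE)
      have "sqrt ((L2_norm \<Omega> (\<lambda>x. u x - \<phi> x))\<^sup>2 + (L2_norm \<Omega> (\<lambda>x. G x - grad \<phi> x))\<^sup>2) < e"
        using \<phi>(2) ng[OF conjunct2[OF a] \<phi>(1)] by simp
      from sqrt_sum_squares_lessD[OF this L2_norm_nonneg L2_norm_nonneg] show ?thesis using \<phi>(1) by blast
    qed
    then show "strong_grad \<gamma> \<Omega> u G" using a by (auto simp: strong_grad_def is_weak_grad_def)
  qed
qed

lemma strong_curl_iff: "strong_curl \<gamma> \<Omega> u G \<longleftrightarrow> u \<in> H0_curl \<gamma> \<Omega> \<and> is_weak_curl \<Omega> u G"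
proof -
  have ng: "norm_curl \<Omega> (\<lambda>x. u x - \<phi> x) = sqrt ((L2_norm \<Omega> (\<lambda>x. u x - \<phi> x))\<^sup>2 + (L2_norm \<Omega> (\<lambda>x. G x - curl \<phi> x))\<^sup>2)"
    if "is_weak_curl \<Omega> u G" "\<phi> \<in> Cinf0_field \<gamma> \<Omega>" for \<phi>
    unfolding norm_curl_def
    using L2_norm_weak_curl[OF is_weak_curl_diff[OF that(1) strong_curl_imp_weak[OF strong_curl_smooth[OF that(2)]]]] by simp
  show ?thesis
  proof
    assume s: "strong_curl \<gamma> \<Omega> u G"
    note w = strong_curl_imp_weak[OF s]
    have "\<exists>\<phi>\<in>Cinf0_field \<gamma> \<Omega>. norm_curl \<Omega> (\<lambda>x. u x - \<phi> x) < e" if "e > 0" for e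
    proof -
      have "e / 2 > 0" using that by simp
      then obtain \<phi> where \<phi>: "\<phi> \<in> Cinf0_field \<gamma> \<Omega>" "L2_norm \<Omega> (\<lambda>x. u x - \<phi> x) < e / 2" "L2_norm \<Omega> (\<lambda>x. G x - curl \<phi> x) < e / 2"
        using s unfolding strong_curl_def by blast
      have "norm_curl \<Omega> (\<lambda>x. u x - \<phi> x) < e"
        unfolding ng[OF w \<phi>(1)] by (rule sqrt_sum_squares_less[OF L2_norm_nonneg L2_norm_nonneg \<phi>(2,3)])
      then show ?thesis using \<phi>(1) by blast
    qed
    then show "u \<in> H0_curl \<gamma> \<Omega> \<and> is_weak_curl \<Omega> u G" using w by (auto simp: H0_curl_def H_curl_def)
  next
    assume a: "u \<in> H0_curl \<gamma> \<Omega> \<and> is_weak_curl \<Omega> u G"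
    have "\<exists>\<phi>\<in>Cinf0_field \<gamma> \<Omega>. L2_norm \<Omega> (\<lambda>x. u x - \<phi> x) < e \<and> L2_norm \<Omega> (\<lambda>x. G x - curl \<phi> x) < e" if "e > 0" for e
    proof -
      have "\<exists>\<phi>\<in>Cinf0_field \<gamma> \<Omega>. norm_curl \<Omega> (\<lambda>x. u x - \<phi> x) < e" using a that by (simp add: H0_curl_def)
      then obtain \<phi> where \<phi>: "\<phi> \<in> Cinf0_field \<gamma> \<Omega>" "norm_curl \<Omega> (\<lambda>x. u x - \<phi> x) < e" by (elim bexE)
      have "sqrt ((L2_norm \<Omega> (\<lambda>x. u x - \<phi> x))\<^sup>2 + (L2_norm \<Omega> (\<lambda>x. G x - curl \<phi> x))\<^sup>2) < e"
        using \<phi>(2) ng[OF conjunct2[OF a] \<phi>(1)] by simp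
      from sqrt_sum_squares_lessD[OF this L2_norm_nonneg L2_norm_nonneg] show ?thesis using \<phi>(1) by blast
    qed
    then show "strong_curl \<gamma> \<Omega> u G" using a by (auto simp: strong_curl_def is_weak_curl_def)
  qed
qed

lemma strong_div_iff: "strong_div \<gamma> \<Omega> u G \<longleftrightarrow> u \<in> H0_div \<gamma> \<Omega> \<and> is_weak_div \<Omega> u G"
proof -
  have ng: "norm_div \<Omega> (\<lambda>x. u x - \<phi> x) = sqrt ((L2_norm \<Omega> (\<lambda>x. u x - \<phi> x))\<^sup>2 + (L2_norm \<Omega> (\<lambda>x. G x - div3 \<phi> x))\<^sup>2)"
    if "is_weak_div \<Omega> u G" "\<phi> \<in> Cinf0_field \<gamma> \<Omega>" for \<phi>
    unfolding norm_div_def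
    using L2_norm_weak_div[OF is_weak_div_diff[OF that(1) strong_div_imp_weak[OF strong_div_smooth[OF that(2)]]]] by simp
  show ?thesis
  proof
    assume s: "strong_div \<gamma> \<Omega> u G"
    note w = strong_div_imp_weak[OF s]
    have "\<exists>\<phi>\<in>Cinf0_field \<gamma> \<Omega>. norm_div \<Omega> (\<lambda>x. u x - \<phi> x) < e" if "e > 0" for e
    proof -
      have "e / 2 > 0" using that by simp
      then obtain \<phi> where \<phi>: "\<phi> \<in> Cinf0_field \<gamma> \<Omega>" "L2_norm \<Omega> (\<lambda>x. u x - \<phi> x) < e / 2" "L2_norm \<Omega> (\<lambda>x. G x - div3 \<phi> x) < e / 2"
        using s unfolding strong_div_def by blast
      have "norm_div \<Omega> (\<lambda>x. u x - \<phi> x) < e"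
        unfolding ng[OF w \<phi>(1)] by (rule sqrt_sum_squares_less[OF L2_norm_nonneg L2_norm_nonneg \<phi>(2,3)])
      then show ?thesis using \<phi>(1) by blast
    qed
    then show "u \<in> H0_div \<gamma> \<Omega> \<and> is_weak_div \<Omega> u G" using w by (auto simp: H0_div_def H_div_def)
  next
    assume a: "u \<in> H0_div \<gamma> \<Omega> \<and> is_weak_div \<Omega> u G"
    have "\<exists>\<phi>\<in>Cinf0_field \<gamma> \<Omega>. L2_norm \<Omega> (\<lambda>x. u x - \<phi> x) < e \<and> L2_norm \<Omega> (\<lambda>x. G x - div3 \<phi> x) < e" if "e > 0" for e
    proof -
      have "\<exists>\<phi>\<in>Cinf0_field \<gamma> \<Omega>. norm_div \<Omega> (\<lambda>x. u x - \<phi> x) < e" using a that by (simp add: H0_div_def)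
      then obtain \<phi> where \<phi>: "\<phi> \<in> Cinf0_field \<gamma> \<Omega>" "norm_div \<Omega> (\<lambda>x. u x - \<phi> x) < e" by (elim bexE)
      have "sqrt ((L2_norm \<Omega> (\<lambda>x. u x - \<phi> x))\<^sup>2 + (L2_norm \<Omega> (\<lambda>x. G x - div3 \<phi> x))\<^sup>2) < e"
        using \<phi>(2) ng[OF conjunct2[OF a] \<phi>(1)] by simp
      from sqrt_sum_squares_lessD[OF this L2_norm_nonneg L2_norm_nonneg] show ?thesis using \<phi>(1) by blast
    qed
    then show "strong_div \<gamma> \<Omega> u G" using a by (auto simp: strong_div_def is_weak_div_def)
  qed
qed

lemma curl_grad_zero: "smooth f \<Longrightarrow> curl (grad f) x = 0"
  using pderiv3_commute[of f 2 3 x] pderiv3_commute[of f 3 1 x] pderiv3_commute[of f 1 2 x]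
  by (simp add: curl_def vec_eq_iff forall_3)

text \<open>The gradients of the approximating functions vanish near \<gamma> together with the
  functions and have zero curl, so they approximate \<open>G\<close> in the graph norm of the
  curl.\<close>

lemma strong_grad_imp_strong_curl:
  assumes u: "strong_grad \<gamma> \<Omega> u G" shows "strong_curl \<gamma> \<Omega> G (\<lambda>x. 0)"
  unfolding strong_curl_def
proof (intro conjI allI impI)
  fix e :: real assume "e > 0"
  then obtain \<phi> where \<phi>: "\<phi> \<in> Cinf0 \<gamma> \<Omega>" "L2_norm \<Omega> (\<lambda>x. G x - grad \<phi> x) < e"
    using u unfolding strong_grad_def by blast
  have "grad \<phi> \<in> Cinf0_field \<gamma> \<Omega>" using Cinf0_pderiv3[OF \<phi>(1)] by (simp add: Cinf0_field_iff)
  moreover have "L2_norm \<Omega> (\<lambda>x. 0 - curl (grad \<phi>) x) < e"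
    using \<open>e > 0\<close> by (simp add: curl_grad_zero[OF Cinf0_smooth[OF \<phi>(1)]])
  ultimately show "\<exists>\<Phi>\<in>Cinf0_field \<gamma> \<Omega>. L2_norm \<Omega> (\<lambda>x. G x - \<Phi> x) < e \<and> L2_norm \<Omega> (\<lambda>x. 0 - curl \<Phi> x) < e"
    using \<phi>(2) by blast
qed (use u in \<open>auto simp: strong_grad_def\<close>)

lemma strong_grad_scaleR:
  assumes u: "strong_grad \<gamma> \<Omega> u G" shows "strong_grad \<gamma> \<Omega> (\<lambda>x. c * u x) (\<lambda>x. c *\<^sub>R G x)"
  unfolding strong_grad_def
proof (intro conjI allI impI)
  show "(\<lambda>x. c * u x) \<in> L2 \<Omega>" "(\<lambda>x. c *\<^sub>R G x) \<in> L2 \<Omega>"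
    using u L2_scaleR[of u \<Omega> c] by (auto simp: strong_grad_def L2_scaleR)
  fix e :: real assume "e > 0"
  then have "e / (\<bar>c\<bar> + 1) > 0" by (simp add: add_nonneg_pos)
  then obtain \<phi> where \<phi>: "\<phi> \<in> Cinf0 \<gamma> \<Omega>" "L2_norm \<Omega> (\<lambda>x. u x - \<phi> x) < e / (\<bar>c\<bar> + 1)"
      "L2_norm \<Omega> (\<lambda>x. G x - grad \<phi> x) < e / (\<bar>c\<bar> + 1)"
    using u unfolding strong_grad_def by blast
  have small: "\<bar>c\<bar> * a < e" if "a < e / (\<bar>c\<bar> + 1)" "0 \<le> a" for a
  proof -
    have "\<bar>c\<bar> * a \<le> (\<bar>c\<bar> + 1) * a" using that by (intro mult_right_mono) auto
    also have "\<dots> < e" using that(1) by (simp add: pos_less_divide_eq add_nonneg_pos mult.commute)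
    finally show ?thesis .
  qed
  have "L2_norm \<Omega> (\<lambda>x. c * u x - c * \<phi> x) < e"
    using small[OF \<phi>(2)] L2_norm_scaleR[of \<Omega> c "\<lambda>x. u x - \<phi> x"] by (simp add: right_diff_distrib)
  moreover have "L2_norm \<Omega> (\<lambda>x. c *\<^sub>R G x - grad (\<lambda>x. c * \<phi> x) x) < e"
  proof -
    have "grad (\<lambda>x. c * \<phi> x) x = c *\<^sub>R grad \<phi> x" for x
      using Cinf0_smooth[OF \<phi>(1)] by (simp add: vec_eq_iff pderiv3_cmult smooth_differentiable)
    then show ?thesis
      using small[OF \<phi>(3)] L2_norm_scaleR[of \<Omega> c "\<lambda>x. G x - grad \<phi> x"] by (simp add: scaleR_right_diff_distrib)
  qed
  ultimately show "\<exists>\<psi>\<in>Cinf0 \<gamma> \<Omega>. L2_norm \<Omega> (\<lambda>x. c * u x - \<psi> x) < e \<and> L2_norm \<Omega> (\<lambda>x. c *\<^sub>R G x - grad \<psi> x) < e"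
    using Cinf0_cmult[OF \<phi>(1), of c] by (intro bexI[of _ "\<lambda>x. c * \<phi> x"] conjI)
qed

end

section \<open>From the Korn and Maxwell inequalities to the Poincare inequality\<close>

lemma L2_Pair:
  assumes f: "f \<in> L2 \<Omega>" and g: "g \<in> L2 \<Omega>"
  shows "(\<lambda>x. (f x, g x)) \<in> L2 \<Omega>"
proof -
  note [measurable] = L2_measurable[OF f] L2_measurable[OF g]
  have "integrable (lebesgue_on \<Omega>) (\<lambda>x. (norm (f x))\<^sup>2 + (norm (g x))\<^sup>2)"
    using f g by (simp add: L2_def)
  then show ?thesis by (simp add: L2_def norm_Pair)
qed

lemma L2_fst_snd:
  fixes m :: "real^3 \<Rightarrow> 'a::euclidean_space \<times> 'b::euclidean_space"
  assumes m: "m \<in> L2 \<Omega>"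
  shows "(\<lambda>x. fst (m x)) \<in> L2 \<Omega>" "L2_norm \<Omega> (\<lambda>x. fst (m x)) \<le> L2_norm \<Omega> m"
    "(\<lambda>x. snd (m x)) \<in> L2 \<Omega>" "L2_norm \<Omega> (\<lambda>x. snd (m x)) \<le> L2_norm \<Omega> m"
proof -
  have f: "(\<lambda>x. fst (m x)) \<in> borel_measurable (lebesgue_on \<Omega>)"
    using measurable_compose[OF L2_measurable[OF m] borel_measurable_continuous_onI[OF continuous_on_fst[OF continuous_on_id]]] .
  have s: "(\<lambda>x. snd (m x)) \<in> borel_measurable (lebesgue_on \<Omega>)"
    using measurable_compose[OF L2_measurable[OF m] borel_measurable_continuous_onI[OF continuous_on_snd[OF continuous_on_id]]] .
  have nf: "norm (fst p) \<le> 1 * norm p" and ns: "norm (snd p) \<le> 1 * norm p" for p :: "'a \<times> 'b"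
    using norm_fst_le[of "fst p" "snd p"] norm_snd_le[of "snd p" "fst p"] by auto
  show "(\<lambda>x. fst (m x)) \<in> L2 \<Omega>" by (rule L2_bounded_by(1)[OF f m nf zero_le_one])
  show "(\<lambda>x. snd (m x)) \<in> L2 \<Omega>" by (rule L2_bounded_by(1)[OF s m ns zero_le_one])
  show "L2_norm \<Omega> (\<lambda>x. fst (m x)) \<le> L2_norm \<Omega> m" using L2_bounded_by(2)[OF f m nf zero_le_one] by simp
  show "L2_norm \<Omega> (\<lambda>x. snd (m x)) \<le> L2_norm \<Omega> m" using L2_bounded_by(2)[OF s m ns zero_le_one] by simp
qed

lemma L2_inner_Pair:
  assumes "f \<in> L2 \<Omega>" "g \<in> L2 \<Omega>" "f' \<in> L2 \<Omega>" "g' \<in> L2 \<Omega>"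
  shows "L2_inner \<Omega> (\<lambda>x. (f x, g x)) (\<lambda>x. (f' x, g' x)) = L2_inner \<Omega> f f' + L2_inner \<Omega> g g'"
  using assms by (simp add: L2_inner_def inner_Pair L2_inner_integrable)

context bounded_open_set
begin

lemma H0_grad_imp_strong: "u \<in> H0_grad \<gamma> \<Omega> \<Longrightarrow> \<exists>G. strong_grad \<gamma> \<Omega> u G"
  using strong_grad_iff by (fastforce simp: H0_grad_def H_grad_def)

lemma H0_curl_imp_strong: "v \<in> H0_curl \<gamma> \<Omega> \<Longrightarrow> \<exists>w. strong_curl \<gamma> \<Omega> v w"
  using strong_curl_iff by (fastforce simp: H0_curl_def H_curl_def)

section \<open>The rows of \<open>T_of u\<close>\<close>

lemma Cinf0_field_vector:
  assumes "a \<in> Cinf0 \<gamma> \<Omega>" "b \<in> Cinf0 \<gamma> \<Omega>" "c \<in> Cinf0 \<gamma> \<Omega>"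
  shows "(\<lambda>x. vector [a x, b x, c x]) \<in> Cinf0_field \<gamma> \<Omega>"
  using assms by (simp add: Cinf0_field_iff forall_3)

lemma strong_curl_zero: "strong_curl \<gamma> \<Omega> (\<lambda>x. 0) (\<lambda>x. 0)"
proof -
  have "strong_grad \<gamma> \<Omega> (\<lambda>x. 0) (grad (\<lambda>x. 0))" by (rule strong_grad_smooth) simp
  moreover have "grad (\<lambda>x. 0) = (\<lambda>x. 0)" by (simp add: fun_eq_iff vec_eq_iff)
  ultimately show ?thesis using strong_grad_imp_strong_curl by simp
qed

text \<open>The nonzero rows of \<open>T_of u\<close> inherit scalar approximations of
  \<open>u\<close>; their curls consist of signed partial derivatives, so the errors are bounded by
  those of \<open>u\<close> and its gradient.\<close>

lemma strong_curl_of_strong_grad: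
  assumes u: "strong_grad \<gamma> \<Omega> u G"
  shows "strong_curl \<gamma> \<Omega> (\<lambda>x. vector [0, 0, u x]) (\<lambda>x. vector [G x $ 2, - G x $ 1, 0])"
    and "strong_curl \<gamma> \<Omega> (\<lambda>x. vector [- u x, 0, 0]) (\<lambda>x. vector [0, - G x $ 3, G x $ 2])"
proof -
  have uL: "u \<in> L2 \<Omega>" "G \<in> L2 \<Omega>" using u by (auto simp: strong_grad_def)
  have GL: "(\<lambda>x. G x $ i) \<in> L2 \<Omega>" for i using uL by (simp add: L2_vec_iff)
  have L: "(\<lambda>x. vector [0, 0, u x] :: real^3) \<in> L2 \<Omega>" "(\<lambda>x. vector [G x $ 2, - G x $ 1, 0] :: real^3) \<in> L2 \<Omega>"
    "(\<lambda>x. vector [- u x, 0, 0] :: real^3) \<in> L2 \<Omega>" "(\<lambda>x. vector [0, - G x $ 3, G x $ 2] :: real^3) \<in> L2 \<Omega>"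
    using uL(1) GL by (simp_all add: L2_vec_iff forall_3 L2_minus)
  have ap: "\<exists>\<phi>\<in>Cinf0 \<gamma> \<Omega>. L2_norm \<Omega> (\<lambda>x. u x - \<phi> x) < e \<and> L2_norm \<Omega> (\<lambda>x. G x - grad \<phi> x) < e" if "e > 0" for e
    using u that by (simp add: strong_grad_def)
  have le: "L2_norm \<Omega> f \<le> L2_norm \<Omega> g"
    if "f \<in> L2 \<Omega>" "g \<in> L2 \<Omega>" "\<And>x. norm (f x) \<le> norm (g x)"
    for f :: "real^3 \<Rightarrow> real^3" and g :: "real^3 \<Rightarrow> 'b::euclidean_space"
    using L2_bounded_by(2)[OF L2_measurable[OF that(1)] that(2), of 1] that(3) by simp
  show "strong_curl \<gamma> \<Omega> (\<lambda>x. vector [0, 0, u x]) (\<lambda>x. vector [G x $ 2, - G x $ 1, 0])"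
    unfolding strong_curl_def
  proof (intro conjI L allI impI)
    fix e :: real assume "e > 0"
    from ap[OF this] obtain \<phi> where \<phi>: "\<phi> \<in> Cinf0 \<gamma> \<Omega>" "L2_norm \<Omega> (\<lambda>x. u x - \<phi> x) < e"
        "L2_norm \<Omega> (\<lambda>x. G x - grad \<phi> x) < e" by blast
    let ?\<Phi> = "\<lambda>x. vector [0, 0, \<phi> x] :: real^3"
    have F: "?\<Phi> \<in> Cinf0_field \<gamma> \<Omega>" using \<phi>(1) by (intro Cinf0_field_vector) auto
    have c: "curl ?\<Phi> x = vector [pderiv3 2 \<phi> x, - pderiv3 1 \<phi> x, 0]" for x
      by (simp add: curl_def)
    have "L2_norm \<Omega> (\<lambda>x. vector [0, 0, u x] - ?\<Phi> x) \<le> L2_norm \<Omega> (\<lambda>x. u x - \<phi> x)"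
    proof (rule le)
      show "norm (vector [0, 0, u x] - ?\<Phi> x) \<le> norm (u x - \<phi> x)" for x
        by (simp add: norm_eq_sqrt_inner inner_vec_def sum_3)
    qed (intro L2_diff L uL Cinf0_field_L2[OF F] Cinf0_L2[OF \<phi>(1)])+
    moreover have "L2_norm \<Omega> (\<lambda>x. vector [G x $ 2, - G x $ 1, 0] - curl ?\<Phi> x) \<le> L2_norm \<Omega> (\<lambda>x. G x - grad \<phi> x)"
    proof (rule le)
      show "norm (vector [G x $ 2, - G x $ 1, 0] - curl ?\<Phi> x) \<le> norm (G x - grad \<phi> x)" for x
        unfolding c norm_le using zero_le_square[of "G x $ 3 - pderiv3 3 \<phi> x"]
        by (simp add: inner_vec_def sum_3 algebra_simps)
    qed (intro L2_diff L uL Cinf0_field_L2[OF F] Cinf0_grad_L2[OF \<phi>(1)])+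
    ultimately show "\<exists>\<Phi>\<in>Cinf0_field \<gamma> \<Omega>. L2_norm \<Omega> (\<lambda>x. vector [0, 0, u x] - \<Phi> x) < e \<and>
        L2_norm \<Omega> (\<lambda>x. vector [G x $ 2, - G x $ 1, 0] - curl \<Phi> x) < e"
      using \<phi>(2,3) F by (intro bexI[of _ ?\<Phi>] conjI) (auto intro: le_less_trans)
  qed
  show "strong_curl \<gamma> \<Omega> (\<lambda>x. vector [- u x, 0, 0]) (\<lambda>x. vector [0, - G x $ 3, G x $ 2])"
    unfolding strong_curl_def
  proof (intro conjI L allI impI)
    fix e :: real assume "e > 0"
    from ap[OF this] obtain \<phi> where \<phi>: "\<phi> \<in> Cinf0 \<gamma> \<Omega>" "L2_norm \<Omega> (\<lambda>x. u x - \<phi> x) < e"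
        "L2_norm \<Omega> (\<lambda>x. G x - grad \<phi> x) < e" by blast
    let ?\<Phi> = "\<lambda>x. vector [- \<phi> x, 0, 0] :: real^3"
    have F: "?\<Phi> \<in> Cinf0_field \<gamma> \<Omega>" using \<phi>(1) by (intro Cinf0_field_vector) (auto simp: Cinf0_minus)
    have c: "curl ?\<Phi> x = vector [0, - pderiv3 3 \<phi> x, pderiv3 2 \<phi> x]" for x
      using Cinf0_smooth[OF \<phi>(1)] by (simp add: curl_def pderiv3_minus smooth_differentiable)
    have "L2_norm \<Omega> (\<lambda>x. vector [- u x, 0, 0] - ?\<Phi> x) \<le> L2_norm \<Omega> (\<lambda>x. u x - \<phi> x)"
    proof (rule le)
      show "norm (vector [- u x, 0, 0] - ?\<Phi> x) \<le> norm (u x - \<phi> x)" for x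
        by (simp add: norm_eq_sqrt_inner inner_vec_def sum_3 abs_minus_commute)
    qed (intro L2_diff L uL Cinf0_field_L2[OF F] Cinf0_L2[OF \<phi>(1)])+
    moreover have "L2_norm \<Omega> (\<lambda>x. vector [0, - G x $ 3, G x $ 2] - curl ?\<Phi> x) \<le> L2_norm \<Omega> (\<lambda>x. G x - grad \<phi> x)"
    proof (rule le)
      show "norm (vector [0, - G x $ 3, G x $ 2] - curl ?\<Phi> x) \<le> norm (G x - grad \<phi> x)" for x
        unfolding c norm_le using zero_le_square[of "G x $ 1 - pderiv3 1 \<phi> x"]
        by (simp add: inner_vec_def sum_3 algebra_simps)
    qed (intro L2_diff L uL Cinf0_field_L2[OF F] Cinf0_grad_L2[OF \<phi>(1)])+
    ultimately show "\<exists>\<Phi>\<in>Cinf0_field \<gamma> \<Omega>. L2_norm \<Omega> (\<lambda>x. vector [- u x, 0, 0] - \<Phi> x) < e \<and>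
        L2_norm \<Omega> (\<lambda>x. vector [0, - G x $ 3, G x $ 2] - curl \<Phi> x) < e"
      using \<phi>(2,3) F by (intro bexI[of _ ?\<Phi>] conjI) (auto intro: le_less_trans)
  qed
qed

text \<open>Smooth approximations of a row (0, 0, u) need not have two vanishing components, so
  their last component gives no direct control of the gradient. Testing with (0, \<psi>, 0) and
  (\<psi>, 0, 0) isolates the partial derivatives of \<open>u\<close>; as \<psi> has to vanish near
  \<open>\<gamma>'\<close> only, the boundary condition on \<gamma> is kept in weak form.\<close>

lemma weak_grad_of_strong_curl:
  assumes v: "strong_curl \<gamma> \<Omega> (\<lambda>x. vector [0, 0, u x]) v" and w: "strong_curl \<gamma> \<Omega> (\<lambda>x. vector [- u x, 0, 0]) w"
    and c: "frontier \<Omega> \<subseteq> closure (\<gamma> \<union> \<gamma>')"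
  shows "weak_grad_on (Cinf0 \<gamma>' \<Omega>) \<Omega> u (\<lambda>x. vector [- v x $ 2, v x $ 1, - w x $ 2])"
proof -
  have L: "(\<lambda>x. vector [0, 0, u x] :: real^3) \<in> L2 \<Omega>" "v \<in> L2 \<Omega>" "w \<in> L2 \<Omega>"
    "(\<lambda>x. vector [- u x, 0, 0] :: real^3) \<in> L2 \<Omega>"
    using v w by (auto simp: strong_curl_def)
  then have uL: "u \<in> L2 \<Omega>" by (simp add: L2_vec_iff forall_3)
  have vw: "(\<lambda>x. v x $ i) \<in> L2 \<Omega>" "(\<lambda>x. w x $ i) \<in> L2 \<Omega>" for i using L by (simp_all add: L2_vec_iff)
  have "L2_inner \<Omega> u (pderiv3 1 \<psi>) = - L2_inner \<Omega> (\<lambda>x. - v x $ 2) \<psi> \<and>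
      L2_inner \<Omega> u (pderiv3 2 \<psi>) = - L2_inner \<Omega> (\<lambda>x. v x $ 1) \<psi> \<and>
      L2_inner \<Omega> u (pderiv3 3 \<psi>) = - L2_inner \<Omega> (\<lambda>x. - w x $ 2) \<psi>" if \<psi>: "\<psi> \<in> Cinf0 \<gamma>' \<Omega>" for \<psi>
  proof -
    let ?P = "\<lambda>x. vector [0, \<psi> x, 0] :: real^3" and ?Q = "\<lambda>x. vector [\<psi> x, 0, 0] :: real^3"
    have P: "?P \<in> Cinf0_field \<gamma>' \<Omega>" and Q: "?Q \<in> Cinf0_field \<gamma>' \<Omega>"
      using \<psi> by (auto intro!: Cinf0_field_vector)
    have cP: "curl ?P = (\<lambda>x. vector [- pderiv3 3 \<psi> x, 0, pderiv3 1 \<psi> x])"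
      and cQ: "curl ?Q = (\<lambda>x. vector [0, pderiv3 3 \<psi> x, - pderiv3 2 \<psi> x])"
      by (simp_all add: curl_def fun_eq_iff)
    have "L2_inner \<Omega> u (pderiv3 1 \<psi>) = L2_inner \<Omega> (\<lambda>x. v x $ 2) \<psi>"
      using strong_curl_Green[OF v P c] unfolding cP by (simp add: L2_inner_def inner_vec_def sum_3)
    moreover have "- L2_inner \<Omega> u (pderiv3 2 \<psi>) = L2_inner \<Omega> (\<lambda>x. v x $ 1) \<psi>"
      using strong_curl_Green[OF v Q c] unfolding cQ by (simp add: L2_inner_def inner_vec_def sum_3)
    moreover have "L2_inner \<Omega> u (pderiv3 3 \<psi>) = L2_inner \<Omega> (\<lambda>x. w x $ 2) \<psi>"
      using strong_curl_Green[OF w P c] unfolding cP by (simp add: L2_inner_def inner_vec_def sum_3)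
    ultimately show ?thesis by (simp add: L2_inner_minus_left)
  qed
  moreover have "(\<lambda>x. vector [- v x $ 2, v x $ 1, - w x $ 2] :: real^3) \<in> L2 \<Omega>"
    using vw by (simp add: L2_vec_iff forall_3 L2_minus)
  ultimately show ?thesis using uL by (simp add: weak_grad_on_def forall_3)
qed

lemma T_of_rows:
  "(\<lambda>x. T_of u x $ 1) = (\<lambda>x. vector [0, 0, u x])" "(\<lambda>x. T_of u x $ 2) = (\<lambda>x. 0)"
  "(\<lambda>x. T_of u x $ 3) = (\<lambda>x. vector [- u x, 0, 0])"
  by (auto simp: T_of_def vec_eq_iff forall_3)

text \<open>The delicate direction leads from the curl space to the gradient space: there only a
  weak gradient is found, and \<open>key\<close> turns it into a strong one.\<close>

lemma T_of_H0_Curl_iff: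
  assumes key: "\<And>u G. weak_grad_on (Cinf0 \<gamma>' \<Omega>) \<Omega> u G \<Longrightarrow> strong_grad \<gamma> \<Omega> u G"
    and c: "frontier \<Omega> \<subseteq> closure (\<gamma> \<union> \<gamma>')"
  shows "T_of u \<in> H0_Curl \<gamma> \<Omega> \<longleftrightarrow> u \<in> H0_grad \<gamma> \<Omega>"
proof
  assume "T_of u \<in> H0_Curl \<gamma> \<Omega>"
  then have "(\<lambda>x. vector [0, 0, u x]) \<in> H0_curl \<gamma> \<Omega>" "(\<lambda>x. vector [- u x, 0, 0]) \<in> H0_curl \<gamma> \<Omega>"
    by (simp_all add: H0_Curl_def forall_3 T_of_rows)
  then obtain v w where "strong_curl \<gamma> \<Omega> (\<lambda>x. vector [0, 0, u x]) v" "strong_curl \<gamma> \<Omega> (\<lambda>x. vector [- u x, 0, 0]) w"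
    using H0_curl_imp_strong by metis
  from key[OF weak_grad_of_strong_curl[OF this c]] show "u \<in> H0_grad \<gamma> \<Omega>" by (simp add: strong_grad_iff)
next
  assume "u \<in> H0_grad \<gamma> \<Omega>"
  then obtain G where "strong_grad \<gamma> \<Omega> u G" using H0_grad_imp_strong by blast
  from strong_curl_of_strong_grad[OF this] strong_curl_zero[of \<gamma>]
  show "T_of u \<in> H0_Curl \<gamma> \<Omega>" by (simp add: H0_Curl_def forall_3 T_of_rows strong_curl_iff)
qed

text \<open>Korn's inequality for the gradient of the infinitesimal rotation \<open>\<phi> (- x\<^sub>2, x\<^sub>1, 0)\<close>: the skew
  part of this gradient contains \<open>\<phi>\<close>, the symmetric part only the gradient of \<open>\<phi>\<close>.\<close>

lemma Korn_imp_Poincare: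
  assumes korn: "irrot_korn_constant \<Omega> \<gamma> c"
  shows "\<exists>C\<ge>0. \<forall>u G. strong_grad \<gamma> \<Omega> u G \<longrightarrow> L2_norm \<Omega> u \<le> C * L2_norm \<Omega> G"
proof -
  obtain R where R: "R > 0" "\<And>x. x \<in> \<Omega> \<Longrightarrow> norm x \<le> R"
    using bounded_\<Omega> bounded_pos by blast
  have Rc: "\<bar>x $ i\<bar> \<le> R" if "x \<in> \<Omega>" for x :: "real^3" and i
    using component_le_norm_cart[of x i] R(2)[OF that] by linarith
  have c: "c > 0" using korn by (simp add: irrot_korn_constant_def)
  let ?C = "c * (9 * R) + R"
  have sm: "L2_norm \<Omega> \<phi> \<le> ?C * L2_norm \<Omega> (grad \<phi>)" if \<phi>: "\<phi> \<in> Cinf0 \<gamma> \<Omega>" for \<phi>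
  proof -
    have s: "smooth \<phi>" using \<phi> by (rule Cinf0_smooth)
    define b where "b i x = (if i = 1 then - (x $ 2) else if i = 2 then x $ 1 else 0)" for i :: 3 and x :: "real^3"
    define \<psi> where "\<psi> i x = b i x * \<phi> x" for i x
    have bs: "smooth (b i)" for i
      by (cases "i = 1"; cases "i = 2") (auto simp: b_def[abs_def] intro: smooth_minus smooth_nth)
    have bR: "\<bar>b i x\<bar> \<le> R" if "x \<in> \<Omega>" for i x using Rc[OF that] R(1) by (auto simp: b_def)
    have \<psi>C: "\<psi> i \<in> Cinf0 \<gamma> \<Omega>" for i unfolding \<psi>_def by (rule Cinf0_mult[OF \<phi> bs])
    have d\<psi>: "pderiv3 j (\<psi> i) x = b i x * pderiv3 j \<phi> x + pderiv3 j (b i) x * \<phi> x" for i j x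
      unfolding \<psi>_def by (intro pderiv3_mult smooth_differentiable bs s)
    have db: "pderiv3 j (b i) x = (if i = 1 \<and> j = 2 then - 1 else if i = 2 \<and> j = 1 then 1 else 0)" for i j x
      by (cases "i = 1"; cases "i = 2") (auto simp: b_def[abs_def] pderiv3_minus smooth_differentiable)
    define T where "T x = (\<chi> i. grad (\<psi> i) x)" for x
    have row: "strong_curl \<gamma> \<Omega> (grad (\<psi> i)) (\<lambda>x. 0)" for i
      by (rule strong_grad_imp_strong_curl[OF strong_grad_smooth[OF \<psi>C]])
    then have "T \<in> H0_Curl0 \<gamma> \<Omega>"
      by (simp add: H0_Curl0_def H0_curl0_def T_def strong_curl_iff)
    then have K: "L2_norm \<Omega> T \<le> c * L2_norm \<Omega> (\<lambda>x. sym_part (T x))"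
      using korn by (simp add: irrot_korn_constant_def)
    have TL: "T \<in> L2 \<Omega>" using row by (simp add: L2_vec_iff[of T] T_def strong_curl_def)
    have gL: "grad \<phi> \<in> L2 \<Omega>" by (rule Cinf0_grad_L2[OF \<phi>])
    have sym: "sym_part (T x) $ i $ j = (b i x * pderiv3 j \<phi> x + b j x * pderiv3 i \<phi> x) / 2" for x i j
    proof -
      \<comment> \<open>The Jacobian of the rotation is skew, so the terms carrying \<phi> itself
        cancel.\<close>
      have "pderiv3 j (b i) x + pderiv3 i (b j) x = 0" by (auto simp: db)
      then have "pderiv3 j (b i) x * \<phi> x + pderiv3 i (b j) x * \<phi> x = 0" by (simp flip: distrib_right)
      then show ?thesis by (simp add: sym_part_def transpose_def T_def d\<psi>)
    qed
    have symL: "(\<lambda>x. sym_part (T x)) \<in> L2 \<Omega>"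
      unfolding L2_vec_iff sym
      by (auto intro!: smooth_L2 smooth_cmult[of _ "1/2", simplified] smooth_add smooth_mult bs smooth_pderiv3 s)
    \<comment> \<open>There are nine entries, each at most R |grad \<phi>| because the coordinates
      are bounded by R on \<Omega>.\<close>
    have "L2_norm \<Omega> (\<lambda>x. sym_part (T x)) \<le> (9 * R) * L2_norm \<Omega> (grad \<phi>)"
    proof (rule L2_bounded_by(2)[OF L2_measurable[OF symL] gL])
      fix x assume x: "x \<in> \<Omega>"
      have entry: "\<bar>sym_part (T x) $ i $ j\<bar> \<le> R * norm (grad \<phi> x)" for i j
      proof -
        have "\<bar>b i x * pderiv3 j \<phi> x\<bar> \<le> R * norm (grad \<phi> x)" for i j
          unfolding abs_mult using component_le_norm_cart[of "grad \<phi> x" j] bR[OF x] R(1)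
          by (intro mult_mono) auto
        moreover have "\<bar>(a + b) / 2\<bar> \<le> r" if "\<bar>a\<bar> \<le> r" "\<bar>b\<bar> \<le> r" for a b r :: real
          using that by (simp add: abs_le_iff)
        ultimately show ?thesis unfolding sym by blast
      qed
      have "norm (sym_part (T x)) \<le> (\<Sum>i\<in>UNIV. norm (sym_part (T x) $ i))"
        unfolding norm_vec_def[of "sym_part (T x)"] by (rule L2_set_le_sum) auto
      also have "\<dots> \<le> (\<Sum>i\<in>(UNIV::3 set). \<Sum>j\<in>(UNIV::3 set). R * norm (grad \<phi> x))"
        by (intro sum_mono order_trans[OF norm_le_l1_cart] entry)
      also have "\<dots> = 9 * R * norm (grad \<phi> x)" by simp
      finally show "norm (sym_part (T x)) \<le> 9 * R * norm (grad \<phi> x)" .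
    qed (use R in auto)
    from order_trans[OF K mult_left_mono[OF this less_imp_le[OF c]]]
    have "L2_norm \<Omega> T \<le> c * (9 * R * L2_norm \<Omega> (grad \<phi>))" .
    moreover have "L2_norm \<Omega> (\<lambda>x. T x $ 2 $ 1) \<le> L2_norm \<Omega> T"
    proof -
      have "(\<lambda>x. T x $ 2) \<in> L2 \<Omega>" using TL L2_vec_iff by blast
      from order_trans[OF L2_norm_nth_le[OF this, of 1] L2_norm_nth_le[OF TL, of 2]] show ?thesis .
    qed
    moreover have "L2_norm \<Omega> \<phi> \<le> L2_norm \<Omega> (\<lambda>x. T x $ 2 $ 1) + L2_norm \<Omega> (\<lambda>x. - (x $ 1 * pderiv3 1 \<phi> x))"
    proof -
      \<comment> \<open>The entry (2,1) is the first partial derivative of the product of the first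
        coordinate and \<phi>, hence \<phi> plus that coordinate times a partial derivative of
        \<phi>.\<close>
      have eq: "\<phi> x = T x $ 2 $ 1 + - (x $ 1 * pderiv3 1 \<phi> x)" for x
        by (simp add: T_def d\<psi> db b_def)
      have 1: "(\<lambda>x. T x $ 2 $ 1) \<in> L2 \<Omega>" using TL by (simp add: L2_vec_iff)
      have 2: "(\<lambda>x. - (x $ 1 * pderiv3 1 \<phi> x)) \<in> L2 \<Omega>"
        by (intro smooth_L2 smooth_minus smooth_mult smooth_nth smooth_pderiv3 s)
      show ?thesis using L2_norm_triangle[OF 1 2] unfolding eq[symmetric] .
    qed
    moreover have "L2_norm \<Omega> (\<lambda>x. - (x $ 1 * pderiv3 1 \<phi> x)) \<le> R * L2_norm \<Omega> (grad \<phi>)"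
    proof (rule L2_bounded_by(2)[OF _ gL])
      show "(\<lambda>x. - (x $ 1 * pderiv3 1 \<phi> x)) \<in> borel_measurable (lebesgue_on \<Omega>)"
        by (intro smooth_measurable smooth_minus smooth_mult smooth_nth smooth_pderiv3 s)
      show "norm (- (x $ 1 * pderiv3 1 \<phi> x)) \<le> R * norm (grad \<phi> x)" if "x \<in> \<Omega>" for x
        using component_le_norm_cart[of "grad \<phi> x" 1] Rc[OF that] R(1) by (auto simp: abs_mult intro!: mult_mono)
    qed (use R in auto)
    ultimately show ?thesis by (simp add: algebra_simps)
  qed
  have "L2_norm \<Omega> u \<le> ?C * L2_norm \<Omega> G" if u: "strong_grad \<gamma> \<Omega> u G" for u G
  proof (rule field_le_epsilon)
    fix e :: real assume e: "e > 0"
    have C0: "?C > 0" using c R by (intro add_pos_pos mult_pos_pos) auto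
    then have "e / (?C + 1) > 0" using e by simp
    then obtain \<phi> where \<phi>: "\<phi> \<in> Cinf0 \<gamma> \<Omega>" "L2_norm \<Omega> (\<lambda>x. u x - \<phi> x) < e / (?C + 1)"
        "L2_norm \<Omega> (\<lambda>x. G x - grad \<phi> x) < e / (?C + 1)"
      using u unfolding strong_grad_def by blast
    have uL: "u \<in> L2 \<Omega>" "G \<in> L2 \<Omega>" using u by (auto simp: strong_grad_def)
    have "L2_norm \<Omega> u \<le> L2_norm \<Omega> \<phi> + e / (?C + 1)"
      using L2_norm_le_add_diff[OF uL(1) Cinf0_L2[OF \<phi>(1)]] \<phi>(2) by linarith
    also have "L2_norm \<Omega> \<phi> \<le> ?C * L2_norm \<Omega> (grad \<phi>)" by (rule sm[OF \<phi>(1)])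
    also have "L2_norm \<Omega> (grad \<phi>) \<le> L2_norm \<Omega> G + e / (?C + 1)"
      using L2_norm_le_add_diff[OF Cinf0_grad_L2[OF \<phi>(1)] uL(2)] \<phi>(3) L2_norm_diff_commute[of \<Omega> "grad \<phi>" G] by linarith
    finally have "L2_norm \<Omega> u \<le> ?C * (L2_norm \<Omega> G + e / (?C + 1)) + e / (?C + 1)"
      using C0 by (simp add: mult_left_mono)
    also have "\<dots> = ?C * L2_norm \<Omega> G + e / (?C + 1) * (?C + 1)"
    proof -
      have "K * (a + q) + q = K * a + q * (K + 1)" for K a q :: real by (simp add: algebra_simps)
      then show ?thesis by blast
    qed
    also have "e / (?C + 1) * (?C + 1) = e" using C0 by simp
    finally show "L2_norm \<Omega> u \<le> ?C * L2_norm \<Omega> G + e" .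
  qed
  moreover have "0 \<le> ?C" using c R by simp
  ultimately show ?thesis by blast
qed

text \<open>The constant \<open>C\<close> may be any Poincare constant. In \<open>main\<close> it
  appears multiplied by \<epsilon>, so letting \<epsilon> tend to 0 replaces it by the Maxwell
  constant.\<close>

lemma Maxwell_imp_Poincare:
  assumes key: "\<And>u G. weak_grad_on (Cinf0 (Gamma_n \<Omega> \<gamma>) \<Omega>) \<Omega> u G \<Longrightarrow> strong_grad \<gamma> \<Omega> u G"
    and cov: "frontier \<Omega> \<subseteq> closure (\<gamma> \<union> Gamma_n \<Omega> \<gamma>)"
    and maxwell: "maxwell_constant \<Omega> \<gamma> c"
    and C: "C \<ge> 0" "\<And>u G. strong_grad \<gamma> \<Omega> u G \<Longrightarrow> L2_norm \<Omega> u \<le> C * L2_norm \<Omega> G"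
    and g: "strong_grad \<gamma> \<Omega> g G"
  shows "L2_norm \<Omega> g \<le> c * L2_norm \<Omega> G"
proof -
  let ?\<gamma>n = "Gamma_n \<Omega> \<gamma>"
  have c: "c > 0" using maxwell by (simp add: maxwell_constant_def)
  have gL: "g \<in> L2 \<Omega>" "G \<in> L2 \<Omega>" using g by (auto simp: strong_grad_def)
  have main: "L2_norm \<Omega> g * L2_norm \<Omega> g \<le> (C * (\<epsilon> * (c * L2_norm \<Omega> g)) + c * L2_norm \<Omega> G) * L2_norm \<Omega> g"
    if \<epsilon>: "\<epsilon> > 0" for \<epsilon>
  proof -
    \<comment> \<open>The weight is the square root of \<epsilon> because it enters the inner
      product of two pairs twice.\<close>
    define s where "s = sqrt \<epsilon>"
    have s: "s > 0" "s * s = \<epsilon>" using \<epsilon> by (auto simp: s_def)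
    define A where "A = (\<lambda>\<Phi> x. (s *\<^sub>R \<Phi> x, div3 \<Phi> x)) ` Cinf0_field ?\<gamma>n \<Omega>"
    define F where "F = (\<lambda>x. (0::real^3, g x))"
    have FL: "F \<in> L2 \<Omega>" unfolding F_def by (intro L2_Pair gL L2_zero)
    have AL: "A \<subseteq> L2 \<Omega>" unfolding A_def using L2_Pair[OF L2_scaleR[OF Cinf0_field_L2(1)] Cinf0_field_L2(3)] by auto
    have AI: "(\<lambda>x. (s *\<^sub>R \<Phi> x, div3 \<Phi> x)) \<in> A" if "\<Phi> \<in> Cinf0_field ?\<gamma>n \<Omega>" for \<Phi>
      unfolding A_def using that by (rule imageI)
    have div_add: "div3 (\<lambda>x. \<Phi> x + \<Psi> x) x = div3 \<Phi> x + div3 \<Psi> x"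
      if "\<Phi> \<in> Cinf0_field ?\<gamma>n \<Omega>" "\<Psi> \<in> Cinf0_field ?\<gamma>n \<Omega>" for \<Phi> \<Psi> x
      using that by (simp add: div3_def pderiv3_add smooth_differentiable Cinf0_field_smooth sum.distrib)
    have div_scale: "div3 (\<lambda>x. k *\<^sub>R \<Phi> x) x = k * div3 \<Phi> x" if "\<Phi> \<in> Cinf0_field ?\<gamma>n \<Omega>" for \<Phi> k x
      using that by (simp add: div3_def pderiv3_cmult smooth_differentiable Cinf0_field_smooth sum_distrib_left)
    have "\<exists>m\<in>L2 \<Omega>. (\<forall>e>0. \<exists>f\<in>A. L2_norm \<Omega> (\<lambda>x. f x - m x) < e) \<and>
        (\<forall>f\<in>A. L2_inner \<Omega> (\<lambda>x. F x - m x) f = 0)"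
    proof (rule L2_projection[OF lmeasurable_\<Omega> FL AL])
      have "(\<lambda>x. 0) \<in> Cinf0_field ?\<gamma>n \<Omega>" by (simp add: Cinf0_field_iff)
      then show "A \<noteq> {}" by (auto simp: A_def)
      show "(\<lambda>x. f x + h x) \<in> A" if fh: "f \<in> A" "h \<in> A" for f h
      proof -
        obtain \<Phi> \<Psi> where *: "\<Phi> \<in> Cinf0_field ?\<gamma>n \<Omega>" "\<Psi> \<in> Cinf0_field ?\<gamma>n \<Omega>"
            "f = (\<lambda>x. (s *\<^sub>R \<Phi> x, div3 \<Phi> x))" "h = (\<lambda>x. (s *\<^sub>R \<Psi> x, div3 \<Psi> x))"
          using fh by (auto simp: A_def)
        have S: "(\<lambda>x. \<Phi> x + \<Psi> x) \<in> Cinf0_field ?\<gamma>n \<Omega>" using *(1,2) by (simp add: Cinf0_field_iff Cinf0_add)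
        have eq: "(\<lambda>x. f x + h x) = (\<lambda>x. (s *\<^sub>R (\<Phi> x + \<Psi> x), div3 (\<lambda>x. \<Phi> x + \<Psi> x) x))"
          unfolding *(3,4) by (simp add: div_add[OF *(1,2)] scaleR_add_right)
        show ?thesis unfolding eq by (rule AI[OF S])
      qed
      show "(\<lambda>x. k *\<^sub>R f x) \<in> A" if f: "f \<in> A" for f k
      proof -
        obtain \<Phi> where *: "\<Phi> \<in> Cinf0_field ?\<gamma>n \<Omega>" "f = (\<lambda>x. (s *\<^sub>R \<Phi> x, div3 \<Phi> x))"
          using f by (auto simp: A_def)
        have S: "(\<lambda>x. k *\<^sub>R \<Phi> x) \<in> Cinf0_field ?\<gamma>n \<Omega>" using *(1) by (simp add: Cinf0_field_iff Cinf0_cmult)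
        have eq: "(\<lambda>x. k *\<^sub>R f x) = (\<lambda>x. (s *\<^sub>R (k *\<^sub>R \<Phi> x), div3 (\<lambda>x. k *\<^sub>R \<Phi> x) x))"
          unfolding *(2) by (simp add: div_scale[OF *(1)] mult.commute)
        show ?thesis unfolding eq by (rule AI[OF S])
      qed
    qed
    then obtain m where mL: "m \<in> L2 \<Omega>" and ap: "\<And>e. e > 0 \<Longrightarrow> \<exists>f\<in>A. L2_norm \<Omega> (\<lambda>x. f x - m x) < e"
      and orth: "\<And>f. f \<in> A \<Longrightarrow> L2_inner \<Omega> (\<lambda>x. F x - m x) f = 0" by blast
    \<comment> \<open>The weight is undone, so that (v, d) itself is a limit of pairs (\<Phi>, div
      \<Phi>).\<close>
    define v where "v x = (1 / s) *\<^sub>R fst (m x)" for x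
    define d where "d x = snd (m x)" for x
    define p where "p x = g x - d x" for x
    have vL: "v \<in> L2 \<Omega>" unfolding v_def by (intro L2_scaleR L2_fst_snd mL)
    have dL: "d \<in> L2 \<Omega>" unfolding d_def by (intro L2_fst_snd mL)
    have pL: "p \<in> L2 \<Omega>" unfolding p_def by (intro L2_diff gL dL)
    have m_eq: "m x = (s *\<^sub>R v x, d x)" for x using s by (simp add: v_def d_def)
    have sd: "strong_div ?\<gamma>n \<Omega> v d"
      unfolding strong_div_def
    proof (intro conjI vL dL allI impI)
      fix e :: real assume e: "e > 0"
      \<comment> \<open>The first component carries the weight \<open>s\<close>, so accuracy
        \<open>s * e\<close> is needed there to reach accuracy \<open>e\<close> for
        \<open>v\<close>.\<close>
      then have e': "min e (s * e) > 0" using s by simp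
      obtain f where f: "f \<in> A" "L2_norm \<Omega> (\<lambda>x. f x - m x) < min e (s * e)" using ap[OF e'] by blast
      obtain \<Phi> where \<Phi>: "\<Phi> \<in> Cinf0_field ?\<gamma>n \<Omega>" "f = (\<lambda>x. (s *\<^sub>R \<Phi> x, div3 \<Phi> x))"
        using f(1) by (auto simp: A_def)
      have mf: "(\<lambda>x. m x - f x) \<in> L2 \<Omega>" using mL AL f(1) by (intro L2_diff) auto
      have "s * L2_norm \<Omega> (\<lambda>x. v x - \<Phi> x) = L2_norm \<Omega> (\<lambda>x. s *\<^sub>R (v x - \<Phi> x))"
        using s by (subst L2_norm_scaleR) simp
      also have "\<dots> = L2_norm \<Omega> (\<lambda>x. fst (m x - f x))" by (simp add: m_eq \<Phi>(2) scaleR_diff_right)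
      also have "\<dots> < s * e"
        using L2_fst_snd(2)[OF mf] f(2) L2_norm_diff_commute[of \<Omega> m f] by linarith
      finally have 1: "L2_norm \<Omega> (\<lambda>x. v x - \<Phi> x) < e" using s(1) by simp
      have "L2_norm \<Omega> (\<lambda>x. d x - div3 \<Phi> x) = L2_norm \<Omega> (\<lambda>x. snd (m x - f x))" by (simp add: m_eq \<Phi>(2))
      also have "\<dots> < e"
        using L2_fst_snd(4)[OF mf] f(2) L2_norm_diff_commute[of \<Omega> m f] by linarith
      finally show "\<exists>\<Phi>\<in>Cinf0_field ?\<gamma>n \<Omega>. L2_norm \<Omega> (\<lambda>x. v x - \<Phi> x) < e \<and> L2_norm \<Omega> (\<lambda>x. d x - div3 \<Phi> x) < e"
        using 1 \<Phi>(1) by blast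
    qed
    \<comment> \<open>The orthogonality of F - m to \<open>A\<close>, i.e. the Euler-Lagrange
      equation of the least squares problem. As \<Phi> need not vanish near \<gamma>, it contains
      the boundary condition of \<open>p\<close> as well.\<close>
    have pdiv: "L2_inner \<Omega> p (div3 \<Phi>) = \<epsilon> * L2_inner \<Omega> v \<Phi>" if \<Phi>: "\<Phi> \<in> Cinf0_field ?\<gamma>n \<Omega>" for \<Phi>
    proof -
      note \<Phi>L = Cinf0_field_L2[OF \<Phi>]
      have "0 = L2_inner \<Omega> (\<lambda>x. ((- s) *\<^sub>R v x, p x)) (\<lambda>x. (s *\<^sub>R \<Phi> x, div3 \<Phi> x))"
        using orth[of "\<lambda>x. (s *\<^sub>R \<Phi> x, div3 \<Phi> x)"] \<Phi> by (simp add: A_def F_def m_eq p_def)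
      also have "\<dots> = L2_inner \<Omega> (\<lambda>x. (- s) *\<^sub>R v x) (\<lambda>x. s *\<^sub>R \<Phi> x) + L2_inner \<Omega> p (div3 \<Phi>)"
        by (rule L2_inner_Pair[OF L2_scaleR[OF vL] pL L2_scaleR[OF \<Phi>L(1)] \<Phi>L(3)])
      also have "L2_inner \<Omega> (\<lambda>x. (- s) *\<^sub>R v x) (\<lambda>x. s *\<^sub>R \<Phi> x) = - (\<epsilon> * L2_inner \<Omega> v \<Phi>)"
        unfolding L2_inner_scaleR_left L2_inner_scaleR_right using s(2) by (simp flip: mult.assoc)
      finally show ?thesis by simp
    qed
    have epL: "(\<lambda>x. (- \<epsilon>) *\<^sub>R v x) \<in> L2 \<Omega>" by (rule L2_scaleR[OF vL])
    have "weak_grad_on (Cinf0 ?\<gamma>n \<Omega>) \<Omega> p (\<lambda>x. (- \<epsilon>) *\<^sub>R v x)"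
    proof (rule weak_grad_on_field_iff[THEN iffD1, OF Cinf0_smooth Cinf0_zero pL epL], assumption, intro allI impI)
      fix \<Phi> :: "real^3 \<Rightarrow> real^3" assume "\<forall>i. (\<lambda>x. \<Phi> x $ i) \<in> Cinf0 ?\<gamma>n \<Omega>"
      then have "\<Phi> \<in> Cinf0_field ?\<gamma>n \<Omega>" by (simp add: Cinf0_field_iff)
      from pdiv[OF this] show "L2_inner \<Omega> p (div3 \<Phi>) = - L2_inner \<Omega> (\<lambda>x. (- \<epsilon>) *\<^sub>R v x) \<Phi>"
        unfolding L2_inner_scaleR_left by simp
    qed
    then have sg: "strong_grad \<gamma> \<Omega> p (\<lambda>x. (- \<epsilon>) *\<^sub>R v x)" by (rule key)
    \<comment> \<open>\<open>v\<close> is the gradient of - p/\<epsilon>, hence free of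
      curl.\<close>
    have "strong_curl \<gamma> \<Omega> v (\<lambda>x. 0)"
      using strong_grad_imp_strong_curl[OF strong_grad_scaleR[OF sg, of "- 1 / \<epsilon>"]] \<epsilon> by simp
    then have vc: "v \<in> H0_curl \<gamma> \<Omega>" "is_weak_curl \<Omega> v (\<lambda>x. 0)" by (simp_all add: strong_curl_iff)
    have vd: "v \<in> H0_div ?\<gamma>n \<Omega>" "is_weak_div \<Omega> v d" using sd by (simp_all add: strong_div_iff)
    have "L2_inner \<Omega> v h = 0" if h: "h \<in> harmonic_fields \<Omega> \<gamma>" for h
    proof -
      have sh: "strong_div ?\<gamma>n \<Omega> h (\<lambda>x. 0)"
        using h by (simp add: harmonic_fields_def H0_div0_def strong_div_iff)
      \<comment> \<open>A harmonic field is a limit of admissible \<Phi> whose divergences tend to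
        0, and by \<open>pdiv\<close> the inner product of \<Phi> with v is 1/\<epsilon> times that
        of div \<Phi> with p.\<close>
      have "L2_inner \<Omega> h v = (1 / \<epsilon>) * L2_inner \<Omega> (\<lambda>x. 0) p"
      proof (rule L2_inner_limit)
        fix e :: real assume "e > 0"
        then obtain \<Phi> where \<Phi>: "\<Phi> \<in> Cinf0_field ?\<gamma>n \<Omega>" "L2_norm \<Omega> (\<lambda>x. h x - \<Phi> x) < e"
            "L2_norm \<Omega> (\<lambda>x. 0 - div3 \<Phi> x) < e"
          using sh unfolding strong_div_def by blast
        have "L2_inner \<Omega> \<Phi> v = (1 / \<epsilon>) * L2_inner \<Omega> (div3 \<Phi>) p"
          using pdiv[OF \<Phi>(1)] \<epsilon> by (simp add: L2_inner_commute[of _ \<Phi>] L2_inner_commute[of _ "div3 \<Phi>"])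
        then show "\<exists>A' B'. A' \<in> L2 \<Omega> \<and> B' \<in> L2 \<Omega> \<and> L2_norm \<Omega> (\<lambda>x. h x - A' x) < e \<and>
            L2_norm \<Omega> (\<lambda>x. 0 - B' x) < e \<and> L2_inner \<Omega> A' v = (1 / \<epsilon>) * L2_inner \<Omega> B' p"
          using \<Phi> by (intro exI[of _ \<Phi>] exI[of _ "div3 \<Phi>"] conjI Cinf0_field_L2[OF \<Phi>(1)])
      qed (use sh vL pL in \<open>auto simp: strong_div_def\<close>)
      then show ?thesis by (simp add: L2_inner_commute[of _ v])
    qed
    then have "v \<in> L2_orth \<Omega> (harmonic_fields \<Omega> \<gamma>)" using vL by (simp add: L2_orth_def)
    then have "L2_norm \<Omega> v \<le> c * sqrt ((L2_norm \<Omega> (weak_curl \<Omega> v))\<^sup>2 + (L2_norm \<Omega> (weak_div \<Omega> v))\<^sup>2)"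
      using maxwell vc vd by (simp add: maxwell_constant_def)
    then have vle: "L2_norm \<Omega> v \<le> c * L2_norm \<Omega> d"
      by (simp add: L2_norm_weak_curl[OF vc(2)] L2_norm_weak_div[OF vd(2)])
    \<comment> \<open>A projection does not increase the norm. As \<open>m\<close> is only a limit
      of members of \<open>A\<close>, its orthogonality to F - m is itself a limit, taken with the
      factor 0 in \<open>L2_inner_limit\<close>.\<close>
    have dle: "L2_norm \<Omega> d \<le> L2_norm \<Omega> g"
    proof -
      have FmL: "(\<lambda>x. F x - m x) \<in> L2 \<Omega>" by (rule L2_diff[OF FL mL])
      have "L2_inner \<Omega> m (\<lambda>x. F x - m x) = 0 * L2_inner \<Omega> m m"
      proof (rule L2_inner_limit)
        fix e :: real assume "e > 0"
        from ap[OF this] obtain f where f: "f \<in> A" "L2_norm \<Omega> (\<lambda>x. f x - m x) < e" by blast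
        then show "\<exists>A' B'. A' \<in> L2 \<Omega> \<and> B' \<in> L2 \<Omega> \<and> L2_norm \<Omega> (\<lambda>x. m x - A' x) < e \<and>
            L2_norm \<Omega> (\<lambda>x. m x - B' x) < e \<and> L2_inner \<Omega> A' (\<lambda>x. F x - m x) = 0 * L2_inner \<Omega> B' m"
          using AL orth[OF f(1)] L2_norm_diff_commute[of \<Omega> f m]
          by (intro exI[of _ f]) (auto simp: L2_inner_commute[of _ f])
      qed (use mL FmL in auto)
      then have "(L2_norm \<Omega> m)\<^sup>2 = L2_inner \<Omega> m F"
        using mL FL by (simp add: L2_norm_sq_inner L2_inner_diff_right)
      also have "\<dots> \<le> L2_norm \<Omega> m * L2_norm \<Omega> F" using L2_Cauchy_Schwarz[OF mL FL] by linarith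
      finally have "L2_norm \<Omega> m * L2_norm \<Omega> m \<le> L2_norm \<Omega> m * L2_norm \<Omega> F" by (simp add: power2_eq_square)
      then have "L2_norm \<Omega> m \<le> L2_norm \<Omega> F"
        using L2_norm_nonneg[of \<Omega> m] L2_norm_nonneg[of \<Omega> F] by (cases "L2_norm \<Omega> m = 0") auto
      also have "\<dots> = L2_norm \<Omega> g" by (simp add: L2_norm_def F_def norm_Pair)
      finally show ?thesis using L2_fst_snd(4)[OF mL] unfolding d_def by linarith
    qed
    have vg: "L2_norm \<Omega> v \<le> c * L2_norm \<Omega> g" using vle mult_left_mono[OF dle, of c] c by linarith
    have "L2_norm \<Omega> p \<le> C * L2_norm \<Omega> (\<lambda>x. (- \<epsilon>) *\<^sub>R v x)" by (rule C(2)[OF sg])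
    also have "\<dots> \<le> C * (\<epsilon> * (c * L2_norm \<Omega> g))"
      unfolding L2_norm_scaleR using C(1) vg \<epsilon> by (intro mult_left_mono) auto
    finally have ple: "L2_norm \<Omega> p \<le> C * (\<epsilon> * (c * L2_norm \<Omega> g))" .
    \<comment> \<open>\<open>g\<close> is split into p and d = div v, and the second part is
      integrated by parts against \<open>G\<close>.\<close>
    have "L2_norm \<Omega> g * L2_norm \<Omega> g = L2_inner \<Omega> (\<lambda>x. p x + d x) g"
      by (simp add: p_def L2_norm_sq_inner flip: power2_eq_square)
    also have "\<dots> = L2_inner \<Omega> p g - L2_inner \<Omega> v G"
      using strong_div_Green[OF sd g cov] by (simp add: L2_inner_add_left pL dL gL)
    also have "\<dots> \<le> L2_norm \<Omega> p * L2_norm \<Omega> g + L2_norm \<Omega> v * L2_norm \<Omega> G"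
      using L2_Cauchy_Schwarz[OF pL gL(1)] L2_Cauchy_Schwarz[OF vL gL(2)] by linarith
    also have "\<dots> \<le> C * (\<epsilon> * (c * L2_norm \<Omega> g)) * L2_norm \<Omega> g + c * L2_norm \<Omega> g * L2_norm \<Omega> G"
      by (intro add_mono mult_right_mono ple vg) auto
    finally show ?thesis by (simp add: algebra_simps)
  qed
  show ?thesis
  proof (cases "L2_norm \<Omega> g = 0")
    case True
    then show ?thesis using c by simp
  next
    case False
    then have pos: "L2_norm \<Omega> g > 0" using L2_norm_nonneg[of \<Omega> g] by linarith
    show ?thesis
    proof (rule field_le_epsilon)
      fix e :: real assume e: "e > 0"
      define k where "k = C * (c * L2_norm \<Omega> g)"
      have k: "k \<ge> 0" using C(1) c by (simp add: k_def)
      \<comment> \<open>The choice \<epsilon> = e/(k + 1) makes the remainder k\<epsilon> at most e;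
        the summand 1 covers k = 0.\<close>
      have "e / (k + 1) > 0" using e k by simp
      from main[OF this] have "L2_norm \<Omega> g \<le> C * (e / (k + 1) * (c * L2_norm \<Omega> g)) + c * L2_norm \<Omega> G"
        using pos by (simp add: mult_le_cancel_right)
      also have "C * (e / (k + 1) * (c * L2_norm \<Omega> g)) = k * (e / (k + 1))" by (simp add: k_def)
      also have "k * (e / (k + 1)) \<le> e" using e k by (simp add: field_simps)
      finally show "L2_norm \<Omega> g \<le> c * L2_norm \<Omega> G + e" by simp
    qed
  qed
qed

end

theorem corollary17:
  fixes \<Omega> \<Gamma>t :: "(real^3) set" and c\<^sub>m c\<^sub>k :: real
  assumes "is_domain \<Omega>" and "bounded \<Omega>" and "lipschitz_boundary \<Omega>"
    and "\<Gamma>t \<noteq> {}" and "openin (top_of_set (frontier \<Omega>)) \<Gamma>t"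
    and "separated_by_lipschitz_curve (frontier \<Omega>) \<Gamma>t (Gamma_n \<Omega> \<Gamma>t)"
    and "sliceable \<Omega> \<Gamma>t"
    and "maxwell_constant \<Omega> \<Gamma>t c\<^sub>m"
    and "irrot_korn_constant \<Omega> \<Gamma>t c\<^sub>k"
  shows "(\<forall>u. T_of u \<in> H0_Curl \<Gamma>t \<Omega> \<longleftrightarrow> u \<in> H0_grad \<Gamma>t \<Omega>) \<and>
         (\<forall>u\<in>H0_grad \<Gamma>t \<Omega>.
            L2_norm \<Omega> u
              \<le> max (sqrt 2 * c\<^sub>k) (c\<^sub>m * sqrt (1 + 2 * c\<^sub>k\<^sup>2)) * L2_norm \<Omega> (weak_grad \<Omega> u))"
proof -
  interpret bounded_open_set \<Omega>
    using assms(1,2) by unfold_locales (simp_all add: is_domain_def)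
  let ?\<Gamma> = "frontier \<Omega>" and ?\<Gamma>n = "Gamma_n \<Omega> \<Gamma>t"
  have sub: "\<Gamma>t \<subseteq> ?\<Gamma>" "?\<Gamma>n \<subseteq> ?\<Gamma>" using assms(5) openin_imp_subset by (auto simp: Gamma_n_def)
  have "bounded ?\<Gamma>" using bounded_closure[OF assms(2)] by (rule bounded_subset) (auto simp: frontier_def)
  then have "compact ?\<Gamma>" by (simp add: compact_eq_bounded_closed frontier_closed)
  then obtain L C where cov: "linear_covering (closure \<Gamma>t \<inter> closure ?\<Gamma>n) L C"
    using interface_linear_covering[of ?\<Gamma> \<Gamma>t] assms(5,6) by (auto simp: Gamma_n_def)
  have key: "strong_grad \<Gamma>t \<Omega> u G" if "weak_grad_on (Cinf0 ?\<Gamma>n \<Omega>) \<Omega> u G" for u G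
    by (rule weak_grad_imp_strong_grad[OF assms(3) sub tube_volume[OF cov] that])
  have "?\<Gamma> \<subseteq> closure \<Gamma>t \<union> ?\<Gamma>n" by (auto simp: Gamma_n_def)
  also have "\<dots> \<subseteq> closure (\<Gamma>t \<union> ?\<Gamma>n)" using closure_subset[of ?\<Gamma>n] by (auto simp: closure_Un)
  finally have fr: "?\<Gamma> \<subseteq> closure (\<Gamma>t \<union> ?\<Gamma>n)" .
  have "L2_norm \<Omega> u \<le> max (sqrt 2 * c\<^sub>k) (c\<^sub>m * sqrt (1 + 2 * c\<^sub>k\<^sup>2)) * L2_norm \<Omega> (weak_grad \<Omega> u)"
    if u: "u \<in> H0_grad \<Gamma>t \<Omega>" for u
  proof -
    obtain G where G: "strong_grad \<Gamma>t \<Omega> u G" using H0_grad_imp_strong[OF u] by blast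
    obtain D where D: "D \<ge> 0" "\<And>u G. strong_grad \<Gamma>t \<Omega> u G \<Longrightarrow> L2_norm \<Omega> u \<le> D * L2_norm \<Omega> G"
      using Korn_imp_Poincare[OF assms(9)] by blast
    have "L2_norm \<Omega> u \<le> c\<^sub>m * L2_norm \<Omega> G"
      by (rule Maxwell_imp_Poincare[OF key fr assms(8) D G])
    also have "\<dots> \<le> max (sqrt 2 * c\<^sub>k) (c\<^sub>m * sqrt (1 + 2 * c\<^sub>k\<^sup>2)) * L2_norm \<Omega> G"
    proof (rule mult_right_mono)
      \<comment> \<open>The factor \<open>sqrt (1 + 2 * c\<^sub>k\<^sup>2)\<close> is at least 1, so
        the second entry of the maximum dominates \<open>c\<^sub>m\<close>.\<close>
      have "1 \<le> sqrt (1 + 2 * c\<^sub>k\<^sup>2)" by simp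
      moreover have "0 \<le> c\<^sub>m" using assms(8) by (simp add: maxwell_constant_def)
      ultimately have "c\<^sub>m * 1 \<le> c\<^sub>m * sqrt (1 + 2 * c\<^sub>k\<^sup>2)" by (rule mult_left_mono)
      then show "c\<^sub>m \<le> max (sqrt 2 * c\<^sub>k) (c\<^sub>m * sqrt (1 + 2 * c\<^sub>k\<^sup>2))" by simp
    qed simp
    also have "L2_norm \<Omega> G = L2_norm \<Omega> (weak_grad \<Omega> u)"
      using L2_norm_weak_grad[OF strong_grad_imp_weak[OF G]] by simp
    finally show ?thesis .
  qed
  then show ?thesis using T_of_H0_Curl_iff[OF key fr] by blast
qed

end
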